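(* Suppose $\gamma>0$, $\mu>0$, $s>0$ and $1<p<5$ (with $\alpha>0$, $\beta>0$). Let $\{\vec u_n\}\subset H^1(\mathbb R;\mathbb C^3)$ be any minimizing sequence for $I(\gamma,\mu,s)$. Then the following properties hold. (i) The set $\mathcal G_{\gamma,\mu,s}$ is not empty. Furthermore, $\{\vec u_n\}$ is relatively compact in $H^1(\mathbb R;\mathbb C^3)$ up to translations; that is, there exist $\{y_n\}\subset\mathbb R$ and an element $\vec\varphi\in H^1(\mathbb R;\mathbb C^3)$ such that $\{\vec u_n(\cdot+y_n)\}$ has a subsequence converging strongly in $H^1(\mathbb R;\mathbb C^3)$ to $\vec\varphi$. (ii) $$\lim_{n\to\infty}\ \inf_{\vec g\in\mathcal G_{\gamma,\mu,s},\,y\in\mathbb R}\|\vec u_n(\cdot+y)-\vec g\|_{H^1(\mathbb R;\mathbb C^3)}=0.$$ (iii) $$\lim_{n\to\infty}\ \inf_{\vec g\in\mathcal G_{\gamma,\mu,s}}\|\vec u_n-\vec g\|_{H^1(\mathbb R;\mathbb C^3)}=0.$$ (iv) Each $\vec u=(u_1,u_2,u_3)\in\mathcal G_{\gamma,\mu,s}$ is a classical solution (each $u_i\in C^2(\mathbb R)$, equations holding pointwise) of the system $$\begin{cases}-\partial_x^2u_1+2\omega_1u_1-\beta|u_1|^{p-1}u_1=\alpha u_3\overline{u_2},\\ -\partial_x^2u_2+2\omega_2u_2-\beta|u_2|^{p-1}u_2=\alpha u_3\overline{u_1},\\ -\partial_x^2u_3+2\omega_3u_3-\beta|u_3|^{p-1}u_3=\alpha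 u_1u_2,\end{cases}$$ for some $\omega_1,\omega_2,\omega_3\in\mathbb R$. Furthermore, there exist numbers $\theta_1,\theta_2\in\mathbb R$ and non-negative functions $\rho_1,\rho_2,\rho_3$ on $\mathbb R$ such that $u_1(x)=e^{i\theta_1}\rho_1(x)$, $u_2(x)=e^{i\theta_2}\rho_2(x)$ and $u_3(x)=e^{i(\theta_1+\theta_2)}\rho_3(x)$ for all $x\in\mathbb R$.
   Context: Fix $\alpha>0$, $\beta>0$, $p>1$. $H^1(\mathbb R;\mathbb C^3)$ is the product of three copies of the Sobolev space $H^1(\mathbb R,\mathbb C)$; write $\vec u=(u_1,u_2,u_3)$. The energy is $$E(\vec u)=\sum_{i=1}^3\Big\{\frac12\int_{\mathbb R}|\partial_xu_i|^2dx-\frac{\beta}{p+1}\int_{\mathbb R}|u_i|^{p+1}dx\Big\}-\alpha\,\mathrm{Re}\int_{\mathbb R}u_1u_2\overline{u_3}\,dx .$$ Define $I(\gamma,\mu,s)=\inf\{E(\vec u):\vec u\in H^1(\mathbb R;\mathbb C^3),\ \|u_1\|_{L^2}^2=\gamma,\ \|u_2\|_{L^2}^2=\mu,\ \|u_3\|_{L^2}^2=s\}$, and let $\mathcal G_{\gamma,\mu,s}$ be the set of all $\vec u\in H^1(\mathbb R;\mathbb C^3)$ with $\|u_1\|_{L^2}^2=\gamma$, $\|u_2\|_{L^2}^2=\mu$, $\|u_3\|_{L^2}^2=s$ and $E(\vec u)=I(\gamma,\mu,s)$. A minimizing sequence for $I(\gamma,\mu,s)$ is a sequence $\{\vec u_n\}=\{(u_{1,n},u_{2,n},u_{3,n})\}$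 in $H^1(\mathbb R;\mathbb C^3)$ such that $\|u_{1,n}\|_{L^2}^2\to\gamma$, $\|u_{2,n}\|_{L^2}^2\to\mu$, $\|u_{3,n}\|_{L^2}^2\to s$ and $E(\vec u_n)\to I(\gamma,\mu,s)$ as $n\to\infty$. *)

theory Defs
  imports "HOL-Analysis.Analysis"
begin

text \<open>
  Elements of \<open>L\<^sup>2\<close> and \<open>H\<^sup>1\<close> are represented by Borel functions; two functions that agree
  almost everywhere represent the same element.  All notions up to the minimization problem are
  invariant under this identification.
\<close>

definition L2 :: "(real \<Rightarrow> complex) set" where
  "L2 = {f. f \<in> borel_measurable lborel \<and> integrable lborel (\<lambda>x. (cmod (f x))\<^sup>2)}"

definition L2_norm :: "(real \<Rightarrow> complex) \<Rightarrow> real" where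
  "L2_norm f = sqrt (LINT x|lborel. (cmod (f x))\<^sup>2)"

definition test_function :: "(real \<Rightarrow> real) \<Rightarrow> bool" where
  "test_function \<phi> \<longleftrightarrow>
     (\<forall>k. (deriv ^^ k) \<phi> differentiable_on UNIV) \<and> compact (closure {x. \<phi> x \<noteq> 0})"

definition has_weak_derivative :: "(real \<Rightarrow> complex) \<Rightarrow> (real \<Rightarrow> complex) \<Rightarrow> bool"
    (infix "has'_weak'_derivative" 50) where
  "f has_weak_derivative g \<longleftrightarrow>
     (\<forall>\<phi>. test_function \<phi> \<longrightarrow>
       (LINT x|lborel. deriv \<phi> x *\<^sub>R f x) = - (LINT x|lborel. \<phi> x *\<^sub>R g x))"

definition H1 :: "(real \<Rightarrow> complex) set" where
  "H1 = {f \<in> L2. \<exists>g\<in>L2. f has_weak_derivative g}"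

text \<open>For \<open>f \<in> H1\<close> the chosen function is determined up to a null set.\<close>

definition weak_deriv :: "(real \<Rightarrow> complex) \<Rightarrow> real \<Rightarrow> complex" where
  "weak_deriv f = (SOME g. g \<in> L2 \<and> f has_weak_derivative g)"

definition H1_norm :: "(real \<Rightarrow> complex) \<Rightarrow> real" where
  "H1_norm f = sqrt ((L2_norm f)\<^sup>2 + (L2_norm (weak_deriv f))\<^sup>2)"

text \<open>
  A triple \<open>(u\<^sub>1, u\<^sub>2, u\<^sub>3)\<close> of functions is a single function with values in \<open>complex^3\<close>;
  the product space carries the Hilbert product norm.
\<close>

abbreviation component :: "(real \<Rightarrow> complex^3) \<Rightarrow> 3 \<Rightarrow> real \<Rightarrow> complex" where
  "component u i \<equiv> (\<lambda>x. u x $ i)"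

definition H1_3 :: "(real \<Rightarrow> complex^3) set" where
  "H1_3 = {u. \<forall>i. component u i \<in> H1}"

definition H1_3_norm :: "(real \<Rightarrow> complex^3) \<Rightarrow> real" where
  "H1_3_norm u = sqrt (\<Sum>i\<in>UNIV. (H1_norm (component u i))\<^sup>2)"

definition energy :: "real \<Rightarrow> real \<Rightarrow> real \<Rightarrow> (real \<Rightarrow> complex^3) \<Rightarrow> real" where
  "energy \<alpha> \<beta> p u =
     (\<Sum>i\<in>UNIV. 1/2 * (LINT x|lborel. (cmod (weak_deriv (component u i) x))\<^sup>2)
              - \<beta> / (p + 1) * (LINT x|lborel. cmod (u x $ i) powr (p + 1)))
     - \<alpha> * Re (LINT x|lborel. u x $ 1 * u x $ 2 * cnj (u x $ 3))"

definition admissible :: "real \<Rightarrow> real \<Rightarrow> real \<Rightarrow> (real \<Rightarrow> complex^3) set" where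
  "admissible \<gamma> \<mu> s = {u \<in> H1_3.
     (L2_norm (component u 1))\<^sup>2 = \<gamma> \<and> (L2_norm (component u 2))\<^sup>2 = \<mu> \<and> (L2_norm (component u 3))\<^sup>2 = s}"

text \<open>The infimum is taken in \<open>ereal\<close>, so that it is meaningful even if the energy is unbounded
  below.\<close>

definition min_energy :: "real \<Rightarrow> real \<Rightarrow> real \<Rightarrow> real \<Rightarrow> real \<Rightarrow> real \<Rightarrow> ereal" where
  "min_energy \<alpha> \<beta> p \<gamma> \<mu> s = (INF u\<in>admissible \<gamma> \<mu> s. ereal (energy \<alpha> \<beta> p u))"

definition minimizers ::
    "real \<Rightarrow> real \<Rightarrow> real \<Rightarrow> real \<Rightarrow> real \<Rightarrow> real \<Rightarrow> (real \<Rightarrow> complex^3) set" where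
  "minimizers \<alpha> \<beta> p \<gamma> \<mu> s =
     {u \<in> admissible \<gamma> \<mu> s. ereal (energy \<alpha> \<beta> p u) = min_energy \<alpha> \<beta> p \<gamma> \<mu> s}"

definition minimizing_sequence ::
    "real \<Rightarrow> real \<Rightarrow> real \<Rightarrow> real \<Rightarrow> real \<Rightarrow> real \<Rightarrow> (nat \<Rightarrow> real \<Rightarrow> complex^3) \<Rightarrow> bool" where
  "minimizing_sequence \<alpha> \<beta> p \<gamma> \<mu> s u \<longleftrightarrow>
     (\<forall>n. u n \<in> H1_3) \<and>
     (\<lambda>n. (L2_norm (component (u n) 1))\<^sup>2) \<longlonglongrightarrow> \<gamma> \<and>
     (\<lambda>n. (L2_norm (component (u n) 2))\<^sup>2) \<longlonglongrightarrow> \<mu> \<and>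
     (\<lambda>n. (L2_norm (component (u n) 3))\<^sup>2) \<longlonglongrightarrow> s \<and>
     (\<lambda>n. ereal (energy \<alpha> \<beta> p (u n))) \<longlonglongrightarrow> min_energy \<alpha> \<beta> p \<gamma> \<mu> s"

text \<open>Pointwise derivatives, to be applied to the continuous representative of an \<open>H\<^sup>1\<close> class.\<close>

definition dx :: "(real \<Rightarrow> complex) \<Rightarrow> real \<Rightarrow> complex" where
  "dx f = (\<lambda>x. vector_derivative f (at x))"

definition C2 :: "(real \<Rightarrow> complex) set" where
  "C2 = {f. f differentiable_on UNIV \<and> dx f differentiable_on UNIV \<and>
            continuous_on UNIV (dx (dx f))}"

definition classical_solution ::
    "real \<Rightarrow> real \<Rightarrow> real \<Rightarrow> real \<Rightarrow> real \<Rightarrow> real \<Rightarrow> (real \<Rightarrow> complex^3) \<Rightarrow> bool" where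
  "classical_solution \<alpha> \<beta> p \<omega>1 \<omega>2 \<omega>3 u \<longleftrightarrow>
     (\<forall>i. component u i \<in> C2) \<and>
     (\<forall>x. - dx (dx (component u 1)) x + of_real (2 * \<omega>1) * u x $ 1
            - of_real (\<beta> * cmod (u x $ 1) powr (p - 1)) * u x $ 1 = of_real \<alpha> * u x $ 3 * cnj (u x $ 2)) \<and>
     (\<forall>x. - dx (dx (component u 2)) x + of_real (2 * \<omega>2) * u x $ 2
            - of_real (\<beta> * cmod (u x $ 2) powr (p - 1)) * u x $ 2 = of_real \<alpha> * u x $ 3 * cnj (u x $ 1)) \<and>
     (\<forall>x. - dx (dx (component u 3)) x + of_real (2 * \<omega>3) * u x $ 3
            - of_real (\<beta> * cmod (u x $ 3) powr (p - 1)) * u x $ 3 = of_real \<alpha> * u x $ 1 * u x $ 2)"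

end

(*
A minimizing sequence is bounded in H1, so after translations it has a weak limit phi, and the
masses and the energy split asymptotically between phi and the remainder. The usual strict
subadditivity argument needs no rearrangement here: two triples phi and v are replaced by
sqrt(|phi_i|^2 + |v_i|^2), which adds up the masses, does not increase the kinetic energy, and
strictly gains in the power terms when both pieces are large at the same place. Hence a remainder
that does not tend to 0 uniformly could be shifted on top of phi and merged with it, at a gain. A
remainder that does tend to 0 uniformly carries no mass, because its mass would be better used in
a profile of negative energy. All three components of phi are nonzero, since otherwise the moduli
of components living at different places could be shifted onto each other.

A minimizer solves the Euler-Lagrange equations, and so do its moduli, which have no zeros by a
comparison argument. Comparing the kinetic energies shows that the phases are constant, and the
sign of the coupling term forces the relation between them.
*)

theory Submission
  imports Defs "HOL-Complex_Analysis.Great_Picard"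
begin

subsection \<open>Square integrable functions\<close>

text \<open>Three masses are prescribed separately, so a subadditivity argument would treat the
  infimum as a function of three variables, with degenerate cases where some of them vanish. Here
  every contradiction is reached at the given masses: the competitor is assembled from pieces of the
  minimizing sequence itself, and its masses converge to the prescribed ones. The gain must then be
  bounded below independently of \<open>n\<close>. It is, because bounded kinetic energy makes all
  functions Hoelder continuous of order 1/2 with a common constant, so that a value away from zero
  persists on an interval of fixed length. Merging gains only where the same component of both
  pieces is large; hence the need for a limit without vanishing components.

  The bound \<open>p < 5\<close> enters through scaling: dilating a profile by \<open>z\<close> at
  fixed mass multiplies the kinetic energy by \<open>z\<^sup>2\<close> and the power term by
  \<open>z powr ((p - 1) / 2)\<close>, whose exponent is below 2. This gives negative energies for
  small \<open>z\<close> and coercivity for large kinetic energy.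

  Weak convergence in \<open>H1\<close> is handled as pointwise convergence of continuous
  representatives with bounded norms.\<close>

definition sqn :: "(real \<Rightarrow> complex) \<Rightarrow> real" where
  "sqn f = (LINT x|lborel. (cmod (f x))\<^sup>2)"

lemma L2_norm_square: "(L2_norm f)\<^sup>2 = sqn f"
  by (simp add: L2_norm_def sqn_def)

lemma L2_norm_eq: "L2_norm f = sqrt (sqn f)"
  by (simp add: L2_norm_def sqn_def)

lemma L2_measurable: "f \<in> L2 \<Longrightarrow> f \<in> borel_measurable borel"
  by (simp add: L2_def)

lemma L2_integrable: "f \<in> L2 \<Longrightarrow> integrable lborel (\<lambda>x. (cmod (f x))\<^sup>2)"
  by (simp add: L2_def)

lemma sqn_nonneg [simp]: "0 \<le> sqn f"
  by (simp add: sqn_def)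

lemma norm_add_square_le: "(norm (a + b :: 'a :: real_normed_vector))\<^sup>2 \<le> 2 * (norm a)\<^sup>2 + 2 * (norm b)\<^sup>2"
proof -
  have "(norm (a + b))\<^sup>2 \<le> (norm a + norm b)\<^sup>2"
    by (intro power_mono norm_triangle_ineq) simp
  also have "\<dots> \<le> 2 * (norm a)\<^sup>2 + 2 * (norm b)\<^sup>2"
    using sum_squares_bound[of "norm a" "norm b"] by (simp add: power2_sum)
  finally show ?thesis .
qed

lemma L2_dominated:
  assumes "f \<in> L2" "g \<in> borel_measurable borel" "AE x in lborel. cmod (g x) \<le> C * cmod (f x)"
  shows "g \<in> L2"
proof -
  have "integrable lborel (\<lambda>x. C\<^sup>2 * (cmod (f x))\<^sup>2)"
    using L2_integrable[OF assms(1)] by simp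
  then have "integrable lborel (\<lambda>x. (cmod (g x))\<^sup>2)"
  proof (rule Bochner_Integration.integrable_bound)
    show "(\<lambda>x. (cmod (g x))\<^sup>2) \<in> borel_measurable lborel"
      using assms(2) by measurable
    show "AE x in lborel. norm ((cmod (g x))\<^sup>2) \<le> norm (C\<^sup>2 * (cmod (f x))\<^sup>2)"
      using assms(3)
    proof eventually_elim
      case (elim x)
      have "(cmod (g x))\<^sup>2 \<le> (C * cmod (f x))\<^sup>2"
        using elim by (intro power_mono) auto
      then show ?case by (simp add: power_mult_distrib)
    qed
  qed
  then show ?thesis using assms(2) by (simp add: L2_def)
qed

lemma L2_add: assumes "f \<in> L2" "g \<in> L2" shows "(\<lambda>x. f x + g x) \<in> L2"
proof -
  note [measurable] = L2_measurable[OF assms(1)] L2_measurable[OF assms(2)]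
  have "integrable lborel (\<lambda>x. (cmod (f x + g x))\<^sup>2)"
  proof (rule Bochner_Integration.integrable_bound)
    show "integrable lborel (\<lambda>x. 2 * (cmod (f x))\<^sup>2 + 2 * (cmod (g x))\<^sup>2)"
      using assms[THEN L2_integrable] by simp
  qed (auto intro!: AE_I2 norm_add_square_le)
  then show ?thesis by (simp add: L2_def)
qed

lemma L2_cmult: "f \<in> L2 \<Longrightarrow> (\<lambda>x. c * f x) \<in> L2"
  by (rule L2_dominated[of f _ "cmod c"]) (auto simp: norm_mult L2_def)

lemma L2_minus: "f \<in> L2 \<Longrightarrow> (\<lambda>x. - f x) \<in> L2"
  by (rule L2_dominated[of f _ 1]) (auto simp: L2_def)

lemma L2_diff: "f \<in> L2 \<Longrightarrow> g \<in> L2 \<Longrightarrow> (\<lambda>x. f x - g x) \<in> L2"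
  using L2_add[OF _ L2_minus] by (simp add: diff_conv_add_uminus del: add_uminus_conv_diff)

lemma L2_cnj: "f \<in> L2 \<Longrightarrow> (\<lambda>x. cnj (f x)) \<in> L2"
  by (rule L2_dominated[of f _ 1])
     (auto simp: L2_def intro: measurable_compose[OF _ borel_measurable_continuous_onI[OF continuous_on_cnj[OF continuous_on_id]]])

lemma L2_norm_fun: "f \<in> L2 \<Longrightarrow> (\<lambda>x. complex_of_real (cmod (f x))) \<in> L2"
  by (rule L2_dominated[of f _ 1]) (auto simp: L2_def)

lemma L2_zero: "(\<lambda>x. 0) \<in> L2"
  by (simp add: L2_def)

lemma L2_shift: assumes "f \<in> L2" shows "(\<lambda>x. f (x + c)) \<in> L2"
  using lborel_integrable_real_affine[OF L2_integrable[OF assms], of 1 c] L2_measurable[OF assms]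
  by (simp add: L2_def add.commute)

lemma lborel_integral_shift:
  fixes f :: "real \<Rightarrow> 'a :: {banach, second_countable_topology}"
  shows "(LINT x|lborel. f (x + c)) = (LINT x|lborel. f x)"
  using lborel_integral_real_affine[of 1 f c] by (simp add: add.commute)

lemma sqn_cmult: "sqn (\<lambda>x. c * f x) = (cmod c)\<^sup>2 * sqn f"
  by (simp add: sqn_def norm_mult power_mult_distrib)

lemma L2_mult_integrable_norm:
  assumes "f \<in> L2" "g \<in> L2"
  shows "integrable lborel (\<lambda>x. cmod (f x) * cmod (g x))"
proof (rule Bochner_Integration.integrable_bound)
  show "integrable lborel (\<lambda>x. (cmod (f x))\<^sup>2 + (cmod (g x))\<^sup>2)"
    using assms[THEN L2_integrable] by simp
  show "(\<lambda>x. cmod (f x) * cmod (g x)) \<in> borel_measurable lborel"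
    using assms[THEN L2_measurable] by measurable
  have "cmod a * cmod b \<le> (cmod a)\<^sup>2 + (cmod b)\<^sup>2" for a b
    using sum_squares_bound[of "cmod a" "cmod b"] mult_nonneg_nonneg[OF norm_ge_zero norm_ge_zero, of a b]
    by linarith
  then show "AE x in lborel. norm (cmod (f x) * cmod (g x)) \<le> norm ((cmod (f x))\<^sup>2 + (cmod (g x))\<^sup>2)"
    by (auto intro!: AE_I2)
qed

lemma L2_mult_integrable:
  assumes "f \<in> L2" "g \<in> L2"
  shows "integrable lborel (\<lambda>x. f x * g x)"
  by (rule Bochner_Integration.integrable_bound[OF L2_mult_integrable_norm[OF assms]])
     (use assms[THEN L2_measurable] in \<open>auto simp: norm_mult\<close>)

text \<open>The integral of \<open>(t * f x - g x)\<^sup>2\<close> is a polynomial in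
  \<open>t\<close> of degree at most two that is never negative; \<open>A = 0\<close> leaves a
  linear one, which must be constant.\<close>

lemma Cauchy_Schwarz_integral:
  fixes f g :: "'a \<Rightarrow> real"
  assumes "integrable M (\<lambda>x. (f x)\<^sup>2)" "integrable M (\<lambda>x. (g x)\<^sup>2)" "integrable M (\<lambda>x. f x * g x)"
  shows "(LINT x|M. f x * g x)\<^sup>2 \<le> (LINT x|M. (f x)\<^sup>2) * (LINT x|M. (g x)\<^sup>2)"
proof -
  define A B X where "A = (LINT x|M. (f x)\<^sup>2)" and "B = (LINT x|M. (g x)\<^sup>2)" and "X = (LINT x|M. f x * g x)"
  have q: "0 \<le> A * t\<^sup>2 - 2 * X * t + B" for t
  proof -
    have "0 \<le> (LINT x|M. (t * f x - g x)\<^sup>2)" by simp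
    also have "\<dots> = (LINT x|M. t\<^sup>2 * (f x)\<^sup>2 - 2 * t * (f x * g x) + (g x)\<^sup>2)"
      by (simp add: power2_eq_square algebra_simps)
    also have "\<dots> = t\<^sup>2 * A - 2 * t * X + B"
      using assms by (simp add: A_def B_def X_def)
    finally show ?thesis by (simp add: algebra_simps)
  qed
  have "A \<ge> 0" by (simp add: A_def)
  have "X\<^sup>2 \<le> A * B"
  proof (cases "A = 0")
    case True
    have "X = 0"
    proof (rule ccontr)
      assume "X \<noteq> 0"
      \<comment> \<open>At this \<open>t\<close> the linear polynomial takes the value -1.\<close>
      then show False using q[of "(B + 1) / (2 * X)"] True by (simp add: field_simps)
    qed
    then show ?thesis using True by simp
  next
    case False
    then have "A > 0" using \<open>A \<ge> 0\<close> by simp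
    have "A * (A * (X/A)\<^sup>2 - 2 * X * (X/A) + B) \<ge> 0"
      using q[of "X/A"] \<open>A > 0\<close> by (intro mult_nonneg_nonneg) auto
    moreover have "A * (A * (X/A)\<^sup>2 - 2 * X * (X/A) + B) = A * B - X\<^sup>2"
      using \<open>A > 0\<close> by (simp add: field_simps power2_eq_square)
    ultimately show ?thesis by simp
  qed
  then show ?thesis by (simp add: A_def B_def X_def)
qed

lemma L2_Cauchy_Schwarz:
  assumes "f \<in> L2" "g \<in> L2"
  shows "(LINT x|lborel. cmod (f x) * cmod (g x))\<^sup>2 \<le> sqn f * sqn g"
  unfolding sqn_def using assms by (intro Cauchy_Schwarz_integral L2_integrable L2_mult_integrable_norm)

lemma integrable_indicator_Icc: "integrable lborel (indicat_real {a..b::real})"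
  by (rule integrable_real_indicator) (simp_all add: emeasure_lborel_Icc_eq)

lemma L2_set_integrable:
  assumes "g \<in> L2"
  shows "set_integrable lborel {a..b::real} g"
proof -
  have 1: "(\<lambda>x. complex_of_real (indicator {a..b} x)) \<in> L2"
    by (auto simp: L2_def power2_eq_square indicator_inter_arith[symmetric] integrable_indicator_Icc)
  show ?thesis
    using L2_mult_integrable[OF 1 assms] by (simp add: set_integrable_def scaleR_conv_of_real)
qed

text \<open>Cauchy-Schwarz against the indicator of the interval. The local right-hand side is the
  one that is averaged in \<open>H1c_dominated\<close>; the global one gives Hoelder
  continuity.\<close>

lemma L2_interval_integral_bound:
  assumes "g \<in> L2" "a \<le> b"
  shows "(LINT t:{a..b}|lborel. cmod (g t))\<^sup>2 \<le> (b - a) * (LINT t:{a..b}|lborel. (cmod (g t))\<^sup>2)"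
    and "(LINT t:{a..b}|lborel. cmod (g t))\<^sup>2 \<le> (b - a) * sqn g"
proof -
  have [measurable]: "g \<in> borel_measurable borel" using L2_measurable[OF assms(1)] .
  have i2: "integrable lborel (\<lambda>x. indicator {a..b} x * (cmod (g x))\<^sup>2)"
    using integrable_mult_indicator[OF _ L2_integrable[OF assms(1)], of "{a..b}"] by simp
  have e: "(indicat_real {a..b} x * cmod (g x))\<^sup>2 = indicator {a..b} x * (cmod (g x))\<^sup>2" for x
    by (simp add: indicator_def)
  have e': "(indicat_real {a..b} x)\<^sup>2 = indicator {a..b} x" for x
    by (simp add: indicator_def)
  have i1: "integrable lborel (\<lambda>x. indicat_real {a..b} x * (indicator {a..b} x * cmod (g x)))"
    using set_integrable_norm[OF L2_set_integrable[OF assms(1), of a b]]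
    by (simp add: set_integrable_def mult.assoc[symmetric] indicator_inter_arith[symmetric])
  have "(LINT x|lborel. indicator {a..b} x * (indicator {a..b} x * cmod (g x)))\<^sup>2 \<le>
        (LINT x|lborel. (indicat_real {a..b} x)\<^sup>2) * (LINT x|lborel. (indicator {a..b} x * cmod (g x))\<^sup>2)"
    by (intro Cauchy_Schwarz_integral) (use i1 i2 in \<open>auto simp: e e' integrable_indicator_Icc\<close>)
  then show 1: "(LINT t:{a..b}|lborel. cmod (g t))\<^sup>2 \<le> (b - a) * (LINT t:{a..b}|lborel. (cmod (g t))\<^sup>2)"
    using assms(2) unfolding e e' by (simp add: set_lebesgue_integral_def mult.assoc[symmetric] indicator_inter_arith[symmetric])
  have "(LINT t:{a..b}|lborel. (cmod (g t))\<^sup>2) \<le> sqn g"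
    unfolding set_lebesgue_integral_def sqn_def
    by (rule integral_mono) (use i2 L2_integrable[OF assms(1)] in \<open>auto simp: indicator_def\<close>)
  then show "(LINT t:{a..b}|lborel. cmod (g t))\<^sup>2 \<le> (b - a) * sqn g"
    using 1 assms(2) by (meson diff_ge_0_iff_ge mult_left_mono order_trans)
qed

section \<open>Almost everywhere equality and completeness of L2\<close>

lemma L2_nn_integral:
  "f \<in> L2 \<Longrightarrow> (\<integral>\<^sup>+x. ennreal ((cmod (f x))\<^sup>2) \<partial>lborel) = ennreal (sqn f)"
  unfolding sqn_def by (intro nn_integral_eq_integral L2_integrable) auto

text \<open>The form in which Fatou's lemma and Tonelli's theorem deliver \<open>L2\<close>
  bounds.\<close>

lemma L2I_nn_integral:
  assumes "f \<in> borel_measurable borel" "(\<integral>\<^sup>+x. ennreal ((cmod (f x))\<^sup>2) \<partial>lborel) \<le> ennreal B" "0 \<le> B"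
  shows "f \<in> L2" "sqn f \<le> B"
proof -
  have "integrable lborel (\<lambda>x. (cmod (f x))\<^sup>2)"
    using assms by (intro integrableI_nonneg) (auto simp: order_le_less_trans)
  then show "f \<in> L2" using assms(1) by (simp add: L2_def)
  then show "sqn f \<le> B" using L2_nn_integral assms(2,3) by simp
qed

text \<open>Closed intervals are stable under intersection and generate the Borel sets, so Dynkin's
  theorem extends the vanishing of the integral to all Borel sets. The cut-off to a bounded interval
  makes \<open>k\<close> integrable, so that complements can be treated by subtraction from the
  total integral.\<close>

lemma AE_eq_0_if_interval_integrals_0:
  fixes k :: "real \<Rightarrow> complex"
  assumes int: "\<And>a b. set_integrable lborel {a..b} k"
    and zero: "\<And>a b. a \<le> b \<Longrightarrow> (LINT t:{a..b}|lborel. k t) = 0"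
  shows "AE x in lborel. k x = 0"
proof -
  have "AE x in lborel. indicat_real {- real N..real N} x *\<^sub>R k x = 0" for N
  proof (rule sigma_finite_measure.density_zero[OF sigma_finite_lborel])
    let ?k = "\<lambda>x. indicat_real {- real N..real N} x *\<^sub>R k x"
    show ik: "integrable lborel ?k"
      using int[of "-real N" "real N"] by (simp add: set_integrable_def)
    have si: "set_integrable lborel A ?k" if "A \<in> sets borel" for A
      using integrable_mult_indicator[OF _ ik, of A] that by (simp add: set_integrable_def)
    have tot: "(LINT x|lborel. ?k x) = 0"
      using zero[of "-real N" "real N"] by (simp add: set_lebesgue_integral_def)
    fix A :: "real set" assume "A \<in> sets lborel"
    then have "A \<in> sigma_sets UNIV (range (\<lambda>(a, b). {a..b::real}))"
      by (simp add: borel_eq_atLeastAtMost)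
    have int_st: "Int_stable (range (\<lambda>(a, b). {a..b::real}))"
      by (auto simp: Int_stable_def)
    have sub: "range (\<lambda>(a, b). {a..b::real}) \<subseteq> Pow UNIV" by simp
    from \<open>A \<in> sigma_sets UNIV _\<close> show "(LINT x:A|lborel. ?k x) = 0"
    proof (induction rule: sigma_sets_induct_disjoint[OF int_st sub, consumes 1, case_names basic empty compl union])
      case (basic A)
      then obtain a b where A: "A = {a..b}" by auto
      have "(LINT x:A|lborel. ?k x) = (LINT x:{max a (- real N)..min b (real N)}|lborel. k x)"
        unfolding set_lebesgue_integral_def A
        by (intro Bochner_Integration.integral_cong) (auto simp: indicator_def)
      also have "\<dots> = 0"
        using zero[of "max a (- real N)" "min b (real N)"]
        by (cases "max a (- real N) \<le> min b (real N)") (auto simp: set_lebesgue_integral_def)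
      finally show ?case .
    next
      case empty
      show ?case by (simp add: set_lebesgue_integral_def)
    next
      case (compl A)
      then have A: "A \<in> sets borel" by (simp add: borel_eq_atLeastAtMost)
      have "(LINT x:(UNIV - A)|lborel. ?k x) + (LINT x:A|lborel. ?k x) = (LINT x:((UNIV - A) \<union> A)|lborel. ?k x)"
        using A by (intro set_integral_Un[symmetric] si) auto
      also have "\<dots> = 0" using tot by (simp add: set_lebesgue_integral_def)
      finally show ?case using compl by simp
    next
      case (union A)
      then have A: "A i \<in> sets borel" for i by (auto simp: borel_eq_atLeastAtMost)
      have "(LINT x:(\<Union>i. A i)|lborel. ?k x) = (\<Sum>i. (LINT x:A i|lborel. ?k x))"
        using A union(1) by (intro lebesgue_integral_countable_add si) (auto simp: disjoint_family_on_def)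
      then show ?case using union by simp
    qed
  qed
  then have "AE x in lborel. \<forall>N. indicat_real {- real N..real N} x *\<^sub>R k x = 0"
    unfolding AE_all_countable by blast
  then show ?thesis
  proof eventually_elim
    case (elim x)
    obtain N :: nat where "\<bar>x\<bar> \<le> real N" using real_arch_simple by blast
    then have "x \<in> {- real N..real N}" by auto
    then show ?case using elim[rule_format, of N] by simp
  qed
qed

text \<open>Riesz-Fischer: a rapidly converging subsequence converges almost everywhere, and Fatou's
  lemma along it controls the distance to the limit.\<close>

lemma L2_complete:
  assumes h: "\<And>n. h n \<in> L2"
    and Cau: "\<And>e. e > 0 \<Longrightarrow> \<exists>N. \<forall>m\<ge>N. \<forall>n\<ge>N. sqn (\<lambda>x. h m x - h n x) < e"
  shows "\<exists>g\<in>L2. (\<lambda>n. sqn (\<lambda>x. h n x - g x)) \<longlonglongrightarrow> 0"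
proof -
  note [measurable] = h[THEN L2_measurable]
  \<comment> \<open>The Cauchy bound is attached to the later of two consecutive indices; hence the
    shift in \<open>r k = r0 (Suc k)\<close>.\<close>
  have "\<exists>r. \<forall>k. True \<and> (r (Suc k) > r k \<and> (\<forall>m\<ge>r (Suc k). \<forall>n\<ge>r (Suc k). sqn (\<lambda>x. h m x - h n x) < (1/4)^k))"
  proof (rule dependent_nat_choice)
    fix x :: nat and k
    obtain N where N: "\<forall>m\<ge>N. \<forall>n\<ge>N. sqn (\<lambda>x. h m x - h n x) < (1/4)^k"
      using Cau[of "(1/4)^k"] by auto
    then show "\<exists>y. True \<and> (x < y \<and> (\<forall>m\<ge>y. \<forall>n\<ge>y. sqn (\<lambda>x. h m x - h n x) < (1/4)^k))"
      by (intro exI[of _ "max N (Suc x)"]) auto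
  qed auto
  then obtain r0 :: "nat \<Rightarrow> nat" where r0: "\<And>k. r0 k < r0 (Suc k)"
    "\<And>k m n. m \<ge> r0 (Suc k) \<Longrightarrow> n \<ge> r0 (Suc k) \<Longrightarrow> sqn (\<lambda>x. h m x - h n x) < (1/4)^k" by blast
  define r where "r k = r0 (Suc k)" for k
  have r: "strict_mono r" using r0(1) by (simp add: strict_mono_Suc_iff r_def)
  define D where "D k x = cmod (h (r (Suc k)) x - h (r k) x)" for k x
  have [measurable]: "D k \<in> borel_measurable borel" for k unfolding D_def by measurable
  have D: "(\<integral>\<^sup>+x. ennreal ((D k x)\<^sup>2) \<partial>lborel) \<le> ennreal ((1/4)^k)" for k
  proof -
    have "sqn (\<lambda>x. h (r (Suc k)) x - h (r k) x) \<le> (1/4)^k"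
      using r0(2)[of k "r (Suc k)" "r k"] r0(1)[of "Suc k"] unfolding r_def by simp
    then show ?thesis unfolding D_def using L2_nn_integral[OF L2_diff[OF h h]] by (simp add: ennreal_leI)
  qed
  have "(\<integral>\<^sup>+x. (\<Sum>k. ennreal (2^k * (D k x)\<^sup>2)) \<partial>lborel) = (\<Sum>k. \<integral>\<^sup>+x. ennreal (2^k * (D k x)\<^sup>2) \<partial>lborel)"
    by (intro nn_integral_suminf) auto
  also have "\<dots> \<le> (\<Sum>k. ennreal ((1/2)^k))"
  proof (intro suminf_le summableI)
    fix k
    have "(\<integral>\<^sup>+x. ennreal (2^k * (D k x)\<^sup>2) \<partial>lborel) = ennreal (2^k) * (\<integral>\<^sup>+x. ennreal ((D k x)\<^sup>2) \<partial>lborel)"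
      by (simp add: ennreal_mult nn_integral_cmult)
    also have "\<dots> \<le> ennreal (2^k) * ennreal ((1/4)^k)"
      by (intro mult_left_mono D) auto
    also have "\<dots> = ennreal ((1/2)^k)"
      by (simp add: ennreal_mult[symmetric] power_mult_distrib[symmetric])
    finally show "(\<integral>\<^sup>+x. ennreal (2^k * (D k x)\<^sup>2) \<partial>lborel) \<le> ennreal ((1/2)^k)" .
  qed
  also have "\<dots> = ennreal (\<Sum>k. (1/2)^k)"
    by (intro suminf_ennreal2 summable_geometric) auto
  also have "\<dots> < \<infinity>" by simp
  finally have "(\<integral>\<^sup>+x. (\<Sum>k. ennreal (2^k * (D k x)\<^sup>2)) \<partial>lborel) \<noteq> \<infinity>" by simp
  then have "AE x in lborel. (\<Sum>k. ennreal (2^k * (D k x)\<^sup>2)) \<noteq> \<infinity>"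
    by (intro nn_integral_noteq_infinite) auto
  then have conv: "AE x in lborel. convergent (\<lambda>k. h (r k) x)"
  proof eventually_elim
    case (elim x)
    have sm: "summable (\<lambda>k. 2^k * (D k x)\<^sup>2)"
      using elim by (intro summable_suminf_not_top) auto
    have "summable (\<lambda>k. D k x)"
    proof (rule summable_comparison_test'[of "\<lambda>k. (1/2)^k + 2^k * (D k x)\<^sup>2"])
      show "summable (\<lambda>k. (1/2)^k + 2^k * (D k x)\<^sup>2)"
        by (intro summable_add sm summable_geometric) auto
      fix k :: nat
      \<comment> \<open>The weight \<open>2^k\<close>, taken out of the decay \<open>(1/4)^k\<close>
        of the squared distances, lets this square bound \<open>2 * D k x\<close> by two summable
        terms.\<close>
      have "0 \<le> (1 - 2^k * D k x)\<^sup>2" by simp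
      then have "2 * (2^k * D k x) \<le> 1 + (2^k)\<^sup>2 * (D k x)\<^sup>2"
        by (simp add: power2_eq_square algebra_simps)
      then have "(1/2)^k * (2 * (2^k * D k x)) \<le> (1/2)^k * (1 + (2^k)\<^sup>2 * (D k x)\<^sup>2)"
        by (intro mult_left_mono) auto
      then have "2 * D k x \<le> (1/2)^k + 2^k * (D k x)\<^sup>2"
        by (simp add: power_divide power2_eq_square field_simps)
      moreover have "D k x \<ge> 0" by (simp add: D_def)
      ultimately show "norm (D k x) \<le> (1/2)^k + 2^k * (D k x)\<^sup>2" by simp
    qed
    then have "summable (\<lambda>k. h (r (Suc k)) x - h (r k) x)"
      unfolding D_def by (rule summable_norm_cancel)
    then have "convergent (\<lambda>n. (h (r n) x - h (r 0) x) + h (r 0) x)"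
      unfolding summable_iff_convergent sum_lessThan_telescope[of "\<lambda>k. h (r k) x"]
      by (intro convergent_add convergent_const)
    then show ?case by simp
  qed
  define g where "g x = lim (\<lambda>k. h (r k) x)" for x
  have [measurable]: "g \<in> borel_measurable borel" unfolding g_def by measurable
  have lim: "AE x in lborel. (\<lambda>k. h (r k) x) \<longlonglongrightarrow> g x"
    using conv by eventually_elim (simp add: g_def convergent_LIMSEQ_iff)
  \<comment> \<open>Fatou's lemma in the index of the subsequence, with \<open>n\<close>
    fixed.\<close>
  have key: "(\<lambda>x. h n x - g x) \<in> L2 \<and> sqn (\<lambda>x. h n x - g x) \<le> e"
    if e: "e > 0" and N: "\<forall>m\<ge>N. \<forall>n\<ge>N. sqn (\<lambda>x. h m x - h n x) < e" and n: "n \<ge> N" for n N e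
  proof -
    have "(\<integral>\<^sup>+x. ennreal ((cmod (h n x - g x))\<^sup>2) \<partial>lborel) =
        (\<integral>\<^sup>+x. liminf (\<lambda>k. ennreal ((cmod (h n x - h (r k) x))\<^sup>2)) \<partial>lborel)"
    proof (intro nn_integral_cong_AE, use lim in eventually_elim)
      case (elim x)
      have "(\<lambda>k. ennreal ((cmod (h n x - h (r k) x))\<^sup>2)) \<longlonglongrightarrow> ennreal ((cmod (h n x - g x))\<^sup>2)"
        by (intro tendsto_intros elim tendsto_ennrealI)
      then show ?case by (intro lim_imp_Liminf[symmetric]) auto
    qed
    also have "\<dots> \<le> liminf (\<lambda>k. \<integral>\<^sup>+x. ennreal ((cmod (h n x - h (r k) x))\<^sup>2) \<partial>lborel)"
      by (intro nn_integral_liminf) auto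
    also have "\<dots> \<le> limsup (\<lambda>k. \<integral>\<^sup>+x. ennreal ((cmod (h n x - h (r k) x))\<^sup>2) \<partial>lborel)"
      by (intro Liminf_le_Limsup) auto
    also have "\<dots> \<le> ennreal e"
    proof (intro Limsup_bounded eventually_sequentiallyI[of N])
      fix k assume "k \<ge> N"
      then have "r k \<ge> N" using seq_suble[OF r, of k] by linarith
      then have "sqn (\<lambda>x. h n x - h (r k) x) < e" using N n by blast
      then show "(\<integral>\<^sup>+x. ennreal ((cmod (h n x - h (r k) x))\<^sup>2) \<partial>lborel) \<le> ennreal e"
        using L2_nn_integral[OF L2_diff[OF h[of n] h[of "r k"]]] by (simp add: ennreal_leI)
    qed
    finally show ?thesis using e by (intro conjI L2I_nn_integral[of _ e]) auto
  qed
  obtain N1 where N1: "\<forall>m\<ge>N1. \<forall>n\<ge>N1. sqn (\<lambda>x. h m x - h n x) < 1" using Cau[of 1] by auto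
  have "g \<in> L2"
    using L2_diff[OF h[of N1] conjunct1[OF key[OF _ N1, of N1]]] by simp
  moreover have "(\<lambda>n. sqn (\<lambda>x. h n x - g x)) \<longlonglongrightarrow> 0"
  proof (rule LIMSEQ_I)
    fix e :: real assume "e > 0"
    then obtain N where N: "\<forall>m\<ge>N. \<forall>n\<ge>N. sqn (\<lambda>x. h m x - h n x) < e/2" using Cau[of "e/2"] by auto
    show "\<exists>no. \<forall>n\<ge>no. norm (sqn (\<lambda>x. h n x - g x) - 0) < e"
    proof (intro exI[of _ N] allI impI)
      fix n assume "n \<ge> N"
      then have "sqn (\<lambda>x. h n x - g x) \<le> e/2" using key[OF _ N, of n] \<open>e > 0\<close> by simp
      moreover have "0 \<le> sqn (\<lambda>x. h n x - g x)" by simp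
      ultimately show "norm (sqn (\<lambda>x. h n x - g x) - 0) < e" using \<open>e > 0\<close> by simp
    qed
  qed
  ultimately show ?thesis by blast
qed

subsection \<open>Test functions\<close>

definition smooth :: "(real \<Rightarrow> real) \<Rightarrow> bool" where
  "smooth f \<longleftrightarrow> (\<forall>k. (deriv ^^ k) f differentiable_on UNIV)"

text \<open>All derivatives stay in a set that is closed under differentiation. Stability results
  thus ask for a suitable set instead of formulas for higher derivatives.\<close>

lemma smooth_coinduct:
  assumes "f \<in> S" "\<And>f. f \<in> S \<Longrightarrow> \<exists>f'\<in>S. \<forall>x. (f has_real_derivative f' x) (at x)"
  shows "smooth f"
proof -
  have d: "deriv h \<in> S \<and> h differentiable_on UNIV" if "h \<in> S" for h
  proof -
    obtain h' where h': "h' \<in> S" "\<And>x. (h has_real_derivative h' x) (at x)" using assms(2)[OF \<open>h \<in> S\<close>] by blast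
    have "deriv h = h'" using h'(2) by (auto intro: DERIV_imp_deriv)
    then show ?thesis using h' by (auto simp: differentiable_on_def real_differentiable_def)
  qed
  have "(deriv ^^ k) f \<in> S" for k
    by (induction k) (use assms(1) d in auto)
  then show ?thesis using d by (auto simp: smooth_def)
qed

lemma smooth_deriv: assumes "smooth f" shows "smooth (deriv f)"
proof -
  have "(deriv ^^ k) (deriv f) = (deriv ^^ Suc k) f" for k by (simp add: funpow_swap1)
  then show ?thesis using assms unfolding smooth_def by presburger
qed

lemma smooth_DERIV: assumes "smooth f" shows "(f has_real_derivative deriv f x) (at x)"
proof -
  have "f differentiable_on UNIV" using assms[unfolded smooth_def, rule_format, of 0] by simp
  then show ?thesis by (simp add: differentiable_on_def DERIV_deriv_iff_real_differentiable)
qed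

lemma smooth_antiderivative:
  assumes "smooth f" "\<And>x. (F has_real_derivative f x) (at x)" shows "smooth F"
proof -
  have "deriv F = f" using assms(2) by (auto intro: DERIV_imp_deriv)
  then have "(deriv ^^ Suc k) F = (deriv ^^ k) f" for k by (simp add: funpow_swap1)
  moreover have "F differentiable_on UNIV"
    using assms(2) by (auto simp: differentiable_on_def real_differentiable_def)
  ultimately show ?thesis using assms(1) unfolding smooth_def by (metis funpow_0 not0_implies_Suc)
qed

lemma smooth_continuous: "smooth f \<Longrightarrow> continuous_on UNIV f"
  using DERIV_isCont[OF smooth_DERIV] by (auto simp: continuous_on_eq_continuous_at)

lemma smooth_add: assumes "smooth f" "smooth g" shows "smooth (\<lambda>x. f x + g x)"
proof (rule smooth_coinduct[of _ "{\<lambda>x. f x + g x | f g. smooth f \<and> smooth g}"])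
  fix h assume "h \<in> {\<lambda>x. f x + g x | f g. smooth f \<and> smooth g}"
  then obtain f g where h: "h = (\<lambda>x. f x + g x)" "smooth f" "smooth g" by auto
  show "\<exists>h'\<in>{\<lambda>x. f x + g x | f g. smooth f \<and> smooth g}. \<forall>x. (h has_real_derivative h' x) (at x)"
    by (rule bexI[of _ "\<lambda>x. deriv f x + deriv g x"])
       (use h smooth_deriv smooth_DERIV in \<open>auto intro!: derivative_eq_intros\<close>)
qed (use assms in auto)

lemma smooth_affine: assumes "smooth f" shows "smooth (\<lambda>x. c * f (a * x + b))"
proof (rule smooth_coinduct[of _ "{\<lambda>x. c * f (a * x + b) | f c. smooth f}"])
  fix h assume "h \<in> {\<lambda>x. c * f (a * x + b) | f c. smooth f}"
  then obtain f c where h: "h = (\<lambda>x. c * f (a * x + b))" "smooth f" by auto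
  have "(h has_real_derivative (c * a) * deriv f (a * x + b)) (at x)" for x
  proof -
    have "((\<lambda>x. a * x + b) has_real_derivative a) (at x)" by (auto intro!: derivative_eq_intros)
    from DERIV_cmult[OF DERIV_chain2[OF smooth_DERIV[OF h(2)] this], of c] show ?thesis
      by (simp add: h(1) mult_ac)
  qed
  then show "\<exists>h'\<in>{\<lambda>x. c * f (a * x + b) | f c. smooth f}. \<forall>x. (h has_real_derivative h' x) (at x)"
    using smooth_deriv[OF h(2)] by (intro bexI[of _ "\<lambda>x. (c * a) * deriv f (a * x + b)"]) auto
qed (use assms in auto)

text \<open>The derivative of a product is a sum of two products; admitting sums makes the class
  closed under differentiation, as \<open>smooth_coinduct\<close> requires.\<close>

inductive_set smooth_products :: "(real \<Rightarrow> real) set" where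
  prod: "smooth f \<Longrightarrow> smooth g \<Longrightarrow> (\<lambda>x. f x * g x) \<in> smooth_products"
| sum: "f \<in> smooth_products \<Longrightarrow> g \<in> smooth_products \<Longrightarrow> (\<lambda>x. f x + g x) \<in> smooth_products"

lemma smooth_mult: assumes "smooth f" "smooth g" shows "smooth (\<lambda>x. f x * g x)"
proof (rule smooth_coinduct[of _ smooth_products])
  fix h assume "h \<in> smooth_products"
  then show "\<exists>h'\<in>smooth_products. \<forall>x. (h has_real_derivative h' x) (at x)"
  proof induction
    case (prod f g)
    have "(\<lambda>x. deriv f x * g x + f x * deriv g x) \<in> smooth_products"
      using prod by (intro smooth_products.intros smooth_deriv)
    moreover have "((\<lambda>x. f x * g x) has_real_derivative deriv f x * g x + f x * deriv g x) (at x)" for x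
      using DERIV_mult[OF smooth_DERIV[OF prod(1), of x] smooth_DERIV[OF prod(2), of x]] by (simp add: mult.commute add.commute)
    ultimately show ?case by (intro bexI[of _ "\<lambda>x. deriv f x * g x + f x * deriv g x"]) auto
  next
    case (sum f g)
    then obtain f' g' where "f' \<in> smooth_products" "g' \<in> smooth_products"
      "\<And>x. (f has_real_derivative f' x) (at x)" "\<And>x. (g has_real_derivative g' x) (at x)" by blast
    then show ?case
      by (intro bexI[of _ "\<lambda>x. f' x + g' x"]) (auto intro: DERIV_add smooth_products.intros)
  qed
qed (use assms in \<open>auto intro: smooth_products.intros\<close>)

section \<open>Exponentially flat functions and smooth steps\<close>

definition flat :: "real poly \<Rightarrow> real \<Rightarrow> real" where
  "flat P x = (if x > 0 then poly P (1 / x) * exp (- (1 / x)) else 0)"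

lemma poly_times_exp_minus_tendsto_0: "((\<lambda>y::real. poly P y * exp (- y)) \<longlongrightarrow> 0) at_top"
proof -
  have "((\<lambda>y::real. \<Sum>i\<le>degree P. coeff P i * (y ^ i / exp y)) \<longlongrightarrow> (\<Sum>i\<le>degree P. coeff P i * 0)) at_top"
    by (intro tendsto_sum tendsto_mult tendsto_const tendsto_power_div_exp_0)
  then show ?thesis by (simp add: poly_altdef sum_distrib_right exp_minus divide_inverse mult.assoc)
qed

text \<open>By the chain rule, \<open>P(y) * exp (- y)\<close> at \<open>y = 1 / x\<close> has the
  derivative \<open>y\<^sup>2 * (P(y) - P'(y)) * exp (- y)\<close>, so the family
  \<open>flat\<close> is closed under differentiation. At \<open>0\<close> the difference quotient
  from the right is again of this form, and exponential decay wins.\<close>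

lemma flat_DERIV: "(flat P has_real_derivative flat ([:0, 0, 1:] * (P - pderiv P)) x) (at x)"
proof -
  consider "x > 0" | "x < 0" | "x = 0" by linarith
  then show ?thesis
  proof cases
    case 1
    have "((\<lambda>x. poly P (1 / x) * exp (- (1 / x))) has_real_derivative flat ([:0, 0, 1:] * (P - pderiv P)) x) (at x)"
      using 1 by (auto simp: flat_def field_simps power2_eq_square intro!: derivative_eq_intros DERIV_chain2[OF poly_DERIV])
    then show ?thesis
    proof (rule DERIV_cong_ev[THEN iffD1, rotated -1, OF _ refl])
      show "\<forall>\<^sub>F y in nhds x. poly P (1 / y) * exp (- (1 / y)) = flat P y"
        using eventually_nhds_in_open[of "{0<..}" x] 1 by (auto elim!: eventually_mono simp: flat_def)
    qed simp
  next
    case 2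
    have "((\<lambda>x::real. 0) has_real_derivative flat ([:0, 0, 1:] * (P - pderiv P)) x) (at x)"
      using 2 by (auto simp: flat_def)
    then show ?thesis
    proof (rule DERIV_cong_ev[THEN iffD1, rotated -1, OF _ refl])
      show "\<forall>\<^sub>F y in nhds x. 0 = flat P y"
        using eventually_nhds_in_open[of "{..<0}" x] 2 by (auto elim!: eventually_mono simp: flat_def)
    qed simp
  next
    case 3
    \<comment> \<open>\<open>pCons 0 P\<close> is the polynomial \<open>y * P\<close>; the factor
      \<open>y = inverse h\<close> comes from dividing by \<open>h\<close>.\<close>
    have "((\<lambda>h. poly (pCons 0 P) (inverse h) * exp (- inverse h)) \<longlongrightarrow> 0) (at_right (0::real))"
      by (rule filterlim_compose[OF poly_times_exp_minus_tendsto_0 filterlim_inverse_at_top_right])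
    then have "((\<lambda>h. (flat P (0 + h) - flat P 0) / h) \<longlongrightarrow> 0) (at_right 0)"
      by (rule Lim_transform_eventually)
         (auto simp: eventually_at_filter flat_def divide_inverse mult_ac)
    moreover have "((\<lambda>h. (flat P (0 + h) - flat P 0) / h) \<longlongrightarrow> 0) (at_left 0)"
      by (rule Lim_transform_eventually[OF tendsto_const]) (auto simp: eventually_at_filter flat_def)
    ultimately have "((\<lambda>h. (flat P (0 + h) - flat P 0) / h) \<longlongrightarrow> 0) (at 0)"
      by (simp add: filterlim_split_at)
    then show ?thesis using 3 by (simp add: DERIV_def flat_def)
  qed
qed

lemma smooth_flat: "smooth (flat P)"
  by (rule smooth_coinduct[of _ "range flat"]) (use flat_DERIV in auto)

lemma antiderivative_exists:
  fixes f :: "real \<Rightarrow> 'a::euclidean_space"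
  assumes "continuous_on UNIV f"
  shows "\<exists>F. \<forall>x. (F has_vector_derivative f x) (at x)"
  using einterval_antiderivative[of "-\<infinity>" "\<infinity>" f] assms by (auto simp: continuous_on_eq_continuous_at)

text \<open>The bump \<open>exp (- 1 / x) * exp (- 1 / (1 - x))\<close> on the unit interval is
  integrated and normalized.\<close>

lemma smooth_step_exists:
  "\<exists>\<eta>. smooth \<eta> \<and> (\<forall>x\<le>0. \<eta> x = 0) \<and> (\<forall>x\<ge>1. \<eta> x = 1) \<and> (\<forall>x. 0 \<le> \<eta> x \<and> \<eta> x \<le> 1)"
proof -
  define e where "e x = flat 1 x * (1 * flat 1 ((-1) * x + 1))" for x
  have se: "smooth e" unfolding e_def by (intro smooth_mult smooth_affine smooth_flat)
  have e0: "e x \<ge> 0" for x by (auto simp: e_def flat_def)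
  have e1: "e x > 0" if "0 < x" "x < 1" for x using that by (auto simp: e_def flat_def)
  have e2: "e x = 0" if "x \<le> 0 \<or> x \<ge> 1" for x using that by (auto simp: e_def flat_def)
  obtain F where F: "\<And>x. (F has_real_derivative e x) (at x)"
    using antiderivative_exists[OF smooth_continuous[OF se]] by (auto simp: has_real_derivative_iff_has_vector_derivative)
  have mono: "F x \<le> F y" if "x \<le> y" for x y
    using that by (rule DERIV_nonneg_imp_nondecreasing) (use F e0 in blast)
  obtain z where z: "0 < z" "z < 1" "F 1 - F 0 = (1 - 0) * e z" using MVT2[of 0 1 F e] F by auto
  then have pos: "F 1 > F 0" using e1[of z] by simp
  have l: "F x = F 0" if "x \<le> 0" for x
  proof (cases "x = 0")
    case False
    then have "x < 0" using that by simp
    then obtain z where "x < z" "z < 0" "F 0 - F x = (0 - x) * e z" using MVT2[of x 0 F e] F by blast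
    then show ?thesis using e2[of z] by simp
  qed simp
  have r: "F x = F 1" if "x \<ge> 1" for x
  proof (cases "x = 1")
    case False
    then have "1 < x" using that by simp
    then obtain z where "1 < z" "z < x" "F x - F 1 = (x - 1) * e z" using MVT2[of 1 x F e] F by blast
    then show ?thesis using e2[of z] by simp
  qed simp
  define k where "k = 1 / (F 1 - F 0)"
  have k: "k > 0" "k * (F 1 - F 0) = 1" using pos by (auto simp: k_def)
  define \<eta> where "\<eta> x = k * (F x - F 0)" for x
  have "smooth \<eta>"
  proof (rule smooth_antiderivative)
    show "smooth (\<lambda>x. k * e (1 * x + 0))" by (intro smooth_affine se)
    show "(\<eta> has_real_derivative k * e (1 * x + 0)) (at x)" for x
      unfolding \<eta>_def by (auto intro!: derivative_eq_intros F)
  qed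
  moreover have "0 \<le> \<eta> x \<and> \<eta> x \<le> 1" for x
  proof -
    have "F 0 \<le> F x" using mono[of 0 x] l[of x] by linarith
    moreover have "F x \<le> F 1" using mono[of x 1] r[of x] by linarith
    ultimately show ?thesis using k mult_left_mono[of "F x - F 0" "F 1 - F 0" k] by (auto simp: \<eta>_def)
  qed
  moreover have "\<eta> x = 0" if "x \<le> 0" for x
    unfolding \<eta>_def l[OF that] by simp
  moreover have "\<eta> x = 1" if "x \<ge> 1" for x
    unfolding \<eta>_def r[OF that] by (rule k(2))
  ultimately show ?thesis by blast
qed


section \<open>Test functions and their supports\<close>

lemma test_functionI:
  assumes "smooth \<phi>" "\<And>x. \<phi> x \<noteq> 0 \<Longrightarrow> a \<le> x \<and> x \<le> b"
  shows "test_function \<phi>"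
proof -
  have "closure {x. \<phi> x \<noteq> 0} \<subseteq> {a..b}" using assms(2) by (intro closure_minimal) auto
  then have "compact (closure {x. \<phi> x \<noteq> 0})"
    by (meson bounded_closed_interval bounded_subset closed_closure compact_eq_bounded_closed)
  then show ?thesis using assms(1) by (simp add: test_function_def smooth_def)
qed

lemma test_function_smooth: "test_function \<phi> \<Longrightarrow> smooth \<phi>"
  by (simp add: test_function_def smooth_def)

lemma test_function_support:
  assumes "test_function \<phi>"
  obtains c where "c > 0" "\<And>x. \<phi> x \<noteq> 0 \<Longrightarrow> -c < x \<and> x < c" "\<And>x. deriv \<phi> x \<noteq> 0 \<Longrightarrow> -c < x \<and> x < c"
proof -
  have "bounded {x. \<phi> x \<noteq> 0}"
    using assms by (auto simp: test_function_def dest: compact_imp_bounded bounded_subset[OF _ closure_subset])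
  then obtain B where B: "B > 0" "\<And>x. \<phi> x \<noteq> 0 \<Longrightarrow> \<bar>x\<bar> \<le> B" by (auto simp: bounded_pos)
  \<comment> \<open>The radius \<open>B + 1\<close> keeps \<open>x\<close> inside an open set on
    which \<open>\<phi>\<close> vanishes identically.\<close>
  have "deriv \<phi> x = 0" if "\<bar>x\<bar> \<ge> B + 1" for x
  proof -
    have "\<phi> y = 0" if "y \<in> {y. \<bar>y\<bar> > B}" for y using B(2)[of y] that by force
    moreover have "open {y::real. \<bar>y\<bar> > B}" by (intro open_Collect_less continuous_intros)
    ultimately have "(\<phi> has_real_derivative 0) (at x)"
      using that by (intro has_field_derivative_transform_within_open[OF DERIV_const[of 0], where S="{y. \<bar>y\<bar> > B}"]) auto
    then show ?thesis by (rule DERIV_imp_deriv)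
  qed
  then have d: "\<bar>x\<bar> < B + 1" if "deriv \<phi> x \<noteq> 0" for x using that by (meson not_le)
  show ?thesis
  proof (rule that[of "B + 1"])
    show "-(B + 1) < x \<and> x < B + 1" if "\<phi> x \<noteq> 0" for x using B(2)[OF that] by linarith
    show "-(B + 1) < x \<and> x < B + 1" if "deriv \<phi> x \<noteq> 0" for x using d[OF that] by linarith
  qed (use B in simp)
qed

lemma test_function_deriv: assumes "test_function \<phi>" shows "test_function (deriv \<phi>)"
proof -
  obtain c where c: "\<And>x. deriv \<phi> x \<noteq> 0 \<Longrightarrow> -c < x \<and> x < c" using test_function_support[OF assms] by metis
  show ?thesis
  proof (rule test_functionI[of _ "-c" c])
    show "smooth (deriv \<phi>)" by (rule smooth_deriv[OF test_function_smooth[OF assms]])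
    show "- c \<le> x \<and> x \<le> c" if "deriv \<phi> x \<noteq> 0" for x using c[OF that] by simp
  qed
qed

lemma test_function_add: assumes "test_function \<phi>" "test_function \<psi>" shows "test_function (\<lambda>x. \<phi> x + \<psi> x)"
proof -
  obtain c where c: "\<And>x. \<phi> x \<noteq> 0 \<Longrightarrow> -c < x \<and> x < c" using test_function_support[OF assms(1)] by metis
  obtain d where d: "\<And>x. \<psi> x \<noteq> 0 \<Longrightarrow> -d < x \<and> x < d" using test_function_support[OF assms(2)] by metis
  show ?thesis
  proof (rule test_functionI[of _ "-(max c d)" "max c d"])
    fix x assume "\<phi> x + \<psi> x \<noteq> 0"
    then have "\<phi> x \<noteq> 0 \<or> \<psi> x \<noteq> 0" by (rule contrapos_np) simp
    then show "- max c d \<le> x \<and> x \<le> max c d" using c[of x] d[of x] by auto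
  qed (use assms in \<open>auto intro: smooth_add test_function_smooth\<close>)
qed

lemma test_function_cmult: assumes "test_function \<phi>" shows "test_function (\<lambda>x. k * \<phi> x)"
proof -
  obtain c where c: "\<And>x. \<phi> x \<noteq> 0 \<Longrightarrow> -c < x \<and> x < c" using test_function_support[OF assms(1)] by metis
  show ?thesis
  proof (rule test_functionI[of _ "-c" c])
    show "smooth (\<lambda>x. k * \<phi> x)" using smooth_affine[OF test_function_smooth[OF assms], of k 1 0] by simp
    show "- c \<le> x \<and> x \<le> c" if "k * \<phi> x \<noteq> 0" for x using c[of x] that by simp
  qed
qed

lemma test_function_bound:
  assumes "test_function \<phi>"
  obtains C where "C \<ge> 0" "\<And>x. \<bar>\<phi> x\<bar> \<le> C"
proof -
  obtain c where c: "\<And>x. \<phi> x \<noteq> 0 \<Longrightarrow> -c < x \<and> x < c" using test_function_support[OF assms(1)] by metis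
  have "compact (\<phi> ` {-c..c})"
    by (intro compact_continuous_image continuous_on_subset[OF smooth_continuous] test_function_smooth assms) auto
  then obtain C where C: "C > 0" "\<And>x. x \<in> {-c..c} \<Longrightarrow> \<bar>\<phi> x\<bar> \<le> C" by (auto dest!: compact_imp_bounded simp: bounded_pos)
  then have "\<bar>\<phi> x\<bar> \<le> C" for x using c[of x] by (cases "\<phi> x = 0") auto
  then show ?thesis using C by (intro that[of C]) auto
qed

lemma test_function_measurable: "test_function \<phi> \<Longrightarrow> \<phi> \<in> borel_measurable borel"
  using smooth_continuous[OF test_function_smooth] by (rule borel_measurable_continuous_onI)

lemma test_function_times_integrable:
  fixes k :: "real \<Rightarrow> complex"
  assumes "test_function \<phi>" and k: "\<And>a b. set_integrable lborel {a..b} k"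
    and [measurable]: "k \<in> borel_measurable borel"
  shows "integrable lborel (\<lambda>x. \<phi> x *\<^sub>R k x)"
proof -
  obtain c where c: "\<And>x. \<phi> x \<noteq> 0 \<Longrightarrow> -c < x \<and> x < c" using test_function_support[OF assms(1)] by metis
  obtain C where C: "C \<ge> 0" "\<And>x. \<bar>\<phi> x\<bar> \<le> C" using test_function_bound[OF assms(1)] by metis
  note [measurable] = test_function_measurable[OF assms(1)]
  have "integrable lborel (\<lambda>x. C *\<^sub>R (indicator {-c..c} x *\<^sub>R k x))"
    by (rule integrable_scaleR_right) (use k[of "-c" c] in \<open>simp add: set_integrable_def\<close>)
  then show ?thesis
  proof (rule Bochner_Integration.integrable_bound)
    show "AE x in lborel. norm (\<phi> x *\<^sub>R k x) \<le> norm (C *\<^sub>R (indicator {-c..c} x *\<^sub>R k x))"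
    proof (rule AE_I2)
      fix x
      show "norm (\<phi> x *\<^sub>R k x) \<le> norm (C *\<^sub>R (indicator {-c..c} x *\<^sub>R k x))"
        using c[of x] C(1) C(2)[of x] by (cases "\<phi> x = 0") (auto intro!: mult_right_mono)
    qed
  qed measurable
qed

text \<open>Differences of two ever steeper smooth steps converge boundedly to the indicator of
  \<open>{a<..b}\<close>; dominated convergence reduces the claim to integrals over
  intervals.\<close>

lemma AE_eq_0_if_test_integrals_0:
  fixes k :: "real \<Rightarrow> complex"
  assumes [measurable]: "k \<in> borel_measurable borel" and k: "\<And>a b. set_integrable lborel {a..b} k"
    and z: "\<And>\<phi>. test_function \<phi> \<Longrightarrow> (LINT x|lborel. \<phi> x *\<^sub>R k x) = 0"
  shows "AE x in lborel. k x = 0"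
proof (rule AE_eq_0_if_interval_integrals_0[OF k])
  fix a b :: real assume "a \<le> b"
  obtain \<eta> where \<eta>: "smooth \<eta>" "\<And>x. x \<le> 0 \<Longrightarrow> \<eta> x = 0" "\<And>x. x \<ge> 1 \<Longrightarrow> \<eta> x = 1" "\<And>x. 0 \<le> \<eta> x" "\<And>x. \<eta> x \<le> 1"
    using smooth_step_exists by metis
  define \<zeta> where "\<zeta> n x = 1 * \<eta> (real (Suc n) * x + (- real (Suc n) * a)) + (-1) * \<eta> (real (Suc n) * x + (- real (Suc n) * b))" for n x
  \<comment> \<open>Each step is completed within length \<open>1 / Suc n \<le> 1\<close>, so the
    one interval \<open>{a..b + 1}\<close> supports all \<open>\<zeta> n\<close>.\<close>
  have out: "\<zeta> n x = 0" if "x < a \<or> x > b + 1" for n x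
  proof -
    have "real (Suc n) * (x - b) \<ge> 1 * 1" if "x > b + 1" using that by (intro mult_mono) auto
    moreover have "real (Suc n) * (x - a) \<ge> real (Suc n) * (x - b)" using \<open>a \<le> b\<close> by (intro mult_left_mono) auto
    moreover have "real (Suc n) * (x - a) \<le> 0" if "x < a" using that by (intro mult_nonneg_nonpos) auto
    moreover have "real (Suc n) * (x - b) \<le> 0" if "x < a" using that \<open>a \<le> b\<close> by (intro mult_nonneg_nonpos) auto
    ultimately show ?thesis using that \<eta>(2,3) unfolding \<zeta>_def
      by (smt (verit, best) mult_minus_left right_diff_distrib)
  qed
  have t: "test_function (\<zeta> n)" for n
  proof (rule test_functionI[of _ a "b + 1"])
    show "smooth (\<zeta> n)" unfolding \<zeta>_def by (intro smooth_add smooth_affine \<eta>)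
    show "a \<le> x \<and> x \<le> b + 1" if "\<zeta> n x \<noteq> 0" for x using out[of x n] that by force
  qed
  note [measurable] = test_function_measurable[OF t]
  have step: "(\<lambda>n. \<eta> (real (Suc n) * x + (- real (Suc n) * c))) \<longlonglongrightarrow> indicator {c<..} x" for x c
  proof (cases "x > c")
    case True
    obtain N where N: "real N * (x - c) > 1" using reals_Archimedean3[of "x - c"] True by auto
    have "\<eta> (real (Suc n) * x + (- real (Suc n) * c)) = 1" if "n \<ge> N" for n
    proof (rule \<eta>(3))
      have "real N * (x - c) \<le> real (Suc n) * (x - c)" using True that by (intro mult_right_mono) auto
      then show "1 \<le> real (Suc n) * x + (- real (Suc n) * c)" using N by (simp add: algebra_simps)
    qed
    then show ?thesis using True by (intro tendsto_eventually eventually_sequentiallyI[of N]) auto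
  next
    case False
    have "\<eta> (real (Suc n) * x + (- real (Suc n) * c)) = 0" for n
    proof (rule \<eta>(2))
      have "real (Suc n) * (x - c) \<le> 0" using False by (intro mult_nonneg_nonpos) auto
      then show "real (Suc n) * x + (- real (Suc n) * c) \<le> 0" by (simp add: algebra_simps)
    qed
    then show ?thesis using False by simp
  qed
  have "(\<lambda>n. LINT x|lborel. \<zeta> n x *\<^sub>R k x) \<longlonglongrightarrow> (LINT x|lborel. indicator {a<..b} x *\<^sub>R k x)"
  proof (rule integral_dominated_convergence)
    show "integrable lborel (\<lambda>x. norm (indicat_real {a..b+1} x *\<^sub>R k x))"
      using k[of a "b+1"] by (intro integrable_norm) (simp add: set_integrable_def)
    show "AE x in lborel. (\<lambda>n. \<zeta> n x *\<^sub>R k x) \<longlonglongrightarrow> indicat_real {a<..b} x *\<^sub>R k x"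
    proof (rule AE_I2)
      fix x
      have "(\<lambda>n. \<zeta> n x) \<longlonglongrightarrow> 1 * indicator {a<..} x + (-1) * indicator {b<..} x"
        unfolding \<zeta>_def by (intro tendsto_intros step)
      also have "1 * indicator {a<..} x + (-1) * indicator {b<..} x = indicat_real {a<..b} x"
        using \<open>a \<le> b\<close> by (auto simp: indicator_def)
      finally show "(\<lambda>n. \<zeta> n x *\<^sub>R k x) \<longlonglongrightarrow> indicat_real {a<..b} x *\<^sub>R k x" by (intro tendsto_intros)
    qed
    have "\<bar>\<zeta> n x\<bar> \<le> 1" for n x
      using \<eta>(4,5)[of "real (Suc n) * x + (- real (Suc n) * a)"] \<eta>(4,5)[of "real (Suc n) * x + (- real (Suc n) * b)"]
      unfolding \<zeta>_def by linarith
    then show "AE x in lborel. norm (\<zeta> n x *\<^sub>R k x) \<le> norm (indicat_real {a..b+1} x *\<^sub>R k x)" for n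
      using out[of _ n] by (intro AE_I2) (auto simp: indicator_def intro!: mult_left_le_one_le)
  qed measurable
  then have "(LINT x|lborel. indicator {a<..b} x *\<^sub>R k x) = 0"
    unfolding z[OF t] by (simp only: LIMSEQ_const_iff)
  moreover have "(LINT x|lborel. indicator {a<..b} x *\<^sub>R k x) = (LINT x|lborel. indicator {a..b} x *\<^sub>R k x)"
  proof (rule integral_cong_AE)
    show "AE x in lborel. indicat_real {a<..b} x *\<^sub>R k x = indicat_real {a..b} x *\<^sub>R k x"
      using AE_lborel_singleton[of a] by eventually_elim (auto simp: indicator_def)
  qed measurable
  ultimately show "(LINT t:{a..b}|lborel. k t) = 0" by (simp add: set_lebesgue_integral_def)
qed

subsection \<open>Weak derivatives and continuous representatives\<close>

lemma set_integral_Icc_split: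
  fixes g :: "real \<Rightarrow> 'a :: {banach, second_countable_topology}"
  assumes "set_integrable lborel {a..c} g" "a \<le> b" "b \<le> c"
  shows "(LINT t:{a..c}|lborel. g t) = (LINT t:{a..b}|lborel. g t) + (LINT t:{b..c}|lborel. g t)"
proof -
  have "(LINT t:{a..b} \<union> {b..c}|lborel. g t) = (LINT t:{a..b}|lborel. g t) + (LINT t:{b..c}|lborel. g t)"
  proof (rule set_integral_Un_AE)
    show "AE x in lborel. \<not> (x \<in> {a..b} \<and> x \<in> {b..c})"
      using AE_lborel_singleton[of b] by eventually_elim auto
  qed (use assms in \<open>auto intro: set_integrable_subset\<close>)
  moreover have "{a..b} \<union> {b..c} = {a..c}" using assms by auto
  ultimately show ?thesis by simp
qed

text \<open>For \<open>g\<close> in \<open>L2\<close> this says that \<open>f\<close> is absolutely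
  continuous with derivative \<open>g\<close>. Increments over \<open>x \<le> y\<close> avoid a base
  point and oriented integrals.\<close>

definition primitive_of :: "(real \<Rightarrow> complex) \<Rightarrow> (real \<Rightarrow> complex) \<Rightarrow> bool" (infix "primitive'_of" 50) where
  "f primitive_of g \<longleftrightarrow> (\<forall>x y. x \<le> y \<longrightarrow> f y - f x = (LINT t:{x..y}|lborel. g t))"

lemma primitive_ofD: "f primitive_of g \<Longrightarrow> x \<le> y \<Longrightarrow> f y - f x = (LINT t:{x..y}|lborel. g t)"
  by (simp add: primitive_of_def)

lemma primitive_exists:
  assumes "g \<in> L2" shows "\<exists>f. f primitive_of g"
proof -
  define f where "f x = (if 0 \<le> x then (LINT t:{0..x}|lborel. g t) else - (LINT t:{x..0}|lborel. g t))" for x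
  note i = L2_set_integrable[OF assms]
  have "f y - f x = (LINT t:{x..y}|lborel. g t)" if "x \<le> y" for x y
    using that set_integral_Icc_split[OF i, of 0 x y] set_integral_Icc_split[OF i, of x 0 y]
      set_integral_Icc_split[OF i, of x y 0] by (auto simp: f_def)
  then show ?thesis by (auto simp: primitive_of_def)
qed

lemma set_integral_norm_bound':
  fixes g :: "real \<Rightarrow> complex"
  assumes "set_integrable lborel A g"
  shows "cmod (LINT t:A|lborel. g t) \<le> (LINT t:A|lborel. cmod (g t))"
  using set_integral_norm_bound[OF assms] by simp

text \<open>Cauchy-Schwarz on the interval between \<open>x\<close> and \<open>y\<close>: the
  embedding of \<open>H1\<close> into the Hoelder functions of order 1/2, the source of all
  equicontinuity below.\<close>

lemma primitive_Holder:
  assumes "f primitive_of g" "g \<in> L2"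
  shows "(cmod (f y - f x))\<^sup>2 \<le> \<bar>y - x\<bar> * sqn g"
proof -
  have *: "(cmod (f y - f x))\<^sup>2 \<le> (y - x) * sqn g" if "x \<le> y" for x y
  proof -
    have "cmod (f y - f x) \<le> (LINT t:{x..y}|lborel. cmod (g t))"
      using set_integral_norm_bound'[OF L2_set_integrable[OF assms(2), of x y]] primitive_ofD[OF assms(1) that] by simp
    then have "(cmod (f y - f x))\<^sup>2 \<le> (LINT t:{x..y}|lborel. cmod (g t))\<^sup>2"
      by (intro power_mono) auto
    then show ?thesis using L2_interval_integral_bound(2)[OF assms(2) that] by simp
  qed
  show ?thesis using *[of x y] *[of y x] by (cases "x \<le> y") (auto simp: norm_minus_commute)
qed

lemma primitive_Holder':
  assumes "f primitive_of g" "g \<in> L2"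
  shows "cmod (f y - f x) \<le> sqrt (\<bar>y - x\<bar> * sqn g)"
  using primitive_Holder[OF assms, of y x] by (intro real_le_rsqrt)

lemma primitive_continuous:
  assumes "f primitive_of g" "g \<in> L2"
  shows "continuous_on UNIV f"
proof -
  have "(f \<longlongrightarrow> f x) (at x)" for x
  proof (rule tendsto_norm_zero_cancel[THEN LIM_zero_cancel])
    have "((\<lambda>y. sqrt (\<bar>y - x\<bar> * sqn g)) \<longlongrightarrow> sqrt (\<bar>x - x\<bar> * sqn g)) (at x)"
      by (intro tendsto_intros)
    then have 1: "((\<lambda>y. sqrt (\<bar>y - x\<bar> * sqn g)) \<longlongrightarrow> 0) (at x)" by simp
    show "((\<lambda>y. norm (f y - f x)) \<longlongrightarrow> 0) (at x)"
      by (rule tendsto_sandwich[OF _ _ tendsto_const 1])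
         (use primitive_Holder'[OF assms] in \<open>auto intro!: always_eventually\<close>)
  qed
  then show ?thesis by (simp add: continuous_on_def)
qed

lemma continuous_set_integrable:
  fixes f :: "real \<Rightarrow> 'a :: {banach, second_countable_topology}"
  shows "continuous_on UNIV f \<Longrightarrow> set_integrable lborel {a..b} f"
  by (rule borel_integrable_atLeastAtMost') (auto intro: continuous_on_subset)

section \<open>Primitives are weakly differentiable\<close>

lemma test_function_FTC:
  assumes "test_function \<phi>" "a \<le> b"
  shows "(LINT x|lborel. indicator {a..b} x *\<^sub>R deriv \<phi> x) = \<phi> b - \<phi> a"
  using assms(2)
proof (rule integral_FTC_atLeastAtMost)
  show "(\<phi> has_vector_derivative deriv \<phi> x) (at x within {a..b})" for x
    using smooth_DERIV[OF test_function_smooth[OF assms(1)], of x]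
    by (simp add: has_real_derivative_iff_has_vector_derivative has_vector_derivative_at_within)
  show "continuous_on {a..b} (deriv \<phi>)"
    by (rule continuous_on_subset[OF smooth_continuous[OF smooth_deriv[OF test_function_smooth[OF assms(1)]]]]) simp
qed

lemma integrable_product_lborel:
  fixes f :: "real \<Rightarrow> real" and g :: "real \<Rightarrow> complex"
  assumes f: "integrable lborel f" and g: "integrable lborel g"
  shows "integrable (lborel \<Otimes>\<^sub>M lborel) (\<lambda>(x, y). f x *\<^sub>R g y)"
proof (rule lborel_pair.Fubini_integrable)
  note [measurable] = borel_measurable_integrable[OF f] borel_measurable_integrable[OF g]
  show "(\<lambda>(x, y). f x *\<^sub>R g y) \<in> borel_measurable (lborel \<Otimes>\<^sub>M lborel)" by measurable
  have "integrable lborel (\<lambda>x. \<bar>f x\<bar> * (LINT y|lborel. cmod (g y)))"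
    using f by (intro integrable_mult_left integrable_abs)
  then show "integrable lborel (\<lambda>x. LINT y|lborel. norm (case (x, y) of (x, y) \<Rightarrow> f x *\<^sub>R g y))" by simp
  show "AE x in lborel. integrable lborel (\<lambda>y. case (x, y) of (x, y) \<Rightarrow> f x *\<^sub>R g y)"
    using g by (intro AE_I2) simp
qed

text \<open>Integration by parts as Fubini's theorem on the triangle \<open>y \<le> x\<close> in the
  square over \<open>{-c..c}\<close>.\<close>

lemma primitive_has_weak_derivative:
  assumes F: "f primitive_of g" and g: "g \<in> L2"
  shows "f has_weak_derivative g"
  unfolding has_weak_derivative_def
proof (intro allI impI)
  fix \<phi> assume t: "test_function \<phi>"
  obtain c where c: "c > 0" "\<And>x. \<phi> x \<noteq> 0 \<Longrightarrow> -c < x \<and> x < c" "\<And>x. deriv \<phi> x \<noteq> 0 \<Longrightarrow> -c < x \<and> x < c"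
    using test_function_support[OF t] by metis
  note t' = test_function_deriv[OF t]
  note [measurable] = test_function_measurable[OF t] test_function_measurable[OF t'] L2_measurable[OF g]
    borel_measurable_continuous_onI[OF primitive_continuous[OF F g]]
  let ?I = "indicat_real {-c..c}"
  \<comment> \<open>Integrating over \<open>y\<close> first produces
    \<open>deriv \<phi> x * (f x - f (-c))\<close>; over \<open>x\<close> first it produces
    \<open>- \<phi> y * g y\<close>, because \<open>\<phi> c = 0\<close>.\<close>
  define K where "K x y = (if y \<le> x then (?I x * deriv \<phi> x) *\<^sub>R (?I y *\<^sub>R g y) else 0)" for x y :: real
  have i\<phi>: "integrable lborel (\<lambda>x. ?I x * deriv \<phi> x)"
    using continuous_set_integrable[OF smooth_continuous[OF test_function_smooth[OF t']], of "-c" c]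
    by (simp add: set_integrable_def)
  have ig: "integrable lborel (\<lambda>y. ?I y *\<^sub>R g y)"
    using L2_set_integrable[OF g, of "-c" c] by (simp add: set_integrable_def)
  have [measurable]: "case_prod K \<in> borel_measurable (lborel \<Otimes>\<^sub>M lborel)"
    unfolding K_def[abs_def] by measurable
  have iK: "integrable (lborel \<Otimes>\<^sub>M lborel) (case_prod K)"
    by (rule Bochner_Integration.integrable_bound[OF integrable_product_lborel[OF i\<phi> ig]]) (auto simp: K_def)
  have 1: "(LINT y|lborel. K x y) = deriv \<phi> x *\<^sub>R (f x - f (-c))" for x
  proof (cases "-c \<le> x \<and> x \<le> c")
    case True
    have "(LINT y|lborel. K x y) = (LINT y|lborel. deriv \<phi> x *\<^sub>R (indicator {-c..x} y *\<^sub>R g y))"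
      using True by (intro Bochner_Integration.integral_cong) (auto simp: K_def indicator_def)
    also have "\<dots> = deriv \<phi> x *\<^sub>R (f x - f (-c))"
      unfolding integral_scaleR_right using primitive_ofD[OF F, of "-c" x] True by (simp add: set_lebesgue_integral_def)
    finally show ?thesis .
  next
    case False
    then have "deriv \<phi> x = 0" using c(3)[of x] by force
    then have "K x y = 0" for y by (simp add: K_def)
    then show ?thesis using \<open>deriv \<phi> x = 0\<close> by simp
  qed
  have 2: "(LINT x|lborel. K x y) = - (\<phi> y *\<^sub>R g y)" for y
  proof (cases "-c \<le> y \<and> y \<le> c")
    case True
    have "\<phi> c = 0" using c(2)[of c] by force
    have "(LINT x|lborel. K x y) = (LINT x|lborel. (indicator {y..c} x *\<^sub>R deriv \<phi> x) *\<^sub>R g y)"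
      using True by (intro Bochner_Integration.integral_cong) (auto simp: K_def indicator_def)
    also have "\<dots> = (LINT x|lborel. indicator {y..c} x *\<^sub>R deriv \<phi> x) *\<^sub>R g y"
    proof (rule integral_scaleR_left)
      have "integrable lborel (\<lambda>x. indicator {y..c} x *\<^sub>R deriv \<phi> x)"
        using continuous_set_integrable[OF smooth_continuous[OF test_function_smooth[OF t']], of y c]
        by (simp add: set_integrable_def)
      then show "g y \<noteq> 0 \<Longrightarrow> integrable lborel (\<lambda>x. indicator {y..c} x *\<^sub>R deriv \<phi> x)" .
    qed
    also have "\<dots> = - (\<phi> y *\<^sub>R g y)"
      using test_function_FTC[OF t, of y c] True \<open>\<phi> c = 0\<close> by simp
    finally show ?thesis .
  next
    case False
    then have "\<phi> y = 0" using c(2)[of y] by force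
    then have "K x y = 0" for x using False by (simp add: K_def)
    then show ?thesis using \<open>\<phi> y = 0\<close> by simp
  qed
  \<comment> \<open>The vanishing mean of \<open>deriv \<phi>\<close> removes the constant
    \<open>f (-c)\<close> that the kernel leaves behind.\<close>
  have "(LINT x|lborel. deriv \<phi> x) = (LINT x|lborel. indicator {-c..c} x *\<^sub>R deriv \<phi> x)"
    using c(3) by (intro Bochner_Integration.integral_cong) (auto simp: indicator_def less_eq_real_def)
  also have "\<dots> = 0"
  proof -
    have "\<phi> c = 0" "\<phi> (-c) = 0" using c(2)[of c] c(2)[of "-c"] by force+
    then show ?thesis using test_function_FTC[OF t, of "-c" c] c(1) by simp
  qed
  finally have 0: "(LINT x|lborel. deriv \<phi> x) = 0" .
  have i1: "integrable lborel (\<lambda>x. deriv \<phi> x *\<^sub>R f x)"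
    by (intro test_function_times_integrable t' continuous_set_integrable primitive_continuous[OF F g]) measurable
  have i2: "integrable lborel (\<lambda>x. deriv \<phi> x *\<^sub>R f (-c))"
    by (intro test_function_times_integrable t' continuous_set_integrable continuous_on_const) measurable
  have "(LINT x|lborel. (LINT y|lborel. K x y)) = (LINT x|lborel. deriv \<phi> x *\<^sub>R f x) - (LINT x|lborel. deriv \<phi> x *\<^sub>R f (-c))"
    unfolding 1 scaleR_diff_right using i1 i2 by (rule Bochner_Integration.integral_diff)
  also have "(LINT x|lborel. deriv \<phi> x *\<^sub>R f (-c)) = 0"
  proof -
    have "integrable lborel (deriv \<phi>)"
    proof (rule Bochner_Integration.integrable_bound[OF i\<phi>])
      show "AE x in lborel. norm (deriv \<phi> x) \<le> norm (?I x * deriv \<phi> x)"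
        using c(3) by (intro AE_I2) (auto simp: indicator_def less_eq_real_def)
    qed measurable
    then show ?thesis using 0 by (subst integral_scaleR_left) auto
  qed
  finally have "(LINT x|lborel. deriv \<phi> x *\<^sub>R f x) = (LINT y|lborel. (LINT x|lborel. K x y))"
    using lborel_pair.Fubini_integral[OF iK] by simp
  then show "(LINT x|lborel. deriv \<phi> x *\<^sub>R f x) = - (LINT x|lborel. \<phi> x *\<^sub>R g x)"
    by (simp add: 2)
qed

section \<open>Weakly differentiable functions are primitives\<close>

lemma test_function_integrable:
  assumes "test_function \<phi>" shows "integrable lborel \<phi>"
proof -
  have "integrable lborel (\<lambda>x. \<phi> x *\<^sub>R (1::complex))"
    by (intro test_function_times_integrable assms continuous_set_integrable continuous_on_const) measurable
  then have "integrable lborel (\<lambda>x. norm (\<phi> x *\<^sub>R (1::complex)))" by (rule integrable_norm)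
  then show ?thesis using test_function_measurable[OF assms] by (simp add: integrable_abs_iff)
qed

text \<open>A primitive that is zero to the left of the support is zero to the right of it as well,
  because the mean vanishes.\<close>

lemma test_function_antiderivative:
  assumes t: "test_function \<zeta>" and z: "(LINT x|lborel. \<zeta> x) = 0"
  shows "\<exists>\<phi>. test_function \<phi> \<and> deriv \<phi> = \<zeta>"
proof -
  obtain c where c: "c > 0" "\<And>x. \<zeta> x \<noteq> 0 \<Longrightarrow> -c < x \<and> x < c" using test_function_support[OF t] by metis
  obtain F where F: "\<And>x. (F has_real_derivative \<zeta> x) (at x)"
    using antiderivative_exists[OF smooth_continuous[OF test_function_smooth[OF t]]]
    by (auto simp: has_real_derivative_iff_has_vector_derivative)
  define \<phi> where "\<phi> x = F x - F (-c)" for x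
  have D: "(\<phi> has_real_derivative \<zeta> x) (at x)" for x
    unfolding \<phi>_def by (auto intro!: derivative_eq_intros F)
  have int: "(LINT x|lborel. indicator {a..b} x *\<^sub>R \<zeta> x) = \<phi> b - \<phi> a" if "a \<le> b" for a b
    using that
  proof (rule integral_FTC_atLeastAtMost)
    show "(\<phi> has_vector_derivative \<zeta> x) (at x within {a..b})" for x
      using D by (simp add: has_real_derivative_iff_has_vector_derivative has_vector_derivative_at_within)
    show "continuous_on {a..b} \<zeta>"
      by (rule continuous_on_subset[OF smooth_continuous[OF test_function_smooth[OF t]]]) simp
  qed
  have left: "\<phi> x = 0" if "x \<le> -c" for x
  proof -
    have "indicator {x..-c} y *\<^sub>R \<zeta> y = 0" for y
      using c(2)[of y] by (cases "\<zeta> y = 0") (auto simp: indicator_def)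
    then have "(LINT y|lborel. indicator {x..-c} y *\<^sub>R \<zeta> y) = 0" by (simp only: integral_zero)
    then show ?thesis using int[OF that] by (simp add: \<phi>_def)
  qed
  have right: "\<phi> x = 0" if "x \<ge> c" for x
  proof -
    have "indicator {-c..x} y *\<^sub>R \<zeta> y = \<zeta> y" for y
      using c(2)[of y] that by (cases "\<zeta> y = 0") (auto simp: indicator_def)
    then have "(LINT y|lborel. indicator {-c..x} y *\<^sub>R \<zeta> y) = 0" using z by (simp only:)
    then show ?thesis using int[of "-c" x] that c(1) by (simp add: \<phi>_def)
  qed
  have "test_function \<phi>"
  proof (rule test_functionI)
    show "smooth \<phi>" by (rule smooth_antiderivative[OF test_function_smooth[OF t] D])
    show "-c \<le> x \<and> x \<le> c" if "\<phi> x \<noteq> 0" for x using left[of x] right[of x] that by force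
  qed
  moreover have "deriv \<phi> = \<zeta>" using D by (auto intro: DERIV_imp_deriv)
  ultimately show ?thesis by blast
qed

lemma test_function_integral_1_exists: "\<exists>\<psi>. test_function \<psi> \<and> (LINT x|lborel. \<psi> x) = 1"
proof -
  obtain \<eta> where \<eta>: "smooth \<eta>" "\<And>x. x \<le> 0 \<Longrightarrow> \<eta> x = 0" "\<And>x. x \<ge> 1 \<Longrightarrow> \<eta> x = 1"
    using smooth_step_exists by metis
  have out: "deriv \<eta> x = 0" if "x < 0 \<or> x > 1" for x
  proof -
    have "(\<eta> has_real_derivative 0) (at x)"
    proof (cases "x < 0")
      case True
      then show ?thesis
        using \<eta>(2) by (intro has_field_derivative_transform_within_open[OF DERIV_const[of 0], where S="{..<0}"]) auto
    next
      case False
      then show ?thesis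
        using \<eta>(3) that by (intro has_field_derivative_transform_within_open[OF DERIV_const[of 1], where S="{1<..}"]) auto
    qed
    then show ?thesis by (rule DERIV_imp_deriv)
  qed
  have "test_function (deriv \<eta>)"
  proof (rule test_functionI)
    show "smooth (deriv \<eta>)" by (rule smooth_deriv[OF \<eta>(1)])
    show "0 \<le> x \<and> x \<le> 1" if "deriv \<eta> x \<noteq> 0" for x using out[of x] that by force
  qed
  moreover have "(LINT x|lborel. indicator {0..1} x *\<^sub>R deriv \<eta> x) = \<eta> 1 - \<eta> 0"
  proof (rule integral_FTC_atLeastAtMost)
    show "(\<eta> has_vector_derivative deriv \<eta> x) (at x within {0..1})" for x
      using smooth_DERIV[OF \<eta>(1), of x]
      by (simp add: has_real_derivative_iff_has_vector_derivative has_vector_derivative_at_within)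
    show "continuous_on {0..1} (deriv \<eta>)"
      by (rule continuous_on_subset[OF smooth_continuous[OF smooth_deriv[OF \<eta>(1)]]]) simp
  qed simp
  moreover have "indicator {0..1} x *\<^sub>R deriv \<eta> x = deriv \<eta> x" for x
    using out[of x] by (cases "x \<in> {0..1}") (auto simp: indicator_def)
  ultimately have "test_function (deriv \<eta>)" "(LINT x|lborel. deriv \<eta> x) = \<eta> 1 - \<eta> 0" by (simp_all only:)
  then show ?thesis using \<eta>(2)[of 0] \<eta>(3)[of 1] by (intro exI[of _ "deriv \<eta>"]) simp
qed

text \<open>The du Bois-Reymond lemma: subtract a primitive of \<open>g\<close>, and test the difference with
  \<open>\<zeta> - (\<integral>\<zeta>) \<psi>\<close>, which is the derivative of a test function.\<close>

lemma weak_derivative_representative: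
  assumes f: "f \<in> L2" and g: "g \<in> L2" and w: "f has_weak_derivative g"
  shows "\<exists>F. F primitive_of g \<and> (AE x in lborel. F x = f x)"
proof -
  obtain F where F: "F primitive_of g" using primitive_exists[OF g] by blast
  note wF = primitive_has_weak_derivative[OF F g] and cF = primitive_continuous[OF F g]
  note [measurable] = L2_measurable[OF f] L2_measurable[OF g] borel_measurable_continuous_onI[OF cF]
  obtain \<psi> where \<psi>: "test_function \<psi>" "(LINT x|lborel. \<psi> x) = 1" using test_function_integral_1_exists by blast
  define h where "h x = f x - F x" for x
  have [measurable]: "h \<in> borel_measurable borel" unfolding h_def by measurable
  have sh: "set_integrable lborel {a..b} h" for a b
    unfolding h_def by (intro set_integral_diff L2_set_integrable f continuous_set_integrable cF)
  note ih = test_function_times_integrable[OF _ sh \<open>h \<in> borel_measurable borel\<close>]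
  have z: "(LINT x|lborel. deriv \<phi> x *\<^sub>R h x) = 0" if "test_function \<phi>" for \<phi>
  proof -
    note t = test_function_deriv[OF that]
    have "(LINT x|lborel. deriv \<phi> x *\<^sub>R h x) = (LINT x|lborel. deriv \<phi> x *\<^sub>R f x) - (LINT x|lborel. deriv \<phi> x *\<^sub>R F x)"
      unfolding h_def scaleR_diff_right
      by (intro Bochner_Integration.integral_diff test_function_times_integrable t L2_set_integrable f
          continuous_set_integrable cF) measurable
    then show ?thesis using w wF that by (simp add: has_weak_derivative_def)
  qed
  \<comment> \<open>If \<open>h\<close> is constant, this is its value, since \<open>\<psi>\<close>
    has integral 1.\<close>
  define c where "c = (LINT x|lborel. \<psi> x *\<^sub>R h x)"
  have "AE x in lborel. h x - c = 0"
  proof (rule AE_eq_0_if_test_integrals_0)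
    show "set_integrable lborel {a..b} (\<lambda>x. h x - c)" for a b
      by (intro set_integral_diff sh continuous_set_integrable continuous_on_const)
    fix \<zeta> assume t: "test_function \<zeta>"
    define I where "I = (LINT x|lborel. \<zeta> x)"
    have t2: "test_function (\<lambda>x. \<zeta> x + (-I) * \<psi> x)"
      by (intro test_function_add test_function_cmult t \<psi>)
    have "(LINT x|lborel. \<zeta> x + (-I) * \<psi> x) = 0"
      using \<psi> t by (simp add: test_function_integrable I_def)
    then obtain \<phi> where "test_function \<phi>" "deriv \<phi> = (\<lambda>x. \<zeta> x + (-I) * \<psi> x)"
      using test_function_antiderivative[OF t2] by blast
    then have "(LINT x|lborel. (\<zeta> x + (-I) * \<psi> x) *\<^sub>R h x) = 0" using z by metis
    moreover have "(LINT x|lborel. (\<zeta> x + (-I) * \<psi> x) *\<^sub>R h x) =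
       (LINT x|lborel. \<zeta> x *\<^sub>R h x) + (LINT x|lborel. (-I) *\<^sub>R (\<psi> x *\<^sub>R h x))"
      unfolding scaleR_add_left scaleR_scaleR[symmetric]
      by (intro Bochner_Integration.integral_add integrable_scaleR_right ih t \<psi>)
    moreover have "(LINT x|lborel. (-I) *\<^sub>R (\<psi> x *\<^sub>R h x)) = (-I) *\<^sub>R c"
      unfolding c_def by (rule integral_scaleR_right)
    ultimately have "(LINT x|lborel. \<zeta> x *\<^sub>R h x) + (-I) *\<^sub>R c = 0" by (simp only:)
    then have "(LINT x|lborel. \<zeta> x *\<^sub>R h x) = I *\<^sub>R c" by simp
    moreover have "(LINT x|lborel. \<zeta> x *\<^sub>R (h x - c)) = (LINT x|lborel. \<zeta> x *\<^sub>R h x) - (LINT x|lborel. \<zeta> x *\<^sub>R c)"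
      unfolding scaleR_diff_right
      using ih[OF t] integrable_scaleR_left[OF test_function_integrable[OF t]] by (intro Bochner_Integration.integral_diff) auto
    moreover have "(LINT x|lborel. \<zeta> x *\<^sub>R c) = I *\<^sub>R c"
      unfolding I_def using test_function_integrable[OF t] by (intro integral_scaleR_left) auto
    ultimately show "(LINT x|lborel. \<zeta> x *\<^sub>R (h x - c)) = 0" by simp
  qed measurable
  then have "AE x in lborel. F x + c = f x" by eventually_elim (simp add: h_def algebra_simps)
  moreover have "(\<lambda>x. F x + c) primitive_of g" using F by (simp add: primitive_of_def)
  ultimately show ?thesis by blast
qed

lemma weak_derivative_unique:
  assumes "f has_weak_derivative g" "f has_weak_derivative h" "g \<in> L2" "h \<in> L2"
  shows "AE x in lborel. g x = h x"
proof -
  note L = L2_diff[OF assms(3,4)]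
  have "AE x in lborel. g x - h x = 0"
  proof (rule AE_eq_0_if_test_integrals_0[OF L2_measurable[OF L] L2_set_integrable[OF L]])
    fix \<phi> assume t: "test_function \<phi>"
    have "(LINT x|lborel. \<phi> x *\<^sub>R (g x - h x)) = (LINT x|lborel. \<phi> x *\<^sub>R g x) - (LINT x|lborel. \<phi> x *\<^sub>R h x)"
      unfolding scaleR_diff_right
      by (intro Bochner_Integration.integral_diff test_function_times_integrable t L2_set_integrable L2_measurable assms)
    moreover have "(LINT x|lborel. \<phi> x *\<^sub>R g x) = (LINT x|lborel. \<phi> x *\<^sub>R h x)"
      using assms(1)[unfolded has_weak_derivative_def, rule_format, OF t]
        assms(2)[unfolded has_weak_derivative_def, rule_format, OF t] by simp
    ultimately show "(LINT x|lborel. \<phi> x *\<^sub>R (g x - h x)) = 0" by simp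
  qed
  then show ?thesis by simp
qed

lemma has_weak_derivative_cong:
  assumes "AE x in lborel. f x = f' x" "f \<in> borel_measurable borel" "f' \<in> borel_measurable borel"
  shows "f has_weak_derivative g \<longleftrightarrow> f' has_weak_derivative g"
proof -
  have "(LINT x|lborel. deriv \<phi> x *\<^sub>R f x) = (LINT x|lborel. deriv \<phi> x *\<^sub>R f' x)" if "test_function \<phi>" for \<phi>
  proof (rule integral_cong_AE)
    note [measurable] = test_function_measurable[OF test_function_deriv[OF that]] assms(2,3)
    show "(\<lambda>x. deriv \<phi> x *\<^sub>R f x) \<in> borel_measurable lborel" by measurable
    show "(\<lambda>x. deriv \<phi> x *\<^sub>R f' x) \<in> borel_measurable lborel" by measurable
    show "AE x in lborel. deriv \<phi> x *\<^sub>R f x = deriv \<phi> x *\<^sub>R f' x" using assms(1) by eventually_elim simp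
  qed
  then show ?thesis by (simp add: has_weak_derivative_def)
qed

text \<open>Genuine equality, not only almost everywhere: the choice depends only on the set of weak
  derivatives, which is the same for both functions.\<close>

lemma weak_deriv_cong:
  assumes "AE x in lborel. f x = f' x" "f \<in> borel_measurable borel" "f' \<in> borel_measurable borel"
  shows "weak_deriv f = weak_deriv f'"
  unfolding weak_deriv_def has_weak_derivative_cong[OF assms] ..

lemma weak_deriv_AE_eq:
  assumes "f has_weak_derivative g" "g \<in> L2"
  shows "weak_deriv f \<in> L2" "f has_weak_derivative weak_deriv f" "AE x in lborel. weak_deriv f x = g x"
proof -
  have "weak_deriv f \<in> L2 \<and> f has_weak_derivative weak_deriv f"
    unfolding weak_deriv_def by (rule someI[of _ g]) (use assms in blast)
  then show "weak_deriv f \<in> L2" "f has_weak_derivative weak_deriv f" by auto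
  then show "AE x in lborel. weak_deriv f x = g x" using weak_derivative_unique assms by blast
qed

lemma sqn_cong_AE: "AE x in lborel. f x = g x \<Longrightarrow> f \<in> L2 \<Longrightarrow> g \<in> L2 \<Longrightarrow> sqn f = sqn g"
  unfolding sqn_def by (intro integral_cong_AE) (auto simp: L2_def)

text \<open>The continuous representatives of the elements of \<open>H1\<close>.\<close>

definition H1c :: "(real \<Rightarrow> complex) set" where
  "H1c = {f. f \<in> L2 \<and> weak_deriv f \<in> L2 \<and> f primitive_of weak_deriv f}"

lemma H1c_D:
  assumes "f \<in> H1c"
  shows "f \<in> L2" "weak_deriv f \<in> L2" "f primitive_of weak_deriv f" "continuous_on UNIV f" "f \<in> borel_measurable borel"
  using assms primitive_continuous[of f "weak_deriv f"] L2_measurable by (auto simp: H1c_def)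

text \<open>The way into \<open>H1c\<close>: the chosen \<open>weak_deriv\<close> may differ from
  \<open>g\<close> on a null set, but it has the same integrals.\<close>

lemma H1c_I:
  assumes "f \<in> L2" "g \<in> L2" "f primitive_of g"
  shows "f \<in> H1c" "AE x in lborel. weak_deriv f x = g x" "sqn (weak_deriv f) = sqn g"
proof -
  note w = weak_deriv_AE_eq[OF primitive_has_weak_derivative[OF assms(3,2)] assms(2)]
  show "AE x in lborel. weak_deriv f x = g x" by (rule w)
  then show "sqn (weak_deriv f) = sqn g" by (rule sqn_cong_AE[OF _ w(1) assms(2)])
  have "(LINT t:{x..y}|lborel. g t) = (LINT t:{x..y}|lborel. weak_deriv f t)" for x y
    using w(1,3) assms(2) by (intro set_lebesgue_integral_cong_AE) (auto simp: L2_def)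
  then show "f \<in> H1c" using assms w by (simp add: H1c_def primitive_of_def)
qed

lemma H1c_subset_H1: "f \<in> H1c \<Longrightarrow> f \<in> H1"
  using primitive_has_weak_derivative by (auto simp: H1c_def H1_def)

lemma H1_representative:
  assumes "f \<in> H1"
  shows "\<exists>F\<in>H1c. (AE x in lborel. F x = f x)"
proof -
  from assms obtain g where g: "f \<in> L2" "g \<in> L2" "f has_weak_derivative g" by (auto simp: H1_def)
  then obtain F where F: "F primitive_of g" "AE x in lborel. F x = f x"
    using weak_derivative_representative by blast
  have "F \<in> L2"
    by (rule L2_dominated[OF g(1), of _ 1])
       (use F(2) borel_measurable_continuous_onI[OF primitive_continuous[OF F(1) g(2)]] in auto)
  then show ?thesis using H1c_I(1)[OF _ g(2) F(1)] F(2) by blast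
qed

subsection \<open>The Hilbert space structure and weak compactness\<close>

abbreviation kin :: "(real \<Rightarrow> complex) \<Rightarrow> real" where
  "kin f \<equiv> sqn (weak_deriv f)"

lemma primitive_of_add:
  assumes "f primitive_of f'" "g primitive_of g'" "f' \<in> L2" "g' \<in> L2"
  shows "(\<lambda>x. f x + g x) primitive_of (\<lambda>x. f' x + g' x)"
  unfolding primitive_of_def
proof (intro allI impI)
  fix x y :: real assume "x \<le> y"
  have "f y + g y - (f x + g x) = (f y - f x) + (g y - g x)" by simp
  then show "f y + g y - (f x + g x) = (LINT t:{x..y}|lborel. f' t + g' t)"
    unfolding primitive_ofD[OF assms(1) \<open>x \<le> y\<close>] primitive_ofD[OF assms(2) \<open>x \<le> y\<close>]
      set_integral_add(2)[OF L2_set_integrable[OF assms(3)] L2_set_integrable[OF assms(4)]] .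
qed

lemma primitive_of_cmult:
  "f primitive_of f' \<Longrightarrow> (\<lambda>x. c * f x) primitive_of (\<lambda>x. c * f' x)"
  by (auto simp: primitive_of_def right_diff_distrib[symmetric])

lemma primitive_of_shift:
  assumes "f primitive_of f'"
  shows "(\<lambda>x. f (x + c)) primitive_of (\<lambda>x. f' (x + c))"
  unfolding primitive_of_def
proof (intro allI impI)
  fix x y :: real assume "x \<le> y"
  have "(LINT t:{x..y}|lborel. f' (t + c)) = (LINT t|lborel. indicator {x + c..y + c} (t + c) *\<^sub>R f' (t + c))"
    unfolding set_lebesgue_integral_def by (intro Bochner_Integration.integral_cong) (auto simp: indicator_def)
  also have "\<dots> = (LINT t:{x + c..y + c}|lborel. f' t)"
    unfolding set_lebesgue_integral_def using lborel_integral_shift[of "\<lambda>t. indicator {x + c..y + c} t *\<^sub>R f' t" c] .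
  also have "\<dots> = f (y + c) - f (x + c)" using primitive_ofD[OF assms, of "x + c" "y + c"] \<open>x \<le> y\<close> by simp
  finally show "f (y + c) - f (x + c) = (LINT t:{x..y}|lborel. f' (t + c))" by simp
qed

text \<open>\<open>weak_deriv\<close> is a choice, so it is additive only almost everywhere; the
  identity for the kinetic energy holds exactly and is stated separately. The analogous rules below
  have the same form.\<close>

lemma H1c_add:
  assumes "f \<in> H1c" "g \<in> H1c"
  shows "(\<lambda>x. f x + g x) \<in> H1c"
    and "AE x in lborel. weak_deriv (\<lambda>x. f x + g x) x = weak_deriv f x + weak_deriv g x"
    and "kin (\<lambda>x. f x + g x) = sqn (\<lambda>x. weak_deriv f x + weak_deriv g x)"
proof -
  note f = H1c_D[OF assms(1)] and g = H1c_D[OF assms(2)]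
  note * = H1c_I[OF L2_add[OF f(1) g(1)] L2_add[OF f(2) g(2)] primitive_of_add[OF f(3) g(3) f(2) g(2)]]
  show "(\<lambda>x. f x + g x) \<in> H1c"
    "AE x in lborel. weak_deriv (\<lambda>x. f x + g x) x = weak_deriv f x + weak_deriv g x"
    "kin (\<lambda>x. f x + g x) = sqn (\<lambda>x. weak_deriv f x + weak_deriv g x)" by (fact *)+
qed

lemma H1c_cmult:
  assumes "f \<in> H1c"
  shows "(\<lambda>x. c * f x) \<in> H1c"
    and "AE x in lborel. weak_deriv (\<lambda>x. c * f x) x = c * weak_deriv f x"
    and "kin (\<lambda>x. c * f x) = (cmod c)\<^sup>2 * kin f"
proof -
  note f = H1c_D[OF assms(1)]
  note * = H1c_I[OF L2_cmult[OF f(1)] L2_cmult[OF f(2)] primitive_of_cmult[OF f(3)]]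
  show "(\<lambda>x. c * f x) \<in> H1c"
    "AE x in lborel. weak_deriv (\<lambda>x. c * f x) x = c * weak_deriv f x" by (fact *)+
  show "kin (\<lambda>x. c * f x) = (cmod c)\<^sup>2 * kin f" unfolding *(3) by (rule sqn_cmult)
qed

lemma H1c_diff:
  assumes "f \<in> H1c" "g \<in> H1c"
  shows "(\<lambda>x. f x - g x) \<in> H1c"
    and "AE x in lborel. weak_deriv (\<lambda>x. f x - g x) x = weak_deriv f x - weak_deriv g x"
    and "kin (\<lambda>x. f x - g x) = sqn (\<lambda>x. weak_deriv f x - weak_deriv g x)"
proof -
  note f = H1c_D[OF assms(1)] and g = H1c_D[OF assms(2)]
  have "(\<lambda>x. f x - g x) primitive_of (\<lambda>x. weak_deriv f x - weak_deriv g x)"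
    using primitive_of_add[OF f(3) primitive_of_cmult[OF g(3), of "-1"] f(2) L2_cmult[OF g(2)]] by simp
  note * = H1c_I[OF L2_diff[OF f(1) g(1)] L2_diff[OF f(2) g(2)] this]
  show "(\<lambda>x. f x - g x) \<in> H1c"
    "AE x in lborel. weak_deriv (\<lambda>x. f x - g x) x = weak_deriv f x - weak_deriv g x"
    "kin (\<lambda>x. f x - g x) = sqn (\<lambda>x. weak_deriv f x - weak_deriv g x)" by (fact *)+
qed

lemma sqn_shift: "sqn (\<lambda>x. f (x + c)) = sqn f"
  unfolding sqn_def by (rule lborel_integral_shift)

lemma H1c_shift:
  assumes "f \<in> H1c"
  shows "(\<lambda>x. f (x + c)) \<in> H1c"
    and "AE x in lborel. weak_deriv (\<lambda>x. f (x + c)) x = weak_deriv f (x + c)"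
    and "kin (\<lambda>x. f (x + c)) = kin f"
proof -
  note f = H1c_D[OF assms(1)]
  note * = H1c_I[OF L2_shift[OF f(1)] L2_shift[OF f(2)] primitive_of_shift[OF f(3)]]
  show "(\<lambda>x. f (x + c)) \<in> H1c"
    "AE x in lborel. weak_deriv (\<lambda>x. f (x + c)) x = weak_deriv f (x + c)" by (fact *)+
  show "kin (\<lambda>x. f (x + c)) = kin f" unfolding *(3) by (rule sqn_shift)
qed

lemma H1c_zero: "(\<lambda>x. 0) \<in> H1c" "kin (\<lambda>x. 0) = 0"
  using H1c_I[OF L2_zero L2_zero, unfolded primitive_of_def] by (auto simp: sqn_def)

text \<open>\<open>L2\<close> is regarded as a real Hilbert space: the energy is real valued, and
  its variations are linear over the reals only. Complex identities are recovered by testing with a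
  function and with its multiple by \<open>\<i>\<close>.\<close>

definition L2_inner :: "(real \<Rightarrow> complex) \<Rightarrow> (real \<Rightarrow> complex) \<Rightarrow> real" where
  "L2_inner f g = (LINT x|lborel. Re (f x * cnj (g x)))"

lemma L2_inner_integrable:
  assumes "f \<in> L2" "g \<in> L2" shows "integrable lborel (\<lambda>x. Re (f x * cnj (g x)))"
  by (rule integrable_Re[OF L2_mult_integrable[OF assms(1) L2_cnj[OF assms(2)]]])

lemma norm_add_square_Re: "(cmod (a + b))\<^sup>2 = (cmod a)\<^sup>2 + (cmod b)\<^sup>2 + 2 * Re (a * cnj b)"
  by (simp only: cmod_power2) (simp add: power2_eq_square algebra_simps)

lemma sqn_add:
  assumes "f \<in> L2" "g \<in> L2"
  shows "sqn (\<lambda>x. f x + g x) = sqn f + sqn g + 2 * L2_inner f g"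
proof -
  have "sqn (\<lambda>x. f x + g x) = (LINT x|lborel. ((cmod (f x))\<^sup>2 + (cmod (g x))\<^sup>2) + 2 * Re (f x * cnj (g x)))"
    by (simp only: norm_add_square_Re sqn_def)
  also have "\<dots> = (LINT x|lborel. (cmod (f x))\<^sup>2 + (cmod (g x))\<^sup>2) + (LINT x|lborel. 2 * Re (f x * cnj (g x)))"
    using assms[THEN L2_integrable] L2_inner_integrable[OF assms]
    by (intro Bochner_Integration.integral_add) (simp_all del: times_complex.sel)
  also have "(LINT x|lborel. (cmod (f x))\<^sup>2 + (cmod (g x))\<^sup>2) = sqn f + sqn g"
    unfolding sqn_def using assms[THEN L2_integrable] by (rule Bochner_Integration.integral_add)
  also have "(LINT x|lborel. 2 * Re (f x * cnj (g x))) = 2 * L2_inner f g"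
    unfolding L2_inner_def by (rule integral_mult_right_zero)
  finally show ?thesis .
qed

lemma L2_inner_cmult_real: "L2_inner f (\<lambda>x. of_real c * g x) = c * L2_inner f g"
proof -
  have "Re (f x * cnj (of_real c * g x)) = c * Re (f x * cnj (g x))" for x by (simp add: algebra_simps)
  then show ?thesis unfolding L2_inner_def by (simp only: integral_mult_right_zero)
qed

lemma sqn_diff:
  assumes "f \<in> L2" "g \<in> L2"
  shows "sqn (\<lambda>x. f x - g x) = sqn f + sqn g - 2 * L2_inner f g"
proof -
  have "sqn (\<lambda>x. f x + of_real (-1) * g x) = sqn f + sqn (\<lambda>x. of_real (-1) * g x) + 2 * L2_inner f (\<lambda>x. of_real (-1) * g x)"
    by (intro sqn_add L2_cmult assms)
  then show ?thesis unfolding L2_inner_cmult_real sqn_cmult by simp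
qed

lemma L2_inner_bound':
  assumes "f \<in> L2" "g \<in> L2"
  shows "\<bar>L2_inner f g\<bar> \<le> (LINT x|lborel. cmod (f x) * cmod (g x))"
proof -
  have "\<bar>Re (f x * cnj (g x))\<bar> \<le> cmod (f x) * cmod (g x)" for x
    using abs_Re_le_cmod[of "f x * cnj (g x)"] by (simp only: norm_mult complex_mod_cnj)
  then show ?thesis unfolding L2_inner_def
    by (intro order_trans[OF integral_abs_bound] integral_mono integrable_abs L2_inner_integrable L2_mult_integrable_norm assms)
qed

lemma L2_inner_bound:
  assumes "f \<in> L2" "g \<in> L2"
  shows "\<bar>L2_inner f g\<bar> \<le> L2_norm f * L2_norm g"
proof -
  note L2_inner_bound'[OF assms]
  also have "(LINT x|lborel. cmod (f x) * cmod (g x)) \<le> sqrt (sqn f * sqn g)"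
    using L2_Cauchy_Schwarz[OF assms] by (rule real_le_rsqrt)
  finally show ?thesis by (simp add: L2_norm_eq real_sqrt_mult)
qed

lemma L2_norm_nonneg: "0 \<le> L2_norm f" by (simp add: L2_norm_eq)

lemma L2_norm_triangle:
  assumes "f \<in> L2" "g \<in> L2"
  shows "L2_norm (\<lambda>x. f x + g x) \<le> L2_norm f + L2_norm g"
proof (rule power2_le_imp_le)
  have "(L2_norm (\<lambda>x. f x + g x))\<^sup>2 \<le> sqn f + sqn g + 2 * (L2_norm f * L2_norm g)"
    unfolding L2_norm_square sqn_add[OF assms] using L2_inner_bound[OF assms] by linarith
  also have "\<dots> = (L2_norm f + L2_norm g)\<^sup>2" by (simp add: power2_sum L2_norm_square)
  finally show "(L2_norm (\<lambda>x. f x + g x))\<^sup>2 \<le> (L2_norm f + L2_norm g)\<^sup>2" .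
qed (simp add: L2_norm_nonneg)

lemma sqn_add_le:
  assumes "f \<in> L2" "g \<in> L2"
  shows "sqn (\<lambda>x. f x + g x) \<le> 2 * sqn f + 2 * sqn g"
proof -
  have "0 \<le> sqn (\<lambda>x. f x - g x)" by simp
  then show ?thesis unfolding sqn_diff[OF assms] sqn_add[OF assms] by linarith
qed

lemma sqn_diff_le:
  assumes "f \<in> L2" "g \<in> L2"
  shows "sqn (\<lambda>x. f x - g x) \<le> 2 * sqn f + 2 * sqn g"
  using sqn_add_le[OF assms(1) L2_minus[OF assms(2)]] by (simp add: sqn_def)

text \<open>The squared triangle inequality between \<open>x\<close> and \<open>y\<close>, with
  Hoelder continuity, is averaged over the \<open>y\<close> in \<open>{x..x+L}\<close>. The length
  is free: \<open>L = 1\<close> gives boundedness, while \<open>coercive\<close> takes a short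
  interval for large kinetic energy, which amounts to a Gagliardo-Nirenberg inequality.\<close>

lemma H1c_pointwise_bound:
  assumes f: "f \<in> H1c" and L: "L > 0"
  shows "(cmod (f x))\<^sup>2 \<le> 2 * sqn f / L + 2 * L * kin f"
proof -
  have i: "set_integrable lborel {x..x+L} (\<lambda>y. (cmod (f y))\<^sup>2)"
    using integrable_mult_indicator[OF _ L2_integrable[OF H1c_D(1)[OF f]], of "{x..x+L}"]
    by (simp add: set_integrable_def)
  have ic: "set_integrable lborel {x..x+L} (\<lambda>y. c)" for c :: real
    by (intro continuous_set_integrable continuous_on_const)
  have Lc: "(LINT y:{x..x+L}|lborel. c) = L * c" for c :: real
    using L by (simp add: set_lebesgue_integral_def)
  have "L * (cmod (f x))\<^sup>2 = (LINT y:{x..x+L}|lborel. (cmod (f x))\<^sup>2)"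
    by (simp only: Lc)
  also have "\<dots> \<le> (LINT y:{x..x+L}|lborel. 2 * (cmod (f y))\<^sup>2 + 2 * L * kin f)"
  proof (rule set_integral_mono)
    fix y assume y: "y \<in> {x..x+L}"
    have "(cmod (f x))\<^sup>2 \<le> 2 * (cmod (f y))\<^sup>2 + 2 * (cmod (f x - f y))\<^sup>2"
      using norm_add_square_le[of "f y" "f x - f y"] by simp
    also have "(cmod (f x - f y))\<^sup>2 \<le> \<bar>x - y\<bar> * kin f"
      by (rule primitive_Holder[OF H1c_D(3)[OF f] H1c_D(2)[OF f]])
    also have "\<bar>x - y\<bar> * kin f \<le> L * kin f" using y by (intro mult_right_mono) auto
    finally show "(cmod (f x))\<^sup>2 \<le> 2 * (cmod (f y))\<^sup>2 + 2 * L * kin f" by simp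
  qed (use i ic in auto)
  also have "\<dots> = 2 * (LINT y:{x..x+L}|lborel. (cmod (f y))\<^sup>2) + L * (2 * L * kin f)"
    using i ic[of "2 * L * kin f"] Lc[of "2 * L * kin f"]
    by (subst set_integral_add(2)) auto
  also have "(LINT y:{x..x+L}|lborel. (cmod (f y))\<^sup>2) \<le> sqn f"
    unfolding set_lebesgue_integral_def sqn_def
    by (rule integral_mono) (use i L2_integrable[OF H1c_D(1)[OF f]] in \<open>auto simp: indicator_def set_integrable_def\<close>)
  finally show ?thesis using L by (simp add: field_simps)
qed

section \<open>Weak limits in H1 as pointwise limits\<close>

lemma Holder_imp_continuous:
  fixes f :: "real \<Rightarrow> complex"
  assumes "\<And>x y. cmod (f y - f x) \<le> sqrt (\<bar>y - x\<bar> * B)"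
  shows "continuous_on UNIV f"
proof -
  have "(f \<longlongrightarrow> f x) (at x)" for x
  proof (rule tendsto_norm_zero_cancel[THEN LIM_zero_cancel])
    have "((\<lambda>y. sqrt (\<bar>y - x\<bar> * B)) \<longlongrightarrow> sqrt (\<bar>x - x\<bar> * B)) (at x)"
      by (intro tendsto_intros)
    then have 1: "((\<lambda>y. sqrt (\<bar>y - x\<bar> * B)) \<longlongrightarrow> 0) (at x)" by simp
    show "((\<lambda>y. norm (f y - f x)) \<longlongrightarrow> 0) (at x)"
      by (rule tendsto_sandwich[OF _ _ tendsto_const 1]) (use assms in \<open>auto intro!: always_eventually\<close>)
  qed
  then show ?thesis by (simp add: continuous_on_def)
qed

text \<open>The parallelogram law, with the midpoint in place of the sum.\<close>

lemma sqn_diff_half: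
  assumes "f \<in> L2" "g \<in> L2"
  shows "sqn (\<lambda>x. f x - g x) = 2 * sqn f + 2 * sqn g - 4 * sqn (\<lambda>x. (1/2) * (f x + g x))"
proof -
  have "(cmod (1/2))\<^sup>2 = 1/4" by (simp add: power_divide)
  moreover have "A + B - 2 * I = 2 * A + 2 * B - 4 * (1/4 * (A + B + 2 * I))" for A B I :: real
    by (simp add: field_simps)
  ultimately show ?thesis unfolding sqn_cmult sqn_diff[OF assms] sqn_add[OF assms] by (simp only:)
qed

text \<open>Weak closedness of balls: the elements of almost minimal norm in a decreasing sequence of
  convex sets form a Cauchy sequence, by the parallelogram law.\<close>

lemma pointwise_limit_of_primitives:
  assumes f: "\<And>k. f k primitive_of g k" "\<And>k. g k \<in> L2" "\<And>k. sqn (g k) \<le> B"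
    and lim: "\<And>x. (\<lambda>k. f k x) \<longlonglongrightarrow> \<phi> x"
  shows "\<exists>h\<in>L2. \<phi> primitive_of h \<and> sqn h \<le> B"
proof -
  define q :: "nat \<Rightarrow> real" where "q i = of_rat (from_nat i)" for i
  \<comment> \<open>\<open>q\<close> enumerates the rationals. The conditions are convex, so
    midpoints stay in \<open>C n\<close>; shrinking tolerances at more and more rationals force the
    limit of such primitives to agree with \<open>\<phi>\<close> there.\<close>
  define C where "C n = {h \<in> L2. \<exists>F. F primitive_of h \<and> (\<forall>i<n. cmod (F (q i) - \<phi> (q i)) \<le> 1 / Suc n)}" for n
  have C_dec: "C (Suc n) \<subseteq> C n" for n
  proof -
    have le: "1 / real (Suc (Suc n)) \<le> 1 / Suc n" by (intro divide_left_mono) auto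
    show ?thesis
    proof
      fix h assume "h \<in> C (Suc n)"
      then obtain F where F: "h \<in> L2" "F primitive_of h"
        "\<And>i. i < Suc n \<Longrightarrow> cmod (F (q i) - \<phi> (q i)) \<le> 1 / Suc (Suc n)" unfolding C_def by blast
      have "cmod (F (q i) - \<phi> (q i)) \<le> 1 / Suc n" if "i < n" for i
        using F(3)[of i] that le by (meson less_SucI order_trans)
      then show "h \<in> C n" unfolding C_def using F(1,2) by blast
    qed
  qed
  then have C_dec: "n \<le> m \<Longrightarrow> C m \<subseteq> C n" for n m by (rule lift_Suc_antimono_le)
  have C_ne: "\<exists>h\<in>C n. sqn h \<le> B" for n
  proof -
    have "\<forall>\<^sub>F k in sequentially. \<forall>i\<in>{..<n}. cmod (f k (q i) - \<phi> (q i)) < 1 / Suc n"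
      using lim by (intro eventually_ball_finite ballI) (auto simp: tendsto_iff dist_norm)
    then obtain k where "\<forall>i\<in>{..<n}. cmod (f k (q i) - \<phi> (q i)) < 1 / Suc n"
      by (auto simp: eventually_sequentially)
    then have "\<forall>i<n. cmod (f k (q i) - \<phi> (q i)) \<le> 1 / Suc n" by (meson lessThan_iff less_imp_le)
    then have "g k \<in> C n" using f(1,2)[of k] unfolding C_def by blast
    then show ?thesis using f(3) by blast
  qed
  have C_mid: "(\<lambda>x. (1/2) * (h x + h' x)) \<in> C n" if h: "h \<in> C n" "h' \<in> C n" for h h' n
  proof -
    obtain F F' where F: "F primitive_of h" "\<And>i. i < n \<Longrightarrow> cmod (F (q i) - \<phi> (q i)) \<le> 1 / Suc n"
      and F': "F' primitive_of h'" "\<And>i. i < n \<Longrightarrow> cmod (F' (q i) - \<phi> (q i)) \<le> 1 / Suc n"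
      using h unfolding C_def by blast
    have L: "h \<in> L2" "h' \<in> L2" using h by (auto simp: C_def)
    have half: "cmod ((1/2) * z) \<le> (1/2) * r" if "cmod z \<le> r" for z r using that by (simp add: norm_mult)
    have "cmod ((1/2) * (F (q i) + F' (q i)) - \<phi> (q i)) \<le> 1 / Suc n" if "i < n" for i
    proof -
      have "(1/2) * (F (q i) + F' (q i)) - \<phi> (q i) = (1/2) * ((F (q i) - \<phi> (q i)) + (F' (q i) - \<phi> (q i)))"
        by (simp add: algebra_simps)
      also have "cmod \<dots> \<le> (1/2) * (cmod (F (q i) - \<phi> (q i)) + cmod (F' (q i) - \<phi> (q i)))"
        by (rule half[OF norm_triangle_ineq])
      also have "\<dots> \<le> 1 / Suc n" using F(2)[OF that] F'(2)[OF that] by simp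
      finally show ?thesis .
    qed
    then show ?thesis unfolding C_def
      using primitive_of_cmult[OF primitive_of_add[OF F(1) F'(1) L], of "1/2"] L2_cmult[OF L2_add[OF L], of "1/2"] by blast
  qed
  define d where "d n = (INF h\<in>C n. sqn h)" for n
  have d_le: "d n \<le> sqn h" if "h \<in> C n" for n h
    unfolding d_def using that by (intro cINF_lower bdd_belowI2[of _ 0]) auto
  have d_B: "d n \<le> B" for n using C_ne[of n] d_le by force
  have "incseq d"
    unfolding incseq_Suc_iff
  proof
    fix n
    have "C (Suc n) \<noteq> {}" using C_ne[of "Suc n"] by blast
    then show "d n \<le> d (Suc n)" unfolding d_def[of "Suc n"]
      using C_dec[of n "Suc n"] by (intro cINF_greatest d_le) auto
  qed
  then have "\<exists>l. d \<longlonglongrightarrow> l" using d_B incseq_convergent[of d B] by metis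
  then obtain l where l: "d \<longlonglongrightarrow> l" by blast
  have d_l: "d n \<le> l" for n using incseq_le[OF \<open>incseq d\<close> l] .
  have "\<exists>h\<in>C n. sqn h < d n + 1 / Suc n" for n
  proof -
    have "(INF h\<in>C n. sqn h) < d n + 1 / Suc n" unfolding d_def[symmetric] by simp
    then show ?thesis using C_ne[of n] by (subst (asm) cINF_less_iff) (auto intro!: bdd_belowI2[of _ 0])
  qed
  then obtain h where h: "\<And>n. h n \<in> C n" "\<And>n. sqn (h n) < d n + 1 / Suc n" by metis
  have hL: "h n \<in> L2" for n using h(1) by (auto simp: C_def)
  have "\<exists>N. \<forall>m\<ge>N. \<forall>n\<ge>N. sqn (\<lambda>x. h m x - h n x) < e" if "e > 0" for e
  proof -
    \<comment> \<open>For \<open>m\<close> and \<open>n\<close> beyond \<open>N\<close>, the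
      midpoint of \<open>h m\<close> and \<open>h n\<close> lies in \<open>C N\<close>, so its
      squared norm is at least \<open>d N\<close>; the parallelogram law then bounds the squared
      distance by this quantity.\<close>
    have "(\<lambda>N. 4 * (l - d N) + 4 * (1 / Suc N)) \<longlonglongrightarrow> 4 * (l - l) + 4 * 0"
      by (intro tendsto_intros l LIMSEQ_Suc[OF lim_1_over_n])
    then have "\<forall>\<^sub>F N in sequentially. 4 * (l - d N) + 4 * (1 / Suc N) < e"
      using that by (intro order_tendstoD) auto
    then obtain N where N: "4 * (l - d N) + 4 * (1 / Suc N) < e" by (auto simp: eventually_sequentially)
    have "sqn (\<lambda>x. h m x - h n x) < e" if "m \<ge> N" "n \<ge> N" for m n
    proof -
      define \<delta> where "\<delta> k = 1 / real (Suc k)" for k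
      define M where "M = sqn (\<lambda>x. (1/2) * (h m x + h n x))"
      have "d N \<le> M" unfolding M_def
        using h(1)[of m] h(1)[of n] C_dec[OF that(1)] C_dec[OF that(2)] by (intro d_le C_mid) auto
      moreover have "1 / real (Suc m) \<le> 1 / Suc N" "1 / real (Suc n) \<le> 1 / Suc N"
        using that by (auto intro!: divide_left_mono)
      moreover have "4 * l - 4 * d N + 4 * \<delta> N < e" using N by (simp add: \<delta>_def)
      ultimately show ?thesis
        using sqn_diff_half[OF hL hL, of m n, folded M_def] h(2)[of m] h(2)[of n] d_l[of m] d_l[of n]
        unfolding \<delta>_def[symmetric] by linarith
    qed
    then show ?thesis by blast
  qed
  from L2_complete[OF hL this] obtain g' where g': "g' \<in> L2" "(\<lambda>n. sqn (\<lambda>x. h n x - g' x)) \<longlonglongrightarrow> 0" by blast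
  have "\<forall>n. \<exists>F. F primitive_of h n \<and> (\<forall>i<n. cmod (F (q i) - \<phi> (q i)) \<le> 1 / Suc n)"
    using h(1) by (auto simp: C_def)
  then obtain F where F: "\<And>n. F n primitive_of h n" "\<And>n i. i < n \<Longrightarrow> cmod (F n (q i) - \<phi> (q i)) \<le> 1 / Suc n" by metis
  have F_lim: "(\<lambda>n. F n (q i)) \<longlonglongrightarrow> \<phi> (q i)" for i
  proof (rule LIM_zero_cancel, rule Lim_null_comparison)
    show "\<forall>\<^sub>F n in sequentially. cmod (F n (q i) - \<phi> (q i)) \<le> 1 / Suc n"
      using eventually_gt_at_top[of i] by eventually_elim (use F(2) in auto)
    show "(\<lambda>n. 1 / real (Suc n)) \<longlonglongrightarrow> 0" by (rule LIMSEQ_Suc[OF lim_1_over_n])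
  qed
  obtain P where P: "P primitive_of g'" using primitive_exists[OF g'(1)] by blast
  have P_lim: "(\<lambda>n. F n y - F n x) \<longlonglongrightarrow> P y - P x" for x y
  proof (rule LIM_zero_cancel, rule Lim_null_comparison)
    show "\<forall>\<^sub>F n in sequentially. cmod ((F n y - F n x) - (P y - P x)) \<le> sqrt (\<bar>y - x\<bar> * sqn (\<lambda>x. h n x - g' x))"
    proof (intro always_eventually allI)
      fix n
      have "(\<lambda>x. F n x + (-1) * P x) primitive_of (\<lambda>x. h n x + (-1) * g' x)"
        by (intro primitive_of_add primitive_of_cmult F P hL L2_cmult g')
      from primitive_Holder'[OF this, of y x] show "cmod ((F n y - F n x) - (P y - P x)) \<le> sqrt (\<bar>y - x\<bar> * sqn (\<lambda>x. h n x - g' x))"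
        using L2_diff[OF hL g'(1)] by (simp add: algebra_simps)
    qed
    have "(\<lambda>n. sqrt (\<bar>y - x\<bar> * sqn (\<lambda>x. h n x - g' x))) \<longlonglongrightarrow> sqrt (\<bar>y - x\<bar> * 0)"
      by (intro tendsto_intros g')
    then show "(\<lambda>n. sqrt (\<bar>y - x\<bar> * sqn (\<lambda>x. h n x - g' x))) \<longlonglongrightarrow> 0" by simp
  qed
  have eq: "\<phi> (q i) - \<phi> (q j) = P (q i) - P (q j)" for i j
    by (rule LIMSEQ_unique[OF tendsto_diff[OF F_lim F_lim] P_lim])
  \<comment> \<open>\<open>\<phi>\<close> and \<open>P\<close> differ by a constant on the
    rationals; continuity of both carries this to the whole line.\<close>
  have "continuous_on UNIV \<phi>"
  proof (rule Holder_imp_continuous)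
    fix x y
    have "(\<lambda>k. cmod (f k y - f k x)) \<longlonglongrightarrow> cmod (\<phi> y - \<phi> x)" by (intro tendsto_intros lim)
    moreover have "cmod (f k y - f k x) \<le> sqrt (\<bar>y - x\<bar> * B)" for k
      using primitive_Holder'[OF f(1,2), of k y x] f(3)[of k]
      by (meson abs_ge_zero mult_left_mono order_trans real_sqrt_le_mono)
    ultimately show "cmod (\<phi> y - \<phi> x) \<le> sqrt (\<bar>y - x\<bar> * B)" by (intro LIMSEQ_le_const2) auto
  qed
  then have cont: "continuous_on UNIV (\<lambda>x. \<phi> x - P x)"
    by (intro continuous_intros primitive_continuous[OF P g'(1)])
  have "\<rat> \<subseteq> {x. \<phi> x - P x = \<phi> (q 0) - P (q 0)}"
  proof
    fix x :: real assume "x \<in> \<rat>"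
    then obtain r where "x = of_rat r" by (auto elim: Rats_cases)
    then have "x = q (to_nat r)" by (simp add: q_def)
    then show "x \<in> {x. \<phi> x - P x = \<phi> (q 0) - P (q 0)}" using eq[of "to_nat r" 0] by (simp add: algebra_simps)
  qed
  then have "closure \<rat> \<subseteq> {x. \<phi> x - P x = \<phi> (q 0) - P (q 0)}"
    by (intro closure_minimal closed_Collect_eq cont continuous_on_const)
  then have "\<phi> x - P x = \<phi> (q 0) - P (q 0)" for x
    unfolding Rats_closure_real by blast
  moreover define c where "c = \<phi> (q 0) - P (q 0)"
  ultimately have \<phi>: "\<phi> x = P x + c" for x
    by (metis add.commute diff_add_cancel)
  have "\<phi> primitive_of g'" using P unfolding primitive_of_def \<phi> by simp
  moreover have "sqn g' \<le> B"
  proof -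
    have *: "L2_norm g' \<le> sqrt (B + 1 / Suc n) + L2_norm (\<lambda>x. h n x - g' x)" for n
    proof -
      have "L2_norm g' \<le> L2_norm (h n) + L2_norm (\<lambda>x. h n x - g' x)"
        using L2_norm_triangle[OF hL L2_diff[OF g'(1) hL], of n n] by (simp add: L2_norm_eq sqn_def norm_minus_commute)
      moreover have "L2_norm (h n) \<le> sqrt (B + 1 / Suc n)"
        unfolding L2_norm_eq using h(2)[of n] d_B[of n] by (intro real_sqrt_le_mono) linarith
      ultimately show ?thesis by linarith
    qed
    have "(\<lambda>n. sqrt (B + 1 / Suc n) + L2_norm (\<lambda>x. h n x - g' x)) \<longlonglongrightarrow> sqrt (B + 0) + sqrt 0"
      unfolding L2_norm_eq by (intro tendsto_intros g' LIMSEQ_Suc[OF lim_1_over_n])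
    then have "L2_norm g' \<le> sqrt (B + 0) + sqrt 0" by (rule LIMSEQ_le_const) (use * in blast)
    then show ?thesis by (simp add: L2_norm_eq)
  qed
  ultimately show ?thesis using g'(1) by blast
qed

text \<open>Weak lower semicontinuity of the kinetic energy.\<close>

lemma H1c_pointwise_limit:
  assumes "\<And>k. f k \<in> H1c" "\<And>k. kin (f k) \<le> B" "\<And>x. (\<lambda>k. f k x) \<longlonglongrightarrow> \<phi> x" "\<phi> \<in> L2"
  shows "\<phi> \<in> H1c" "kin \<phi> \<le> B"
proof -
  obtain h where h: "h \<in> L2" "\<phi> primitive_of h" "sqn h \<le> B"
    using pointwise_limit_of_primitives[of f "\<lambda>k. weak_deriv (f k)" B \<phi>] assms H1c_D by metis
  then show "\<phi> \<in> H1c" "kin \<phi> \<le> B" using H1c_I[OF assms(4) h(1,2)] by auto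
qed

lemma L2_pointwise_limit:
  assumes "\<And>k. f k \<in> L2" "\<And>k. sqn (f k) \<le> A" "\<And>x. (\<lambda>k. f k x) \<longlonglongrightarrow> \<phi> x"
  shows "\<phi> \<in> L2" "sqn \<phi> \<le> A"
proof -
  note [measurable] = assms(1)[THEN L2_measurable]
  have [measurable]: "\<phi> \<in> borel_measurable borel"
    by (rule borel_measurable_LIMSEQ_metric[of f]) (use assms in auto)
  have "0 \<le> A" using assms(2)[of 0] sqn_nonneg[of "f 0"] by linarith
  have "(\<integral>\<^sup>+x. ennreal ((cmod (\<phi> x))\<^sup>2) \<partial>lborel) = (\<integral>\<^sup>+x. liminf (\<lambda>k. ennreal ((cmod (f k x))\<^sup>2)) \<partial>lborel)"
  proof (intro nn_integral_cong)
    fix x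
    have "(\<lambda>k. ennreal ((cmod (f k x))\<^sup>2)) \<longlonglongrightarrow> ennreal ((cmod (\<phi> x))\<^sup>2)"
      by (intro tendsto_intros assms tendsto_ennrealI)
    then show "ennreal ((cmod (\<phi> x))\<^sup>2) = liminf (\<lambda>k. ennreal ((cmod (f k x))\<^sup>2))"
      by (intro lim_imp_Liminf[symmetric]) auto
  qed
  also have "\<dots> \<le> liminf (\<lambda>k. \<integral>\<^sup>+x. ennreal ((cmod (f k x))\<^sup>2) \<partial>lborel)"
    by (intro nn_integral_liminf) auto
  also have "\<dots> \<le> limsup (\<lambda>k. \<integral>\<^sup>+x. ennreal ((cmod (f k x))\<^sup>2) \<partial>lborel)"
    by (intro Liminf_le_Limsup) auto
  also have "\<dots> \<le> ennreal A"
    using assms(2) L2_nn_integral[OF assms(1)] by (intro Limsup_bounded always_eventually) (auto intro: ennreal_leI)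
  finally show "\<phi> \<in> L2" "sqn \<phi> \<le> A" using L2I_nn_integral[of \<phi> A] \<open>0 \<le> A\<close> by auto
qed

text \<open>Otherwise, along a subsequence, \<open>f k + t * \<phi>\<close> would converge pointwise
  to \<open>(1 + t) * \<phi>\<close>, while its kinetic energy stays below that of the limit by at
  least \<open>B + 2\<close>, against lower semicontinuity.\<close>

lemma weak_convergence_eventually:
  assumes f: "\<And>k. f k \<in> H1c" "\<And>k. kin (f k) \<le> B"
    and lim: "\<And>x. (\<lambda>k. f k x) \<longlonglongrightarrow> \<phi> x" and \<phi>: "\<phi> \<in> H1c"
  shows "\<forall>\<^sub>F k in sequentially. t * (L2_inner (weak_deriv (f k)) (weak_deriv \<phi>) - kin \<phi>) > - (B + 1)"
proof (rule ccontr)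
  assume "\<not> ?thesis"
  from not_eventually_sequentiallyD[OF this] obtain r :: "nat \<Rightarrow> nat" where r: "strict_mono r"
    "\<And>n. t * (L2_inner (weak_deriv (f (r n))) (weak_deriv \<phi>) - kin \<phi>) \<le> - (B + 1)"
    unfolding not_less by blast
  define g where "g n x = f (r n) x + of_real t * \<phi> x" for n x
  have L: "weak_deriv (f n) \<in> L2" "weak_deriv \<phi> \<in> L2" for n using f(1) \<phi> H1c_D(2) by auto
  have gk: "kin (g n) \<le> B - 2 * (B + 1) + (2 * t + t\<^sup>2) * kin \<phi>" for n
  proof -
    have "kin (g n) = sqn (\<lambda>x. weak_deriv (f (r n)) x + weak_deriv (\<lambda>x. of_real t * \<phi> x) x)"
      unfolding g_def by (rule H1c_add(3)[OF f(1) H1c_cmult(1)[OF \<phi>]])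
    also have "\<dots> = sqn (\<lambda>x. weak_deriv (f (r n)) x + of_real t * weak_deriv \<phi> x)"
    proof (rule sqn_cong_AE)
      show "AE x in lborel. weak_deriv (f (r n)) x + weak_deriv (\<lambda>x. of_real t * \<phi> x) x =
           weak_deriv (f (r n)) x + of_real t * weak_deriv \<phi> x"
        using H1c_cmult(2)[OF \<phi>, of "of_real t"] by eventually_elim simp
    qed (intro L2_add L L2_cmult H1c_D(2) H1c_cmult \<phi>)+
    also have "\<dots> = kin (f (r n)) + t\<^sup>2 * kin \<phi> + 2 * (t * L2_inner (weak_deriv (f (r n))) (weak_deriv \<phi>))"
      by (simp add: sqn_add[OF L(1) L2_cmult[OF L(2)]] sqn_cmult L2_inner_cmult_real)
    also have "t * L2_inner (weak_deriv (f (r n))) (weak_deriv \<phi>) \<le> - (B + 1) + t * kin \<phi>"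
      using r(2)[of n] by (simp add: algebra_simps)
    finally show ?thesis using f(2)[of "r n"] by (simp add: algebra_simps)
  qed
  have gH: "g n \<in> H1c" for n
    unfolding g_def by (intro H1c_add H1c_cmult f \<phi>)
  have gl: "(\<lambda>n. g n x) \<longlonglongrightarrow> (1 + of_real t) * \<phi> x" for x
  proof -
    have "(\<lambda>n. g n x) \<longlonglongrightarrow> \<phi> x + of_real t * \<phi> x"
      unfolding g_def using LIMSEQ_subseq_LIMSEQ[OF lim r(1)] by (intro tendsto_intros) (simp add: o_def)
    then show ?thesis by (simp add: algebra_simps)
  qed
  have "kin (\<lambda>x. (1 + of_real t) * \<phi> x) \<le> B - 2 * (B + 1) + (2 * t + t\<^sup>2) * kin \<phi>"
    by (rule H1c_pointwise_limit(2)[OF gH gk gl L2_cmult[OF H1c_D(1)[OF \<phi>]]])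
  moreover have "(cmod (1 + of_real t))\<^sup>2 = 1 + 2 * t + t\<^sup>2"
    by (simp only: cmod_power2) (simp add: power2_eq_square algebra_simps)
  ultimately have "(1 + 2 * t + t\<^sup>2) * kin \<phi> \<le> B - 2 * (B + 1) + (2 * t + t\<^sup>2) * kin \<phi>"
    by (simp only: H1c_cmult(3)[OF \<phi>])
  then have "kin \<phi> + B + 2 \<le> 0" by (simp add: algebra_simps)
  moreover have "0 \<le> B" using f(2)[of 0] sqn_nonneg[of "weak_deriv (f 0)"] by linarith
  ultimately show False using sqn_nonneg[of "weak_deriv \<phi>"] by linarith
qed

text \<open>The preceding bound with \<open>t = (B + 1) / e\<close> and
  \<open>t = - (B + 1) / e\<close> gives both sides of the estimate. Testing against the derivative
  of \<open>\<phi>\<close> itself is what the splitting of the kinetic energy uses.\<close>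

lemma weak_convergence:
  assumes f: "\<And>k. f k \<in> H1c" "\<And>k. kin (f k) \<le> B"
    and lim: "\<And>x. (\<lambda>k. f k x) \<longlonglongrightarrow> \<phi> x" and \<phi>: "\<phi> \<in> H1c"
  shows "(\<lambda>k. L2_inner (weak_deriv (f k)) (weak_deriv \<phi>)) \<longlonglongrightarrow> kin \<phi>"
proof (rule LIM_zero_cancel, rule LIMSEQ_I)
  fix e :: real assume e: "e > 0"
  have B: "0 \<le> B" using f(2)[of 0] sqn_nonneg[of "weak_deriv (f 0)"] by linarith
  have "\<forall>\<^sub>F k in sequentially. ((B + 1) / e) * (L2_inner (weak_deriv (f k)) (weak_deriv \<phi>) - kin \<phi>) > - (B + 1) \<and>
      (- (B + 1) / e) * (L2_inner (weak_deriv (f k)) (weak_deriv \<phi>) - kin \<phi>) > - (B + 1)"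
    by (intro eventually_conj weak_convergence_eventually f lim \<phi>)
  then have "\<forall>\<^sub>F k in sequentially. norm (L2_inner (weak_deriv (f k)) (weak_deriv \<phi>) - kin \<phi> - 0) < e"
  proof eventually_elim
    case (elim k)
    define a where "a = L2_inner (weak_deriv (f k)) (weak_deriv \<phi>) - kin \<phi>"
    have *: "- b < s / e * x \<Longrightarrow> - (b * e) < s * x" for b s x :: real
      using e by (simp add: field_simps)
    have "- ((B + 1) * e) < (B + 1) * a" "- ((B + 1) * e) < (- (B + 1)) * a"
      using elim by (auto intro!: * simp: a_def)
    then have "(B + 1) * (-e) < (B + 1) * a" "(B + 1) * a < (B + 1) * e" unfolding mult_minus_left mult_minus_right by linarith+
    then have "-e < a" "a < e" using B by (simp_all only: mult_less_cancel_left_pos)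
    then show ?case by (simp add: a_def)
  qed
  then show "\<exists>no. \<forall>k\<ge>no. norm (L2_inner (weak_deriv (f k)) (weak_deriv \<phi>) - kin \<phi> - 0) < e"
    by (simp only: eventually_sequentially)
qed

text \<open>Diagonal extraction makes the values at the rationals converge; the common Hoelder bound
  carries the convergence to every real point.\<close>

lemma bounded_H1c_subsequence:
  assumes f: "\<And>k. f k \<in> H1c" "\<And>k. sqn (f k) \<le> A" "\<And>k. kin (f k) \<le> B"
  shows "\<exists>r \<phi>. strict_mono (r :: nat \<Rightarrow> nat) \<and> \<phi> \<in> H1c \<and> (\<forall>x. (\<lambda>k. f (r k) x) \<longlonglongrightarrow> \<phi> x)"
proof -
  have "cmod (f k x) \<le> sqrt (2 * A + 2 * B)" for k x
    using H1c_pointwise_bound[OF f(1), of 1 k x] f(2,3)[of k] by (intro real_le_rsqrt) simp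
  then obtain r where r: "strict_mono (r :: nat \<Rightarrow> nat)" "\<And>x. x \<in> \<rat> \<Longrightarrow> \<exists>l. (\<lambda>n. f (r n) x) \<longlonglongrightarrow> l"
    using function_convergent_subsequence[OF countable_rat, of f "sqrt (2 * A + 2 * B)"] by metis
  have "convergent (\<lambda>n. f (r n) x)" for x
  proof (rule Cauchy_convergent, rule metric_CauchyI)
    fix e :: real assume e: "e > 0"
    have B: "0 \<le> B" using f(3)[of 0] sqn_nonneg[of "weak_deriv (f 0)"] by linarith
    \<comment> \<open>Since \<open>d * (B + 1) = (e/3)\<^sup>2\<close>, the values at
      \<open>x\<close> and at the nearby rational \<open>q\<close> differ by at most
      \<open>e/3\<close>.\<close>
    define d where "d = (e/3)\<^sup>2 / (B + 1)"
    have d: "d > 0" using e B by (simp add: d_def)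
    obtain q where q: "q \<in> \<rat>" "x < q" "q < x + d" using Rats_dense_in_real[of x "x + d"] d by auto
    have close: "cmod (f n x - f n q) \<le> e/3" for n
    proof -
      have "(cmod (f n x - f n q))\<^sup>2 \<le> \<bar>x - q\<bar> * kin (f n)" by (rule primitive_Holder[OF H1c_D(3)[OF f(1)] H1c_D(2)[OF f(1)]])
      also have "\<dots> \<le> d * (B + 1)" using q f(3)[of n] B d by (intro mult_mono) auto
      also have "\<dots> = (e/3)\<^sup>2" using B by (simp add: d_def)
      finally show ?thesis using e by (simp add: power2_le_iff_abs_le)
    qed
    have "Cauchy (\<lambda>n. f (r n) q)" using r(2)[OF q(1)] by (auto intro: LIMSEQ_imp_Cauchy)
    then obtain N where N: "\<And>m n. m \<ge> N \<Longrightarrow> n \<ge> N \<Longrightarrow> dist (f (r m) q) (f (r n) q) < e/3"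
      using e by (meson divide_pos_pos metric_CauchyD zero_less_numeral)
    show "\<exists>M. \<forall>m\<ge>M. \<forall>n\<ge>M. dist (f (r m) x) (f (r n) x) < e"
    proof (intro exI[of _ N] allI impI)
      fix m n assume mn: "m \<ge> N" "n \<ge> N"
      have "dist (f (r m) x) (f (r n) x) \<le> dist (f (r m) x) (f (r m) q) + dist (f (r m) q) (f (r n) q) + dist (f (r n) x) (f (r n) q)"
        using dist_triangle[of "f (r m) x" "f (r n) x" "f (r m) q"] dist_triangle[of "f (r m) q" "f (r n) x" "f (r n) q"]
        by (simp add: dist_commute)
      then show "dist (f (r m) x) (f (r n) x) < e"
        using N[OF mn] close[of "r m"] close[of "r n"] by (simp add: dist_norm)
    qed
  qed
  then have lim: "(\<lambda>n. f (r n) x) \<longlonglongrightarrow> lim (\<lambda>n. f (r n) x)" for x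
    by (simp add: convergent_LIMSEQ_iff)
  have "(\<lambda>x. lim (\<lambda>n. f (r n) x)) \<in> H1c"
    by (rule H1c_pointwise_limit(1)[OF f(1) f(3) lim L2_pointwise_limit(1)[OF H1c_D(1)[OF f(1)] f(2) lim]])
  then show ?thesis using r(1) lim by blast
qed

text \<open>A function dominated by the primitive of \<open>G\<close> is the pointwise limit of its averages over
  short intervals, whose difference quotients are bounded in \<open>L2\<close> by Tonelli's theorem.\<close>

lemma H1c_dominated:
  fixes f :: "real \<Rightarrow> real"
  assumes f: "(\<lambda>x. complex_of_real (f x)) \<in> L2" and G: "G \<in> L2"
    and dom: "\<And>x y. x \<le> y \<Longrightarrow> \<bar>f y - f x\<bar> \<le> (LINT t:{x..y}|lborel. cmod (G t))"
  shows "(\<lambda>x. complex_of_real (f x)) \<in> H1c" "kin (\<lambda>x. complex_of_real (f x)) \<le> sqn G"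
proof -
  note [measurable] = L2_measurable[OF G]
  have sq: "(f y - f x)\<^sup>2 \<le> (LINT t:{x..y}|lborel. cmod (G t))\<^sup>2" if "x \<le> y" for x y
    using power_mono[OF dom[OF that], of 2] by simp
  have H: "\<bar>f y - f x\<bar> \<le> sqrt (\<bar>y - x\<bar> * sqn G)" for x y
    using order_trans[OF sq L2_interval_integral_bound(2)[OF G], of x y]
      order_trans[OF sq L2_interval_integral_bound(2)[OF G], of y x]
    by (cases "x \<le> y") (auto intro!: real_le_rsqrt simp: power2_commute)
  have "continuous_on UNIV (\<lambda>x. complex_of_real (f x))"
    by (rule Holder_imp_continuous[of _ "sqn G"]) (use H in \<open>simp add: of_real_diff[symmetric] del: of_real_diff\<close>)
  then have "continuous_on UNIV (\<lambda>x. Re (complex_of_real (f x)))" by (rule continuous_on_Re)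
  then have cf: "continuous_on UNIV f" by (simp only: Re_complex_of_real)
  note [measurable] = borel_measurable_continuous_onI[OF cf]
  obtain \<Phi> where \<Phi>: "\<And>x. (\<Phi> has_real_derivative f x) (at x)"
    using antiderivative_exists[OF cf] by (auto simp: has_real_derivative_iff_has_vector_derivative)
  define h where "h n = 1 / real (Suc n)" for n
  have h: "h n > 0" for n by (simp add: h_def)
  \<comment> \<open>\<open>F n\<close> averages \<open>f\<close> over \<open>{x..x + h n}\<close>,
    so its derivative is the difference quotient \<open>g n\<close>.\<close>
  define F where "F n x = (\<Phi> (x + h n) - \<Phi> x) / h n" for n x
  define g where "g n x = (f (x + h n) - f x) / h n" for n x
  have cg: "continuous_on UNIV (g n)" for n
    unfolding g_def using h[of n] cf by (intro continuous_intros continuous_on_compose2[OF cf]) auto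
  note [measurable] = borel_measurable_continuous_onI[OF cg]
  have prim: "(\<lambda>x. complex_of_real (F n x)) primitive_of (\<lambda>x. complex_of_real (g n x))" for n
    unfolding primitive_of_def
  proof (intro allI impI)
    fix x y :: real assume "x \<le> y"
    then have "(LINT t|lborel. indicator {x..y} t *\<^sub>R g n t) = F n y - F n x"
    proof (rule integral_FTC_atLeastAtMost)
      fix t
      have "((\<lambda>x. \<Phi> (x + h n)) has_real_derivative f (t + h n)) (at t)"
        using DERIV_shift[of \<Phi> _ t "h n"] \<Phi>[of "t + h n"] by (simp add: add.commute)
      then have "(F n has_real_derivative g n t) (at t)"
        unfolding F_def g_def by (intro DERIV_cdivide DERIV_diff \<Phi>)
      then show "(F n has_vector_derivative g n t) (at t within {x..y})"
        by (simp add: has_real_derivative_iff_has_vector_derivative has_vector_derivative_at_within)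
    qed (rule continuous_on_subset[OF cg], simp)
    then show "complex_of_real (F n y) - complex_of_real (F n x) = (LINT t:{x..y}|lborel. complex_of_real (g n t))"
      by (simp add: set_integral_complex_of_real set_lebesgue_integral_def[of _ _ "g n"])
  qed
  have nn: "(\<integral>\<^sup>+x. ennreal ((cmod (complex_of_real (g n x)))\<^sup>2) \<partial>lborel) \<le> ennreal (sqn G)" for n
  proof -
    have "(\<integral>\<^sup>+x. ennreal ((cmod (complex_of_real (g n x)))\<^sup>2) \<partial>lborel) \<le>
      (\<integral>\<^sup>+x. (\<integral>\<^sup>+t. ennreal (1 / h n) * (indicator {x..x + h n} t * ennreal ((cmod (G t))\<^sup>2)) \<partial>lborel) \<partial>lborel)"
    proof (rule nn_integral_mono)
      fix x
      have i: "integrable lborel (\<lambda>t. indicator {x..x + h n} t * (cmod (G t))\<^sup>2)"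
        using integrable_mult_indicator[OF _ L2_integrable[OF G], of "{x..x + h n}"] by simp
      have "(f (x + h n) - f x)\<^sup>2 \<le> h n * (LINT t:{x..x + h n}|lborel. (cmod (G t))\<^sup>2)"
        using order_trans[OF sq L2_interval_integral_bound(1)[OF G], of x "x + h n"] h[of n] by simp
      then have "(g n x)\<^sup>2 \<le> (1 / h n) * (LINT t:{x..x + h n}|lborel. (cmod (G t))\<^sup>2)"
        using h[of n] by (simp add: g_def power_divide divide_simps power2_eq_square mult_ac)
      then have "ennreal ((cmod (complex_of_real (g n x)))\<^sup>2) \<le> ennreal ((1 / h n) * (LINT t:{x..x + h n}|lborel. (cmod (G t))\<^sup>2))"
        by (intro ennreal_leI) simp
      also have "\<dots> = ennreal (1 / h n) * (\<integral>\<^sup>+t. ennreal (indicator {x..x + h n} t * (cmod (G t))\<^sup>2) \<partial>lborel)"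
        unfolding set_lebesgue_integral_def real_scaleR_def using i h[of n]
        by (subst nn_integral_eq_integral) (auto intro!: ennreal_mult' simp del: times_divide_eq_left mult_1)
      also have "\<dots> = (\<integral>\<^sup>+t. ennreal (1 / h n) * (indicator {x..x + h n} t * ennreal ((cmod (G t))\<^sup>2)) \<partial>lborel)"
        by (subst nn_integral_cmult[symmetric]) (auto simp: ennreal_mult' ennreal_indicator)
      finally show "ennreal ((cmod (complex_of_real (g n x)))\<^sup>2) \<le> \<dots>" .
    qed
    \<comment> \<open>After the exchange, each \<open>t\<close> is met by the \<open>x\<close> in
      \<open>{t - h n..t}\<close>, whose length cancels the factor \<open>1 / h n\<close>.\<close>
    also have "\<dots> = (\<integral>\<^sup>+t. (\<integral>\<^sup>+x. ennreal (1 / h n) * (indicator {x..x + h n} t * ennreal ((cmod (G t))\<^sup>2)) \<partial>lborel) \<partial>lborel)"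
    proof (rule lborel_pair.Fubini')
      have [measurable]: "Measurable.pred (borel \<Otimes>\<^sub>M borel) (\<lambda>z::real\<times>real. snd z \<in> {fst z..fst z + h n})"
        unfolding atLeastAtMost_iff by measurable
      show "(\<lambda>(t, x). ennreal (1 / h n) * (indicator {x..x + h n} t * ennreal ((cmod (G t))\<^sup>2))) \<in>
          borel_measurable (lborel \<Otimes>\<^sub>M lborel)"
        unfolding indicator_def atLeastAtMost_iff by measurable
    qed
    also have "\<dots> = (\<integral>\<^sup>+t. ennreal ((cmod (G t))\<^sup>2) \<partial>lborel)"
    proof (rule nn_integral_cong)
      fix t
      have "(\<integral>\<^sup>+x. ennreal (1 / h n) * (indicator {x..x + h n} t * ennreal ((cmod (G t))\<^sup>2)) \<partial>lborel) =
          (\<integral>\<^sup>+x. (ennreal (1 / h n) * ennreal ((cmod (G t))\<^sup>2)) * indicator {t - h n..t} x \<partial>lborel)"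
        by (intro nn_integral_cong) (auto simp: indicator_def)
      also have "\<dots> = (ennreal (1 / h n) * ennreal ((cmod (G t))\<^sup>2)) * ennreal (h n)"
        using h[of n] by (subst nn_integral_cmult_indicator) auto
      also have "\<dots> = ennreal ((cmod (G t))\<^sup>2)"
        using h[of n] by (simp add: ennreal_mult[symmetric])
      finally show "(\<integral>\<^sup>+x. ennreal (1 / h n) * (indicator {x..x + h n} t * ennreal ((cmod (G t))\<^sup>2)) \<partial>lborel) = ennreal ((cmod (G t))\<^sup>2)" .
    qed
    finally show ?thesis using L2_nn_integral[OF G] by simp
  qed
  have gL: "(\<lambda>x. complex_of_real (g n x)) \<in> L2" "sqn (\<lambda>x. complex_of_real (g n x)) \<le> sqn G" for n
    by (rule L2I_nn_integral[OF _ nn]; simp)+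
  have Flim: "(\<lambda>n. complex_of_real (F n x)) \<longlonglongrightarrow> complex_of_real (f x)" for x
  proof (rule tendsto_of_real)
    have "((\<lambda>h. (\<Phi> (x + h) - \<Phi> x) / h) \<longlongrightarrow> f x) (at 0)" using \<Phi>[of x] by (simp add: DERIV_def)
    moreover have "filterlim h (at 0) sequentially"
      unfolding filterlim_at h_def using LIMSEQ_Suc[OF lim_1_over_n] by auto
    ultimately show "(\<lambda>n. F n x) \<longlonglongrightarrow> f x" unfolding F_def by (rule filterlim_compose)
  qed
  from pointwise_limit_of_primitives[OF prim gL Flim] obtain k
    where k: "k \<in> L2" "(\<lambda>x. complex_of_real (f x)) primitive_of k" "sqn k \<le> sqn G" by blast
  show "(\<lambda>x. complex_of_real (f x)) \<in> H1c" "kin (\<lambda>x. complex_of_real (f x)) \<le> sqn G"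
    using H1c_I[OF f k(1,2)] k(3) by simp_all
qed

lemma H1c_norm:
  assumes "f \<in> H1c"
  shows "(\<lambda>x. complex_of_real (cmod (f x))) \<in> H1c" "kin (\<lambda>x. complex_of_real (cmod (f x))) \<le> kin f"
proof -
  note f = H1c_D[OF assms]
  have "\<bar>cmod (f y) - cmod (f x)\<bar> \<le> (LINT t:{x..y}|lborel. cmod (weak_deriv f t))" if "x \<le> y" for x y
  proof -
    have "\<bar>cmod (f y) - cmod (f x)\<bar> \<le> cmod (f y - f x)" by (rule norm_triangle_ineq3)
    also have "\<dots> \<le> (LINT t:{x..y}|lborel. cmod (weak_deriv f t))"
      using set_integral_norm_bound'[OF L2_set_integrable[OF f(2)], of x y] primitive_ofD[OF f(3) that] by simp
    finally show ?thesis .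
  qed
  note * = H1c_dominated[OF L2_norm_fun[OF f(1)] f(2) this]
  show "(\<lambda>x. complex_of_real (cmod (f x))) \<in> H1c" "kin (\<lambda>x. complex_of_real (cmod (f x))) \<le> kin f"
    using * by simp_all
qed

text \<open>\<open>w\<close> is the modulus of the curve \<open>(a, b)\<close> in the product of two
  complex planes. Its increments are at most the integral of the norm of the derivative of that
  curve, and the square of this norm is the sum of the two kinetic densities.\<close>

lemma H1c_sqrt_sum:
  assumes "a \<in> H1c" "b \<in> H1c"
  defines "w \<equiv> \<lambda>x. complex_of_real (sqrt ((cmod (a x))\<^sup>2 + (cmod (b x))\<^sup>2))"
  shows "w \<in> H1c" "kin w \<le> kin a + kin b" "sqn w = sqn a + sqn b"
proof -
  note a = H1c_D[OF assms(1)] and b = H1c_D[OF assms(2)]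
  note [measurable] = a(5) b(5) L2_measurable[OF a(2)] L2_measurable[OF b(2)]
  have L: "(\<lambda>x. complex_of_real (sqrt ((cmod (a x))\<^sup>2 + (cmod (b x))\<^sup>2))) \<in> L2 \<and>
     sqn (\<lambda>x. complex_of_real (sqrt ((cmod (a x))\<^sup>2 + (cmod (b x))\<^sup>2))) = sqn a + sqn b"
    if "a \<in> L2" "b \<in> L2" for a b
    using that by (auto simp: L2_def sqn_def)
  define G where "G t = complex_of_real (sqrt ((cmod (weak_deriv a t))\<^sup>2 + (cmod (weak_deriv b t))\<^sup>2))" for t
  have G: "G \<in> L2" "sqn G = kin a + kin b" using L[OF a(2) b(2)] unfolding G_def[abs_def] by auto
  have "\<bar>sqrt ((cmod (a y))\<^sup>2 + (cmod (b y))\<^sup>2) - sqrt ((cmod (a x))\<^sup>2 + (cmod (b x))\<^sup>2)\<bar> \<le> (LINT t:{x..y}|lborel. cmod (G t))"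
    if "x \<le> y" for x y
  proof -
    let ?P = "\<lambda>t. (weak_deriv a t, weak_deriv b t)"
    let ?I = "\<lambda>t. indicat_real {x..y} t"
    have nP: "norm (?P t) = cmod (G t)" for t by (simp add: G_def norm_Pair)
    have iG: "integrable lborel (\<lambda>t. ?I t *\<^sub>R G t)"
      using L2_set_integrable[OF G(1), of x y] by (simp add: set_integrable_def)
    have iP: "integrable lborel (\<lambda>t. ?I t *\<^sub>R ?P t)"
    proof (rule Bochner_Integration.integrable_bound[OF iG])
      show "(\<lambda>t. ?I t *\<^sub>R ?P t) \<in> borel_measurable lborel" by measurable
      show "AE t in lborel. norm (?I t *\<^sub>R ?P t) \<le> norm (?I t *\<^sub>R G t)"
        by (intro AE_I2) (simp only: norm_scaleR nP)
    qed
    have "(LINT t|lborel. ?I t *\<^sub>R ?P t) = (a y - a x, b y - b x)"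
    proof (rule prod_eqI)
      have "fst (LINT t|lborel. ?I t *\<^sub>R ?P t) = (LINT t|lborel. fst (?I t *\<^sub>R ?P t))"
        by (rule integral_bounded_linear[OF bounded_linear_fst iP, symmetric])
      then show "fst (LINT t|lborel. ?I t *\<^sub>R ?P t) = fst (a y - a x, b y - b x)"
        using primitive_ofD[OF a(3) that] by (simp add: set_lebesgue_integral_def)
      have "snd (LINT t|lborel. ?I t *\<^sub>R ?P t) = (LINT t|lborel. snd (?I t *\<^sub>R ?P t))"
        by (rule integral_bounded_linear[OF bounded_linear_snd iP, symmetric])
      then show "snd (LINT t|lborel. ?I t *\<^sub>R ?P t) = snd (a y - a x, b y - b x)"
        using primitive_ofD[OF b(3) that] by (simp add: set_lebesgue_integral_def)
    qed
    moreover have "\<bar>norm (a y, b y) - norm (a x, b x)\<bar> \<le> norm ((a y, b y) - (a x, b x))"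
      by (rule norm_triangle_ineq3)
    moreover have "norm (LINT t|lborel. ?I t *\<^sub>R ?P t) \<le> (LINT t|lborel. norm (?I t *\<^sub>R ?P t))"
      by (rule integral_norm_bound)
    moreover have "(LINT t|lborel. norm (?I t *\<^sub>R ?P t)) = (LINT t:{x..y}|lborel. cmod (G t))"
      unfolding set_lebesgue_integral_def norm_scaleR nP by simp
    ultimately show ?thesis by (simp add: norm_Pair)
  qed
  note * = H1c_dominated[OF conjunct1[OF L[OF a(1) b(1)]] G(1) this]
  show "w \<in> H1c" "kin w \<le> kin a + kin b" unfolding w_def using * G(2) by simp_all
  show "sqn w = sqn a + sqn b" unfolding w_def using L[OF a(1) b(1)] by simp
qed

subsection \<open>The terms of the energy\<close>

definition pot :: "real \<Rightarrow> (real \<Rightarrow> complex) \<Rightarrow> real" where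
  "pot q f = (LINT x|lborel. cmod (f x) powr q)"

definition coup :: "(real \<Rightarrow> complex) \<Rightarrow> (real \<Rightarrow> complex) \<Rightarrow> (real \<Rightarrow> complex) \<Rightarrow> real" where
  "coup f g h = Re (LINT x|lborel. f x * g x * cnj (h x))"

lemma powr_split_square: "(x::real) \<ge> 0 \<Longrightarrow> x powr q = x powr (q - 2) * x\<^sup>2"
  by (cases "x = 0") (auto simp: powr_diff)

lemma powr_le_square: "0 \<le> x \<Longrightarrow> x \<le> M \<Longrightarrow> 2 \<le> q \<Longrightarrow> (x::real) powr q \<le> M powr (q - 2) * x\<^sup>2"
  unfolding powr_split_square[of x q] by (intro mult_right_mono powr_mono2) auto

lemma pot_bound:
  assumes f: "f \<in> L2" and M: "\<And>x. cmod (f x) \<le> M" and q: "2 \<le> q"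
  shows "integrable lborel (\<lambda>x. cmod (f x) powr q)" "pot q f \<le> M powr (q - 2) * sqn f" "0 \<le> pot q f"
proof -
  note [measurable] = L2_measurable[OF f]
  have i: "integrable lborel (\<lambda>x. M powr (q - 2) * (cmod (f x))\<^sup>2)"
    using L2_integrable[OF f] by simp
  show i': "integrable lborel (\<lambda>x. cmod (f x) powr q)"
    by (rule Bochner_Integration.integrable_bound[OF i]) (use powr_le_square M q in auto)
  have "pot q f \<le> (LINT x|lborel. M powr (q - 2) * (cmod (f x))\<^sup>2)"
    unfolding pot_def by (intro integral_mono i i' powr_le_square M q) simp
  then show "pot q f \<le> M powr (q - 2) * sqn f" by (simp add: sqn_def)
  show "0 \<le> pot q f" by (simp add: pot_def)
qed

lemma powr_diff_le:
  assumes "0 \<le> (x::real)" "0 \<le> y" "1 \<le> q" "x \<le> T" "y \<le> T"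
  shows "\<bar>x powr q - y powr q\<bar> \<le> q * T powr (q - 1) * \<bar>x - y\<bar>"
proof -
  have *: "\<bar>x powr q - y powr q\<bar> \<le> q * T powr (q - 1) * \<bar>x - y\<bar>"
    if "0 \<le> y" "y < x" "x \<le> T" for x y
  proof -
    have "\<exists>l z. y < z \<and> z < x \<and> ((\<lambda>z. z powr q) has_real_derivative l) (at z) \<and> x powr q - y powr q = (x - y) * l"
    proof (rule MVT[OF that(2)])
      show "continuous_on {y..x} (\<lambda>z. z powr q)"
        using that assms(3) by (intro continuous_on_powr' continuous_intros) auto
      show "(\<lambda>z. z powr q) differentiable (at z)" if "y < z" "z < x" for z
        using that \<open>0 \<le> y\<close> has_real_derivative_powr[of z q] by (auto simp: real_differentiable_def)
    qed
    then obtain l z where z: "y < z" "z < x" "((\<lambda>z. z powr q) has_real_derivative l) (at z)"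
      "x powr q - y powr q = (x - y) * l" by blast
    have "l = q * z powr (q - 1)"
      using z(1,3) that(1) has_real_derivative_powr[of z q] by (intro DERIV_unique) auto
    moreover have "z powr (q - 1) \<le> T powr (q - 1)" using z that assms(3) by (intro powr_mono2) auto
    ultimately have "0 \<le> l" "l \<le> q * T powr (q - 1)" using assms(3) by (auto intro!: mult_left_mono)
    then have "\<bar>(x - y) * l\<bar> \<le> (x - y) * (q * T powr (q - 1))"
      using that by (simp add: abs_mult mult_left_mono)
    then show ?thesis using that z(4) by (simp add: mult.commute)
  qed
  show ?thesis
  proof (cases x y rule: linorder_cases)
    case less
    then show ?thesis using *[of x y] assms by (simp add: abs_minus_commute)
  next
    case greater
    then show ?thesis using *[of y x] assms by simp
  qed simp
qed

text \<open>By symmetry let \<open>cmod b \<le> cmod a\<close>. The mean value theorem bounds the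
  change of the first power, and \<open>cmod b powr q\<close> is absorbed as well, both by multiples
  of \<open>cmod a * cmod b\<close>. Such a bound is wanted because integrals of this product tend
  to zero when one factor is fixed and the other vanishes pointwise.\<close>

lemma norm_powr_add_split:
  assumes "cmod a \<le> M" "cmod b \<le> M" "2 \<le> q"
  shows "\<bar>cmod (a + b) powr q - cmod a powr q - cmod b powr q\<bar> \<le>
     (2 * q * (2 * M) powr (q - 2) + M powr (q - 2)) * (cmod a * cmod b)"
proof -
  have *: "\<bar>cmod (a + b) powr q - cmod a powr q - cmod b powr q\<bar> \<le>
     (2 * q * (2 * M) powr (q - 2) + M powr (q - 2)) * (cmod a * cmod b)"
    if "cmod b \<le> cmod a" "cmod a \<le> M" for a b
  proof -
    have pw: "(2 * cmod a) powr (q - 1) = (2 * cmod a) powr (q - 2) * (2 * cmod a)"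
      by (cases "a = 0") (auto simp: powr_diff power2_eq_square)
    have "\<bar>cmod (a + b) - cmod a\<bar> \<le> cmod b" using norm_triangle_ineq3[of "a + b" a] by simp
    moreover have "cmod (a + b) \<le> 2 * cmod a" using norm_triangle_ineq[of a b] that by simp
    moreover have "\<bar>cmod (a + b) powr q - cmod a powr q\<bar> \<le> q * (2 * cmod a) powr (q - 1) * \<bar>cmod (a + b) - cmod a\<bar>"
      using calculation assms(3) by (intro powr_diff_le) auto
    ultimately have "\<bar>cmod (a + b) powr q - cmod a powr q\<bar> \<le> q * (2 * cmod a) powr (q - 1) * cmod b"
      using assms(3) by (meson mult_left_mono mult_nonneg_nonneg order_trans powr_ge_zero zero_le_numeral)
    also have "\<dots> = (q * (2 * (cmod a * cmod b))) * (2 * cmod a) powr (q - 2)" unfolding pw by simp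
    also have "\<dots> \<le> (q * (2 * (cmod a * cmod b))) * (2 * M) powr (q - 2)"
      using that assms(3) by (intro mult_left_mono powr_mono2) auto
    finally have 1: "\<bar>cmod (a + b) powr q - cmod a powr q\<bar> \<le> 2 * q * (2 * M) powr (q - 2) * (cmod a * cmod b)"
      by (simp add: mult_ac)
    have "cmod b powr q \<le> M powr (q - 2) * (cmod b)\<^sup>2"
      using that assms(3) by (intro powr_le_square) auto
    also have "\<dots> \<le> M powr (q - 2) * (cmod a * cmod b)"
      unfolding power2_eq_square using that by (intro mult_left_mono mult_right_mono) auto
    finally have 2: "cmod b powr q \<le> M powr (q - 2) * (cmod a * cmod b)" .
    have "0 \<le> cmod b powr q" by simp
    then show ?thesis using 1 2 unfolding distrib_right by linarith
  qed
  show ?thesis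
  proof (cases "cmod b \<le> cmod a")
    case False
    then show ?thesis using *[of a b] assms by (simp add: add.commute mult.commute)
  qed (use * assms in auto)
qed

text \<open>\<open>r n\<close> is truncated at \<open>K * cmod (\<phi> x)\<close>: the truncated
  part is dominated by \<open>K * (cmod (\<phi> x))\<^sup>2\<close>, and where the truncation acts
  the product is at most \<open>(cmod (r n x))\<^sup>2 / K\<close>.\<close>

lemma norm_product_tendsto_0:
  assumes \<phi>: "\<phi> \<in> L2" and r: "\<And>n. r n \<in> L2" "\<And>n. sqn (r n) \<le> A" "\<And>x. (\<lambda>n. r n x) \<longlonglongrightarrow> 0"
  shows "(\<lambda>n. LINT x|lborel. cmod (\<phi> x) * cmod (r n x)) \<longlonglongrightarrow> 0"
proof (rule LIMSEQ_I)
  fix e :: real assume e: "e > 0"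
  note [measurable] = L2_measurable[OF \<phi>] L2_measurable[OF r(1)]
  have A: "0 \<le> A" using r(2)[of 0] sqn_nonneg[of "r 0"] by linarith
  \<comment> \<open>With this choice the part where \<open>r n\<close> is large contributes at most
    \<open>(A + 1) / K = e / 2\<close>.\<close>
  define K where "K = 2 * (A + 1) / e"
  have K: "K > 0" using e A by (simp add: K_def)
  define m where "m n x = cmod (\<phi> x) * min (cmod (r n x)) (K * cmod (\<phi> x))" for n x
  have mb: "norm (m n x) \<le> K * (cmod (\<phi> x))\<^sup>2" for n x
  proof -
    have "m n x \<le> cmod (\<phi> x) * (K * cmod (\<phi> x))" unfolding m_def by (intro mult_left_mono) auto
    moreover have "m n x \<ge> 0" unfolding m_def using K by (intro mult_nonneg_nonneg) auto
    ultimately show ?thesis by (simp add: power2_eq_square mult_ac)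
  qed
  have i\<phi>: "integrable lborel (\<lambda>x. K * (cmod (\<phi> x))\<^sup>2)" using L2_integrable[OF \<phi>] by simp
  have mm: "m n \<in> borel_measurable lborel" for n unfolding m_def by measurable
  have im: "integrable lborel (m n)" for n
    by (rule Bochner_Integration.integrable_bound[OF i\<phi> mm]) (use mb in \<open>auto intro: order_trans[OF _ abs_ge_self]\<close>)
  have "(\<lambda>n. LINT x|lborel. m n x) \<longlonglongrightarrow> (LINT x|(lborel :: real measure). (0::real))"
  proof (rule integral_dominated_convergence[where w = "\<lambda>x. K * (cmod (\<phi> x))\<^sup>2"])
    show "AE x in lborel. (\<lambda>n. m n x) \<longlonglongrightarrow> 0"
    proof (rule AE_I2)
      fix x
      have "(\<lambda>n. cmod (\<phi> x) * min (cmod (r n x)) (K * cmod (\<phi> x))) \<longlonglongrightarrow> cmod (\<phi> x) * min (cmod 0) (K * cmod (\<phi> x))"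
        by (intro tendsto_intros r)
      then show "(\<lambda>n. m n x) \<longlonglongrightarrow> 0" using K by (simp add: m_def)
    qed
  qed (use mb mm i\<phi> in auto)
  then have "\<forall>\<^sub>F n in sequentially. (LINT x|lborel. m n x) < e / 2"
    using e by (intro order_tendstoD(2)) auto
  moreover have "(LINT x|lborel. cmod (\<phi> x) * cmod (r n x)) < e" if "(LINT x|lborel. m n x) < e / 2" for n
  proof -
    have "cmod (\<phi> x) * cmod (r n x) \<le> (1 / K) * (cmod (r n x))\<^sup>2 + m n x" for x
    proof (cases "cmod (r n x) \<le> K * cmod (\<phi> x)")
      case True
      then show ?thesis using K by (simp add: m_def)
    next
      case False
      then have "K * cmod (\<phi> x) * cmod (r n x) \<le> cmod (r n x) * cmod (r n x)" by (intro mult_right_mono) auto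
      then have "cmod (\<phi> x) * cmod (r n x) \<le> (1 / K) * (cmod (r n x))\<^sup>2"
        using K by (simp add: field_simps power2_eq_square)
      moreover have "m n x \<ge> 0" unfolding m_def using K by (intro mult_nonneg_nonneg) auto
      ultimately show ?thesis by linarith
    qed
    then have "(LINT x|lborel. cmod (\<phi> x) * cmod (r n x)) \<le> (LINT x|lborel. (1 / K) * (cmod (r n x))\<^sup>2 + m n x)"
      using L2_integrable[OF r(1), of n] im by (intro integral_mono L2_mult_integrable_norm \<phi> r) auto
    also have "\<dots> = (LINT x|lborel. (1 / K) * (cmod (r n x))\<^sup>2) + (LINT x|lborel. m n x)"
      using L2_integrable[OF r(1), of n] im by (intro Bochner_Integration.integral_add) auto
    also have "(LINT x|lborel. (1 / K) * (cmod (r n x))\<^sup>2) = (1 / K) * sqn (r n)" by (simp add: sqn_def)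
    also have "(1 / K) * sqn (r n) \<le> (1 / K) * (A + 1)" using r(2)[of n] K by (intro mult_left_mono) auto
    also have "(1 / K) * (A + 1) = e / 2"
    proof -
      have "1 / (2 * c / e) * c = e / 2" if "c > 0" for c using that e by (simp add: field_simps)
      from this[of "A + 1"] show ?thesis using A unfolding K_def by linarith
    qed
    finally show ?thesis using that by simp
  qed
  ultimately have "\<forall>\<^sub>F n in sequentially. (LINT x|lborel. cmod (\<phi> x) * cmod (r n x)) < e"
    by (auto elim: eventually_mono)
  then show "\<exists>no. \<forall>n\<ge>no. norm ((LINT x|lborel. cmod (\<phi> x) * cmod (r n x)) - 0) < e"
    by (simp add: eventually_sequentially)
qed

lemma pot_add_split:
  assumes a: "a \<in> L2" "\<And>x. cmod (a x) \<le> M" and b: "b \<in> L2" "\<And>x. cmod (b x) \<le> M" and q: "2 \<le> q"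
  shows "\<bar>pot q (\<lambda>x. a x + b x) - pot q a - pot q b\<bar> \<le>
     (2 * q * (2 * M) powr (q - 2) + M powr (q - 2)) * (LINT x|lborel. cmod (a x) * cmod (b x))"
proof -
  have ab: "cmod (a x + b x) \<le> 2 * M" for x using norm_triangle_ineq[of "a x" "b x"] a(2)[of x] b(2)[of x] by linarith
  note i = pot_bound(1)[OF a q] pot_bound(1)[OF b q] pot_bound(1)[OF L2_add[OF a(1) b(1)] ab q]
  have "pot q (\<lambda>x. a x + b x) - pot q a - pot q b =
     (LINT x|lborel. cmod (a x + b x) powr q - cmod (a x) powr q - cmod (b x) powr q)"
    unfolding pot_def using i by simp
  also have "\<bar>\<dots>\<bar> \<le> (LINT x|lborel. \<bar>cmod (a x + b x) powr q - cmod (a x) powr q - cmod (b x) powr q\<bar>)"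
    by (rule integral_abs_bound)
  also have "\<dots> \<le> (LINT x|lborel. (2 * q * (2 * M) powr (q - 2) + M powr (q - 2)) * (cmod (a x) * cmod (b x)))"
    using i L2_mult_integrable_norm[OF a(1) b(1)] a(2) b(2) q by (intro integral_mono norm_powr_add_split) auto
  also have "\<dots> = (2 * q * (2 * M) powr (q - 2) + M powr (q - 2)) * (LINT x|lborel. cmod (a x) * cmod (b x))"
    by simp
  finally show ?thesis .
qed

section \<open>Bounds and splitting of the coupling term\<close>

lemma triple_product_integrable:
  assumes f: "f \<in> L2" "\<And>x. cmod (f x) \<le> M" and g: "g \<in> L2" and h: "h \<in> L2"
  shows "integrable lborel (\<lambda>x. cmod (f x) * cmod (g x) * cmod (h x))"
    "integrable lborel (\<lambda>x. f x * g x * cnj (h x))"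
    "(LINT x|lborel. cmod (f x) * cmod (g x) * cmod (h x)) \<le> M * (LINT x|lborel. cmod (g x) * cmod (h x))"
    "\<bar>coup f g h\<bar> \<le> (LINT x|lborel. cmod (f x) * cmod (g x) * cmod (h x))"
proof -
  note [measurable] = L2_measurable[OF f(1)] L2_measurable[OF g] L2_measurable[OF h] L2_measurable[OF L2_cnj[OF h]]
  have M: "0 \<le> M" using f(2)[of 0] norm_ge_zero[of "f 0"] by linarith
  have i: "integrable lborel (\<lambda>x. M * (cmod (g x) * cmod (h x)))"
    using L2_mult_integrable_norm[OF g h] by simp
  have b: "cmod (f x) * cmod (g x) * cmod (h x) \<le> M * (cmod (g x) * cmod (h x))" for x
    unfolding mult.assoc using f(2) by (intro mult_right_mono) auto
  show i3: "integrable lborel (\<lambda>x. cmod (f x) * cmod (g x) * cmod (h x))"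
    by (rule Bochner_Integration.integrable_bound[OF i]) (use b M in auto)
  show i4: "integrable lborel (\<lambda>x. f x * g x * cnj (h x))"
    by (rule Bochner_Integration.integrable_bound[OF i3]) (auto simp: norm_mult)
  have "(LINT x|lborel. cmod (f x) * cmod (g x) * cmod (h x)) \<le> (LINT x|lborel. M * (cmod (g x) * cmod (h x)))"
    by (intro integral_mono i i3 b)
  then show "(LINT x|lborel. cmod (f x) * cmod (g x) * cmod (h x)) \<le> M * (LINT x|lborel. cmod (g x) * cmod (h x))" by simp
  have "\<bar>coup f g h\<bar> \<le> cmod (LINT x|lborel. f x * g x * cnj (h x))" unfolding coup_def by (rule abs_Re_le_cmod)
  also have "\<dots> \<le> (LINT x|lborel. cmod (f x * g x * cnj (h x)))" by (rule integral_norm_bound)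
  finally show "\<bar>coup f g h\<bar> \<le> (LINT x|lborel. cmod (f x) * cmod (g x) * cmod (h x))"
    by (simp add: norm_mult)
qed

lemma coup_bound:
  assumes "f \<in> L2" "\<And>x. cmod (f x) \<le> M" "g \<in> L2" "h \<in> L2"
  shows "\<bar>coup f g h\<bar> \<le> M * (LINT x|lborel. cmod (g x) * cmod (h x))"
  using triple_product_integrable(3,4)[OF assms] by linarith

lemma coup_commute: "coup f g h = coup g f h"
  by (simp add: coup_def mult.commute)

text \<open>Conjugating the integral brings the third function to the first place, where
  \<open>coup_bound\<close> asks for a uniform bound.\<close>

lemma coup_rotate: "coup f g h = coup h (\<lambda>x. cnj (f x)) g"
proof -
  have "coup f g h = Re (cnj (LINT x|lborel. f x * g x * cnj (h x)))" by (simp add: coup_def)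
  also have "cnj (LINT x|lborel. f x * g x * cnj (h x)) = (LINT x|lborel. cnj (f x * g x * cnj (h x)))"
    by (simp only: Bochner_Integration.integral_cnj)
  finally show ?thesis by (simp add: coup_def mult_ac)
qed

text \<open>Each of the six mixed products contains a primed and an unprimed factor; the remaining
  factor is estimated by \<open>M\<close>.\<close>

lemma norm_triple_split:
  fixes a b c a' b' c' :: complex
  assumes "cmod a \<le> M" "cmod b \<le> M" "cmod c \<le> M" "cmod a' \<le> M" "cmod b' \<le> M" "cmod c' \<le> M"
  shows "cmod ((a + a') * (b + b') * (c + c') - a * b * c - a' * b' * c') \<le>
     M * (cmod b * cmod c' + 2 * (cmod a * cmod b') + 2 * (cmod b * cmod a') + cmod c * cmod b')"
proof -
  have M: "0 \<le> M" using assms(1) norm_ge_zero[of a] by linarith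
  have t: "cmod (x * y * z) \<le> M * (cmod y * cmod z)" if "cmod x \<le> M" for x y z
    using mult_right_mono[OF that, of "cmod y * cmod z"] by (simp add: norm_mult mult.assoc)
  have "(a + a') * (b + b') * (c + c') - a * b * c - a' * b' * c' =
     a * b * c' + c * a * b' + c * b * a' + c' * a * b' + c' * b * a' + a' * c * b'"
    by (simp add: algebra_simps)
  also have "cmod \<dots> \<le> cmod (a * b * c') + cmod (c * a * b') + cmod (c * b * a') + cmod (c' * a * b') + cmod (c' * b * a') + cmod (a' * c * b')"
    by (intro norm_triangle_mono) auto
  also have "\<dots> \<le> M * (cmod b * cmod c') + M * (cmod a * cmod b') + M * (cmod b * cmod a') + M * (cmod a * cmod b') + M * (cmod b * cmod a') + M * (cmod c * cmod b')"
    by (intro add_mono t assms)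
  finally show ?thesis by (simp add: algebra_simps)
qed

lemma coup_add_split:
  assumes L: "a \<in> L2" "b \<in> L2" "c \<in> L2" "a' \<in> L2" "b' \<in> L2" "c' \<in> L2"
    and M: "\<And>x. cmod (a x) \<le> M" "\<And>x. cmod (b x) \<le> M" "\<And>x. cmod (c x) \<le> M"
      "\<And>x. cmod (a' x) \<le> M" "\<And>x. cmod (b' x) \<le> M" "\<And>x. cmod (c' x) \<le> M"
  shows "\<bar>coup (\<lambda>x. a x + a' x) (\<lambda>x. b x + b' x) (\<lambda>x. c x + c' x) - coup a b c - coup a' b' c'\<bar> \<le>
    M * ((LINT x|lborel. cmod (b x) * cmod (c' x)) + 2 * (LINT x|lborel. cmod (a x) * cmod (b' x)) +
      2 * (LINT x|lborel. cmod (b x) * cmod (a' x)) + (LINT x|lborel. cmod (c x) * cmod (b' x)))"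
proof -
  have aa: "cmod (a x + a' x) \<le> 2 * M" for x using norm_triangle_ineq[of "a x" "a' x"] M(1,4)[of x] by linarith
  have i: "integrable lborel (\<lambda>x. (a x + a' x) * (b x + b' x) * cnj (c x + c' x))"
    "integrable lborel (\<lambda>x. a x * b x * cnj (c x))" "integrable lborel (\<lambda>x. a' x * b' x * cnj (c' x))"
    using triple_product_integrable(2)[OF L2_add[OF L(1,4)] aa L2_add[OF L(2,5)] L2_add[OF L(3,6)]]
      triple_product_integrable(2)[OF L(1) M(1) L(2,3)] triple_product_integrable(2)[OF L(4) M(4) L(5,6)] by auto
  let ?d = "\<lambda>x. (a x + a' x) * (b x + b' x) * cnj (c x + c' x) - a x * b x * cnj (c x) - a' x * b' x * cnj (c' x)"
  let ?B = "\<lambda>x. cmod (b x) * cmod (c' x) + 2 * (cmod (a x) * cmod (b' x)) + 2 * (cmod (b x) * cmod (a' x)) + cmod (c x) * cmod (b' x)"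
  have id: "integrable lborel ?d" using i by (intro Bochner_Integration.integrable_diff)
  have iB: "integrable lborel (\<lambda>x. M * ?B x)"
    by (intro integrable_mult_right Bochner_Integration.integrable_add L2_mult_integrable_norm L)
  have e: "coup (\<lambda>x. a x + a' x) (\<lambda>x. b x + b' x) (\<lambda>x. c x + c' x) - coup a b c - coup a' b' c' = Re (LINT x|lborel. ?d x)"
    unfolding coup_def using i by (subst Bochner_Integration.integral_diff, simp, simp, subst Bochner_Integration.integral_diff) simp_all
  have "\<bar>Re (LINT x|lborel. ?d x)\<bar> \<le> cmod (LINT x|lborel. ?d x)" by (rule abs_Re_le_cmod)
  also have "\<dots> \<le> (LINT x|lborel. cmod (?d x))" by (rule integral_norm_bound)
  also have "\<dots> \<le> (LINT x|lborel. M * ?B x)"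
  proof (intro integral_mono integrable_norm id iB)
    fix x
    have c: "cmod (cnj (c x)) \<le> M" "cmod (cnj (c' x)) \<le> M" using M(3,6) by (simp_all only: complex_mod_cnj)
    show "cmod (?d x) \<le> M * ?B x"
      using norm_triple_split[OF M(1)[of x] M(2)[of x] c(1) M(4)[of x] M(5)[of x] c(2)]
      by (simp only: complex_cnj_add complex_mod_cnj)
  qed
  also have "\<dots> = M * ((LINT x|lborel. cmod (b x) * cmod (c' x)) + 2 * (LINT x|lborel. cmod (a x) * cmod (b' x)) +
      2 * (LINT x|lborel. cmod (b x) * cmod (a' x)) + (LINT x|lborel. cmod (c x) * cmod (b' x)))"
  proof -
    note j = L2_mult_integrable_norm[OF L(2,6)] L2_mult_integrable_norm[OF L(1,5)] L2_mult_integrable_norm[OF L(2,4)] L2_mult_integrable_norm[OF L(3,5)]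
    show ?thesis using j by simp
  qed
  finally show ?thesis unfolding e .
qed

lemma H1c_bound:
  assumes "f \<in> H1c" "sqn f \<le> A" "kin f \<le> B"
  shows "cmod (f x) \<le> sqrt (2 * A + 2 * B)"
  using H1c_pointwise_bound[OF assms(1), of 1 x] assms(2,3) by (intro real_le_rsqrt) simp

subsection \<open>Merging two triples of functions\<close>

definition H1c3 :: "(real \<Rightarrow> complex^3) set" where
  "H1c3 = {u. \<forall>i. component u i \<in> H1c}"

lemma H1c3_D: "u \<in> H1c3 \<Longrightarrow> component u i \<in> H1c"
  by (simp add: H1c3_def)

lemma H1c3_L2: "u \<in> H1c3 \<Longrightarrow> component u i \<in> L2"
  using H1c_D(1)[OF H1c3_D] .

lemma H1c3_diff: "u \<in> H1c3 \<Longrightarrow> v \<in> H1c3 \<Longrightarrow> (\<lambda>x. u x - v x) \<in> H1c3"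
  by (auto simp: H1c3_def intro: H1c_diff(1))

lemma H1c3_shift: "u \<in> H1c3 \<Longrightarrow> (\<lambda>x. u (x + c)) \<in> H1c3"
  by (auto simp: H1c3_def H1c_shift(1)[of "component u _" c for u])

text \<open>Pieces with moduli \<open>\<bar>\<phi>\<^sub>i\<bar>\<close> and \<open>\<bar>v\<^sub>i\<bar>\<close> are merged into a single one: the masses add
  up, and the energy does not exceed the sum of the energies.\<close>

definition merge :: "(real \<Rightarrow> complex^3) \<Rightarrow> (real \<Rightarrow> complex^3) \<Rightarrow> real \<Rightarrow> complex^3" where
  "merge \<phi> v x = (\<chi> i. complex_of_real (sqrt ((cmod (\<phi> x $ i))\<^sup>2 + (cmod (v x $ i))\<^sup>2)))"

lemma component_merge:
  "component (merge \<phi> v) i = (\<lambda>x. complex_of_real (sqrt ((cmod (\<phi> x $ i))\<^sup>2 + (cmod (v x $ i))\<^sup>2)))"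
  by (simp add: merge_def)

lemma merge_H1c3:
  assumes "\<phi> \<in> H1c3" "v \<in> H1c3"
  shows "merge \<phi> v \<in> H1c3"
    "kin (component (merge \<phi> v) i) \<le> kin (component \<phi> i) + kin (component v i)"
    "sqn (component (merge \<phi> v) i) = sqn (component \<phi> i) + sqn (component v i)"
  using H1c_sqrt_sum[OF H1c3_D[OF assms(1)] H1c3_D[OF assms(2)]]
  by (simp_all add: H1c3_def component_merge)

text \<open>For \<open>b \<le> a\<close>, write the right-hand side as
  \<open>a * (a + b) powr (s - 1) + b * (a + b) powr (s - 1)\<close> and use
  \<open>a + b \<ge> a\<close> in the first summand, \<open>a + b \<ge> 2 * b\<close> in the second.
  The term with \<open>m\<close> is the quantitative gain of merging.\<close>

lemma powr_add_superadditive: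
  assumes "0 \<le> (a::real)" "0 \<le> b" "1 \<le> s" "0 \<le> m" "m \<le> a" "m \<le> b"
  shows "a powr s + b powr s + (2 powr (s - 1) - 1) * m powr s \<le> (a + b) powr s"
proof -
  have *: "a powr s + b powr s + (2 powr (s - 1) - 1) * m powr s \<le> (a + b) powr s"
    if "0 \<le> b" "b \<le> a" "m \<le> b" for a b :: real
  proof -
    have pw: "x powr s = x * x powr (s - 1)" if "0 \<le> x" for x :: real
      using that by (cases "x = 0") (auto simp: powr_diff)
    have 2: "1 \<le> 2 powr (s - 1)" using assms(3) by (intro ge_one_powr_ge_zero) auto
    have "a * a powr (s - 1) + b * (2 * b) powr (s - 1) \<le> a * (a + b) powr (s - 1) + b * (a + b) powr (s - 1)"
      using that assms(3) by (intro add_mono mult_left_mono powr_mono2) auto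
    also have "\<dots> = (a + b) powr s" using that by (simp add: pw[of "a + b"] distrib_right)
    also have "b * (2 * b) powr (s - 1) = 2 powr (s - 1) * b powr s"
      using that by (simp add: pw[of b] powr_mult)
    finally have 1: "a powr s + 2 powr (s - 1) * b powr s \<le> (a + b) powr s" using that by (simp add: pw[of a])
    have "(2 powr (s - 1) - 1) * m powr s \<le> (2 powr (s - 1) - 1) * b powr s"
      using 2 that assms by (intro mult_left_mono powr_mono2) auto
    then show ?thesis using 1 by (simp add: algebra_simps)
  qed
  show ?thesis
  proof (cases "b \<le> a")
    case False
    then show ?thesis using *[of a b] assms by (simp add: add_ac)
  qed (use *[of b a] assms in auto)
qed

text \<open>The difference of the squares of the two sides is a sum of squares;
  \<open>(a1 * a2 * b3 - b1 * b2 * a3)\<^sup>2\<close> accounts for the mixed term of the left-hand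
  side.\<close>

lemma sqrt_products_ge:
  fixes a1 a2 a3 b1 b2 b3 :: real
  shows "a1 * a2 * a3 + b1 * b2 * b3 \<le> sqrt (a1\<^sup>2 + b1\<^sup>2) * sqrt (a2\<^sup>2 + b2\<^sup>2) * sqrt (a3\<^sup>2 + b3\<^sup>2)"
proof -
  have "(a1\<^sup>2 + b1\<^sup>2) * (a2\<^sup>2 + b2\<^sup>2) * (a3\<^sup>2 + b3\<^sup>2) = (a1 * a2 * a3 + b1 * b2 * b3)\<^sup>2 +
     ((a1 * a2 * b3 - b1 * b2 * a3)\<^sup>2 + (a1 * b2 * a3)\<^sup>2 + (a1 * b2 * b3)\<^sup>2 + (b1 * a2 * a3)\<^sup>2 + (b1 * a2 * b3)\<^sup>2)"
    by (simp add: power2_eq_square algebra_simps)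
  then have "(a1 * a2 * a3 + b1 * b2 * b3)\<^sup>2 \<le> (a1\<^sup>2 + b1\<^sup>2) * (a2\<^sup>2 + b2\<^sup>2) * (a3\<^sup>2 + b3\<^sup>2)"
    by simp
  then have "a1 * a2 * a3 + b1 * b2 * b3 \<le> sqrt ((a1\<^sup>2 + b1\<^sup>2) * (a2\<^sup>2 + b2\<^sup>2) * (a3\<^sup>2 + b3\<^sup>2))"
    by (rule real_le_rsqrt)
  then show ?thesis by (simp add: real_sqrt_mult)
qed

lemma H1c_bounded:
  assumes "f \<in> H1c" obtains M where "\<And>x. cmod (f x) \<le> M" "M \<ge> 0"
  using H1c_bound[OF assms order_refl order_refl] by (metis norm_ge_zero order_trans)

lemma cmod_powr_square: "cmod z powr q = (cmod z)\<^sup>2 powr (q / 2)"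
  by (cases "z = 0") (auto simp: powr_powr simp flip: powr_numeral)

text \<open>The squared modulus of \<open>merge\<close> is the sum of the squared moduli, so
  superadditivity applies with exponent \<open>q / 2\<close>. The gain is collected on
  \<open>{-d..d}\<close>, of length \<open>2 * d\<close>; \<open>a = d = 0\<close> gives plain
  superadditivity.\<close>

lemma pot_merge:
  assumes \<phi>: "\<phi> \<in> H1c3" and v: "v \<in> H1c3" and q: "2 \<le> q" and a: "0 \<le> a" and d: "0 \<le> d"
    and lower: "\<And>x. -d \<le> x \<Longrightarrow> x \<le> d \<Longrightarrow> a \<le> cmod (\<phi> x $ i) \<and> a \<le> cmod (v x $ i)"
  shows "pot q (component \<phi> i) + pot q (component v i) + 2 * d * ((2 powr (q / 2 - 1) - 1) * a powr q)
     \<le> pot q (component (merge \<phi> v) i)"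
proof -
  note f = H1c3_D[OF \<phi>, of i] and g = H1c3_D[OF v, of i] and w = H1c3_D[OF merge_H1c3(1)[OF \<phi> v], of i]
  obtain M1 where M1: "\<And>x. cmod (\<phi> x $ i) \<le> M1" using H1c_bounded[OF f] by metis
  obtain M2 where M2: "\<And>x. cmod (v x $ i) \<le> M2" using H1c_bounded[OF g] by metis
  obtain M3 where M3: "\<And>x. cmod (merge \<phi> v x $ i) \<le> M3" using H1c_bounded[OF w] by metis
  note I = pot_bound(1)[OF H1c_D(1)[OF f] M1 q] pot_bound(1)[OF H1c_D(1)[OF g] M2 q] pot_bound(1)[OF H1c_D(1)[OF w] M3 q]
  define c where "c = (2 powr (q / 2 - 1) - 1) * a powr q"
  have ic: "integrable lborel (\<lambda>x. indicator {-d..d} x * c)"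
    using integrable_indicator_Icc by (intro integrable_mult_left) auto
  have "pot q (component \<phi> i) + pot q (component v i) + 2 * d * c =
     (LINT x|lborel. (cmod (\<phi> x $ i) powr q + cmod (v x $ i) powr q) + indicator {-d..d} x * c)"
    unfolding pot_def using I ic d by simp
  also have "\<dots> \<le> (LINT x|lborel. cmod (merge \<phi> v x $ i) powr q)"
  proof (rule integral_mono)
    fix x
    let ?m = "if x \<in> {-d..d} then a\<^sup>2 else 0"
    have m: "?m \<le> (cmod (\<phi> x $ i))\<^sup>2" "?m \<le> (cmod (v x $ i))\<^sup>2"
      using lower[of x] a by (auto intro!: power_mono)
    have ma: "?m powr (q / 2) = (if x \<in> {-d..d} then a powr q else 0)"
      using cmod_powr_square[of "complex_of_real a" q] a by auto
    have "cmod (merge \<phi> v x $ i) powr q = ((cmod (\<phi> x $ i))\<^sup>2 + (cmod (v x $ i))\<^sup>2) powr (q / 2)"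
    proof -
      have "(cmod (merge \<phi> v x $ i))\<^sup>2 = (cmod (\<phi> x $ i))\<^sup>2 + (cmod (v x $ i))\<^sup>2" by (simp add: merge_def)
      then show ?thesis by (simp only: cmod_powr_square[of "merge \<phi> v x $ i" q])
    qed
    moreover have "(cmod (\<phi> x $ i))\<^sup>2 powr (q / 2) + (cmod (v x $ i))\<^sup>2 powr (q / 2) + (2 powr (q / 2 - 1) - 1) * ?m powr (q / 2)
        \<le> ((cmod (\<phi> x $ i))\<^sup>2 + (cmod (v x $ i))\<^sup>2) powr (q / 2)"
      using q by (intro powr_add_superadditive m) auto
    ultimately show "(cmod (\<phi> x $ i) powr q + cmod (v x $ i) powr q) + indicator {-d..d} x * c \<le> cmod (merge \<phi> v x $ i) powr q"
      unfolding ma cmod_powr_square[symmetric] by (auto simp: c_def indicator_def)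
  qed (use I ic in auto)
  finally show ?thesis by (simp add: c_def pot_def)
qed

text \<open>Replacing all functions by their moduli can only increase the coupling; then
  \<open>sqrt_products_ge\<close> applies pointwise.\<close>

lemma coup_merge:
  assumes \<phi>: "\<phi> \<in> H1c3" and v: "v \<in> H1c3"
  shows "coup (component \<phi> 1) (component \<phi> 2) (component \<phi> 3) + coup (component v 1) (component v 2) (component v 3)
    \<le> coup (component (merge \<phi> v) 1) (component (merge \<phi> v) 2) (component (merge \<phi> v) 3)"
proof -
  note w = merge_H1c3(1)[OF \<phi> v]
  obtain M1 where M1: "\<And>x. cmod (\<phi> x $ 1) \<le> M1" using H1c_bounded[OF H1c3_D[OF \<phi>]] by metis
  obtain M2 where M2: "\<And>x. cmod (v x $ 1) \<le> M2" using H1c_bounded[OF H1c3_D[OF v]] by metis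
  obtain M3 where M3: "\<And>x. cmod (merge \<phi> v x $ 1) \<le> M3" using H1c_bounded[OF H1c3_D[OF w]] by metis
  note T\<phi> = triple_product_integrable[OF H1c3_L2[OF \<phi>] M1 H1c3_L2[OF \<phi>, of 2] H1c3_L2[OF \<phi>, of 3]]
  note Tv = triple_product_integrable[OF H1c3_L2[OF v] M2 H1c3_L2[OF v, of 2] H1c3_L2[OF v, of 3]]
  note Tw = triple_product_integrable[OF H1c3_L2[OF w] M3 H1c3_L2[OF w, of 2] H1c3_L2[OF w, of 3]]
  have "coup (component \<phi> 1) (component \<phi> 2) (component \<phi> 3) + coup (component v 1) (component v 2) (component v 3)
     \<le> (LINT x|lborel. cmod (\<phi> x $ 1) * cmod (\<phi> x $ 2) * cmod (\<phi> x $ 3)) + (LINT x|lborel. cmod (v x $ 1) * cmod (v x $ 2) * cmod (v x $ 3))"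
    using T\<phi>(4) Tv(4) by linarith
  also have "\<dots> = (LINT x|lborel. cmod (\<phi> x $ 1) * cmod (\<phi> x $ 2) * cmod (\<phi> x $ 3) + cmod (v x $ 1) * cmod (v x $ 2) * cmod (v x $ 3))"
    using T\<phi>(1) Tv(1) by (intro Bochner_Integration.integral_add[symmetric])
  also have "\<dots> \<le> (LINT x|lborel. Re (merge \<phi> v x $ 1 * merge \<phi> v x $ 2 * cnj (merge \<phi> v x $ 3)))"
  proof (rule integral_mono)
    fix x
    have "Re (merge \<phi> v x $ 1 * merge \<phi> v x $ 2 * cnj (merge \<phi> v x $ 3)) =
       sqrt ((cmod (\<phi> x $ 1))\<^sup>2 + (cmod (v x $ 1))\<^sup>2) * sqrt ((cmod (\<phi> x $ 2))\<^sup>2 + (cmod (v x $ 2))\<^sup>2) * sqrt ((cmod (\<phi> x $ 3))\<^sup>2 + (cmod (v x $ 3))\<^sup>2)"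
      by (simp add: merge_def)
    then show "cmod (\<phi> x $ 1) * cmod (\<phi> x $ 2) * cmod (\<phi> x $ 3) + cmod (v x $ 1) * cmod (v x $ 2) * cmod (v x $ 3)
       \<le> Re (merge \<phi> v x $ 1 * merge \<phi> v x $ 2 * cnj (merge \<phi> v x $ 3))"
      by (simp only: sqrt_products_ge)
  qed (use T\<phi>(1) Tv(1) integrable_Re[OF Tw(2)] in \<open>auto simp del: times_complex.sel\<close>)
  also have "\<dots> = coup (component (merge \<phi> v) 1) (component (merge \<phi> v) 2) (component (merge \<phi> v) 3)"
    unfolding coup_def using integral_Re[OF Tw(2)] .
  finally show ?thesis .
qed

lemma null_times_bounded:
  fixes x y :: "nat \<Rightarrow> real"
  assumes "x \<longlonglongrightarrow> 0" "\<And>n. \<bar>y n\<bar> \<le> C"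
  shows "(\<lambda>n. x n * y n) \<longlonglongrightarrow> 0"
proof (rule Lim_null_comparison)
  show "\<forall>\<^sub>F n in sequentially. norm (x n * y n) \<le> \<bar>x n\<bar> * C"
    using assms(2) by (auto simp: abs_mult intro!: always_eventually mult_left_mono)
  have "(\<lambda>n. \<bar>x n\<bar> * C) \<longlonglongrightarrow> \<bar>0\<bar> * C" by (intro tendsto_intros assms)
  then show "(\<lambda>n. \<bar>x n\<bar> * C) \<longlonglongrightarrow> 0" by simp
qed

locale three_wave =
  fixes \<alpha> \<beta> p :: real
  assumes \<alpha>: "\<alpha> > 0" and \<beta>: "\<beta> > 0" and p1: "1 < p" and p5: "p < 5"
begin

abbreviation E where "E \<equiv> energy \<alpha> \<beta> p"

lemma energy_eq:
  "E u = (\<Sum>i\<in>UNIV. 1/2 * kin (component u i) - \<beta> / (p + 1) * pot (p + 1) (component u i))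
     - \<alpha> * coup (component u 1) (component u 2) (component u 3)"
  by (simp add: energy_def sqn_def pot_def coup_def)

lemma q2: "2 \<le> p + 1" and \<beta>p: "\<beta> / (p + 1) > 0"
  using p1 \<beta> by auto

lemma energy_shift:
  assumes "u \<in> H1c3" shows "E (\<lambda>x. u (x + c)) = E u"
proof -
  have "pot (p + 1) (\<lambda>x. component u i (x + c)) = pot (p + 1) (component u i)" for i
    unfolding pot_def by (rule lborel_integral_shift[of "\<lambda>x. cmod (component u i x) powr (p + 1)"])
  moreover have "coup (\<lambda>x. component u 1 (x + c)) (\<lambda>x. component u 2 (x + c)) (\<lambda>x. component u 3 (x + c)) =
      coup (component u 1) (component u 2) (component u 3)"
    unfolding coup_def using lborel_integral_shift[of "\<lambda>x. u x $ 1 * u x $ 2 * cnj (u x $ 3)" c] by simp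
  ultimately show ?thesis
    using H1c_shift(3)[OF H1c3_D[OF assms], where c = c] by (simp add: energy_eq)
qed

text \<open>Every term moves in the favourable direction. The gain is booked in the one component
  \<open>i\<close>; for the others \<open>pot_merge\<close> is used with
  \<open>a = d = 0\<close>.\<close>

lemma energy_merge:
  assumes \<phi>: "\<phi> \<in> H1c3" and v: "v \<in> H1c3" and a: "0 \<le> a" and d: "0 \<le> d"
    and lower: "\<And>x. -d \<le> x \<Longrightarrow> x \<le> d \<Longrightarrow> a \<le> cmod (\<phi> x $ i) \<and> a \<le> cmod (v x $ i)"
  shows "E (merge \<phi> v) \<le> E \<phi> + E v - \<beta> / (p + 1) * (2 * d * ((2 powr ((p - 1) / 2) - 1) * a powr (p + 1)))"
proof -
  define c where "c = 2 * d * ((2 powr ((p - 1) / 2) - 1) * a powr (p + 1))"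
  have e: "(p + 1) / 2 - 1 = (p - 1) / 2" by (simp add: field_simps)
  have P: "pot (p + 1) (component \<phi> j) + pot (p + 1) (component v j) + (if j = i then c else 0) \<le> pot (p + 1) (component (merge \<phi> v) j)" for j
  proof (cases "j = i")
    case True
    then show ?thesis using pot_merge[OF \<phi> v q2 a d lower] unfolding c_def e by simp
  next
    case False
    then show ?thesis using pot_merge[OF \<phi> v q2, of 0 0 j] by simp
  qed
  have "(\<Sum>j\<in>UNIV. 1/2 * kin (component (merge \<phi> v) j) - \<beta> / (p + 1) * pot (p + 1) (component (merge \<phi> v) j))
     \<le> (\<Sum>j\<in>UNIV. (1/2 * kin (component \<phi> j) - \<beta> / (p + 1) * pot (p + 1) (component \<phi> j))
       + (1/2 * kin (component v j) - \<beta> / (p + 1) * pot (p + 1) (component v j)) - (if j = i then \<beta> / (p + 1) * c else 0))"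
  proof (rule sum_mono)
    fix j
    have "\<beta> / (p + 1) * (pot (p + 1) (component \<phi> j) + pot (p + 1) (component v j) + (if j = i then c else 0))
       \<le> \<beta> / (p + 1) * pot (p + 1) (component (merge \<phi> v) j)"
      using P \<beta>p by (intro mult_left_mono) auto
    then show "1/2 * kin (component (merge \<phi> v) j) - \<beta> / (p + 1) * pot (p + 1) (component (merge \<phi> v) j)
      \<le> (1/2 * kin (component \<phi> j) - \<beta> / (p + 1) * pot (p + 1) (component \<phi> j))
       + (1/2 * kin (component v j) - \<beta> / (p + 1) * pot (p + 1) (component v j)) - (if j = i then \<beta> / (p + 1) * c else 0)"
      using merge_H1c3(2)[OF \<phi> v, of j] unfolding distrib_left by (auto split: if_splits)
  qed
  also have "\<dots> = (\<Sum>j\<in>UNIV. 1/2 * kin (component \<phi> j) - \<beta> / (p + 1) * pot (p + 1) (component \<phi> j))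
       + (\<Sum>j\<in>UNIV. 1/2 * kin (component v j) - \<beta> / (p + 1) * pot (p + 1) (component v j)) - \<beta> / (p + 1) * c"
    by (simp only: sum_subtractf sum.distrib sum.delta finite UNIV_I if_True)
  finally show ?thesis
    using mult_left_mono[OF coup_merge[OF \<phi> v], of \<alpha>] \<alpha>
    unfolding energy_eq c_def[symmetric] distrib_left by linarith
qed

text \<open>A Brezis-Lieb splitting. The kinetic part follows from weak convergence tested against
  \<open>\<phi>\<close>; all other errors are bounded by integrals of
  \<open>cmod (\<phi> x $ i) * cmod (r n x $ j)\<close>, which tend to zero.\<close>

lemma energy_split:
  assumes u: "\<And>n. u n \<in> H1c3" and \<phi>: "\<phi> \<in> H1c3"
    and A: "\<And>n i. sqn (component (u n) i) \<le> A" and B: "\<And>n i. kin (component (u n) i) \<le> B"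
    and lim: "\<And>i x. (\<lambda>n. u n x $ i) \<longlonglongrightarrow> \<phi> x $ i"
  shows "(\<lambda>n. E (u n) - E \<phi> - E (\<lambda>x. u n x - \<phi> x)) \<longlonglongrightarrow> 0"
    "\<And>i. (\<lambda>n. sqn (component (u n) i) - sqn (component \<phi> i) - sqn (component (\<lambda>x. u n x - \<phi> x) i)) \<longlonglongrightarrow> 0"
proof -
  define r where "r n x = u n x - \<phi> x" for n x
  define P where "P = (\<Sum>i\<in>UNIV. sqn (component \<phi> i))"
  define Q where "Q = (\<Sum>i\<in>UNIV. kin (component \<phi> i))"
  define S where "S = 2 * A + 2 * B + 2 * P + 2 * Q"
  have r: "r n \<in> H1c3" for n unfolding r_def by (intro H1c3_diff u \<phi>)
  have A0: "0 \<le> A" using A[of 0 1] sqn_nonneg order_trans by blast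
  have B0: "0 \<le> B" using B[of 0 1] sqn_nonneg order_trans by blast
  have s: "sqn (component \<phi> i) \<le> P" "kin (component \<phi> i) \<le> Q" for i
    unfolding P_def Q_def by (intro member_le_sum; simp)+
  have PQ: "0 \<le> P" "0 \<le> Q" unfolding P_def Q_def by (simp_all add: sum_nonneg)
  have S\<phi>: "sqn (component \<phi> i) \<le> S" "kin (component \<phi> i) \<le> S" for i
    using s(1)[of i] s(2)[of i] A0 B0 PQ unfolding S_def by linarith+
  have Sr: "sqn (component (r n) i) \<le> S" "kin (component (r n) i) \<le> S" for n i
  proof -
    have "sqn (component (r n) i) \<le> 2 * sqn (component (u n) i) + 2 * sqn (component \<phi> i)"
      unfolding r_def by (simp add: sqn_diff_le H1c3_L2[OF u] H1c3_L2[OF \<phi>])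
    then show "sqn (component (r n) i) \<le> S"
      using A[of n i] A0 B0 s(1)[of i] PQ
      unfolding S_def by linarith
    have "kin (component (r n) i) = sqn (\<lambda>x. weak_deriv (component (u n) i) x - weak_deriv (component \<phi> i) x)"
      unfolding r_def using H1c_diff(3)[OF H1c3_D[OF u] H1c3_D[OF \<phi>]] by simp
    also have "\<dots> \<le> 2 * kin (component (u n) i) + 2 * kin (component \<phi> i)"
      by (intro sqn_diff_le H1c_D(2) H1c3_D u \<phi>)
    finally show "kin (component (r n) i) \<le> S"
      using B[of n i] A0 B0 s(2)[of i] PQ
      unfolding S_def by linarith
  qed
  define M where "M = sqrt (2 * (S) + 2 * (S))"
  have M\<phi>: "cmod (\<phi> x $ i) \<le> M" for x i unfolding M_def by (rule H1c_bound[OF H1c3_D[OF \<phi>] S\<phi>])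
  have Mr: "cmod (r n x $ i) \<le> M" for n x i unfolding M_def by (rule H1c_bound[OF H1c3_D[OF r] Sr])
  have D: "(\<lambda>n. LINT x|lborel. cmod (\<phi> x $ i) * cmod (r n x $ j)) \<longlonglongrightarrow> 0" for i j
  proof (rule norm_product_tendsto_0[OF H1c3_L2[OF \<phi>] H1c3_L2[OF r] Sr(1)])
    show "(\<lambda>n. r n x $ j) \<longlonglongrightarrow> 0" for x
      using LIM_zero[OF lim[of x j]] by (simp add: r_def)
  qed
  have ur: "component (u n) i = (\<lambda>x. \<phi> x $ i + r n x $ i)" for n i by (simp add: r_def)
  have mass: "(\<lambda>n. sqn (component (u n) i) - sqn (component \<phi> i) - sqn (component (r n) i)) \<longlonglongrightarrow> 0" for i
  proof (rule Lim_null_comparison)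
    show "\<forall>\<^sub>F n in sequentially. norm (sqn (component (u n) i) - sqn (component \<phi> i) - sqn (component (r n) i)) \<le>
       2 * (LINT x|lborel. cmod (\<phi> x $ i) * cmod (r n x $ i))"
    proof (intro always_eventually allI)
      fix n
      show "norm (sqn (component (u n) i) - sqn (component \<phi> i) - sqn (component (r n) i)) \<le>
         2 * (LINT x|lborel. cmod (\<phi> x $ i) * cmod (r n x $ i))"
        unfolding ur sqn_add[OF H1c3_L2[OF \<phi>] H1c3_L2[OF r]]
        using L2_inner_bound'[OF H1c3_L2[OF \<phi>] H1c3_L2[OF r], of i n i] by simp
    qed
    show "(\<lambda>n. 2 * (LINT x|lborel. cmod (\<phi> x $ i) * cmod (r n x $ i))) \<longlonglongrightarrow> 0"
      using tendsto_mult_left[OF D, of 2 i i] by simp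
  qed
  then show "\<And>i. (\<lambda>n. sqn (component (u n) i) - sqn (component \<phi> i) - sqn (component (\<lambda>x. u n x - \<phi> x) i)) \<longlonglongrightarrow> 0"
    by (simp add: r_def)
  have kin: "(\<lambda>n. kin (component (u n) i) - kin (component \<phi> i) - kin (component (r n) i)) \<longlonglongrightarrow> 0" for i
  proof -
    have "kin (component (r n) i) = kin (component (u n) i) + kin (component \<phi> i) - 2 * L2_inner (weak_deriv (component (u n) i)) (weak_deriv (component \<phi> i))" for n
      unfolding r_def using H1c_diff(3)[OF H1c3_D[OF u] H1c3_D[OF \<phi>], of n i i]
        sqn_diff[OF H1c_D(2)[OF H1c3_D[OF u]] H1c_D(2)[OF H1c3_D[OF \<phi>]], of n i i] by simp
    then have e: "kin (component (u n) i) - kin (component \<phi> i) - kin (component (r n) i) =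
       2 * (L2_inner (weak_deriv (component (u n) i)) (weak_deriv (component \<phi> i)) - kin (component \<phi> i))" for n by simp
    have "(\<lambda>n. L2_inner (weak_deriv (component (u n) i)) (weak_deriv (component \<phi> i))) \<longlonglongrightarrow> kin (component \<phi> i)"
      by (rule weak_convergence[OF H1c3_D[OF u] B lim H1c3_D[OF \<phi>]])
    from tendsto_mult_left[OF LIM_zero[OF this], of 2] show ?thesis unfolding e by simp
  qed
  have pot: "(\<lambda>n. pot (p + 1) (component (u n) i) - pot (p + 1) (component \<phi> i) - pot (p + 1) (component (r n) i)) \<longlonglongrightarrow> 0" for i
  proof (rule Lim_null_comparison)
    let ?C = "2 * (p + 1) * (2 * M) powr (p + 1 - 2) + M powr (p + 1 - 2)"
    show "\<forall>\<^sub>F n in sequentially. norm (pot (p + 1) (component (u n) i) - pot (p + 1) (component \<phi> i) - pot (p + 1) (component (r n) i))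
        \<le> ?C * (LINT x|lborel. cmod (\<phi> x $ i) * cmod (r n x $ i))"
      unfolding ur real_norm_def
      by (intro always_eventually allI pot_add_split H1c3_L2 \<phi> r M\<phi> Mr q2)
    show "(\<lambda>n. ?C * (LINT x|lborel. cmod (\<phi> x $ i) * cmod (r n x $ i))) \<longlonglongrightarrow> 0"
      using tendsto_mult_left[OF D, of ?C i i] by simp
  qed
  have coup: "(\<lambda>n. coup (component (u n) 1) (component (u n) 2) (component (u n) 3) -
      coup (component \<phi> 1) (component \<phi> 2) (component \<phi> 3) - coup (component (r n) 1) (component (r n) 2) (component (r n) 3)) \<longlonglongrightarrow> 0"
  proof (rule Lim_null_comparison)
    let ?D = "\<lambda>i j n. LINT x|lborel. cmod (\<phi> x $ i) * cmod (r n x $ j)"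
    show "\<forall>\<^sub>F n in sequentially. norm (coup (component (u n) 1) (component (u n) 2) (component (u n) 3) -
      coup (component \<phi> 1) (component \<phi> 2) (component \<phi> 3) - coup (component (r n) 1) (component (r n) 2) (component (r n) 3))
      \<le> M * (?D 2 3 n + 2 * ?D 1 2 n + 2 * ?D 2 1 n + ?D 3 2 n)"
      unfolding ur real_norm_def
      by (intro always_eventually allI coup_add_split H1c3_L2 \<phi> r M\<phi> Mr)
    have "(\<lambda>n. M * (?D 2 3 n + 2 * ?D 1 2 n + 2 * ?D 2 1 n + ?D 3 2 n)) \<longlonglongrightarrow> M * (0 + 2 * 0 + 2 * 0 + 0)"
      by (intro tendsto_intros D)
    then show "(\<lambda>n. M * (?D 2 3 n + 2 * ?D 1 2 n + 2 * ?D 2 1 n + ?D 3 2 n)) \<longlonglongrightarrow> 0" by simp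
  qed
  have "(\<lambda>n. (\<Sum>i\<in>UNIV. 1/2 * (kin (component (u n) i) - kin (component \<phi> i) - kin (component (r n) i))
      - \<beta> / (p + 1) * (pot (p + 1) (component (u n) i) - pot (p + 1) (component \<phi> i) - pot (p + 1) (component (r n) i)))
      - \<alpha> * (coup (component (u n) 1) (component (u n) 2) (component (u n) 3) -
      coup (component \<phi> 1) (component \<phi> 2) (component \<phi> 3) - coup (component (r n) 1) (component (r n) 2) (component (r n) 3)))
      \<longlonglongrightarrow> (\<Sum>i\<in>(UNIV::3 set). 1/2 * 0 - \<beta> / (p + 1) * 0) - \<alpha> * 0"
    by (intro tendsto_intros kin pot coup)
  moreover have "(\<Sum>i\<in>UNIV. 1/2 * (kin (component (u n) i) - kin (component \<phi> i) - kin (component (r n) i))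
      - \<beta> / (p + 1) * (pot (p + 1) (component (u n) i) - pot (p + 1) (component \<phi> i) - pot (p + 1) (component (r n) i)))
      - \<alpha> * (coup (component (u n) 1) (component (u n) 2) (component (u n) 3) -
      coup (component \<phi> 1) (component \<phi> 2) (component \<phi> 3) - coup (component (r n) 1) (component (r n) 2) (component (r n) 3))
      = E (u n) - E \<phi> - E (r n)" for n
    unfolding energy_eq by (simp only: right_diff_distrib sum_subtractf)
  ultimately show "(\<lambda>n. E (u n) - E \<phi> - E (\<lambda>x. u n x - \<phi> x)) \<longlonglongrightarrow> 0"
    unfolding r_def by simp
qed

end

subsection \<open>Negative energy and coercivity\<close>

lemma test_function_H1c:
  assumes t: "test_function \<psi>"
  shows "(\<lambda>x. complex_of_real (\<psi> x)) \<in> H1c"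
    "AE x in lborel. weak_deriv (\<lambda>x. complex_of_real (\<psi> x)) x = complex_of_real (deriv \<psi> x)"
proof -
  have L: "(\<lambda>x. complex_of_real (\<phi> x)) \<in> L2" if "test_function \<phi>" for \<phi>
  proof -
    note [measurable] = test_function_measurable[OF that]
    have c: "continuous_on UNIV (\<lambda>x. complex_of_real (\<phi> x))"
      by (intro continuous_on_of_real smooth_continuous test_function_smooth that)
    have "integrable lborel (\<lambda>x. \<phi> x *\<^sub>R complex_of_real (\<phi> x))"
      by (intro test_function_times_integrable that continuous_set_integrable c) measurable
    then have "integrable lborel (\<lambda>x. norm (\<phi> x *\<^sub>R complex_of_real (\<phi> x)))" by (rule integrable_norm)
    then show ?thesis by (simp add: L2_def power2_eq_square)
  qed
  have "(\<lambda>x. complex_of_real (\<psi> x)) primitive_of (\<lambda>x. complex_of_real (deriv \<psi> x))"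
    unfolding primitive_of_def
  proof (intro allI impI)
    fix x y :: real assume "x \<le> y"
    from test_function_FTC[OF t this]
    show "complex_of_real (\<psi> y) - complex_of_real (\<psi> x) = (LINT t:{x..y}|lborel. complex_of_real (deriv \<psi> t))"
      by (simp add: set_integral_complex_of_real set_lebesgue_integral_def[of _ _ "deriv \<psi>"])
  qed
  note * = H1c_I[OF L[OF t] L[OF test_function_deriv[OF t]] this]
  show "(\<lambda>x. complex_of_real (\<psi> x)) \<in> H1c"
    "AE x in lborel. weak_deriv (\<lambda>x. complex_of_real (\<psi> x)) x = complex_of_real (deriv \<psi> x)"
    using * by simp_all
qed

lemma lborel_integral_dilation:
  fixes f :: "real \<Rightarrow> 'a :: {banach, second_countable_topology}"
  assumes "c > 0"
  shows "(LINT x|lborel. f (c * x)) = (1 / c) *\<^sub>R (LINT x|lborel. f x)"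
  using lborel_integral_real_affine[of c f 0] assms by simp

lemma H1c_dilation:
  assumes f: "f \<in> H1c" and c: "c > 0"
  shows "(\<lambda>x. f (c * x)) \<in> H1c" "sqn (\<lambda>x. f (c * x)) = sqn f / c" "kin (\<lambda>x. f (c * x)) = c * kin f"
    "pot q (\<lambda>x. f (c * x)) = pot q f / c"
proof -
  have L: "(\<lambda>x. g (c * x)) \<in> L2" if "g \<in> L2" for g
    using lborel_integrable_real_affine[OF L2_integrable[OF that], of c 0] L2_measurable[OF that] c
    by (simp add: L2_def)
  have s: "sqn (\<lambda>x. g (c * x)) = sqn g / c" for g
    unfolding sqn_def using lborel_integral_dilation[OF c, of "\<lambda>x. (cmod (g x))\<^sup>2"] by simp
  show "sqn (\<lambda>x. f (c * x)) = sqn f / c" by (rule s)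
  show "pot q (\<lambda>x. f (c * x)) = pot q f / c"
    unfolding pot_def using lborel_integral_dilation[OF c, of "\<lambda>x. cmod (f x) powr q"] by simp
  have "(\<lambda>x. f (c * x)) primitive_of (\<lambda>x. of_real c * weak_deriv f (c * x))"
    unfolding primitive_of_def
  proof (intro allI impI)
    fix x y :: real assume xy: "x \<le> y"
    have "(LINT t:{x..y}|lborel. of_real c * weak_deriv f (c * t)) = (LINT t|lborel. of_real c * (indicator {c * x..c * y} (c * t) *\<^sub>R weak_deriv f (c * t)))"
      unfolding set_lebesgue_integral_def using c
      by (intro Bochner_Integration.integral_cong) (auto simp: indicator_def)
    also have "\<dots> = of_real c * (LINT t|lborel. indicator {c * x..c * y} (c * t) *\<^sub>R weak_deriv f (c * t))"
      by (rule integral_mult_right_zero)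
    also have "(LINT t|lborel. indicator {c * x..c * y} (c * t) *\<^sub>R weak_deriv f (c * t)) = (1 / c) *\<^sub>R (LINT t:{c * x..c * y}|lborel. weak_deriv f t)"
      unfolding set_lebesgue_integral_def
      by (rule lborel_integral_dilation[OF c, of "\<lambda>t. indicator {c * x..c * y} t *\<^sub>R weak_deriv f t"])
    also have "(LINT t:{c * x..c * y}|lborel. weak_deriv f t) = f (c * y) - f (c * x)"
      using primitive_ofD[OF H1c_D(3)[OF f], of "c * x" "c * y"] xy c by simp
    finally show "f (c * y) - f (c * x) = (LINT t:{x..y}|lborel. of_real c * weak_deriv f (c * t))"
      using c by (simp add: scaleR_conv_of_real)
  qed
  note * = H1c_I[OF L[OF H1c_D(1)[OF f]] L2_cmult[OF L[OF H1c_D(2)[OF f]]] this]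
  show "(\<lambda>x. f (c * x)) \<in> H1c" by (rule *(1))
  show "kin (\<lambda>x. f (c * x)) = c * kin f"
    unfolding *(3) sqn_cmult s using c by (simp add: power2_eq_square)
qed

lemma pot_cmult: "pot q (\<lambda>x. c * f x) = cmod c powr q * pot q f"
  by (simp add: pot_def norm_mult powr_mult)

lemma coup_scale:
  "coup (\<lambda>x. of_real a * f x) (\<lambda>x. of_real b * g x) (\<lambda>x. of_real c * h x) = a * b * c * coup f g h"
proof -
  have "(of_real a * f x) * (of_real b * g x) * cnj (of_real c * h x) = of_real (a * b * c) * (f x * g x * cnj (h x))" for x
    by simp
  then show ?thesis unfolding coup_def by (simp only: integral_mult_right_zero Re_complex_of_real) simp
qed

lemma powr_sqrt: "0 \<le> x \<Longrightarrow> sqrt x powr q = x powr (q / 2)"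
  by (simp add: powr_half_sqrt[symmetric] powr_powr)

lemma exists_test_H1c: "\<exists>f\<in>H1c. sqn f > 0 \<and> pot q f > 0" if q: "2 \<le> q"
proof -
  obtain \<psi> where \<psi>: "test_function \<psi>" "(LINT x|lborel. \<psi> x) = 1" using test_function_integral_1_exists by blast
  let ?f = "\<lambda>x. complex_of_real (\<psi> x)"
  have f: "?f \<in> H1c" by (rule test_function_H1c(1)[OF \<psi>(1)])
  note [measurable] = test_function_measurable[OF \<psi>(1)]
  obtain M where M: "\<And>x. cmod (?f x) \<le> M" using H1c_bounded[OF f] by metis
  have nz: "\<not> (AE x in lborel. \<psi> x = 0)"
  proof
    assume "AE x in lborel. \<psi> x = 0"
    then have "(LINT x|lborel. \<psi> x) = (LINT x|(lborel :: real measure). (0::real))" by (intro integral_cong_AE) auto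
    then show False using \<psi>(2) by simp
  qed
  have "sqn ?f \<noteq> 0"
  proof
    assume "sqn ?f = 0"
    then have "AE x in lborel. (cmod (?f x))\<^sup>2 = 0"
      unfolding sqn_def using integral_nonneg_eq_0_iff_AE[OF L2_integrable[OF H1c_D(1)[OF f]]] by simp
    then show False using nz by simp
  qed
  moreover have "pot q ?f \<noteq> 0"
  proof
    assume "pot q ?f = 0"
    then have "AE x in lborel. cmod (?f x) powr q = 0"
      unfolding pot_def using integral_nonneg_eq_0_iff_AE[OF pot_bound(1)[OF H1c_D(1)[OF f] M q]] by simp
    then show False using nz by simp
  qed
  ultimately show ?thesis using f pot_bound(3)[OF H1c_D(1)[OF f] M q] by (intro bexI[of _ ?f]) (auto simp: less_le)
qed

lemma L2_product_le:
  assumes "f \<in> L2" "g \<in> L2" "sqn f \<le> A" "sqn g \<le> A"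
  shows "(LINT x|lborel. cmod (f x) * cmod (g x)) \<le> A"
proof (rule power2_le_imp_le)
  have A: "0 \<le> A" using assms(3) sqn_nonneg[of f] by linarith
  then show "0 \<le> A" .
  have "(LINT x|lborel. cmod (f x) * cmod (g x))\<^sup>2 \<le> sqn f * sqn g" by (rule L2_Cauchy_Schwarz[OF assms(1,2)])
  also have "\<dots> \<le> A * A" using assms A by (intro mult_mono) auto
  finally show "(LINT x|lborel. cmod (f x) * cmod (g x))\<^sup>2 \<le> A\<^sup>2" by (simp add: power2_eq_square)
qed

text \<open>The uniformly bounded component is brought to the first place by
  \<open>coup_commute\<close> or \<open>coup_rotate\<close>; Cauchy-Schwarz handles the other
  two.\<close>

lemma coup_small:
  assumes L: "\<And>i. component u i \<in> L2" and A: "\<And>i. sqn (component u i) \<le> A" and s: "\<And>x. cmod (u x $ l) \<le> s"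
  shows "\<bar>coup (component u 1) (component u 2) (component u 3)\<bar> \<le> s * A"
proof -
  have s0: "0 \<le> s" using s[of 0] norm_ge_zero order_trans by blast
  have P: "s * (LINT x|lborel. cmod (u x $ i) * cmod (u x $ j)) \<le> s * A" for i j
    using s0 L2_product_le[OF L L A A, of i j] by (rule mult_left_mono[rotated])
  consider "l = 1" | "l = 2" | "l = 3" using exhaust_3[of l] by blast
  then show ?thesis
  proof cases
    case 1
    then show ?thesis using coup_bound[OF L[of 1] _ L[of 2] L[of 3], of s] s P[of 2 3] by force
  next
    case 2
    then show ?thesis unfolding coup_commute[of "component u 1"]
      using coup_bound[OF L[of 2] _ L[of 1] L[of 3], of s] s P[of 1 3] by force
  next
    case 3
    have "\<bar>coup (component u 3) (\<lambda>x. cnj (component u 1 x)) (component u 2)\<bar> \<le> s * (LINT x|lborel. cmod (cnj (u x $ 1)) * cmod (u x $ 2))"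
      using s 3 by (intro coup_bound L2_cnj L) auto
    then show ?thesis unfolding coup_rotate[of "component u 1"] using P[of 1 2] by simp
  qed
qed

text \<open>To be used with \<open>y = sqrt K + 1\<close> for the total kinetic energy
  \<open>K\<close>: the first term is then \<open>K / 2\<close>, the other two bound the power terms
  and the coupling.\<close>

lemma square_minus_powr_at_top:
  fixes C1 C2 e :: real
  assumes "e < 2"
  shows "filterlim (\<lambda>y. (y - 1)\<^sup>2 / 2 - C1 * y powr e - C2 * y powr (1/2)) at_top at_top"
proof -
  let ?g = "\<lambda>y::real. (1 - 1 / y)\<^sup>2 / 2 - C1 * y powr (e - 2) - C2 * y powr (-3/2)"
  have "(?g \<longlongrightarrow> (1 - 0)\<^sup>2 / 2 - C1 * 0 - C2 * 0) at_top"
    using assms by (intro tendsto_intros tendsto_neg_powr filterlim_ident tendsto_divide_0[OF tendsto_const]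
        filterlim_at_top_imp_at_infinity) auto
  then have "filterlim (\<lambda>y. ?g y * y\<^sup>2) at_top at_top"
    by (intro filterlim_tendsto_pos_mult_at_top[of _ "1/2"] filterlim_pow_at_top filterlim_ident) auto
  then show ?thesis
  proof (rule filterlim_mono_eventually[OF _ order_refl order_refl])
    show "\<forall>\<^sub>F y in at_top. ?g y * y\<^sup>2 = (y - 1)\<^sup>2 / 2 - C1 * y powr e - C2 * y powr (1/2)"
      using eventually_gt_at_top[of "0::real"]
    proof eventually_elim
      case (elim y)
      have "y powr (e - 2) * y\<^sup>2 = y powr e" "y powr (-3/2) * y\<^sup>2 = y powr (1/2)"
        using elim by (simp_all add: powr_add[symmetric] flip: powr_numeral)
      moreover have "(1 - 1 / y)\<^sup>2 * y\<^sup>2 = (y - 1)\<^sup>2"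
        using elim by (simp add: power_mult_distrib[symmetric] left_diff_distrib)
      ultimately show ?case
        by (simp only: left_diff_distrib mult.assoc times_divide_eq_left)
    qed
  qed
qed

context three_wave
begin

text \<open>Dilating \<open>f\<close> by \<open>z\<close> at fixed mass gives the kinetic part
  \<open>C * z\<^sup>2\<close> and the power part \<open>c * z powr e\<close> with
  \<open>e < 2\<close>; the latter wins for small \<open>z\<close>.\<close>

lemma negative_energy_profile:
  assumes b: "b > 0"
  shows "\<exists>Q\<in>H1c. sqn Q = b \<and> 1/2 * kin Q - \<beta> / (p + 1) * pot (p + 1) Q < 0"
proof -
  obtain f where f: "f \<in> H1c" "sqn f > 0" "pot (p + 1) f > 0" using exists_test_H1c[OF q2] by blast
  define k where "k = b / sqn f"
  define e where "e = (p - 1) / 2"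
  define C where "C = 1/2 * k * kin f"
  define c where "c = \<beta> / (p + 1) * k powr ((p + 1) / 2) * pot (p + 1) f"
  \<comment> \<open>The solution of \<open>(C + 1) * z\<^sup>2 = c * z powr e\<close>; the added 1
    gives strict inequality and covers \<open>C = 0\<close>.\<close>
  define z where "z = (c / (C + 1)) powr (1 / (2 - e))"
  \<comment> \<open>The dilation divides the mass by \<open>z\<close>; this amplitude brings it to
    \<open>b\<close>.\<close>
  define a where "a = sqrt (k * z)"
  have k: "k > 0" using f b by (simp add: k_def)
  have C: "C \<ge> 0" using k by (simp add: C_def)
  have c: "c > 0" using k f \<beta>p unfolding c_def by (intro mult_pos_pos) auto
  have e: "e < 2" "(p + 1) / 2 = e + 1" using p5 by (simp_all add: e_def field_simps)
  have z: "z > 0" using c C by (simp add: z_def)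
  have zs: "z powr (2 - e) = c / (C + 1)" unfolding z_def using e c C by (simp add: powr_powr)
  have a0: "a \<ge> 0" "a\<^sup>2 = k * z" using k z by (simp_all add: a_def)
  define Q where "Q x = of_real a * f (z * x)" for x
  note d = H1c_dilation[OF f(1) z]
  have Q: "Q \<in> H1c" unfolding Q_def by (intro H1c_cmult d)
  have "sqn Q = b" unfolding Q_def sqn_cmult using d(2) a0 z f(2) by (simp add: k_def)
  moreover have "1/2 * kin Q = C * z\<^sup>2"
    unfolding Q_def H1c_cmult(3)[OF d(1)] d(3) using a0 by (simp add: C_def power2_eq_square)
  moreover have "\<beta> / (p + 1) * pot (p + 1) Q = c * z powr e"
  proof -
    have "pot (p + 1) Q = (k * z) powr (e + 1) * (pot (p + 1) f / z)"
      unfolding Q_def pot_cmult d(4) using k z a0(1) by (simp add: a_def powr_sqrt e(2))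
    also have "(k * z) powr (e + 1) = k powr (e + 1) * (z powr e * z)"
      using k z by (simp add: powr_mult powr_add)
    finally show ?thesis using z by (simp add: c_def e(2) mult_ac)
  qed
  moreover have "C * z\<^sup>2 < c * z powr e"
  proof -
    have "z\<^sup>2 = z powr (2 - e) * z powr e" using z by (simp add: powr_add[symmetric])
    then have "C * z\<^sup>2 = (C * (c / (C + 1))) * z powr e" by (simp add: zs)
    also have "\<dots> < c * z powr e"
      using z C c by (intro mult_strict_right_mono) (simp_all add: field_simps)
    finally show ?thesis .
  qed
  ultimately show ?thesis using Q by (intro bexI[of _ Q]) auto
qed

text \<open>The pointwise bound over an interval of length \<open>1 / y\<close> gives squared moduli
  of at most \<open>c * y\<close>. Hence the power terms grow at most like \<open>y powr e\<close>
  and the coupling like \<open>y powr (1/2)\<close>, against a kinetic energy of order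
  \<open>y\<^sup>2\<close>.\<close>

lemma coercive:
  assumes m: "0 \<le> m"
  shows "\<exists>B. \<forall>u\<in>H1c3. (\<forall>i. sqn (component u i) \<le> m) \<longrightarrow> E u \<le> D \<longrightarrow> (\<forall>i. kin (component u i) \<le> B)"
proof -
  define e where "e = (p - 1) / 2"
  define c where "c = 2 * (m + 1)"
  define C1 where "C1 = 3 * (\<beta> / (p + 1) * (c powr e * m))"
  define C2 where "C2 = \<alpha> * (c powr (1/2) * m)"
  have "e < 2" using p5 by (simp add: e_def)
  from square_minus_powr_at_top[OF this, of C1 C2]
  have "\<forall>\<^sub>F y in at_top. (y - 1)\<^sup>2 / 2 - C1 * y powr e - C2 * y powr (1/2) > D"
    by (simp add: filterlim_at_top_dense)
  then obtain Y where Y: "\<And>y. y \<ge> Y \<Longrightarrow> (y - 1)\<^sup>2 / 2 - C1 * y powr e - C2 * y powr (1/2) > D"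
    by (auto simp: eventually_at_top_linorder)
  have "kin (component u i) \<le> Y\<^sup>2" if u: "u \<in> H1c3" and sm: "\<forall>i. sqn (component u i) \<le> m" and Eu: "E u \<le> D" for u i
  proof -
    define K where "K = (\<Sum>i\<in>UNIV. kin (component u i))"
    \<comment> \<open>Adding 1 keeps \<open>y\<close> away from zero, so that \<open>1 / y\<close>
      can serve as a length.\<close>
    define y where "y = sqrt K + 1"
    have K0: "0 \<le> K" by (simp add: K_def sum_nonneg)
    have y: "y \<ge> 1" "(y - 1)\<^sup>2 = K" using K0 by (simp_all add: y_def)
    have kK: "kin (component u j) \<le> K" for j unfolding K_def by (intro member_le_sum) auto
    have Ky: "K \<le> y\<^sup>2" using y power_mono[of "y - 1" y 2] by simp
    have T: "cmod (u x $ j) \<le> sqrt (c * y)" for x j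
    proof (rule real_le_rsqrt)
      have "(cmod (u x $ j))\<^sup>2 \<le> 2 * sqn (component u j) / (1 / y) + 2 * (1 / y) * kin (component u j)"
        using H1c_pointwise_bound[OF H1c3_D[OF u], of "1 / y" x j] y by simp
      also have "\<dots> \<le> 2 * m / (1 / y) + 2 * (1 / y) * y\<^sup>2"
        using sm kK[of j] Ky y by (intro add_mono divide_right_mono mult_left_mono) auto
      also have "\<dots> = c * y" using y by (simp add: c_def power2_eq_square field_simps)
      finally show "(cmod (u x $ j))\<^sup>2 \<le> c * y" .
    qed
    have cy: "0 \<le> c * y" "0 \<le> c" "0 \<le> y" using m y by (auto simp: c_def)
    have P: "\<beta> / (p + 1) * pot (p + 1) (component u j) \<le> \<beta> / (p + 1) * ((c powr e * m) * y powr e)" for j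
    proof (rule mult_left_mono)
      have "pot (p + 1) (component u j) \<le> sqrt (c * y) powr (p + 1 - 2) * sqn (component u j)"
        by (rule pot_bound(2)[OF H1c3_L2[OF u] T q2])
      also have "\<dots> \<le> sqrt (c * y) powr (p + 1 - 2) * m" using sm by (intro mult_left_mono) auto
      also have "sqrt (c * y) powr (p + 1 - 2) = c powr e * y powr e"
        using cy by (simp add: powr_sqrt powr_mult e_def)
      finally show "pot (p + 1) (component u j) \<le> (c powr e * m) * y powr e" by (simp add: mult_ac)
    qed (use \<beta>p in auto)
    have "\<bar>coup (component u 1) (component u 2) (component u 3)\<bar> \<le> sqrt (c * y) * m"
      using coup_small[OF H1c3_L2[OF u], of m 1 "sqrt (c * y)"] sm T by blast
    also have "sqrt (c * y) * m = (c powr (1/2) * m) * y powr (1/2)"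
      using cy by (simp add: real_sqrt_mult powr_half_sqrt)
    finally have "\<alpha> * coup (component u 1) (component u 2) (component u 3) \<le> C2 * y powr (1/2)"
      using \<alpha> mult_left_mono[of "coup (component u 1) (component u 2) (component u 3)" "(c powr (1/2) * m) * y powr (1/2)" \<alpha>]
      by (simp add: C2_def mult_ac)
    moreover have "(\<Sum>j\<in>UNIV. 1/2 * kin (component u j) - \<beta> / (p + 1) * ((c powr e * m) * y powr e))
       \<le> (\<Sum>j\<in>UNIV. 1/2 * kin (component u j) - \<beta> / (p + 1) * pot (p + 1) (component u j))"
      using P by (intro sum_mono diff_left_mono)
    moreover have "(\<Sum>j\<in>UNIV. 1/2 * kin (component u j) - \<beta> / (p + 1) * ((c powr e * m) * y powr e))
      = 1/2 * K - C1 * y powr e"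
      by (simp add: sum_subtractf sum_divide_distrib[symmetric] K_def C1_def)
    ultimately have "K / 2 - C1 * y powr e - C2 * y powr (1/2) \<le> D" using Eu unfolding energy_eq by linarith
    then have "y < Y" using Y[of y] y(2) by (cases "y < Y") auto
    then have "(y - 1)\<^sup>2 \<le> Y\<^sup>2" using y by (intro power_mono) auto
    then show ?thesis using kK[of i] y(2) by linarith
  qed
  then show ?thesis by blast
qed

text \<open>One half of the infimum property, for exact masses and continuous representatives; the
  other half is the convergence of the energies in \<open>minimizing\<close>.\<close>

definition lower_bound :: "(3 \<Rightarrow> real) \<Rightarrow> real \<Rightarrow> bool" where
  "lower_bound m I \<longleftrightarrow> (\<forall>u\<in>H1c3. (\<forall>i. sqn (component u i) = m i) \<longrightarrow> I \<le> E u)"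

lemma convergent_masses_bounded:
  fixes f :: "nat \<Rightarrow> 3 \<Rightarrow> real"
  assumes "\<And>i. (\<lambda>n. f n i) \<longlonglongrightarrow> m i" "\<And>n i. 0 \<le> f n i"
  shows "\<exists>A\<ge>0. \<forall>n i. f n i \<le> A"
proof -
  have "\<exists>K. \<forall>n. \<bar>f n i\<bar> \<le> K" for i
    using convergent_imp_Bseq[OF convergentI[OF assms(1)]] by (auto simp: Bseq_def)
  then obtain K where K: "\<And>i n. \<bar>f n i\<bar> \<le> K i" by metis
  have K0: "0 \<le> K i" for i using K[of 0 i] by linarith
  have "f n i \<le> sum K UNIV" for n i
    using K[of n i] member_le_sum[of i UNIV K] K0 by (simp add: abs_le_iff order_trans)
  then show ?thesis using K0 by (intro exI[of _ "sum K UNIV"]) (simp add: sum_nonneg)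
qed

text \<open>Competitors acquire the prescribed masses only in the limit. Rescaling each component by
  \<open>\<kappa> n i\<close>, which tends to 1, corrects the masses and changes the energy by a
  null sequence, since all terms stay bounded.\<close>

lemma near_minimal:
  assumes lb: "lower_bound m I" and m: "\<And>i. m i > 0" and w: "\<And>n. w n \<in> H1c3"
    and mass: "\<And>i. (\<lambda>n. sqn (component (w n) i)) \<longlonglongrightarrow> m i" and B: "\<And>n i. kin (component (w n) i) \<le> B"
    and \<epsilon>: "\<epsilon> > 0"
  shows "\<forall>\<^sub>F n in sequentially. I - \<epsilon> < E (w n)"
proof -
  obtain A where A: "0 \<le> A" "\<And>n i. sqn (component (w n) i) \<le> A"
    using convergent_masses_bounded[of "\<lambda>n i. sqn (component (w n) i)" m] mass by auto
  define M where "M = sqrt (2 * A + 2 * B)"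
  have M: "cmod (w n x $ i) \<le> M" for n x i unfolding M_def by (rule H1c_bound[OF H1c3_D[OF w] A(2) B])
  define \<kappa> where "\<kappa> n i = sqrt (m i / sqn (component (w n) i))" for n i
  have \<kappa>0: "\<kappa> n i \<ge> 0" for n i using m[of i] by (simp add: \<kappa>_def)
  have \<kappa>1: "(\<lambda>n. \<kappa> n i) \<longlonglongrightarrow> 1" for i
  proof -
    have "(\<lambda>n. \<kappa> n i) \<longlonglongrightarrow> sqrt (m i / m i)"
      unfolding \<kappa>_def using m[of i] by (intro tendsto_intros mass) auto
    then show ?thesis using m[of i] by simp
  qed
  define s where "s n x = (\<chi> i. of_real (\<kappa> n i) * w n x $ i)" for n x
  have cs: "component (s n) i = (\<lambda>x. of_real (\<kappa> n i) * component (w n) i x)" for n i by (simp add: s_def)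
  have "component (s n) i \<in> H1c" for n i unfolding cs by (rule H1c_cmult(1)[OF H1c3_D[OF w]])
  then have s: "s n \<in> H1c3" for n by (simp add: H1c3_def)
  \<comment> \<open>Where a mass is zero, division by zero makes \<open>\<kappa>\<close> zero and
    the rescaled mass is wrong; this happens only finitely often.\<close>
  have pos: "\<forall>\<^sub>F n in sequentially. \<forall>i\<in>UNIV. sqn (component (w n) i) > 0"
    using mass m by (intro eventually_ball_finite ballI order_tendstoD(1)) auto
  have Es: "E (s n) = (\<Sum>i\<in>UNIV. 1/2 * ((\<kappa> n i)\<^sup>2 * kin (component (w n) i)) - \<beta> / (p + 1) * (\<kappa> n i powr (p + 1) * pot (p + 1) (component (w n) i)))
      - \<alpha> * (\<kappa> n 1 * \<kappa> n 2 * \<kappa> n 3 * coup (component (w n) 1) (component (w n) 2) (component (w n) 3))" for n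
    unfolding energy_eq cs coup_scale pot_cmult H1c_cmult(3)[OF H1c3_D[OF w]] norm_of_real
    using \<kappa>0 by simp
  have "(\<lambda>n. (\<Sum>i\<in>UNIV. 1/2 * (((\<kappa> n i)\<^sup>2 - 1) * kin (component (w n) i)) - \<beta> / (p + 1) * ((\<kappa> n i powr (p + 1) - 1) * pot (p + 1) (component (w n) i)))
      - \<alpha> * ((\<kappa> n 1 * \<kappa> n 2 * \<kappa> n 3 - 1) * coup (component (w n) 1) (component (w n) 2) (component (w n) 3)))
      \<longlonglongrightarrow> (\<Sum>i\<in>(UNIV :: 3 set). 1/2 * 0 - \<beta> / (p + 1) * 0) - \<alpha> * 0"
  proof (intro tendsto_intros null_times_bounded)
    fix i
    have "(\<lambda>n. (\<kappa> n i)\<^sup>2 - 1) \<longlonglongrightarrow> 1\<^sup>2 - 1" by (intro tendsto_intros \<kappa>1)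
    then show "(\<lambda>n. (\<kappa> n i)\<^sup>2 - 1) \<longlonglongrightarrow> 0" by simp
    have "(\<lambda>n. \<kappa> n i powr (p + 1) - 1) \<longlonglongrightarrow> 1 powr (p + 1) - 1" by (intro tendsto_intros \<kappa>1) auto
    then show "(\<lambda>n. \<kappa> n i powr (p + 1) - 1) \<longlonglongrightarrow> 0" by simp
    show "\<bar>kin (component (w n) i)\<bar> \<le> B" for n using B by simp
    show "\<bar>pot (p + 1) (component (w n) i)\<bar> \<le> M powr (p + 1 - 2) * A" for n
      using pot_bound(2,3)[OF H1c3_L2[OF w] M q2, of n i]
        mult_left_mono[OF A(2)[of n i], of "M powr (p + 1 - 2)"] by simp
  next
    have "(\<lambda>n. \<kappa> n 1 * \<kappa> n 2 * \<kappa> n 3 - 1) \<longlonglongrightarrow> 1 * 1 * 1 - 1" by (intro tendsto_intros \<kappa>1)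
    then show "(\<lambda>n. \<kappa> n 1 * \<kappa> n 2 * \<kappa> n 3 - 1) \<longlonglongrightarrow> 0" by simp
    show "\<bar>coup (component (w n) 1) (component (w n) 2) (component (w n) 3)\<bar> \<le> M * A" for n
      by (rule coup_small[OF H1c3_L2[OF w] A(2) M])
  qed
  moreover have "(\<Sum>i\<in>UNIV. 1/2 * (((\<kappa> n i)\<^sup>2 - 1) * kin (component (w n) i)) - \<beta> / (p + 1) * ((\<kappa> n i powr (p + 1) - 1) * pot (p + 1) (component (w n) i)))
      - \<alpha> * ((\<kappa> n 1 * \<kappa> n 2 * \<kappa> n 3 - 1) * coup (component (w n) 1) (component (w n) 2) (component (w n) 3)) = E (s n) - E (w n)" for n
    unfolding Es unfolding energy_eq by (simp only: right_diff_distrib left_diff_distrib sum_subtractf mult_1_left)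
  ultimately have "(\<lambda>n. E (s n) - E (w n)) \<longlonglongrightarrow> 0" by simp
  then have "\<forall>\<^sub>F n in sequentially. E (s n) - E (w n) < \<epsilon>" using \<epsilon> by (intro order_tendstoD(2)) auto
  then show ?thesis using pos
  proof eventually_elim
    case (elim n)
    have "sqn (component (s n) i) = m i" for i
    proof -
      have "sqn (component (w n) i) > 0" using elim(2) by simp
      then show ?thesis unfolding cs sqn_cmult using m[of i] by (simp add: \<kappa>_def)
    qed
    then have "I \<le> E (s n)" using lb s by (auto simp: lower_bound_def)
    then show ?case using elim(1) by linarith
  qed
qed

end

subsection \<open>Compactness of minimizing sequences\<close>

lemma component_cases: "P (1::3) \<Longrightarrow> P 2 \<Longrightarrow> P 3 \<Longrightarrow> P i"
  using exhaust_3[of i] by auto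

lemma H1c3_I: "(\<And>i. component u i \<in> H1c) \<Longrightarrow> u \<in> H1c3"
  by (simp add: H1c3_def)

text \<open>Hoelder continuity. The radius depends only on \<open>\<epsilon>\<close> and
  \<open>B\<close>, so gains obtained from it are the same for all members of a sequence.\<close>

lemma H1c_stays_large:
  assumes f: "f \<in> H1c" and B: "kin f \<le> B" and e: "0 < \<epsilon>" "\<epsilon> \<le> cmod (f y)" and x: "\<bar>x - y\<bar> \<le> (\<epsilon> / 2)\<^sup>2 / (B + 1)"
  shows "\<epsilon> / 2 \<le> cmod (f x)"
proof -
  have B0: "0 \<le> B" using B sqn_nonneg[of "weak_deriv f"] by linarith
  have "(cmod (f y - f x))\<^sup>2 \<le> \<bar>y - x\<bar> * kin f" by (rule primitive_Holder[OF H1c_D(3)[OF f] H1c_D(2)[OF f]])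
  also have "\<dots> \<le> ((\<epsilon> / 2)\<^sup>2 / (B + 1)) * (B + 1)" using x B B0 by (intro mult_mono) (auto simp: abs_minus_commute)
  also have "\<dots> = (\<epsilon> / 2)\<^sup>2" using B0 by simp
  finally have "cmod (f y - f x) \<le> \<epsilon> / 2" by (rule power2_le_imp_le) (use e in simp)
  then show ?thesis using norm_triangle_ineq2[of "f y" "f x"] e by linarith
qed

definition sup_norm :: "(real \<Rightarrow> complex) \<Rightarrow> real" where
  "sup_norm f = (SUP x. cmod (f x))"

lemma le_sup_norm: assumes "f \<in> H1c" shows "cmod (f x) \<le> sup_norm f"
proof -
  obtain M where "\<And>x. cmod (f x) \<le> M" using H1c_bounded[OF assms] by metis
  then show ?thesis unfolding sup_norm_def by (intro cSUP_upper) (auto intro!: bdd_aboveI)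
qed

lemma sup_norm_nonneg: "f \<in> H1c \<Longrightarrow> 0 \<le> sup_norm f"
  using le_sup_norm[of f 0] norm_ge_zero[of "f 0"] by linarith

lemma sup_norm_not_null:
  assumes f: "\<And>n. f n \<in> H1c" and nl: "\<not> (\<lambda>n. sup_norm (f n)) \<longlonglongrightarrow> 0"
  shows "\<exists>r \<epsilon>. strict_mono (r :: nat \<Rightarrow> nat) \<and> \<epsilon> > 0 \<and> (\<forall>n. \<exists>z. \<epsilon> \<le> cmod (f (r n) z))"
proof -
  from nl obtain \<epsilon> where \<epsilon>: "\<epsilon> > 0" "\<not> (\<forall>\<^sub>F n in sequentially. dist (sup_norm (f n)) 0 < \<epsilon>)"
    unfolding tendsto_iff by blast
  from not_eventually_sequentiallyD[OF this(2)] obtain r where r: "strict_mono (r :: nat \<Rightarrow> nat)"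
    "\<And>n. \<not> dist (sup_norm (f (r n))) 0 < \<epsilon>" by blast
  \<comment> \<open>Half of \<open>\<epsilon>\<close>, since a supremum need not be
    attained.\<close>
  have "\<exists>z. \<epsilon> / 2 \<le> cmod (f (r n) z)" for n
  proof (rule ccontr)
    assume "\<not> ?thesis"
    then have "sup_norm (f (r n)) \<le> \<epsilon> / 2" unfolding sup_norm_def by (intro cSUP_least) (auto simp: not_le less_imp_le)
    then show False using r(2)[of n] \<epsilon>(1) sup_norm_nonneg[OF f, of "r n"] by (simp add: dist_real_def)
  qed
  then show ?thesis using r(1) \<epsilon>(1) by (intro exI[of _ r] exI[of _ "\<epsilon> / 2"]) auto
qed

lemma H1c3_subsequence:
  assumes u: "\<And>n. u n \<in> H1c3" and A: "\<And>n i. sqn (component (u n) i) \<le> A" and B: "\<And>n i. kin (component (u n) i) \<le> B"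
  shows "\<exists>r \<phi>. strict_mono (r :: nat \<Rightarrow> nat) \<and> \<phi> \<in> H1c3 \<and> (\<forall>i x. (\<lambda>n. u (r n) x $ i) \<longlonglongrightarrow> \<phi> x $ i)"
proof -
  obtain r1 f1 where 1: "strict_mono r1" "f1 \<in> H1c" "\<And>x. (\<lambda>n. component (u (r1 n)) 1 x) \<longlonglongrightarrow> f1 x"
    using bounded_H1c_subsequence[of "\<lambda>n. component (u n) 1" A B] H1c3_D[OF u] A B by blast
  obtain r2 f2 where 2: "strict_mono r2" "f2 \<in> H1c" "\<And>x. (\<lambda>n. component (u (r1 (r2 n))) 2 x) \<longlonglongrightarrow> f2 x"
    using bounded_H1c_subsequence[of "\<lambda>n. component (u (r1 n)) 2" A B] H1c3_D[OF u] A B by blast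
  obtain r3 f3 where 3: "strict_mono r3" "f3 \<in> H1c" "\<And>x. (\<lambda>n. component (u (r1 (r2 (r3 n)))) 3 x) \<longlonglongrightarrow> f3 x"
    using bounded_H1c_subsequence[of "\<lambda>n. component (u (r1 (r2 n))) 3" A B] H1c3_D[OF u] A B by blast
  define \<phi> :: "real \<Rightarrow> complex^3" where "\<phi> x = (\<chi> i. if i = 1 then f1 x else if i = 2 then f2 x else f3 x)" for x
  have m: "strict_mono (\<lambda>n. r1 (r2 (r3 n)))" "strict_mono (\<lambda>n. r2 (r3 n))"
    using 1(1) 2(1) 3(1) by (auto simp: strict_mono_def)
  have "(\<lambda>n. u (r1 (r2 (r3 n))) x $ 1) \<longlonglongrightarrow> f1 x" for x
    using LIMSEQ_subseq_LIMSEQ[OF 1(3) m(2)] by (simp add: o_def)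
  moreover have "(\<lambda>n. u (r1 (r2 (r3 n))) x $ 2) \<longlonglongrightarrow> f2 x" for x
    using LIMSEQ_subseq_LIMSEQ[OF 2(3) 3(1)] by (simp add: o_def)
  ultimately have "(\<lambda>n. u (r1 (r2 (r3 n))) x $ 1) \<longlonglongrightarrow> \<phi> x $ 1" "(\<lambda>n. u (r1 (r2 (r3 n))) x $ 2) \<longlonglongrightarrow> \<phi> x $ 2"
    "(\<lambda>n. u (r1 (r2 (r3 n))) x $ 3) \<longlonglongrightarrow> \<phi> x $ 3" for x
    using 3(3) by (auto simp: \<phi>_def)
  then have "(\<lambda>n. u (r1 (r2 (r3 n))) x $ i) \<longlonglongrightarrow> \<phi> x $ i" for i x
    by (rule component_cases)
  moreover have "component \<phi> 1 \<in> H1c" "component \<phi> 2 \<in> H1c" "component \<phi> 3 \<in> H1c"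
    using 1 2 3 by (simp_all add: \<phi>_def)
  then have "\<phi> \<in> H1c3" by (intro H1c3_I) (rule component_cases)
  ultimately show ?thesis using m(1) by (intro exI[of _ "\<lambda>n. r1 (r2 (r3 n))"] exI[of _ \<phi>]) auto
qed

section \<open>Concentration of minimizing sequences\<close>

context three_wave
begin

lemma coup_ge:
  assumes v: "\<And>i. component v i \<in> H1c" and a: "0 \<le> a" and d: "0 \<le> d"
    and re: "\<And>x i. v x $ i = complex_of_real (\<rho> x i)" "\<And>x i. 0 \<le> \<rho> x i"
    and lower: "\<And>x i. -d \<le> x \<Longrightarrow> x \<le> d \<Longrightarrow> a \<le> \<rho> x i"
  shows "2 * d * a ^ 3 \<le> coup (component v 1) (component v 2) (component v 3)"
proof -
  obtain M where M: "\<And>x. cmod (v x $ 1) \<le> M" using H1c_bounded[OF v] by metis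
  note T = triple_product_integrable[OF H1c_D(1)[OF v] M H1c_D(1)[OF v] H1c_D(1)[OF v], of 2 3]
  have "2 * d * a ^ 3 = (LINT x|lborel. indicator {-d..d} x * a ^ 3)" using d by simp
  also have "\<dots> \<le> (LINT x|lborel. Re (v x $ 1 * v x $ 2 * cnj (v x $ 3)))"
  proof (rule integral_mono)
    show "integrable lborel (\<lambda>x. indicator {-d..d} x * a ^ 3)"
      using integrable_indicator_Icc by (intro integrable_mult_left) auto
    show "integrable lborel (\<lambda>x. Re (v x $ 1 * v x $ 2 * cnj (v x $ 3)))" by (rule integrable_Re[OF T(2)])
    fix x
    have "Re (v x $ 1 * v x $ 2 * cnj (v x $ 3)) = \<rho> x 1 * \<rho> x 2 * \<rho> x 3" by (simp add: re(1))
    moreover have "a ^ 3 \<le> \<rho> x 1 * \<rho> x 2 * \<rho> x 3" if "-d \<le> x" "x \<le> d"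
      unfolding power3_eq_cube using lower[OF that] a re(2) by (intro mult_mono mult_nonneg_nonneg) auto
    moreover have "0 \<le> \<rho> x 1 * \<rho> x 2 * \<rho> x 3" using re(2) by simp
    ultimately show "indicator {-d..d} x * a ^ 3 \<le> Re (v x $ 1 * v x $ 2 * cnj (v x $ 3))"
      by (cases "x \<in> {-d..d}") (auto simp: indicator_def simp del: times_complex.sel)
  qed
  also have "\<dots> = coup (component v 1) (component v 2) (component v 3)" unfolding coup_def by (rule integral_Re[OF T(2)])
  finally show ?thesis .
qed

text \<open>A component of the remainder that tends to \<open>0\<close> uniformly could be replaced by a profile of the
  same mass and of negative energy; hence it carries no mass.\<close>

lemma vanishing_component:
  assumes lb: "lower_bound m I" and m: "\<And>i. m i > 0"
    and r: "\<And>n. r n \<in> H1c3" and \<phi>: "\<phi> \<in> H1c3"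
    and B: "\<And>n i. kin (component (r n) i) \<le> B"
    and en: "(\<lambda>n. E \<phi> + E (r n)) \<longlonglongrightarrow> I"
    and mass: "\<And>i. (\<lambda>n. sqn (component \<phi> i) + sqn (component (r n) i)) \<longlonglongrightarrow> m i"
    and s: "(\<lambda>n. sup_norm (component (r n) l)) \<longlonglongrightarrow> 0"
  shows "(\<lambda>n. sqn (component (r n) l)) \<longlonglongrightarrow> 0"
proof -
  define b where "b i = m i - sqn (component \<phi> i)" for i
  have rm: "(\<lambda>n. sqn (component (r n) i)) \<longlonglongrightarrow> b i" for i
    using tendsto_diff[OF mass tendsto_const[of "sqn (component \<phi> i)"], of i] by (simp add: b_def)
  have "b l \<ge> 0" by (rule LIMSEQ_le_const[OF rm]) simp
  moreover have False if bl: "b l > 0"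
  proof -
    obtain A where A: "0 \<le> A" "\<And>n i. sqn (component (r n) i) \<le> A"
      using convergent_masses_bounded[of "\<lambda>n i. sqn (component (r n) i)" b] rm by auto
    obtain Q where Q: "Q \<in> H1c" "sqn Q = b l" "1/2 * kin Q - \<beta> / (p + 1) * pot (p + 1) Q < 0"
      using negative_energy_profile[OF bl] by blast
    define \<sigma> where "\<sigma> n = (if coup (if 1 = l then Q else component (r n) 1) (if 2 = l then Q else component (r n) 2)
       (if 3 = l then Q else component (r n) 3) \<ge> 0 then 1 else - 1 :: real)" for n
    have \<sigma>1: "\<bar>\<sigma> n\<bar> = 1" "(\<sigma> n)\<^sup>2 = 1" for n by (simp_all add: \<sigma>_def)
    define v where "v n x = (\<chi> i. of_real (if i = l then \<sigma> n else 1) * (if i = l then Q x else r n x $ i))" for n x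
    have cv: "component (v n) i = (\<lambda>x. of_real (if i = l then \<sigma> n else 1) * (if i = l then Q else component (r n) i) x)" for n i
      by (auto simp: v_def)
    have cH: "(if i = l then Q else component (r n) i) \<in> H1c" for n i using Q(1) H1c3_D[OF r] by simp
    have v: "v n \<in> H1c3" for n by (rule H1c3_I) (unfold cv, rule H1c_cmult(1)[OF cH])
    have vk: "kin (component (v n) i) = (if i = l then kin Q else kin (component (r n) i))" for n i
      unfolding cv H1c_cmult(3)[OF cH] norm_of_real by (simp add: \<sigma>1)
    have vs: "sqn (component (v n) i) = (if i = l then b l else sqn (component (r n) i))" for n i
      unfolding cv sqn_cmult norm_of_real by (simp add: \<sigma>1 Q(2))
    have vp: "pot (p + 1) (component (v n) i) = (if i = l then pot (p + 1) Q else pot (p + 1) (component (r n) i))" for n i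
      unfolding cv pot_cmult norm_of_real by (simp add: \<sigma>1)
    have prod\<sigma>: "(if 1 = l then \<sigma> n else 1) * (if 2 = l then \<sigma> n else 1) * (if 3 = l then \<sigma> n else 1) = \<sigma> n" for n
      using exhaust_3[of l] by auto
    have vc: "0 \<le> coup (component (v n) 1) (component (v n) 2) (component (v n) 3)" for n
      unfolding cv coup_scale prod\<sigma> by (simp add: \<sigma>_def mult_nonneg_nonneg)
    define eQ where "eQ = 1/2 * kin Q - \<beta> / (p + 1) * pot (p + 1) Q"
    \<comment> \<open>The kinetic energy of the replaced component is discarded by its sign. The two
      extra terms besides \<open>eQ\<close> tend to zero, because that component does so
      uniformly.\<close>
    have Ev: "E (v n) \<le> E (r n) + eQ + \<beta> / (p + 1) * pot (p + 1) (component (r n) l)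
        + \<alpha> * coup (component (r n) 1) (component (r n) 2) (component (r n) 3)" for n
    proof -
      have "(\<Sum>i\<in>UNIV. 1/2 * kin (component (v n) i) - \<beta> / (p + 1) * pot (p + 1) (component (v n) i)) =
        (\<Sum>i\<in>UNIV. (1/2 * kin (component (r n) i) - \<beta> / (p + 1) * pot (p + 1) (component (r n) i))
          + (if i = l then eQ - (1/2 * kin (component (r n) l) - \<beta> / (p + 1) * pot (p + 1) (component (r n) l)) else 0))"
        by (intro sum.cong) (auto simp: vk vp eQ_def)
      also have "\<dots> = (\<Sum>i\<in>UNIV. 1/2 * kin (component (r n) i) - \<beta> / (p + 1) * pot (p + 1) (component (r n) i))
          + (eQ - (1/2 * kin (component (r n) l) - \<beta> / (p + 1) * pot (p + 1) (component (r n) l)))"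
        by (simp only: sum.distrib sum.delta finite UNIV_I if_True)
      finally have "E (v n) = E (r n) + (eQ - (1/2 * kin (component (r n) l) - \<beta> / (p + 1) * pot (p + 1) (component (r n) l)))
        + \<alpha> * coup (component (r n) 1) (component (r n) 2) (component (r n) 3)
        - \<alpha> * coup (component (v n) 1) (component (v n) 2) (component (v n) 3)"
        unfolding energy_eq by linarith
      then show ?thesis
        using mult_nonneg_nonneg[OF less_imp_le[OF \<alpha>] vc, of n] sqn_nonneg[of "weak_deriv (component (r n) l)"] by linarith
    qed
    define w where "w n = merge \<phi> (v n)" for n
    have w: "w n \<in> H1c3" for n unfolding w_def by (rule merge_H1c3(1)[OF \<phi> v])
    define B' where "B' = (\<Sum>i\<in>UNIV. kin (component \<phi> i)) + max B (kin Q)"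
    have wk: "kin (component (w n) i) \<le> B'" for n i
    proof -
      have "kin (component \<phi> i) \<le> (\<Sum>i\<in>UNIV. kin (component \<phi> i))" by (intro member_le_sum) auto
      moreover have "kin (component (v n) i) \<le> max B (kin Q)" using B[of n i] by (auto simp: vk)
      ultimately show ?thesis using merge_H1c3(2)[OF \<phi> v, of n i] unfolding w_def B'_def by linarith
    qed
    have wm: "(\<lambda>n. sqn (component (w n) i)) \<longlonglongrightarrow> m i" for i
    proof (cases "i = l")
      case True
      then show ?thesis unfolding w_def merge_H1c3(3)[OF \<phi> v] vs by (simp add: b_def)
    next
      case False
      then show ?thesis unfolding w_def merge_H1c3(3)[OF \<phi> v] vs using mass[of i] by simp
    qed
    have nm: "\<forall>\<^sub>F n in sequentially. I - (- eQ / 2) < E (w n)"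
      by (rule near_minimal[OF lb m w wm wk]) (use Q(3) in \<open>simp add: eQ_def\<close>)
    have Ew: "E (w n) \<le> E \<phi> + E (v n)" for n
      using energy_merge[OF \<phi> v, of 0 0] unfolding w_def by simp
    have sl: "cmod (r n x $ l) \<le> sup_norm (component (r n) l)" for n x
      by (rule le_sup_norm[OF H1c3_D[OF r]])
    have pl: "(\<lambda>n. pot (p + 1) (component (r n) l)) \<longlonglongrightarrow> 0"
    proof (rule tendsto_sandwich[OF _ _ tendsto_const])
      show "\<forall>\<^sub>F n in sequentially. 0 \<le> pot (p + 1) (component (r n) l)"
        using pot_bound(3)[OF H1c3_L2[OF r] sl q2] by simp
      show "\<forall>\<^sub>F n in sequentially. pot (p + 1) (component (r n) l) \<le> sup_norm (component (r n) l) powr (p + 1 - 2) * A"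
        using order_trans[OF pot_bound(2)[OF H1c3_L2[OF r] sl q2] mult_left_mono[OF A(2)]] by simp
      have "(\<lambda>n. sup_norm (component (r n) l) powr (p + 1 - 2) * A) \<longlonglongrightarrow> 0 powr (p + 1 - 2) * A"
        using p1 sup_norm_nonneg[OF H1c3_D[OF r]] by (intro tendsto_intros s tendsto_powr2) auto
      then show "(\<lambda>n. sup_norm (component (r n) l) powr (p + 1 - 2) * A) \<longlonglongrightarrow> 0" by simp
    qed
    have cl: "(\<lambda>n. coup (component (r n) 1) (component (r n) 2) (component (r n) 3)) \<longlonglongrightarrow> 0"
    proof (rule Lim_null_comparison)
      show "\<forall>\<^sub>F n in sequentially. norm (coup (component (r n) 1) (component (r n) 2) (component (r n) 3)) \<le> sup_norm (component (r n) l) * A"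
        using coup_small[OF H1c3_L2[OF r] A(2) sl] by simp
      show "(\<lambda>n. sup_norm (component (r n) l) * A) \<longlonglongrightarrow> 0" using tendsto_mult_right[OF s, of A] by simp
    qed
    have "(\<lambda>n. (E \<phi> + E (r n)) + eQ + \<beta> / (p + 1) * pot (p + 1) (component (r n) l)
        + \<alpha> * coup (component (r n) 1) (component (r n) 2) (component (r n) 3)) \<longlonglongrightarrow> I + eQ + \<beta> / (p + 1) * 0 + \<alpha> * 0"
      by (intro tendsto_intros en pl cl)
    moreover have "eQ < 0" using Q(3) by (simp only: eQ_def)
    then have "I + eQ + \<beta> / (p + 1) * 0 + \<alpha> * 0 < I - (- eQ / 2)" by simp
    ultimately have "\<forall>\<^sub>F n in sequentially. (E \<phi> + E (r n)) + eQ + \<beta> / (p + 1) * pot (p + 1) (component (r n) l)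
        + \<alpha> * coup (component (r n) 1) (component (r n) 2) (component (r n) 3) < I - (- eQ / 2)"
      by (rule order_tendstoD(2))
    then have "\<forall>\<^sub>F n in sequentially. False"
      using nm
    proof eventually_elim
      case (elim n)
      then show False using Ew[of n] Ev[of n] by linarith
    qed
    then show False by simp
  qed
  ultimately have "b l = 0" by force
  then show ?thesis using rm[of l] by simp
qed

text \<open>If the remainder did not vanish uniformly, one could shift a nonvanishing part of it on top of \<open>\<phi>\<close>
  and gain energy by merging.\<close>

lemma remainder_vanishes:
  assumes lb: "lower_bound m I" and m: "\<And>i. m i > 0"
    and r: "\<And>n. r n \<in> H1c3" and \<phi>: "\<phi> \<in> H1c3"
    and B: "\<And>n i. kin (component (r n) i) \<le> B"
    and en: "(\<lambda>n. E \<phi> + E (r n)) \<longlonglongrightarrow> I"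
    and mass: "\<And>i. (\<lambda>n. sqn (component \<phi> i) + sqn (component (r n) i)) \<longlonglongrightarrow> m i"
    and nz: "\<phi> 0 $ l \<noteq> 0"
  shows "(\<lambda>n. sup_norm (component (r n) l)) \<longlonglongrightarrow> 0"
proof (rule ccontr)
  assume "\<not> ?thesis"
  then obtain k \<epsilon> where k: "strict_mono (k :: nat \<Rightarrow> nat)" "\<epsilon> > 0" "\<And>n. \<exists>z. \<epsilon> \<le> cmod (component (r (k n)) l z)"
    using sup_norm_not_null[of "\<lambda>n. component (r n) l"] H1c3_D[OF r] by blast
  then obtain z where z: "\<And>n. \<epsilon> \<le> cmod (r (k n) (z n) $ l)" by metis
  define v where "v n x = r (k n) (x + z n)" for n x
  have v: "v n \<in> H1c3" for n unfolding v_def by (rule H1c3_shift[OF r])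
  have cv: "component (v n) i = (\<lambda>x. component (r (k n)) i (x + z n))" for n i by (simp add: v_def)
  have vk: "kin (component (v n) i) = kin (component (r (k n)) i)" for n i
    unfolding cv by (rule H1c_shift(3)[OF H1c3_D[OF r]])
  have vs: "sqn (component (v n) i) = sqn (component (r (k n)) i)" for n i
    unfolding cv by (rule sqn_shift)
  have Ev: "E (v n) = E (r (k n))" for n unfolding v_def by (rule energy_shift[OF r])
  define B' where "B' = (\<Sum>i\<in>UNIV. kin (component \<phi> i)) + B"
  have B0: "0 \<le> B" using B[of 0 l] sqn_nonneg order_trans by blast
  have k\<phi>: "kin (component \<phi> i) \<le> (\<Sum>i\<in>UNIV. kin (component \<phi> i))" for i by (intro member_le_sum) auto
  have s0: "0 \<le> (\<Sum>i\<in>UNIV. kin (component \<phi> i))" by (simp add: sum_nonneg)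
  \<comment> \<open>At \<open>0\<close>, the \<open>l\<close>-th components of \<open>\<phi>\<close>
    and of the shifted remainder both have modulus at least \<open>a\<close>, hence at least
    \<open>a / 2\<close> on \<open>{-d..d}\<close>.\<close>
  define a where "a = min \<epsilon> (cmod (\<phi> 0 $ l))"
  have a: "a > 0" "a \<le> \<epsilon>" "a \<le> cmod (\<phi> 0 $ l)" using k(2) nz by (auto simp: a_def)
  define d where "d = (a / 2)\<^sup>2 / (B' + 1)"
  have d: "d > 0" using a B0 s0 unfolding d_def B'_def by (intro divide_pos_pos) auto
  have low: "a / 2 \<le> cmod (\<phi> x $ l) \<and> a / 2 \<le> cmod (v n x $ l)" if "-d \<le> x" "x \<le> d" for x n
  proof
    have xd: "\<bar>x - 0\<bar> \<le> (a / 2)\<^sup>2 / (B' + 1)" using that by (simp add: d_def abs_le_iff)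
    show "a / 2 \<le> cmod (\<phi> x $ l)"
      by (rule H1c_stays_large[OF H1c3_D[OF \<phi>] _ a(1) a(3) xd]) (use k\<phi>[of l] B0 in \<open>simp add: B'_def\<close>)
    show "a / 2 \<le> cmod (v n x $ l)"
    proof (rule H1c_stays_large[OF H1c3_D[OF v] _ a(1) _ xd])
      show "kin (component (v n) l) \<le> B'" unfolding vk using B[of "k n" l] s0 by (simp add: B'_def)
      show "a \<le> cmod (v n 0 $ l)" using z[of n] a(2) by (simp add: v_def)
    qed
  qed
  define c where "c = \<beta> / (p + 1) * (2 * d * ((2 powr ((p - 1) / 2) - 1) * (a / 2) powr (p + 1)))"
  \<comment> \<open>Superlinearity, \<open>p > 1\<close>, makes the gain factor strictly
    positive.\<close>
  have "(2::real) powr 0 < 2 powr ((p - 1) / 2)" using p1 by (intro powr_less_mono) auto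
  then have c: "c > 0" unfolding c_def using \<beta>p d a by (intro mult_pos_pos) auto
  define w where "w n = merge \<phi> (v n)" for n
  have w: "w n \<in> H1c3" for n unfolding w_def by (rule merge_H1c3(1)[OF \<phi> v])
  have wk: "kin (component (w n) i) \<le> B'" for n i
    using merge_H1c3(2)[OF \<phi> v, of n i] vk[of n i] B[of "k n" i] k\<phi>[of i] unfolding w_def B'_def by linarith
  have wm: "(\<lambda>n. sqn (component (w n) i)) \<longlonglongrightarrow> m i" for i
    unfolding w_def merge_H1c3(3)[OF \<phi> v] vs using LIMSEQ_subseq_LIMSEQ[OF mass k(1)] by (simp add: o_def)
  have Ew: "E (w n) \<le> E \<phi> + E (r (k n)) - c" for n
    unfolding w_def c_def Ev[symmetric] by (rule energy_merge[OF \<phi> v _ _ low]) (use a d in auto)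
  have "\<forall>\<^sub>F n in sequentially. I - c / 2 < E (w n)"
    by (rule near_minimal[OF lb m w wm wk]) (use c in simp)
  moreover have "\<forall>\<^sub>F n in sequentially. E \<phi> + E (r (k n)) < I + c / 2"
    using LIMSEQ_subseq_LIMSEQ[OF en k(1)] c by (intro order_tendstoD(2)) (auto simp: o_def)
  ultimately have "\<forall>\<^sub>F n in sequentially. False"
  proof eventually_elim
    case (elim n)
    then show False using Ew[of n] by linarith
  qed
  then show False by simp
qed

lemma energy_zero: "E (\<lambda>x. 0) = 0"
  using H1c_zero(2) by (simp add: energy_eq pot_def coup_def)

lemma H1c3_zero: "(\<lambda>x. 0) \<in> H1c3"
  by (simp add: H1c3_def H1c_zero)

definition minimizing :: "(3 \<Rightarrow> real) \<Rightarrow> real \<Rightarrow> (nat \<Rightarrow> real \<Rightarrow> complex^3) \<Rightarrow> bool" where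
  "minimizing m I u \<longleftrightarrow> (\<forall>n. u n \<in> H1c3) \<and> (\<forall>i. (\<lambda>n. sqn (component (u n) i)) \<longlonglongrightarrow> m i) \<and> (\<lambda>n. E (u n)) \<longlonglongrightarrow> I"

lemma minimizing_subseq: "minimizing m I u \<Longrightarrow> strict_mono r \<Longrightarrow> minimizing m I (\<lambda>n. u (r n))"
  unfolding minimizing_def using LIMSEQ_subseq_LIMSEQ by (fastforce simp: o_def)

lemma minimizing_shift:
  assumes "minimizing m I u" shows "minimizing m I (\<lambda>n x. u n (x + y n))"
proof -
  have u: "u n \<in> H1c3" for n using assms by (simp add: minimizing_def)
  have "sqn (component (\<lambda>x. u n (x + y n)) i) = sqn (component (u n) i)" for n i
    using sqn_shift[of "component (u n) i" "y n"] by simp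
  then show ?thesis using assms unfolding minimizing_def by (simp add: energy_shift[OF u] H1c3_shift[OF u])
qed

lemma minimizing_bounded:
  assumes "minimizing m I u"
  shows "\<exists>A B. \<forall>n i. sqn (component (u n) i) \<le> A \<and> kin (component (u n) i) \<le> B"
proof -
  have u: "u n \<in> H1c3" for n using assms by (simp add: minimizing_def)
  obtain A where A: "0 \<le> A" "\<And>n i. sqn (component (u n) i) \<le> A"
    using convergent_masses_bounded[of "\<lambda>n i. sqn (component (u n) i)" m] assms by (auto simp: minimizing_def)
  have "Bseq (\<lambda>n. E (u n))"
    using assms by (auto simp: minimizing_def intro: convergent_imp_Bseq convergentI)
  then obtain D where D: "\<And>n. \<bar>E (u n)\<bar> \<le> D" by (auto simp: Bseq_def)
  obtain B where "\<forall>u\<in>H1c3. (\<forall>i. sqn (component u i) \<le> A) \<longrightarrow> E u \<le> D \<longrightarrow> (\<forall>i. kin (component u i) \<le> B)"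
    using coercive[OF A(1)] by blast
  then have "kin (component (u n) i) \<le> B" for n i using u A(2) D[of n] by (auto simp: abs_le_iff)
  then show ?thesis using A(2) by blast
qed

text \<open>Uniform decay of a component is excluded by \<open>vanishing_component\<close> with
  \<open>\<phi> = 0\<close>, the whole sequence being the remainder.\<close>

lemma minimizing_not_vanishing:
  assumes lb: "lower_bound m I" and m: "\<And>i. m i > 0" and u: "minimizing m I u"
  shows "\<exists>r \<epsilon>. strict_mono (r :: nat \<Rightarrow> nat) \<and> \<epsilon> > 0 \<and> (\<forall>n. \<exists>z. \<epsilon> \<le> cmod (u (r n) z $ l))"
proof -
  have uH: "u n \<in> H1c3" for n using u by (simp add: minimizing_def)
  obtain A B where AB: "\<And>n i. sqn (component (u n) i) \<le> A" "\<And>n i. kin (component (u n) i) \<le> B"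
    using minimizing_bounded[OF u] by blast
  have "\<not> (\<lambda>n. sup_norm (component (u n) l)) \<longlonglongrightarrow> 0"
  proof
    assume s: "(\<lambda>n. sup_norm (component (u n) l)) \<longlonglongrightarrow> 0"
    have "(\<lambda>n. sqn (component (u n) l)) \<longlonglongrightarrow> 0"
    proof (rule vanishing_component[OF lb m uH H1c3_zero AB(2) _ _ s])
      show "(\<lambda>n. E (\<lambda>x. 0) + E (u n)) \<longlonglongrightarrow> I" using u by (simp add: minimizing_def energy_zero)
      show "(\<lambda>n. sqn (component (\<lambda>x. 0) i) + sqn (component (u n) i)) \<longlonglongrightarrow> m i" for i
        using u by (simp add: minimizing_def sqn_def[of "\<lambda>x. 0"])
    qed
    moreover have "(\<lambda>n. sqn (component (u n) l)) \<longlonglongrightarrow> m l" using u by (simp add: minimizing_def)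
    ultimately show False using LIMSEQ_unique m[of l] by fastforce
  qed
  from sup_norm_not_null[OF H1c3_D[OF uH] this] show ?thesis .
qed

text \<open>The components of a minimizing sequence concentrate at a common place: otherwise the coupling term
  tends to \<open>0\<close>, and shifting the moduli of the components onto each other decreases the energy.\<close>

lemma minimizing_local_limit:
  assumes lb: "lower_bound m I" and m: "\<And>i. m i > 0" and u: "minimizing m I u"
  shows "\<exists>r y \<phi>. strict_mono (r :: nat \<Rightarrow> nat) \<and> \<phi> \<in> H1c3 \<and> (\<forall>i. \<phi> 0 $ i \<noteq> 0) \<and>
    (\<forall>i x. (\<lambda>n. u (r n) (x + y n) $ i) \<longlonglongrightarrow> \<phi> x $ i)"
proof -
  obtain r1 \<epsilon>1 where 1: "strict_mono (r1 :: nat \<Rightarrow> nat)" "\<epsilon>1 > 0" "\<And>n. \<exists>z. \<epsilon>1 \<le> cmod (u (r1 n) z $ 1)"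
    using minimizing_not_vanishing[OF lb m u, of 1] by blast
  note u1 = minimizing_subseq[OF u 1(1)]
  obtain r2 \<epsilon>2 where 2: "strict_mono (r2 :: nat \<Rightarrow> nat)" "\<epsilon>2 > 0" "\<And>n. \<exists>z. \<epsilon>2 \<le> cmod (u (r1 (r2 n)) z $ 2)"
    using minimizing_not_vanishing[OF lb m u1, of 2] by blast
  note u2 = minimizing_subseq[OF u1 2(1)]
  obtain r3 \<epsilon>3 where 3: "strict_mono (r3 :: nat \<Rightarrow> nat)" "\<epsilon>3 > 0" "\<And>n. \<exists>z. \<epsilon>3 \<le> cmod (u (r1 (r2 (r3 n))) z $ 3)"
    using minimizing_not_vanishing[OF lb m u2, of 3] by blast
  define \<epsilon> where "\<epsilon> = min \<epsilon>1 (min \<epsilon>2 \<epsilon>3)"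
  define U where "U n = u (r1 (r2 (r3 n)))" for n
  have U: "minimizing m I U" unfolding U_def by (rule minimizing_subseq[OF u2 3(1)])
  have \<epsilon>: "\<epsilon> > 0" using 1 2 3 by (simp add: \<epsilon>_def)
  have "\<exists>z. \<epsilon> \<le> cmod (U n z $ 1)" "\<exists>z. \<epsilon> \<le> cmod (U n z $ 2)" "\<exists>z. \<epsilon> \<le> cmod (U n z $ 3)" for n
    using 1(3)[of "r2 (r3 n)"] 2(3)[of "r3 n"] 3(3)[of n] unfolding U_def \<epsilon>_def
    by (meson min.coboundedI1 min.coboundedI2)+
  then have "\<exists>z. \<epsilon> \<le> cmod (U n z $ i)" for n i by (rule component_cases)
  then obtain z where z: "\<And>n i. \<epsilon> \<le> cmod (U n (z n i) $ i)" by metis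
  have UH: "U n \<in> H1c3" for n using U by (simp add: minimizing_def)
  obtain A B where A: "\<And>n i. sqn (component (U n) i) \<le> A" and B: "\<And>n i. kin (component (U n) i) \<le> B"
    using minimizing_bounded[OF U] by blast
  have A0: "0 \<le> A" using A[of 0 1] sqn_nonneg order_trans by blast
  have B0: "0 \<le> B" using B[of 0 1] sqn_nonneg order_trans by blast
  define M where "M = sqrt (2 * A + 2 * B)"
  have M: "cmod (U n x $ i) \<le> M" for n x i unfolding M_def by (rule H1c_bound[OF H1c3_D[OF UH] A B])
  define T where "T n = (LINT x|lborel. cmod (U n x $ 1) * cmod (U n x $ 2) * cmod (U n x $ 3))" for n
  note TU = triple_product_integrable[OF H1c3_L2[OF UH] M H1c3_L2[OF UH, of _ 2] H1c3_L2[OF UH, of _ 3]]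
  have T0: "0 \<le> T n" for n unfolding T_def by simp
  have cT: "\<bar>coup (component (U n) 1) (component (U n) 2) (component (U n) 3)\<bar> \<le> T n" for n
    unfolding T_def by (rule TU(4))
  have "\<not> T \<longlonglongrightarrow> 0"
  proof
    assume T: "T \<longlonglongrightarrow> 0"
    \<comment> \<open>Each component is shifted by its own point \<open>z n i\<close>. This keeps
      masses and power terms, does not raise the kinetic energy, and makes the coupling at least
      \<open>c / \<alpha>\<close>, because all moduli are large near \<open>0\<close>.\<close>
    define v where "v n x = (\<chi> i. complex_of_real (cmod (U n (x + z n i) $ i)))" for n x
    have cv: "component (v n) i = (\<lambda>x. complex_of_real (cmod (component (U n) i (x + z n i))))" for n i by (simp add: v_def)
    note sh = H1c_shift[OF H1c3_D[OF UH]]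
    have v: "component (v n) i \<in> H1c" for n i unfolding cv by (rule H1c_norm(1)[OF sh(1)])
    have vk': "kin (component (v n) i) \<le> kin (component (U n) i)" for n i
      unfolding cv using H1c_norm(2)[OF sh(1)] unfolding sh(3) .
    have vk: "kin (component (v n) i) \<le> B" for n i using order_trans[OF vk' B] .
    have vs: "sqn (component (v n) i) = sqn (component (U n) i)" for n i
      unfolding cv sqn_shift[of "component (U n) i" "z n i", symmetric] by (simp add: sqn_def)
    have vp: "pot (p + 1) (component (v n) i) = pot (p + 1) (component (U n) i)" for n i
      unfolding cv pot_def using lborel_integral_shift[of "\<lambda>x. cmod (component (U n) i x) powr (p + 1)" "z n i"] by simp
    define d where "d = (\<epsilon> / 2)\<^sup>2 / (B + 1)"
    have d: "d > 0" using \<epsilon> B0 by (simp add: d_def)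
    define c where "c = \<alpha> * (2 * d * (\<epsilon> / 2) ^ 3)"
    have c: "c > 0" using \<alpha> d \<epsilon> by (simp add: c_def)
    have vc: "2 * d * (\<epsilon> / 2) ^ 3 \<le> coup (component (v n) 1) (component (v n) 2) (component (v n) 3)" for n
    proof (rule coup_ge[OF v, where \<rho> = "\<lambda>x i. cmod (U n (x + z n i) $ i)"])
      fix x i assume x: "-d \<le> x" "x \<le> d"
      show "\<epsilon> / 2 \<le> cmod (U n (x + z n i) $ i)"
        by (rule H1c_stays_large[OF H1c3_D[OF UH] B \<epsilon> z]) (use x in \<open>simp add: d_def abs_le_iff\<close>)
    qed (use \<epsilon> d in \<open>auto simp: v_def\<close>)
    have Ev: "E (v n) \<le> E (U n) + \<alpha> * T n - c" for n
    proof -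
      have "(\<Sum>i\<in>UNIV. 1/2 * kin (component (v n) i) - \<beta> / (p + 1) * pot (p + 1) (component (v n) i)) \<le>
          (\<Sum>i\<in>UNIV. 1/2 * kin (component (U n) i) - \<beta> / (p + 1) * pot (p + 1) (component (U n) i))"
        unfolding vp using vk' by (intro sum_mono diff_right_mono mult_left_mono) auto
      moreover have "c \<le> \<alpha> * coup (component (v n) 1) (component (v n) 2) (component (v n) 3)"
        unfolding c_def using vc \<alpha> by (intro mult_left_mono) auto
      moreover have "\<alpha> * coup (component (U n) 1) (component (U n) 2) (component (U n) 3) \<le> \<alpha> * T n"
        using cT[of n] \<alpha> by (intro mult_left_mono) auto
      ultimately show ?thesis unfolding energy_eq by linarith
    qed
    have "\<forall>\<^sub>F n in sequentially. I - c / 2 < E (v n)"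
    proof (rule near_minimal[OF lb m _ _ vk])
      show "v n \<in> H1c3" for n by (rule H1c3_I[OF v])
      show "(\<lambda>n. sqn (component (v n) i)) \<longlonglongrightarrow> m i" for i unfolding vs using U by (simp add: minimizing_def)
    qed (use c in simp)
    moreover have "(\<lambda>n. E (U n) + \<alpha> * T n - c) \<longlonglongrightarrow> I + \<alpha> * 0 - c"
      using U by (intro tendsto_intros T) (simp add: minimizing_def)
    then have "\<forall>\<^sub>F n in sequentially. E (U n) + \<alpha> * T n - c < I - c / 2"
      using c by (intro order_tendstoD(2)) auto
    ultimately have "\<forall>\<^sub>F n in sequentially. False"
    proof eventually_elim
      case (elim n)
      then show False using Ev[of n] by linarith
    qed
    then show False by simp
  qed
  then obtain \<delta> where \<delta>: "\<delta> > 0" "\<not> (\<forall>\<^sub>F n in sequentially. dist (T n) 0 < \<delta>)"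
    unfolding tendsto_iff by blast
  from not_eventually_sequentiallyD[OF \<delta>(2)] obtain r4 where r4: "strict_mono (r4 :: nat \<Rightarrow> nat)"
    "\<And>n. \<not> dist (T (r4 n)) 0 < \<delta>" by blast
  have Td: "\<delta> \<le> T (r4 n)" for n using r4(2)[of n] T0[of "r4 n"] by (simp add: dist_real_def)
  \<comment> \<open>If at every point some component were at most \<open>t\<close>, then
    \<open>T\<close> would be at most \<open>t\<close> times the total mass, hence below
    \<open>\<delta>\<close>. So all three exceed \<open>t\<close> at a common point.\<close>
  define t where "t = \<delta> / (3 * A + 1)"
  have t: "t > 0" "t * (3 * A) < \<delta>" using \<delta>(1) A0 by (simp_all add: t_def field_simps)
  have "\<exists>y. \<forall>i. t < cmod (U (r4 n) y $ i)" for n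
  proof (rule ccontr)
    assume "\<not> ?thesis"
    then have small: "\<exists>i. cmod (U (r4 n) y $ i) \<le> t" for y by (auto simp: not_less)
    let ?s = "\<lambda>i x. (cmod (U (r4 n) x $ i))\<^sup>2"
    note i2 = L2_integrable[OF H1c3_L2[OF UH]]
    have "T (r4 n) \<le> (LINT x|lborel. t * (?s 1 x + ?s 2 x + ?s 3 x))"
      unfolding T_def
    proof (rule integral_mono[OF TU(1)])
      show "integrable lborel (\<lambda>x. t * (?s 1 x + ?s 2 x + ?s 3 x))"
        by (intro integrable_mult_right Bochner_Integration.integrable_add i2)
      fix x
      have *: "a * b * c \<le> t * (a\<^sup>2 + b\<^sup>2 + c\<^sup>2)" if "0 \<le> a" "0 \<le> b" "0 \<le> c" "a \<le> t" for a b c :: real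
      proof -
        have "b * c \<le> a\<^sup>2 + b\<^sup>2 + c\<^sup>2"
          using sum_squares_bound[of b c] that mult_nonneg_nonneg[of b c] zero_le_power2[of a] by linarith
        then have "a * (b * c) \<le> t * (a\<^sup>2 + b\<^sup>2 + c\<^sup>2)" using that by (intro mult_mono) auto
        then show ?thesis by (simp add: mult.assoc)
      qed
      obtain i where "cmod (U (r4 n) x $ i) \<le> t" using small by blast
      moreover have "i = 1 \<or> i = 2 \<or> i = 3" by (rule exhaust_3)
      ultimately show "cmod (U (r4 n) x $ 1) * cmod (U (r4 n) x $ 2) * cmod (U (r4 n) x $ 3) \<le> t * (?s 1 x + ?s 2 x + ?s 3 x)"
        using *[of "cmod (U (r4 n) x $ 1)" "cmod (U (r4 n) x $ 2)" "cmod (U (r4 n) x $ 3)"]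
          *[of "cmod (U (r4 n) x $ 2)" "cmod (U (r4 n) x $ 1)" "cmod (U (r4 n) x $ 3)"]
          *[of "cmod (U (r4 n) x $ 3)" "cmod (U (r4 n) x $ 1)" "cmod (U (r4 n) x $ 2)"]
        by (auto simp: mult_ac add_ac)
    qed
    also have "\<dots> = t * (sqn (component (U (r4 n)) 1) + sqn (component (U (r4 n)) 2) + sqn (component (U (r4 n)) 3))"
      unfolding sqn_def using i2[of "r4 n" 1] i2[of "r4 n" 2] i2[of "r4 n" 3] by simp
    also have "\<dots> \<le> t * (3 * A)"
      using A[of "r4 n" 1] A[of "r4 n" 2] A[of "r4 n" 3] t(1) by (intro mult_left_mono) auto
    finally show False using Td[of n] t(2) by linarith
  qed
  then obtain y where y: "\<And>n i. t < cmod (U (r4 n) (y n) $ i)" by metis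
  define W where "W n x = U (r4 n) (x + y n)" for n x
  have W: "W n \<in> H1c3" for n unfolding W_def by (rule H1c3_shift[OF UH])
  have cW: "component (W n) i = (\<lambda>x. component (U (r4 n)) i (x + y n))" for n i by (simp add: W_def)
  have WA: "sqn (component (W n) i) \<le> A" for n i
    unfolding cW using A[of "r4 n" i] sqn_shift[of "component (U (r4 n)) i" "y n"] by simp
  have WB: "kin (component (W n) i) \<le> B" for n i unfolding cW H1c_shift(3)[OF H1c3_D[OF UH]] by (rule B)
  obtain r5 \<phi> where 5: "strict_mono (r5 :: nat \<Rightarrow> nat)" "\<phi> \<in> H1c3" "\<And>i x. (\<lambda>n. W (r5 n) x $ i) \<longlonglongrightarrow> \<phi> x $ i"
    using H1c3_subsequence[of W A B, OF W WA WB] by blast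
  have "\<phi> 0 $ i \<noteq> 0" for i
  proof -
    have "t \<le> cmod (\<phi> 0 $ i)"
      by (rule LIMSEQ_le_const[OF tendsto_norm[OF 5(3)]]) (use y in \<open>auto simp: W_def intro!: less_imp_le\<close>)
    then show ?thesis using t(1) by auto
  qed
  moreover have "strict_mono (\<lambda>n. r1 (r2 (r3 (r4 (r5 n)))))"
    using 1(1) 2(1) 3(1) r4(1) 5(1) by (simp add: strict_mono_def)
  ultimately show ?thesis
    using 5(2,3) unfolding W_def U_def
    by (intro exI[of _ "\<lambda>n. r1 (r2 (r3 (r4 (r5 n))))"] exI[of _ "\<lambda>n. y (r5 n)"] exI[of _ \<phi>]) auto
qed

text \<open>When the remainder loses its mass, its power terms and its coupling vanish too. Thus
  \<open>E \<phi>\<close> plus half the kinetic energies of the remainder tends to \<open>I\<close>,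
  while \<open>I \<le> E \<phi>\<close> by the lower bound; this forces equality and strong
  convergence.\<close>

theorem minimizing_compact:
  assumes lb: "lower_bound m I" and m: "\<And>i. m i > 0" and u: "minimizing m I u"
  shows "\<exists>r y \<phi>. strict_mono (r :: nat \<Rightarrow> nat) \<and> \<phi> \<in> H1c3 \<and> (\<forall>i. sqn (component \<phi> i) = m i) \<and> E \<phi> = I \<and>
    (\<forall>i. (\<lambda>n. sqn (component (\<lambda>x. u (r n) (x + y n) - \<phi> x) i)) \<longlonglongrightarrow> 0) \<and>
    (\<forall>i. (\<lambda>n. kin (component (\<lambda>x. u (r n) (x + y n) - \<phi> x) i)) \<longlonglongrightarrow> 0)"
proof -
  obtain k y \<phi> where k: "strict_mono (k :: nat \<Rightarrow> nat)" and \<phi>: "\<phi> \<in> H1c3" and nz: "\<And>i. \<phi> 0 $ i \<noteq> 0"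
    and lim': "\<And>i x. (\<lambda>n. u (k n) (x + y n) $ i) \<longlonglongrightarrow> \<phi> x $ i"
    using minimizing_local_limit[OF lb m u] by blast
  define U where "U n x = u (k n) (x + y n)" for n x
  have U: "minimizing m I U"
    unfolding U_def by (rule minimizing_shift[OF minimizing_subseq[OF u k]])
  have UH: "U n \<in> H1c3" for n using U by (simp add: minimizing_def)
  have lim: "(\<lambda>n. U n x $ i) \<longlonglongrightarrow> \<phi> x $ i" for i x using lim' by (simp add: U_def)
  obtain A B where A: "\<And>n i. sqn (component (U n) i) \<le> A" and B: "\<And>n i. kin (component (U n) i) \<le> B"
    using minimizing_bounded[OF U] by blast
  define r where "r n x = U n x - \<phi> x" for n x
  have r: "r n \<in> H1c3" for n unfolding r_def by (rule H1c3_diff[OF UH \<phi>])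
  note sp = energy_split[OF UH \<phi> A B lim, folded r_def]
  have en: "(\<lambda>n. E \<phi> + E (r n)) \<longlonglongrightarrow> I"
    using tendsto_diff[OF _ sp(1), of "\<lambda>n. E (U n)" I] U by (simp add: minimizing_def)
  have mass: "(\<lambda>n. sqn (component \<phi> i) + sqn (component (r n) i)) \<longlonglongrightarrow> m i" for i
    using tendsto_diff[OF _ sp(2), of "\<lambda>n. sqn (component (U n) i)" "m i" i] U by (simp add: minimizing_def)
  have rB: "kin (component (r n) i) \<le> 2 * B + 2 * (\<Sum>i\<in>UNIV. kin (component \<phi> i))" for n i
  proof -
    have "kin (component (r n) i) = sqn (\<lambda>x. weak_deriv (component (U n) i) x - weak_deriv (component \<phi> i) x)"
      unfolding r_def using H1c_diff(3)[OF H1c3_D[OF UH] H1c3_D[OF \<phi>]] by simp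
    also have "\<dots> \<le> 2 * kin (component (U n) i) + 2 * kin (component \<phi> i)"
      by (intro sqn_diff_le H1c_D(2) H1c3_D UH \<phi>)
    finally show ?thesis
      using B[of n i] member_le_sum[of i UNIV "\<lambda>i. kin (component \<phi> i)"] by simp
  qed
  have sup: "(\<lambda>n. sup_norm (component (r n) i)) \<longlonglongrightarrow> 0" for i
    by (rule remainder_vanishes[OF lb m r \<phi> rB en mass nz])
  have r0: "(\<lambda>n. sqn (component (r n) i)) \<longlonglongrightarrow> 0" for i
    by (rule vanishing_component[OF lb m r \<phi> rB en mass sup])
  have m\<phi>: "sqn (component \<phi> i) = m i" for i
    using LIMSEQ_unique[OF mass tendsto_add[OF tendsto_const r0]] by simp
  obtain S where S: "\<And>n i. sqn (component (r n) i) \<le> S"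
    using convergent_masses_bounded[of "\<lambda>n i. sqn (component (r n) i)" "\<lambda>_. 0"] r0 by auto
  define M where "M = sqrt (2 * S + 2 * (2 * B + 2 * (\<Sum>i\<in>UNIV. kin (component \<phi> i))))"
  have M: "cmod (r n x $ i) \<le> M" for n x i unfolding M_def by (rule H1c_bound[OF H1c3_D[OF r] S rB])
  have pot0: "(\<lambda>n. pot (p + 1) (component (r n) i)) \<longlonglongrightarrow> 0" for i
  proof (rule tendsto_sandwich[OF _ _ tendsto_const])
    show "\<forall>\<^sub>F n in sequentially. 0 \<le> pot (p + 1) (component (r n) i)"
      using pot_bound(3)[OF H1c3_L2[OF r] M q2] by simp
    show "\<forall>\<^sub>F n in sequentially. pot (p + 1) (component (r n) i) \<le> M powr (p + 1 - 2) * sqn (component (r n) i)"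
      using pot_bound(2)[OF H1c3_L2[OF r] M q2] by simp
    show "(\<lambda>n. M powr (p + 1 - 2) * sqn (component (r n) i)) \<longlonglongrightarrow> 0"
      using tendsto_mult_left[OF r0, of "M powr (p + 1 - 2)" i] by simp
  qed
  have coup0: "(\<lambda>n. coup (component (r n) 1) (component (r n) 2) (component (r n) 3)) \<longlonglongrightarrow> 0"
  proof (rule Lim_null_comparison)
    show "\<forall>\<^sub>F n in sequentially. norm (coup (component (r n) 1) (component (r n) 2) (component (r n) 3)) \<le> sup_norm (component (r n) 1) * S"
      using coup_small[OF H1c3_L2[OF r] S le_sup_norm[OF H1c3_D[OF r]]] by simp
    show "(\<lambda>n. sup_norm (component (r n) 1) * S) \<longlonglongrightarrow> 0" using tendsto_mult_right[OF sup[of 1], of S] by simp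
  qed
  have I: "I \<le> E \<phi>" using lb \<phi> m\<phi> by (simp add: lower_bound_def)
  have "(\<lambda>n. (E \<phi> + E (r n)) + (\<Sum>i\<in>UNIV. \<beta> / (p + 1) * pot (p + 1) (component (r n) i))
      + \<alpha> * coup (component (r n) 1) (component (r n) 2) (component (r n) 3)) \<longlonglongrightarrow> I + (\<Sum>i\<in>(UNIV::3 set). \<beta> / (p + 1) * 0) + \<alpha> * 0"
    by (intro tendsto_intros en pot0 coup0)
  moreover have "(E \<phi> + E (r n)) + (\<Sum>i\<in>UNIV. \<beta> / (p + 1) * pot (p + 1) (component (r n) i))
      + \<alpha> * coup (component (r n) 1) (component (r n) 2) (component (r n) 3) = E \<phi> + (\<Sum>i\<in>UNIV. 1/2 * kin (component (r n) i))" for n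
    unfolding energy_eq[of "r n"] sum_subtractf by linarith
  ultimately have K: "(\<lambda>n. E \<phi> + (\<Sum>i\<in>UNIV. 1/2 * kin (component (r n) i))) \<longlonglongrightarrow> I"
    by (simp only: mult_zero_right sum.neutral_const add_0_right)
  have "E \<phi> \<le> I" by (rule LIMSEQ_le_const[OF K]) (auto intro!: sum_nonneg)
  then have EI: "E \<phi> = I" using I by simp
  have K0: "(\<lambda>n. \<Sum>i\<in>UNIV. 1/2 * kin (component (r n) i)) \<longlonglongrightarrow> 0"
    using tendsto_diff[OF K tendsto_const[of "E \<phi>"]] by (simp add: EI)
  have "(\<lambda>n. kin (component (r n) i)) \<longlonglongrightarrow> 0" for i
  proof (rule tendsto_sandwich[OF _ _ tendsto_const])
    show "\<forall>\<^sub>F n in sequentially. kin (component (r n) i) \<le> 2 * (\<Sum>i\<in>UNIV. 1/2 * kin (component (r n) i))"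
      using member_le_sum[of i UNIV "\<lambda>i. 1/2 * kin (component (r _) i)"]
      by (intro always_eventually allI) (simp add: sum_divide_distrib[symmetric] member_le_sum)
    show "(\<lambda>n. 2 * (\<Sum>i\<in>UNIV. 1/2 * kin (component (r n) i))) \<longlonglongrightarrow> 0" using tendsto_mult_left[OF K0, of 2] by simp
  qed simp
  then show ?thesis
    using k \<phi> m\<phi> EI r0 unfolding r_def U_def by (intro exI[of _ k] exI[of _ y] exI[of _ \<phi>]) auto
qed

end

subsection \<open>Euler--Lagrange equations\<close>

lemma primitive_has_vector_derivative:
  assumes f: "f primitive_of g" and g: "continuous_on UNIV g"
  shows "(f has_vector_derivative g x) (at x)"
proof -
  obtain \<Phi> where \<Phi>: "\<And>x. (\<Phi> has_vector_derivative g x) (at x)" using antiderivative_exists[OF g] by blast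
  have *: "f y - f x = \<Phi> y - \<Phi> x" if "x \<le> y" for x y
  proof -
    have "(LINT t|lborel. indicator {x..y} t *\<^sub>R g t) = \<Phi> y - \<Phi> x"
      using that by (rule integral_FTC_atLeastAtMost) (use \<Phi> g in \<open>auto intro: has_vector_derivative_at_within continuous_on_subset\<close>)
    then show ?thesis using primitive_ofD[OF f that] by (simp add: set_lebesgue_integral_def)
  qed
  have "f y = \<Phi> y + (f 0 - \<Phi> 0)" for y
    using *[of 0 y] *[of y 0] by (cases "0 \<le> y") (auto simp: algebra_simps)
  then have "f = (\<lambda>y. \<Phi> y + (f 0 - \<Phi> 0))" by blast
  moreover have "((\<lambda>y. \<Phi> y + (f 0 - \<Phi> 0)) has_vector_derivative g x + 0) (at x)"
    by (intro has_vector_derivative_add \<Phi> has_vector_derivative_const)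
  ultimately show ?thesis by simp
qed

lemma primitive_of_cong_AE:
  assumes "f primitive_of g" "AE x in lborel. g x = h x" "g \<in> borel_measurable borel" "h \<in> borel_measurable borel"
  shows "f primitive_of h"
proof -
  have "(LINT t:{x..y}|lborel. g t) = (LINT t:{x..y}|lborel. h t)" for x y
    using assms(2-4) by (intro set_lebesgue_integral_cong_AE) auto
  then show ?thesis using assms(1) by (simp add: primitive_of_def)
qed

section \<open>Tangent inequalities for powers\<close>

lemma powr_above_tangent:
  assumes "0 < (x::real)" "0 \<le> y" "1 \<le> q"
  shows "x powr q + q * x powr (q - 1) * (y - x) \<le> y powr q"
proof (cases "y \<le> x")
  case True
  have "\<bar>x powr q - y powr q\<bar> \<le> q * x powr (q - 1) * \<bar>x - y\<bar>"
    using True assms by (intro powr_diff_le) auto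
  then have "x powr q - y powr q \<le> q * x powr (q - 1) * (x - y)" using True by simp
  then show ?thesis by (simp add: algebra_simps)
next
  case False
  then have "x < y" by simp
  then obtain z where z: "x < z" "z < y" "y powr q - x powr q = (y - x) * (q * z powr (q - 1))"
    using MVT2[of x y "\<lambda>z. z powr q" "\<lambda>z. q * z powr (q - 1)"] has_real_derivative_powr assms(1) by force
  have "q * x powr (q - 1) * (y - x) \<le> q * z powr (q - 1) * (y - x)"
    using z \<open>x < y\<close> assms by (intro mult_right_mono mult_left_mono powr_mono2) auto
  then show ?thesis using z(3) by (simp add: mult_ac)
qed

text \<open>Convexity of \<open>cmod z powr q\<close>, reduced to one real variable by
  \<open>Re ((a + b) * cnj a) \<le> cmod (a + b) * cmod a\<close>.\<close>

lemma norm_powr_above_tangent: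
  assumes "1 \<le> q"
  shows "cmod a powr q + q * (cmod a powr (q - 2) * Re (a * cnj b)) \<le> cmod (a + b) powr q"
proof (cases "a = 0")
  case False
  then have a: "cmod a > 0" by simp
  have "Re ((a + b) * cnj a) \<le> cmod (a + b) * cmod a"
    using complex_Re_le_cmod[of "(a + b) * cnj a"] by (simp only: norm_mult complex_mod_cnj)
  moreover have "Re ((a + b) * cnj a) = (cmod a)\<^sup>2 + Re (a * cnj b)"
    unfolding cmod_power2 by (simp add: power2_eq_square algebra_simps)
  ultimately have "cmod a * cmod a + Re (a * cnj b) \<le> cmod (a + b) * cmod a" by (simp add: power2_eq_square)
  then have *: "Re (a * cnj b) \<le> cmod a * (cmod (a + b) - cmod a)" by (simp add: algebra_simps)
  have pw: "cmod a powr (q - 1) = cmod a powr (q - 2) * cmod a"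
    using a by (simp add: powr_diff power2_eq_square)
  have "q * (cmod a powr (q - 2) * Re (a * cnj b)) \<le> q * (cmod a powr (q - 2) * (cmod a * (cmod (a + b) - cmod a)))"
    using * assms by (intro mult_left_mono) auto
  also have "\<dots> = q * cmod a powr (q - 1) * (cmod (a + b) - cmod a)" unfolding pw by simp
  finally show ?thesis using powr_above_tangent[OF a norm_ge_zero assms, of "a + b"] by linarith
qed simp

text \<open>The real gradient of \<open>cmod z powr q / q\<close>, evaluated along
  \<open>f\<close>.\<close>

definition nonlin :: "real \<Rightarrow> (real \<Rightarrow> complex) \<Rightarrow> real \<Rightarrow> complex" where
  "nonlin q f x = of_real (cmod (f x) powr (q - 2)) * f x"

lemma nonlin_L2:
  assumes f: "f \<in> L2" and M: "\<And>x. cmod (f x) \<le> M" and q: "2 \<le> q"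
  shows "nonlin q f \<in> L2"
proof (rule L2_dominated[OF f, of _ "M powr (q - 2)"])
  note [measurable] = L2_measurable[OF f]
  show "nonlin q f \<in> borel_measurable borel" unfolding nonlin_def[abs_def] by measurable
  show "AE x in lborel. cmod (nonlin q f x) \<le> M powr (q - 2) * cmod (f x)"
    using M q by (intro AE_I2) (auto simp: nonlin_def norm_mult intro!: mult_right_mono powr_mono2)
qed

lemma L2_inner_add_left:
  assumes "f \<in> L2" "g \<in> L2" "h \<in> L2"
  shows "L2_inner (\<lambda>x. f x + g x) h = L2_inner f h + L2_inner g h"
  unfolding L2_inner_def distrib_right plus_complex.sel
  using L2_inner_integrable[OF assms(1,3)] L2_inner_integrable[OF assms(2,3)] by (rule Bochner_Integration.integral_add)

lemma L2_inner_commute: "L2_inner f g = L2_inner g f"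
proof -
  have "Re (f x * cnj (g x)) = Re (g x * cnj (f x))" for x by (simp add: mult.commute)
  then show ?thesis unfolding L2_inner_def by (simp only:)
qed

lemma L2_inner_cmult_real_left: "L2_inner (\<lambda>x. of_real c * f x) g = c * L2_inner f g"
  using L2_inner_cmult_real[of g c f] by (simp add: L2_inner_commute)

text \<open>A lower bound that is affine in \<open>t\<close> and exact at \<open>t = 0\<close>; it
  takes the place of differentiation under the integral sign.\<close>

lemma pot_above_tangent:
  assumes f: "f \<in> H1c" and h: "h \<in> H1c" and q: "2 \<le> q"
  shows "pot q f + t * q * L2_inner (nonlin q f) h \<le> pot q (\<lambda>x. f x + of_real t * h x)"
proof -
  have th: "(\<lambda>x. of_real t * h x) \<in> H1c" by (rule H1c_cmult(1)[OF h])
  obtain M where M: "\<And>x. cmod (f x) \<le> M" using H1c_bounded[OF f] by metis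
  obtain M' where M': "\<And>x. cmod (f x + of_real t * h x) \<le> M'" using H1c_bounded[OF H1c_add(1)[OF f th]] by metis
  note nl = nonlin_L2[OF H1c_D(1)[OF f] M q]
  note i = pot_bound(1)[OF H1c_D(1)[OF f] M q] L2_inner_integrable[OF nl H1c_D(1)[OF th]]
    pot_bound(1)[OF H1c_D(1)[OF H1c_add(1)[OF f th]] M' q]
  have "pot q f + q * L2_inner (nonlin q f) (\<lambda>x. of_real t * h x) =
     (LINT x|lborel. cmod (f x) powr q) + (LINT x|lborel. q * Re (nonlin q f x * cnj (of_real t * h x)))"
    by (simp only: pot_def L2_inner_def integral_mult_right_zero)
  also have "\<dots> = (LINT x|lborel. cmod (f x) powr q + q * Re (nonlin q f x * cnj (of_real t * h x)))"
    using i by (intro Bochner_Integration.integral_add[symmetric] integrable_mult_right)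
  also have "\<dots> \<le> (LINT x|lborel. cmod (f x + of_real t * h x) powr q)"
  proof (rule integral_mono)
    show "integrable lborel (\<lambda>x. cmod (f x) powr q + q * Re (nonlin q f x * cnj (of_real t * h x)))"
      using i by (intro Bochner_Integration.integrable_add integrable_mult_right)
    show "integrable lborel (\<lambda>x. cmod (f x + of_real t * h x) powr q)" by (rule i(3))
    fix x
    have "Re (nonlin q f x * cnj (of_real t * h x)) = cmod (f x) powr (q - 2) * Re (f x * cnj (of_real t * h x))"
    proof -
      have "Re (of_real c * z) = c * Re z" for c z by simp
      then show ?thesis unfolding nonlin_def mult.assoc .
    qed
    then show "cmod (f x) powr q + q * Re (nonlin q f x * cnj (of_real t * h x)) \<le> cmod (f x + of_real t * h x) powr q"
      using norm_powr_above_tangent[of q "f x" "of_real t * h x"] q by (simp only:)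
  qed
  also have "\<dots> = pot q (\<lambda>x. f x + of_real t * h x)" by (simp only: pot_def)
  finally show ?thesis unfolding L2_inner_cmult_real by (simp only: mult_ac)
qed

text \<open>The normalized variation \<open>\<kappa>(t) (f + t h)\<close> has energy at most \<open>G(t)\<close>, since the power term is convex;
  \<open>G\<close> is an elementary function with a minimum at \<open>0\<close>.\<close>

lemma Euler_Lagrange_scalar:
  fixes \<alpha> \<beta> p :: real
  assumes f: "f \<in> H1c" and pos: "sqn f > 0" and F: "F \<in> L2" and \<beta>: "\<beta> > 0" and p: "p > 1"
    and min: "\<And>v. v \<in> H1c \<Longrightarrow> sqn v = sqn f \<Longrightarrow>
      1/2 * kin f - \<beta> / (p + 1) * pot (p + 1) f - \<alpha> * L2_inner f F \<le> 1/2 * kin v - \<beta> / (p + 1) * pot (p + 1) v - \<alpha> * L2_inner v F"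
  shows "\<exists>\<omega>. \<forall>h\<in>H1c. L2_inner (weak_deriv f) (weak_deriv h) + 2 * \<omega> * L2_inner f h
     - \<beta> * L2_inner (nonlin (p + 1) f) h - \<alpha> * L2_inner F h = 0"
proof -
  \<comment> \<open>Testing the claimed equation with \<open>h = f\<close> leaves this as the only
    possible multiplier.\<close>
  define \<omega> where "\<omega> = - (kin f - \<beta> * pot (p + 1) f - \<alpha> * L2_inner f F) / (2 * sqn f)"
  have "L2_inner (weak_deriv f) (weak_deriv h) + 2 * \<omega> * L2_inner f h
     - \<beta> * L2_inner (nonlin (p + 1) f) h - \<alpha> * L2_inner F h = 0" if h: "h \<in> H1c" for h
  proof -
    define s where "s = sqn f"
    define N where "N t = s + t\<^sup>2 * sqn h + 2 * (t * L2_inner f h)" for t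
    \<comment> \<open>Restores the mass of \<open>f + t * h\<close> to \<open>s\<close>; it is
      differentiable at \<open>t = 0\<close> because \<open>N 0 = s > 0\<close>.\<close>
    define \<kappa> where "\<kappa> t = sqrt (s / N t)" for t
    define K where "K t = kin f + t\<^sup>2 * kin h + 2 * (t * L2_inner (weak_deriv f) (weak_deriv h))" for t
    define P where "P t = pot (p + 1) f + t * (p + 1) * L2_inner (nonlin (p + 1) f) h" for t
    define C where "C t = L2_inner f F + t * L2_inner h F" for t
    define G where "G t = 1/2 * ((\<kappa> t)\<^sup>2 * K t) - \<beta> / (p + 1) * (\<kappa> t powr (p + 1) * P t) - \<alpha> * (\<kappa> t * C t)" for t
    have s: "s > 0" using pos by (simp add: s_def)
    have th: "(\<lambda>x. of_real t * h x) \<in> H1c" for t by (rule H1c_cmult(1)[OF h])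
    note ft = H1c_add[OF f th]
    have sN: "sqn (\<lambda>x. f x + of_real t * h x) = N t" for t
      unfolding sqn_add[OF H1c_D(1)[OF f] H1c_D(1)[OF th]] sqn_cmult L2_inner_cmult_real N_def s_def by simp
    have kK: "kin (\<lambda>x. f x + of_real t * h x) = K t" for t
    proof -
      have "kin (\<lambda>x. f x + of_real t * h x) = sqn (\<lambda>x. weak_deriv f x + of_real t * weak_deriv h x)"
        unfolding ft(3)
      proof (rule sqn_cong_AE)
        show "AE x in lborel. weak_deriv f x + weak_deriv (\<lambda>x. of_real t * h x) x = weak_deriv f x + of_real t * weak_deriv h x"
          using H1c_cmult(2)[OF h, of "of_real t"] by eventually_elim simp
      qed (intro L2_add L2_cmult H1c_D(2) f h th)+
      then show ?thesis
        unfolding sqn_add[OF H1c_D(2)[OF f] L2_cmult[OF H1c_D(2)[OF h]]] sqn_cmult L2_inner_cmult_real K_def by simp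
    qed
    have iC: "L2_inner (\<lambda>x. f x + of_real t * h x) F = C t" for t
      unfolding L2_inner_add_left[OF H1c_D(1)[OF f] H1c_D(1)[OF th] F] L2_inner_cmult_real_left C_def ..
    have G0: "G 0 \<le> G t" if "N t > 0" for t
    proof -
      have \<kappa>: "\<kappa> t \<ge> 0" "(\<kappa> t)\<^sup>2 * N t = s" using that s by (simp_all add: \<kappa>_def)
      define v where "v x = of_real (\<kappa> t) * (f x + of_real t * h x)" for x
      have v: "v \<in> H1c" unfolding v_def by (rule H1c_cmult(1)[OF ft(1)])
      have "sqn v = sqn f" unfolding v_def sqn_cmult sN using \<kappa> by (simp add: s_def)
      from min[OF v this] have "1/2 * kin f - \<beta> / (p + 1) * pot (p + 1) f - \<alpha> * L2_inner f F
         \<le> 1/2 * kin v - \<beta> / (p + 1) * pot (p + 1) v - \<alpha> * L2_inner v F" .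
      also have "kin v = (\<kappa> t)\<^sup>2 * K t" unfolding v_def H1c_cmult(3)[OF ft(1)] kK by simp
      also have "L2_inner v F = \<kappa> t * C t" unfolding v_def L2_inner_cmult_real_left iC ..
      also have "pot (p + 1) v = \<kappa> t powr (p + 1) * pot (p + 1) (\<lambda>x. f x + of_real t * h x)"
        unfolding v_def pot_cmult using \<kappa>(1) by simp
      finally have 1: "1/2 * kin f - \<beta> / (p + 1) * pot (p + 1) f - \<alpha> * L2_inner f F
         \<le> 1/2 * ((\<kappa> t)\<^sup>2 * K t) - \<beta> / (p + 1) * (\<kappa> t powr (p + 1) * pot (p + 1) (\<lambda>x. f x + of_real t * h x)) - \<alpha> * (\<kappa> t * C t)" .
      have "P t \<le> pot (p + 1) (\<lambda>x. f x + of_real t * h x)"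
        unfolding P_def using p by (intro pot_above_tangent f h) simp
      then have "\<beta> / (p + 1) * (\<kappa> t powr (p + 1) * P t) \<le> \<beta> / (p + 1) * (\<kappa> t powr (p + 1) * pot (p + 1) (\<lambda>x. f x + of_real t * h x))"
        using \<beta> p by (intro mult_left_mono) auto
      moreover have "G 0 = 1/2 * kin f - \<beta> / (p + 1) * pot (p + 1) f - \<alpha> * L2_inner f F"
        using s by (simp add: G_def \<kappa>_def N_def K_def P_def C_def)
      ultimately show ?thesis using 1 unfolding G_def by linarith
    qed
    have DN: "(N has_real_derivative 2 * L2_inner f h) (at 0)"
      unfolding N_def by (auto intro!: derivative_eq_intros)
    have N0: "N 0 = s" by (simp add: N_def)
    define k where "k = - L2_inner f h / s"
    have D\<kappa>: "(\<kappa> has_real_derivative k) (at 0)"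
      unfolding \<kappa>_def using s by (auto intro!: derivative_eq_intros DN simp: N0 k_def field_simps power2_eq_square)
    have \<kappa>0: "\<kappa> 0 = 1" using s by (simp add: \<kappa>_def N0)
    have Dp: "((\<lambda>t. \<kappa> t powr (p + 1)) has_real_derivative (p + 1) * k) (at 0)"
      using DERIV_chain2[OF has_real_derivative_powr[of "\<kappa> 0" "p + 1"] D\<kappa>] by (simp add: \<kappa>0)
    have DK: "(K has_real_derivative 2 * L2_inner (weak_deriv f) (weak_deriv h)) (at 0)"
      unfolding K_def by (auto intro!: derivative_eq_intros)
    have DP: "(P has_real_derivative (p + 1) * L2_inner (nonlin (p + 1) f) h) (at 0)"
      unfolding P_def by (auto intro!: derivative_eq_intros)
    have DC: "(C has_real_derivative L2_inner h F) (at 0)"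
      unfolding C_def by (auto intro!: derivative_eq_intros)
    have K0: "K 0 = kin f" and P0: "P 0 = pot (p + 1) f" and C0: "C 0 = L2_inner f F"
      by (simp_all add: K_def P_def C_def)
    have D\<kappa>2: "((\<lambda>t. (\<kappa> t)\<^sup>2) has_real_derivative 2 * k) (at 0)"
      using DERIV_power[OF D\<kappa>, of 2] by (simp add: \<kappa>0)
    define g where "g = 1/2 * (2 * k * kin f + 2 * L2_inner (weak_deriv f) (weak_deriv h)) - \<beta> / (p + 1) * ((p + 1) * k * pot (p + 1) f + (p + 1) * L2_inner (nonlin (p + 1) f) h)
        - \<alpha> * (k * L2_inner f F + L2_inner h F)"
    have DG: "(G has_real_derivative g) (at 0)"
      unfolding G_def g_def
      using DERIV_diff[OF DERIV_diff[OF DERIV_cmult[OF DERIV_mult[OF D\<kappa>2 DK], of "1/2"] DERIV_cmult[OF DERIV_mult[OF Dp DP], of "\<beta> / (p + 1)"]]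
        DERIV_cmult[OF DERIV_mult[OF D\<kappa> DC], of \<alpha>]]
      by (simp add: \<kappa>0 K0 P0 C0 mult_ac)
    have "\<forall>\<^sub>F t in nhds 0. N t > 0"
      using DERIV_isCont[OF DN] s N0 by (intro order_tendstoD(1)) (auto simp: isCont_def tendsto_nhds_iff continuous_at_imp_continuous_at_within)
    then obtain d where d: "d > 0" "\<And>t. \<bar>t\<bar> < d \<Longrightarrow> N t > 0"
      by (auto simp: eventually_nhds_metric dist_real_def)
    have "g = 0"
      by (rule DERIV_local_min[OF DG d(1)]) (use G0 d(2) in auto)
    moreover have "g = k * (kin f - \<beta> * pot (p + 1) f - \<alpha> * L2_inner f F) + L2_inner (weak_deriv f) (weak_deriv h)
       - \<beta> * L2_inner (nonlin (p + 1) f) h - \<alpha> * L2_inner h F"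
      using p by (simp add: g_def field_simps)
    moreover have "k * (kin f - \<beta> * pot (p + 1) f - \<alpha> * L2_inner f F) = 2 * \<omega> * L2_inner f h"
      using pos by (simp add: k_def \<omega>_def s_def field_simps)
    ultimately show ?thesis by (simp add: L2_inner_commute[of h F])
  qed
  then show ?thesis by blast
qed

lemma L2_inner_test:
  assumes k: "k \<in> L2" and t: "test_function \<psi>"
  shows "L2_inner k (\<lambda>x. c * of_real (\<psi> x)) = Re (cnj c * (LINT x|lborel. \<psi> x *\<^sub>R k x))"
proof -
  have i: "integrable lborel (\<lambda>x. cnj c * (\<psi> x *\<^sub>R k x))"
    by (intro integrable_mult_right test_function_times_integrable t L2_set_integrable k L2_measurable)
  have "Re (k x * cnj (c * of_real (\<psi> x))) = Re (cnj c * (\<psi> x *\<^sub>R k x))" for x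
    by (simp add: scaleR_conv_of_real mult_ac)
  then have "L2_inner k (\<lambda>x. c * of_real (\<psi> x)) = (LINT x|lborel. Re (cnj c * (\<psi> x *\<^sub>R k x)))"
    unfolding L2_inner_def by (simp only:)
  also have "\<dots> = Re (LINT x|lborel. cnj c * (\<psi> x *\<^sub>R k x))" by (rule integral_Re[OF i])
  also have "(LINT x|lborel. cnj c * (\<psi> x *\<^sub>R k x)) = cnj c * (LINT x|lborel. \<psi> x *\<^sub>R k x)"
    by (rule integral_mult_right_zero)
  finally show ?thesis .
qed

lemma L2_inner_cong_AE:
  assumes "AE x in lborel. g x = h x" "f \<in> L2" "g \<in> L2" "h \<in> L2"
  shows "L2_inner f g = L2_inner f h"
  unfolding L2_inner_def
proof (rule integral_cong_AE)
  show "AE x in lborel. Re (f x * cnj (g x)) = Re (f x * cnj (h x))" using assms(1) by eventually_elim simp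
qed (use L2_inner_integrable[OF assms(2,3)] L2_inner_integrable[OF assms(2,4)] in \<open>auto simp del: times_complex.sel\<close>)

text \<open>The equation is known for real parts of inner products. Testing with
  \<open>\<psi>\<close> and with \<open>\<i> * \<psi>\<close> recovers the real and the imaginary
  part of the complex identity.\<close>

lemma weak_second_derivative:
  assumes f: "f \<in> H1c" and Q: "Q \<in> L2"
    and eq: "\<And>h. h \<in> H1c \<Longrightarrow> L2_inner (weak_deriv f) (weak_deriv h) + L2_inner Q h = 0"
  shows "weak_deriv f has_weak_derivative Q"
  unfolding has_weak_derivative_def
proof (intro allI impI)
  fix \<psi> assume t: "test_function \<psi>"
  let ?X = "LINT x|lborel. deriv \<psi> x *\<^sub>R weak_deriv f x" and ?Y = "LINT x|lborel. \<psi> x *\<^sub>R Q x"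
  note th = test_function_H1c[OF t]
  note td = test_function_H1c(1)[OF test_function_deriv[OF t]]
  have "Re (cnj c * ?X) + Re (cnj c * ?Y) = 0" for c
  proof -
    have h: "(\<lambda>x. c * of_real (\<psi> x)) \<in> H1c" by (rule H1c_cmult(1)[OF th(1)])
    have "AE x in lborel. weak_deriv (\<lambda>x. c * of_real (\<psi> x)) x = c * of_real (deriv \<psi> x)"
      using H1c_cmult(2)[OF th(1), of c] th(2) by eventually_elim simp
    then have "L2_inner (weak_deriv f) (weak_deriv (\<lambda>x. c * of_real (\<psi> x))) = L2_inner (weak_deriv f) (\<lambda>x. c * of_real (deriv \<psi> x))"
      by (intro L2_inner_cong_AE H1c_D(2) f h L2_cmult H1c_D(1)[OF td])
    then show ?thesis
      using eq[OF h] L2_inner_test[OF H1c_D(2)[OF f] test_function_deriv[OF t], of c] L2_inner_test[OF Q t, of c] by linarith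
  qed
  from this[of 1] this[of "\<i>"] have "Re ?X + Re ?Y = 0" "Im ?X + Im ?Y = 0" by simp_all
  then show "?X = - ?Y" by (simp add: complex_eq_iff eq_neg_iff_add_eq_0)
qed

text \<open>The coupling term is linear in each component: \<open>coup_field u l\<close> represents it as a functional of the
  \<open>l\<close>-th one.\<close>

definition coup_field :: "(real \<Rightarrow> complex^3) \<Rightarrow> 3 \<Rightarrow> real \<Rightarrow> complex" where
  "coup_field u l x = (if l = 1 then u x $ 3 * cnj (u x $ 2) else if l = 2 then u x $ 3 * cnj (u x $ 1) else u x $ 1 * u x $ 2)"

lemma L2_mult_bounded:
  assumes "f \<in> L2" "\<And>x. cmod (g x) \<le> M" "g \<in> borel_measurable borel"
  shows "(\<lambda>x. g x * f x) \<in> L2"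
proof (rule L2_dominated[OF assms(1), of _ M])
  show "(\<lambda>x. g x * f x) \<in> borel_measurable borel" using assms(3) L2_measurable[OF assms(1)] by measurable
  show "AE x in lborel. cmod (g x * f x) \<le> M * cmod (f x)"
    using assms(2) by (intro AE_I2) (auto simp: norm_mult intro: mult_right_mono)
qed

lemma coup_field_L2:
  assumes u: "u \<in> H1c3" shows "coup_field u l \<in> L2"
proof -
  have c: "continuous_on UNIV (component u i)" for i by (rule H1c_D(4)[OF H1c3_D[OF u]])
  obtain M where M: "\<And>x. cmod (u x $ 3) \<le> M" using H1c_bounded[OF H1c3_D[OF u]] by metis
  obtain M' where M': "\<And>x. cmod (u x $ 1) \<le> M'" using H1c_bounded[OF H1c3_D[OF u]] by metis
  note m = borel_measurable_continuous_onI[OF c]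
  have "l = 1 \<or> l = 2 \<or> l = 3" by (rule exhaust_3)
  then show ?thesis
    using L2_mult_bounded[OF L2_cnj[OF H1c3_L2[OF u]] M m, of 2] L2_mult_bounded[OF L2_cnj[OF H1c3_L2[OF u]] M m, of 1]
      L2_mult_bounded[OF H1c3_L2[OF u] M' m, of 2]
    by (auto simp: coup_field_def[abs_def])
qed

lemma coup_inner:
  assumes u: "u \<in> H1c3"
  shows "coup (component u 1) (component u 2) (component u 3) = L2_inner (component u l) (coup_field u l)"
proof -
  obtain M where M: "\<And>x. cmod (u x $ 1) \<le> M" using H1c_bounded[OF H1c3_D[OF u]] by metis
  note T = triple_product_integrable(2)[OF H1c3_L2[OF u] M H1c3_L2[OF u, of 2] H1c3_L2[OF u, of 3]]
  have "l = 1 \<or> l = 2 \<or> l = 3" by (rule exhaust_3)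
  then have "Re (u x $ l * cnj (coup_field u l x)) = Re (u x $ 1 * u x $ 2 * cnj (u x $ 3))" for x
    by (auto simp: coup_field_def algebra_simps)
  then have "L2_inner (component u l) (coup_field u l) = (LINT x|lborel. Re (u x $ 1 * u x $ 2 * cnj (u x $ 3)))"
    unfolding L2_inner_def by (simp only:)
  then show ?thesis unfolding coup_def using integral_Re[OF T] by (simp only:)
qed

section \<open>Minimizers solve the differential equations\<close>

context three_wave
begin

text \<open>Minimality is stated by comparison, without the value of the infimum, so that it passes
  directly to the moduli of a minimizer.\<close>

definition is_minimizer :: "(real \<Rightarrow> complex^3) \<Rightarrow> bool" where
  "is_minimizer u \<longleftrightarrow> u \<in> H1c3 \<and> (\<forall>i. sqn (component u i) > 0) \<and>
    (\<forall>v\<in>H1c3. (\<forall>i. sqn (component v i) = sqn (component u i)) \<longrightarrow> E u \<le> E v)"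

text \<open>Only the \<open>l\<close>-th component is varied: the terms of the other two are
  constant and the coupling is linear in the varied one, which is the scalar problem.\<close>

lemma minimizer_Euler_Lagrange:
  assumes "is_minimizer u"
  shows "\<exists>\<omega>. \<forall>h\<in>H1c. L2_inner (weak_deriv (component u l)) (weak_deriv h) + 2 * \<omega> * L2_inner (component u l) h
     - \<beta> * L2_inner (nonlin (p + 1) (component u l)) h - \<alpha> * L2_inner (coup_field u l) h = 0"
proof (rule Euler_Lagrange_scalar)
  have u: "u \<in> H1c3" using assms by (simp add: is_minimizer_def)
  show "component u l \<in> H1c" by (rule H1c3_D[OF u])
  show "0 < sqn (component u l)" using assms by (simp add: is_minimizer_def)
  show "coup_field u l \<in> L2" by (rule coup_field_L2[OF u])
  show "\<beta> > 0" "p > 1" by (fact \<beta> p1)+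
  fix v assume v: "v \<in> H1c" "sqn v = sqn (component u l)"
  define w where "w x = (\<chi> i. if i = l then v x else u x $ i)" for x
  have cw: "component w i = (if i = l then v else component u i)" for i by (auto simp: w_def)
  have w: "w \<in> H1c3" by (rule H1c3_I) (use v(1) H1c3_D[OF u] in \<open>simp add: cw\<close>)
  have F: "coup_field w l = coup_field u l"
    by (rule ext) (use exhaust_3[of l] in \<open>auto simp: coup_field_def w_def\<close>)
  have "E u \<le> E w" using assms w v(2) by (auto simp: is_minimizer_def cw)
  moreover have "(\<Sum>i\<in>UNIV. 1/2 * kin (component w i) - \<beta> / (p + 1) * pot (p + 1) (component w i)) =
     (\<Sum>i\<in>UNIV. (1/2 * kin (component u i) - \<beta> / (p + 1) * pot (p + 1) (component u i)) +
       (if i = l then (1/2 * kin v - \<beta> / (p + 1) * pot (p + 1) v) - (1/2 * kin (component u l) - \<beta> / (p + 1) * pot (p + 1) (component u l)) else 0))"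
    by (intro sum.cong) (auto simp: cw)
  moreover have "\<dots> = (\<Sum>i\<in>UNIV. 1/2 * kin (component u i) - \<beta> / (p + 1) * pot (p + 1) (component u i)) +
      ((1/2 * kin v - \<beta> / (p + 1) * pot (p + 1) v) - (1/2 * kin (component u l) - \<beta> / (p + 1) * pot (p + 1) (component u l)))"
    by (simp only: sum.distrib sum.delta finite UNIV_I if_True)
  moreover have cwv: "coup (component w 1) (component w 2) (component w 3) = L2_inner v (coup_field u l)"
    unfolding coup_inner[OF w, of l] F by (simp add: cw)
  ultimately show "1/2 * kin (component u l) - \<beta> / (p + 1) * pot (p + 1) (component u l) - \<alpha> * L2_inner (component u l) (coup_field u l)
     \<le> 1/2 * kin v - \<beta> / (p + 1) * pot (p + 1) v - \<alpha> * L2_inner v (coup_field u l)"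
    unfolding energy_eq coup_inner[OF u, of l] cwv by linarith
qed

text \<open>Bootstrapping: the weak derivative of \<open>weak_deriv\<close> is a continuous
  expression in \<open>u\<close>, so the continuous representative \<open>D\<close> of
  \<open>weak_deriv\<close> is continuously differentiable. The almost everywhere identity with
  \<open>D\<close> is kept for the later comparison of kinetic energies.\<close>

lemma minimizer_ODE:
  assumes "is_minimizer u"
  shows "\<exists>\<omega> D. continuous_on UNIV D \<and> (AE x in lborel. weak_deriv (component u l) x = D x) \<and>
    (\<forall>x. (component u l has_vector_derivative D x) (at x)) \<and>
    (\<forall>x. (D has_vector_derivative (of_real (2 * \<omega>) * u x $ l - of_real (\<beta> * cmod (u x $ l) powr (p - 1)) * u x $ l
      - of_real \<alpha> * coup_field u l x)) (at x)) \<and>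
    continuous_on UNIV (\<lambda>x. of_real (2 * \<omega>) * u x $ l - of_real (\<beta> * cmod (u x $ l) powr (p - 1)) * u x $ l
      - of_real \<alpha> * coup_field u l x)"
proof -
  have u: "u \<in> H1c3" using assms by (simp add: is_minimizer_def)
  note f = H1c3_D[OF u, of l]
  obtain \<omega> where \<omega>: "\<And>h. h \<in> H1c \<Longrightarrow> L2_inner (weak_deriv (component u l)) (weak_deriv h) + 2 * \<omega> * L2_inner (component u l) h
     - \<beta> * L2_inner (nonlin (p + 1) (component u l)) h - \<alpha> * L2_inner (coup_field u l) h = 0"
    using minimizer_Euler_Lagrange[OF assms, of l] by blast
  define Q where "Q x = (of_real (2 * \<omega>) * component u l x + of_real (- \<beta>) * nonlin (p + 1) (component u l) x)
     + of_real (- \<alpha>) * coup_field u l x" for x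
  obtain M where M: "\<And>x. cmod (u x $ l) \<le> M" using H1c_bounded[OF f] by metis
  note nl = nonlin_L2[OF H1c_D(1)[OF f] M q2]
  have "Q \<in> L2" unfolding Q_def by (intro L2_add L2_cmult H1c_D(1)[OF f] nl coup_field_L2[OF u])
  have Qi: "L2_inner Q h = 2 * \<omega> * L2_inner (component u l) h - \<beta> * L2_inner (nonlin (p + 1) (component u l)) h
     - \<alpha> * L2_inner (coup_field u l) h" if "h \<in> H1c" for h
  proof -
    have "L2_inner Q h = (2 * \<omega>) * L2_inner (component u l) h + (- \<beta>) * L2_inner (nonlin (p + 1) (component u l)) h
       + (- \<alpha>) * L2_inner (coup_field u l) h"
      unfolding Q_def
      by (simp only: L2_inner_add_left[OF L2_add[OF L2_cmult[OF H1c_D(1)[OF f]] L2_cmult[OF nl]] L2_cmult[OF coup_field_L2[OF u]] H1c_D(1)[OF that]]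
        L2_inner_add_left[OF L2_cmult[OF H1c_D(1)[OF f]] L2_cmult[OF nl] H1c_D(1)[OF that]] L2_inner_cmult_real_left)
    then show ?thesis by simp
  qed
  have "weak_deriv (component u l) has_weak_derivative Q"
    by (rule weak_second_derivative[OF f \<open>Q \<in> L2\<close>]) (use \<omega> Qi in force)
  from weak_derivative_representative[OF H1c_D(2)[OF f] \<open>Q \<in> L2\<close> this]
  obtain D where D: "D primitive_of Q" "AE x in lborel. D x = weak_deriv (component u l) x" by blast
  have cD: "continuous_on UNIV D" by (rule primitive_continuous[OF D(1) \<open>Q \<in> L2\<close>])
  have D': "AE x in lborel. weak_deriv (component u l) x = D x" using D(2) by eventually_elim simp
  have "component u l primitive_of D"
    by (rule primitive_of_cong_AE[OF H1c_D(3)[OF f] D' L2_measurable[OF H1c_D(2)[OF f]] borel_measurable_continuous_onI[OF cD]])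
  then have 1: "(component u l has_vector_derivative D x) (at x)" for x
    by (rule primitive_has_vector_derivative[OF _ cD])
  have cu: "continuous_on UNIV (\<lambda>x. u x $ i)" for i by (rule H1c_D(4)[OF H1c3_D[OF u]])
  have Qeq: "Q x = of_real (2 * \<omega>) * u x $ l - of_real (\<beta> * cmod (u x $ l) powr (p - 1)) * u x $ l - of_real \<alpha> * coup_field u l x" for x
    by (simp add: Q_def nonlin_def)
  have "continuous_on UNIV (coup_field u l)"
  proof -
    have "continuous_on UNIV (\<lambda>x. u x $ 3 * cnj (u x $ 2))" "continuous_on UNIV (\<lambda>x. u x $ 3 * cnj (u x $ 1))"
      "continuous_on UNIV (\<lambda>x. u x $ 1 * u x $ 2)" by (intro continuous_intros cu)+
    then show ?thesis by (cases "l = 1"; cases "l = 2"; simp add: coup_field_def[abs_def])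
  qed
  then have cQ: "continuous_on UNIV (\<lambda>x. of_real (2 * \<omega>) * u x $ l - of_real (\<beta> * cmod (u x $ l) powr (p - 1)) * u x $ l - of_real \<alpha> * coup_field u l x)"
    using p1 by (intro continuous_intros cu continuous_on_powr') auto
  have "Q = (\<lambda>x. of_real (2 * \<omega>) * u x $ l - of_real (\<beta> * cmod (u x $ l) powr (p - 1)) * u x $ l - of_real \<alpha> * coup_field u l x)"
    by (rule ext) (rule Qeq)
  with cQ have "continuous_on UNIV Q" by (simp only:)
  then have 2: "(D has_vector_derivative Q x) (at x)" for x by (rule primitive_has_vector_derivative[OF D(1)])
  show ?thesis
    by (rule exI[of _ \<omega>], rule exI[of _ D]) (intro conjI allI cD D' 1 cQ 2[unfolded Qeq])
qed

lemma minimizer_classical_solution: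
  assumes "is_minimizer u"
  shows "\<exists>\<omega>1 \<omega>2 \<omega>3. classical_solution \<alpha> \<beta> p \<omega>1 \<omega>2 \<omega>3 u"
proof -
  define P where "P l \<omega> D \<longleftrightarrow> (\<forall>x. (component u l has_vector_derivative D x) (at x)) \<and>
    (\<forall>x. (D has_vector_derivative (of_real (2 * \<omega>) * u x $ l - of_real (\<beta> * cmod (u x $ l) powr (p - 1)) * u x $ l
      - of_real \<alpha> * coup_field u l x)) (at x)) \<and>
    continuous_on UNIV (\<lambda>x. of_real (2 * \<omega>) * u x $ l - of_real (\<beta> * cmod (u x $ l) powr (p - 1)) * u x $ l
      - of_real \<alpha> * coup_field u l x)" for l \<omega> D
  have "\<exists>\<omega> D. P l \<omega> D" for l using minimizer_ODE[OF assms, of l] unfolding P_def by blast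
  then obtain \<omega> D where PD: "\<And>l. P l (\<omega> l) (D l)" by metis
  have D: "\<And>l x. (component u l has_vector_derivative D l x) (at x)"
    and D': "\<And>l x. (D l has_vector_derivative (of_real (2 * \<omega> l) * u x $ l - of_real (\<beta> * cmod (u x $ l) powr (p - 1)) * u x $ l
      - of_real \<alpha> * coup_field u l x)) (at x)"
    and c: "\<And>l. continuous_on UNIV (\<lambda>x. of_real (2 * \<omega> l) * u x $ l - of_real (\<beta> * cmod (u x $ l) powr (p - 1)) * u x $ l
      - of_real \<alpha> * coup_field u l x)"
    using PD unfolding P_def by blast+
  have dx1: "dx (component u l) = D l" for l
    using vector_derivative_at[OF D] by (auto simp: dx_def)
  have dx2: "dx (D l) = (\<lambda>x. of_real (2 * \<omega> l) * u x $ l - of_real (\<beta> * cmod (u x $ l) powr (p - 1)) * u x $ l - of_real \<alpha> * coup_field u l x)" for l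
    using vector_derivative_at[OF D'] by (auto simp: dx_def)
  have d1: "component u l differentiable_on UNIV" for l
    using D by (auto simp: differentiable_on_def intro: differentiableI_vector)
  have d2: "D l differentiable_on UNIV" for l
    using D' by (auto simp: differentiable_on_def intro: differentiableI_vector)
  have "component u l \<in> C2" for l
    unfolding C2_def mem_Collect_eq dx1 dx2 using d1 d2 c by blast
  then have "classical_solution \<alpha> \<beta> p (\<omega> 1) (\<omega> 2) (\<omega> 3) u"
    unfolding classical_solution_def dx1 dx2 by (simp add: coup_field_def mult_ac)
  then show ?thesis by blast
qed

end

subsection \<open>Phases of minimizers\<close>

text \<open>If \<open>r'' \<le> k\<^sup>2 r\<close>, then \<open>e\<^sup>k\<^sup>x (r' - k r)\<close> and hence, to the right of a zero of \<open>r\<close>, also \<open>e\<^sup>-\<^sup>k\<^sup>x r\<close>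
  is nonincreasing.\<close>

lemma nonneg_zero_to_the_right:
  fixes r d s :: "real \<Rightarrow> real"
  assumes r: "\<And>x. (r has_real_derivative d x) (at x)" and d: "\<And>x. (d has_real_derivative s x) (at x)"
    and s: "\<And>x. s x \<le> k\<^sup>2 * r x" and r0: "\<And>x. 0 \<le> r x" and z: "r a = 0" and x: "a \<le> x"
  shows "r x = 0"
proof -
  have "d a = 0"
    by (rule DERIV_local_min[OF r, of 1]) (use r0 z in auto)
  have le: "d y \<le> k * r y" if "a \<le> y" for y
  proof -
    have "exp (k * y) * (d y - k * r y) \<le> exp (k * a) * (d a - k * r a)"
      using that
    proof (rule DERIV_nonpos_imp_nonincreasing)
      fix t
      have "((\<lambda>y. exp (k * y) * (d y - k * r y)) has_real_derivative exp (k * t) * (s t - k\<^sup>2 * r t)) (at t)"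
        by (auto intro!: derivative_eq_intros r d simp: algebra_simps power2_eq_square)
      moreover have "exp (k * t) * (s t - k\<^sup>2 * r t) \<le> 0" using s[of t] by (intro mult_nonneg_nonpos) auto
      ultimately show "\<exists>y. ((\<lambda>y. exp (k * y) * (d y - k * r y)) has_real_derivative y) (at t) \<and> y \<le> 0" by blast
    qed
    then have "exp (k * y) * (d y - k * r y) \<le> 0" by (simp add: z \<open>d a = 0\<close>)
    then have "d y - k * r y \<le> 0" using exp_gt_zero[of "k * y"] by (simp add: mult_le_0_iff)
    then show ?thesis by simp
  qed
  have "exp (- (k * x)) * r x \<le> exp (- (k * a)) * r a"
    using x
  proof (rule DERIV_nonpos_imp_nonincreasing)
    fix t assume t: "a \<le> t"
    have "((\<lambda>x. exp (- (k * x)) * r x) has_real_derivative exp (- (k * t)) * (d t - k * r t)) (at t)"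
      by (auto intro!: derivative_eq_intros r simp: algebra_simps)
    moreover have "exp (- (k * t)) * (d t - k * r t) \<le> 0" using le[OF t] by (intro mult_nonneg_nonpos) auto
    ultimately show "\<exists>y. ((\<lambda>x. exp (- (k * x)) * r x) has_real_derivative y) (at t) \<and> y \<le> 0" by blast
  qed
  then have "exp (- (k * x)) * r x \<le> 0" by (simp add: z)
  then have "r x \<le> 0" using exp_gt_zero[of "- (k * x)"] by (simp add: mult_le_0_iff)
  then show ?thesis using r0[of x] by simp
qed

text \<open>The part to the left of the zero follows by reflecting the line.\<close>

lemma nonneg_zero_everywhere:
  fixes r d s :: "real \<Rightarrow> real"
  assumes r: "\<And>x. (r has_real_derivative d x) (at x)" and d: "\<And>x. (d has_real_derivative s x) (at x)"
    and s: "\<And>x. s x \<le> k\<^sup>2 * r x" and r0: "\<And>x. 0 \<le> r x" and z: "r a = 0"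
  shows "r x = 0"
proof (cases "a \<le> x")
  case True
  then show ?thesis using nonneg_zero_to_the_right[OF assms] by blast
next
  case False
  have "r (- (- x)) = 0"
  proof (rule nonneg_zero_to_the_right[where r = "\<lambda>y. r (- y)" and d = "\<lambda>y. - d (- y)" and s = "\<lambda>y. s (- y)"
        and a = "- a" and k = k and x = "- x"])
    show "((\<lambda>y. r (- y)) has_real_derivative - d (- y)) (at y)" for y
      using DERIV_chain2[OF r DERIV_minus[OF DERIV_ident], of y] by simp
    show "((\<lambda>y. - d (- y)) has_real_derivative s (- y)) (at y)" for y
      using DERIV_minus[OF DERIV_chain2[OF d DERIV_minus[OF DERIV_ident], of y]] by simp
  qed (use s r0 z False in auto)
  then show ?thesis by simp
qed

section \<open>Curves in the plane and their moduli\<close>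

lemma has_vector_derivative_Re_Im:
  assumes "(f has_vector_derivative D) (at x)"
  shows "((\<lambda>x. Re (f x)) has_real_derivative Re D) (at x)" "((\<lambda>x. Im (f x)) has_real_derivative Im D) (at x)"
  using bounded_linear.has_vector_derivative[OF bounded_linear_Re assms]
    bounded_linear.has_vector_derivative[OF bounded_linear_Im assms]
  by (simp_all add: has_real_derivative_iff_has_vector_derivative)

text \<open>Both sides are half the derivative of
  \<open>(r x)\<^sup>2 = (cmod (f x))\<^sup>2\<close>.\<close>

lemma modulus_derivative:
  assumes f: "(f has_vector_derivative D) (at x)" and r: "(r has_real_derivative d) (at x)" and rf: "\<And>x. r x = cmod (f x)"
  shows "r x * d = Re (f x) * Re D + Im (f x) * Im D"
proof -
  have "((\<lambda>x. (r x)\<^sup>2) has_real_derivative 2 * (r x * d)) (at x)"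
    using DERIV_power[OF r, of 2] by (simp add: mult_ac)
  moreover have "((\<lambda>x. (Re (f x))\<^sup>2 + (Im (f x))\<^sup>2) has_real_derivative 2 * (Re (f x) * Re D + Im (f x) * Im D)) (at x)"
    using DERIV_add[OF DERIV_power[OF has_vector_derivative_Re_Im(1)[OF f], of 2] DERIV_power[OF has_vector_derivative_Re_Im(2)[OF f], of 2]]
    by (simp add: algebra_simps)
  moreover have "(\<lambda>x. (r x)\<^sup>2) = (\<lambda>x. (Re (f x))\<^sup>2 + (Im (f x))\<^sup>2)" by (simp add: rf cmod_power2)
  ultimately have "2 * (r x * d) = 2 * (Re (f x) * Re D + Im (f x) * Im D)"
    using DERIV_unique by force
  then show ?thesis by simp
qed

text \<open>Cauchy-Schwarz in the plane for \<open>r x * d = Re (f x * cnj D)\<close>.\<close>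

lemma modulus_derivative_le:
  assumes f: "(f has_vector_derivative D) (at x)" and r: "(r has_real_derivative d) (at x)" and rf: "\<And>x. r x = cmod (f x)"
    and pos: "r x > 0"
  shows "\<bar>d\<bar> \<le> cmod D"
proof -
  have "Re (f x * cnj D) = r x * d" using modulus_derivative[OF f r rf] by simp
  then have "\<bar>r x * d\<bar> \<le> cmod (f x * cnj D)" using abs_Re_le_cmod[of "f x * cnj D"] by simp
  also have "\<dots> = r x * cmod D" by (simp add: norm_mult rf)
  finally show ?thesis using pos by (simp add: abs_mult)
qed

text \<open>A nonvanishing curve whose speed equals the speed of its modulus has constant phase.\<close>

lemma constant_phase:
  fixes f D :: "real \<Rightarrow> complex" and r d :: "real \<Rightarrow> real"
  assumes f: "\<And>x. (f has_vector_derivative D x) (at x)" and r: "\<And>x. (r has_real_derivative d x) (at x)"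
    and rf: "\<And>x. r x = cmod (f x)" and pos: "\<And>x. r x > 0" and eq: "\<And>x. cmod (D x) = \<bar>d x\<bar>"
  shows "\<exists>c. cmod c = 1 \<and> (\<forall>x. f x = c * of_real (r x))"
proof -
  have rd: "r x * d x = Re (f x) * Re (D x) + Im (f x) * Im (D x)" for x
    by (rule modulus_derivative[OF f r rf])
  \<comment> \<open>The equality case of Cauchy-Schwarz: the squared difference expands to zero, so
    the velocity is a real multiple of the position.\<close>
  have Dx: "of_real (r x) * D x = of_real (d x) * f x" for x
  proof -
    have "(cmod (of_real (r x) * D x - of_real (d x) * f x))\<^sup>2 =
       (r x)\<^sup>2 * (cmod (D x))\<^sup>2 + (d x)\<^sup>2 * (cmod (f x))\<^sup>2 - 2 * d x * r x * (Re (f x) * Re (D x) + Im (f x) * Im (D x))"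
      unfolding cmod_power2 by (simp add: power2_eq_square algebra_simps)
    also have "\<dots> = 0" unfolding rd[symmetric] eq rf[symmetric] by (simp add: power2_eq_square algebra_simps)
    finally show ?thesis by simp
  qed
  define g where "g x = inverse (r x) *\<^sub>R f x" for x
  have "(g has_vector_derivative 0) (at x)" for x
  proof -
    have i: "((\<lambda>x. inverse (r x)) has_real_derivative - (inverse (r x) * d x * inverse (r x))) (at x)"
      using DERIV_inverse'[OF r, of x] pos[of x] by simp
    have "(g has_vector_derivative (inverse (r x) *\<^sub>R D x + (- (inverse (r x) * d x * inverse (r x))) *\<^sub>R f x)) (at x)"
      unfolding g_def by (rule has_vector_derivative_scaleR[OF i f])
    moreover have "inverse (r x) *\<^sub>R D x + (- (inverse (r x) * d x * inverse (r x))) *\<^sub>R f x = 0"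
    proof -
      have "inverse (r x) *\<^sub>R D x = (inverse (r x) * inverse (r x)) *\<^sub>R (of_real (r x) * D x)"
        using pos[of x] by (simp add: scaleR_conv_of_real)
      then show ?thesis unfolding Dx by (simp add: scaleR_conv_of_real mult_ac)
    qed
    ultimately show ?thesis by simp
  qed
  then obtain c where c: "\<And>x. g x = c"
    using has_vector_derivative_zero_constant[of UNIV g] by (metis UNIV_I convex_UNIV)
  have "f x = c * of_real (r x)" for x
    using c[of x] pos[of x] by (simp add: g_def scaleR_conv_of_real field_simps)
  moreover have "cmod c = 1" using c[of 0, symmetric] pos[of 0] rf[of 0] by (simp add: g_def)
  ultimately show ?thesis by blast
qed

lemma AE_lborel_False: "\<not> (AE x in (lborel :: real measure). False)"
proof
  assume "AE x in (lborel :: real measure). False"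
  then have "(LINT x|(lborel :: real measure). indicator {0..1} x) = (LINT x|(lborel :: real measure). (0::real))"
    by (intro integral_cong_AE) auto
  then show False by simp
qed

lemma continuous_AE_eq:
  fixes f g :: "real \<Rightarrow> real"
  assumes "continuous_on UNIV f" "continuous_on UNIV g" "AE x in lborel. f x = g x"
  shows "f x = g x"
proof (rule ccontr)
  assume x: "f x \<noteq> g x"
  have o: "open {x. f x \<noteq> g x}" using assms(1,2) by (rule open_Collect_neq)
  then obtain e where e: "e > 0" "ball x e \<subseteq> {x. f x \<noteq> g x}" using x openE by blast
  have "AE y in lborel. indicator {x..x + e/2} y = (0::real)"
    using assms(3)
  proof eventually_elim
    case (elim y)
    have "y \<in> ball x e" if "y \<in> {x..x + e/2}" using that e(1) by (auto simp: dist_real_def)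
    then show ?case using elim e(2) by (auto simp: indicator_def)
  qed
  then have "(LINT y|lborel. indicator {x..x + e/2} y) = (LINT y|(lborel :: real measure). (0::real))"
    by (intro integral_cong_AE) auto
  then show False using e(1) by simp
qed

section \<open>Moduli and phases of minimizers\<close>

context three_wave
begin

definition modulus :: "(real \<Rightarrow> complex^3) \<Rightarrow> real \<Rightarrow> complex^3" where
  "modulus u x = (\<chi> i. of_real (cmod (u x $ i)))"

lemma component_modulus: "component (modulus u) i = (\<lambda>x. of_real (cmod (component u i x)))"
  by (simp add: modulus_def)

text \<open>Passing to moduli keeps masses and power terms, does not raise the kinetic energies and
  does not lower the coupling. Minimality of \<open>u\<close> turns these inequalities into
  equalities, from which the phases are determined.\<close>

lemma modulus_minimizer:
  assumes "is_minimizer u"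
  shows "is_minimizer (modulus u)" "kin (component (modulus u) i) = kin (component u i)"
    "coup (component (modulus u) 1) (component (modulus u) 2) (component (modulus u) 3) = coup (component u 1) (component u 2) (component u 3)"
proof -
  have u: "u \<in> H1c3" using assms by (simp add: is_minimizer_def)
  note n = H1c_norm[OF H1c3_D[OF u]]
  have m: "modulus u \<in> H1c3" by (rule H1c3_I) (unfold component_modulus, rule n(1))
  have s: "sqn (component (modulus u) i) = sqn (component u i)" for i
    unfolding component_modulus by (simp add: sqn_def)
  have k: "kin (component (modulus u) i) \<le> kin (component u i)" for i
    unfolding component_modulus by (rule n(2))
  have pt: "pot (p + 1) (component (modulus u) i) = pot (p + 1) (component u i)" for i
    unfolding component_modulus by (simp add: pot_def)
  obtain M where M: "\<And>x. cmod (u x $ 1) \<le> M" using H1c_bounded[OF H1c3_D[OF u]] by metis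
  obtain M' where M': "\<And>x. cmod (modulus u x $ 1) \<le> M'" using H1c_bounded[OF H1c3_D[OF m]] by metis
  note T = triple_product_integrable[OF H1c3_L2[OF u] M H1c3_L2[OF u, of 2] H1c3_L2[OF u, of 3]]
  note T' = triple_product_integrable(2)[OF H1c3_L2[OF m] M' H1c3_L2[OF m, of 2] H1c3_L2[OF m, of 3]]
  have "Re (modulus u x $ 1 * modulus u x $ 2 * cnj (modulus u x $ 3)) = cmod (u x $ 1) * cmod (u x $ 2) * cmod (u x $ 3)" for x
    by (simp add: modulus_def)
  then have "coup (component (modulus u) 1) (component (modulus u) 2) (component (modulus u) 3) =
     (LINT x|lborel. cmod (u x $ 1) * cmod (u x $ 2) * cmod (u x $ 3))"
    unfolding coup_def integral_Re[OF T', symmetric] by (simp only:)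
  then have c: "coup (component u 1) (component u 2) (component u 3) \<le>
     coup (component (modulus u) 1) (component (modulus u) 2) (component (modulus u) 3)" using T(4) by linarith
  have ks: "(\<Sum>i\<in>UNIV. 1/2 * kin (component (modulus u) i) - \<beta> / (p + 1) * pot (p + 1) (component (modulus u) i)) \<le>
     (\<Sum>i\<in>UNIV. 1/2 * kin (component u i) - \<beta> / (p + 1) * pot (p + 1) (component u i))"
    unfolding pt using k by (intro sum_mono diff_right_mono mult_left_mono) auto
  have \<alpha>c: "\<alpha> * coup (component u 1) (component u 2) (component u 3) \<le>
     \<alpha> * coup (component (modulus u) 1) (component (modulus u) 2) (component (modulus u) 3)"
    using c \<alpha> by (intro mult_left_mono) auto
  have le: "E u \<le> E (modulus u)" using assms m s by (simp add: is_minimizer_def)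
  have ge: "E (modulus u) \<le> E u" unfolding energy_eq using ks \<alpha>c by linarith
  show "is_minimizer (modulus u)"
    unfolding is_minimizer_def
  proof (intro conjI allI ballI impI)
    show "modulus u \<in> H1c3" by (rule m)
    show "0 < sqn (component (modulus u) i)" for i using assms by (simp add: s is_minimizer_def)
    show "E (modulus u) \<le> E v" if "v \<in> H1c3" "\<forall>i. sqn (component v i) = sqn (component (modulus u) i)" for v
      using ge assms that unfolding s by (force simp: is_minimizer_def)
  qed
  have "\<alpha> * coup (component u 1) (component u 2) (component u 3) =
     \<alpha> * coup (component (modulus u) 1) (component (modulus u) 2) (component (modulus u) 3)"
    using le ge ks \<alpha>c unfolding energy_eq by linarith
  then show "coup (component (modulus u) 1) (component (modulus u) 2) (component (modulus u) 3) = coup (component u 1) (component u 2) (component u 3)"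
    using \<alpha> by simp
  have e: "(\<Sum>i\<in>UNIV. 1/2 * kin (component (modulus u) i) - \<beta> / (p + 1) * pot (p + 1) (component (modulus u) i)) =
     (\<Sum>i\<in>UNIV. 1/2 * kin (component u i) - \<beta> / (p + 1) * pot (p + 1) (component u i))"
    using le ge ks \<alpha>c unfolding energy_eq by linarith
  have "(\<Sum>i\<in>UNIV. kin (component u i) - kin (component (modulus u) i)) = 0"
    using e unfolding pt sum_subtractf by (simp add: sum_divide_distrib[symmetric])
  then show "kin (component (modulus u) i) = kin (component u i)"
    using k by (subst (asm) sum_nonneg_eq_0_iff) auto
qed

text \<open>The modulus satisfies \<open>r'' = 2 \<omega> r - \<beta> r powr p - \<alpha> F\<close>
  with \<open>F \<ge> 0\<close>, so \<open>r'' \<le> k\<^sup>2 r\<close>. A zero would spread to the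
  whole line and contradict the positive mass.\<close>

lemma minimizer_modulus_positive:
  assumes "is_minimizer u"
  shows "\<exists>d. (\<forall>x. ((\<lambda>x. cmod (u x $ l)) has_real_derivative d x) (at x)) \<and> continuous_on UNIV d \<and>
    (AE x in lborel. weak_deriv (component (modulus u) l) x = of_real (d x)) \<and> (\<forall>x. cmod (u x $ l) > 0)"
proof -
  note mm = modulus_minimizer(1)[OF assms]
  obtain \<omega> D where c: "continuous_on UNIV D" and w: "AE x in lborel. weak_deriv (component (modulus u) l) x = D x"
    and 1: "\<And>x. (component (modulus u) l has_vector_derivative D x) (at x)"
    and 2: "\<And>x. (D has_vector_derivative (of_real (2 * \<omega>) * modulus u x $ l - of_real (\<beta> * cmod (modulus u x $ l) powr (p - 1)) * modulus u x $ l
      - of_real \<alpha> * coup_field (modulus u) l x)) (at x)"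
    using minimizer_ODE[OF mm, of l] by blast
  define r where "r x = cmod (u x $ l)" for x
  define F where "F x = Re (coup_field (modulus u) l x)" for x
  have F: "0 \<le> F x" for x
    using exhaust_3[of l] by (auto simp: F_def coup_field_def modulus_def)
  have r1: "(r has_real_derivative Re (D x)) (at x)" for x
    using has_vector_derivative_Re_Im(1)[OF 1, of x] by (simp add: modulus_def r_def[abs_def])
  have "Im (D x) = 0" for x
  proof -
    have "((\<lambda>x. 0) has_real_derivative Im (D x)) (at x)"
      using has_vector_derivative_Re_Im(2)[OF 1, of x] by (simp add: modulus_def)
    then show ?thesis using DERIV_unique[OF _ DERIV_const[of 0 "at x"]] by blast
  qed
  then have DD: "D x = of_real (Re (D x))" for x by (simp add: complex_eq_iff)
  define s where "s x = 2 * \<omega> * r x - \<beta> * r x powr (p - 1) * r x - \<alpha> * F x" for x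
  have r2: "((\<lambda>x. Re (D x)) has_real_derivative s x) (at x)" for x
    using has_vector_derivative_Re_Im(1)[OF 2, of x] by (simp add: modulus_def r_def s_def F_def)
  \<comment> \<open>At least 1, so that \<open>2 * \<omega> \<le> k \<le> k\<^sup>2\<close>.\<close>
  define k where "k = 2 * \<bar>\<omega>\<bar> + 1"
  have k1: "1 \<le> k" "2 * \<omega> \<le> k" by (simp_all add: k_def)
  then have k2: "2 * \<omega> \<le> k\<^sup>2" using mult_right_mono[of 1 k k] unfolding power2_eq_square by linarith
  have r0: "0 \<le> r x" for x by (simp add: r_def)
  have s: "s x \<le> k\<^sup>2 * r x" for x
  proof -
    have "0 \<le> \<beta> * r x powr (p - 1) * r x" "0 \<le> \<alpha> * F x" using \<beta> \<alpha> r0[of x] F[of x] by simp_all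
    moreover have "2 * \<omega> * r x \<le> k\<^sup>2 * r x" using k2 r0 by (intro mult_right_mono)
    ultimately show ?thesis unfolding s_def by linarith
  qed
  have "r x > 0" for x
  proof (rule ccontr)
    assume "\<not> r x > 0"
    then have "r x = 0" using r0[of x] by simp
    then have "r y = 0" for y using nonneg_zero_everywhere[OF r1 r2 s r0] by blast
    then have "sqn (component u l) = 0" by (simp add: sqn_def r_def)
    then show False using assms unfolding is_minimizer_def by (metis less_irrefl)
  qed
  moreover have "continuous_on UNIV (\<lambda>x. Re (D x))" by (intro continuous_intros c)
  moreover have "AE x in lborel. weak_deriv (component (modulus u) l) x = of_real (Re (D x))"
    using w by eventually_elim (use DD in simp)
  ultimately show ?thesis using r1 unfolding r_def by (intro exI[of _ "\<lambda>x. Re (D x)"]) auto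
qed

text \<open>The speed of the modulus is at most that of the curve and has the same square integral,
  so the two agree almost everywhere and, by continuity, everywhere; \<open>constant_phase\<close>
  applies.\<close>

lemma minimizer_phase:
  assumes "is_minimizer u"
  shows "\<exists>c. cmod c = 1 \<and> (\<forall>x. u x $ l = c * of_real (cmod (u x $ l)))"
proof -
  obtain d where d: "\<And>x. ((\<lambda>x. cmod (u x $ l)) has_real_derivative d x) (at x)" "continuous_on UNIV d"
    "AE x in lborel. weak_deriv (component (modulus u) l) x = of_real (d x)" "\<And>x. cmod (u x $ l) > 0"
    using minimizer_modulus_positive[OF assms, of l] by blast
  obtain D where D: "continuous_on UNIV D" "AE x in lborel. weak_deriv (component u l) x = D x"
    "\<And>x. (component u l has_vector_derivative D x) (at x)"
    using minimizer_ODE[OF assms, of l] by blast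
  have u: "u \<in> H1c3" and m: "modulus u \<in> H1c3"
    using assms modulus_minimizer(1)[OF assms] by (simp_all add: is_minimizer_def)
  note dD = modulus_derivative_le[OF D(3) d(1) refl d(4)]
  have mD: "D \<in> borel_measurable borel" by (rule borel_measurable_continuous_onI[OF D(1)])
  have md: "(\<lambda>x. complex_of_real (d x)) \<in> borel_measurable borel"
    using borel_measurable_continuous_onI[OF d(2)] by simp
  have LD: "D \<in> L2"
    by (rule L2_dominated[OF H1c_D(2)[OF H1c3_D[OF u, of l]] mD, where C = 1]) (use D(2) in \<open>auto elim: eventually_mono\<close>)
  have Ld: "(\<lambda>x. complex_of_real (d x)) \<in> L2"
    by (rule L2_dominated[OF H1c_D(2)[OF H1c3_D[OF m, of l]] md, where C = 1]) (use d(3) in \<open>auto elim: eventually_mono\<close>)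
  have "sqn D = kin (component u l)"
    by (rule sqn_cong_AE[symmetric, OF D(2) H1c_D(2)[OF H1c3_D[OF u]] LD])
  moreover have "sqn (\<lambda>x. complex_of_real (d x)) = kin (component (modulus u) l)"
    by (rule sqn_cong_AE[symmetric, OF d(3) H1c_D(2)[OF H1c3_D[OF m]] Ld])
  ultimately have eq: "sqn D = sqn (\<lambda>x. complex_of_real (d x))" using modulus_minimizer(2)[OF assms, of l] by simp
  have i: "integrable lborel (\<lambda>x. (cmod (D x))\<^sup>2)" "integrable lborel (\<lambda>x. (d x)\<^sup>2)"
    using L2_integrable[OF LD] L2_integrable[OF Ld] by simp_all
  have "(LINT x|lborel. (cmod (D x))\<^sup>2 - (d x)\<^sup>2) = 0"
    using i eq by (simp add: sqn_def)
  moreover have "0 \<le> (cmod (D x))\<^sup>2 - (d x)\<^sup>2" for x using power_mono[OF dD[of x], of 2] by simp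
  ultimately have "AE x in lborel. (cmod (D x))\<^sup>2 - (d x)\<^sup>2 = 0"
    using i by (subst (asm) integral_nonneg_eq_0_iff_AE) auto
  then have ae: "AE x in lborel. (cmod (D x))\<^sup>2 = (d x)\<^sup>2" by eventually_elim simp
  have "(cmod (D x))\<^sup>2 = (d x)\<^sup>2" for x
    by (rule continuous_AE_eq[OF _ _ ae]) (intro continuous_intros D(1) d(2))+
  then have "(cmod (D x))\<^sup>2 = \<bar>d x\<bar>\<^sup>2" for x by simp
  then have "cmod (D x) = \<bar>d x\<bar>" for x by (rule power2_eq_imp_eq) auto
  from constant_phase[OF D(3) d(1) refl d(4) this] show ?thesis .
qed

text \<open>The coupling of \<open>u\<close> is \<open>Re (c 1 * c 2 * cnj (c 3))\<close> times that
  of the moduli. The two couplings agree, and they are nonzero because the moduli have no zeros; a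
  number of modulus 1 with real part 1 is 1.\<close>

lemma minimizer_phases:
  assumes "is_minimizer u"
  shows "\<exists>\<theta>1 \<theta>2 :: real. \<forall>x. u x $ 1 = exp (\<i> * of_real \<theta>1) * of_real (cmod (u x $ 1)) \<and>
    u x $ 2 = exp (\<i> * of_real \<theta>2) * of_real (cmod (u x $ 2)) \<and>
    u x $ 3 = exp (\<i> * of_real (\<theta>1 + \<theta>2)) * of_real (cmod (u x $ 3))"
proof -
  obtain c where c: "\<And>l. cmod (c l) = 1" "\<And>l x. u x $ l = c l * of_real (cmod (u x $ l))"
    using minimizer_phase[OF assms] by metis
  have u: "u \<in> H1c3" and m: "modulus u \<in> H1c3"
    using assms modulus_minimizer(1)[OF assms] by (simp_all add: is_minimizer_def)
  have pos: "cmod (u x $ l) > 0" for x l using minimizer_modulus_positive[OF assms, of l] by blast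
  define C where "C = coup (component (modulus u) 1) (component (modulus u) 2) (component (modulus u) 3)"
  define I where "I = (LINT x|lborel. cmod (u x $ 1) * cmod (u x $ 2) * cmod (u x $ 3))"
  obtain M where M: "\<And>x. cmod (u x $ 1) \<le> M" using H1c_bounded[OF H1c3_D[OF u]] by metis
  note T = triple_product_integrable[OF H1c3_L2[OF u] M H1c3_L2[OF u, of 2] H1c3_L2[OF u, of 3]]
  have "C = Re (LINT x|lborel. complex_of_real (cmod (u x $ 1) * cmod (u x $ 2) * cmod (u x $ 3)))"
    unfolding C_def coup_def by (simp add: modulus_def)
  then have CI: "C = I" by (simp add: I_def del: of_real_mult)
  have "u x $ 1 * u x $ 2 * cnj (u x $ 3) = (c 1 * c 2 * cnj (c 3)) * complex_of_real (cmod (u x $ 1) * cmod (u x $ 2) * cmod (u x $ 3))" for x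
    by (subst c(2)[of x 1], subst c(2)[of x 2], subst c(2)[of x 3]) (simp add: mult_ac)
  then have "coup (component u 1) (component u 2) (component u 3) =
      Re (LINT x|lborel. (c 1 * c 2 * cnj (c 3)) * complex_of_real (cmod (u x $ 1) * cmod (u x $ 2) * cmod (u x $ 3)))"
    unfolding coup_def by (simp only:)
  also have "\<dots> = Re ((c 1 * c 2 * cnj (c 3)) * complex_of_real I)"
    unfolding I_def by (simp only: integral_mult_right_zero integral_complex_of_real)
  finally have "Re (c 1 * c 2 * cnj (c 3)) * I = I"
    using modulus_minimizer(3)[OF assms] CI unfolding C_def by simp
  moreover have "I \<noteq> 0"
  proof
    assume "I = 0"
    then have "AE x in lborel. cmod (u x $ 1) * cmod (u x $ 2) * cmod (u x $ 3) = 0"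
      unfolding I_def using T(1) by (subst (asm) integral_nonneg_eq_0_iff_AE) auto
    then have "AE x in (lborel :: real measure). False"
      by eventually_elim (use pos in \<open>auto dest: less_imp_neq\<close>)
    then show False using AE_lborel_False by blast
  qed
  ultimately have re: "Re (c 1 * c 2 * cnj (c 3)) = 1" by simp
  have nc: "cmod (c 1 * c 2 * cnj (c 3)) = 1" by (simp add: norm_mult c(1))
  have "(Re (c 1 * c 2 * cnj (c 3)))\<^sup>2 + (Im (c 1 * c 2 * cnj (c 3)))\<^sup>2 = 1"
    using nc cmod_power2[of "c 1 * c 2 * cnj (c 3)"] by simp
  then have "Im (c 1 * c 2 * cnj (c 3)) = 0" unfolding re by simp
  then have one: "c 1 * c 2 * cnj (c 3) = 1" using re by (simp add: complex_eq_iff)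
  have "c 3 * cnj (c 3) = 1" using c(1)[of 3] by (simp add: complex_norm_square[symmetric])
  then have c3: "c 3 = c 1 * c 2" using one
    by (metis mult.assoc mult.commute mult.right_neutral)
  have e: "exp (\<i> * of_real (Arg (c l))) = c l" for l
  proof -
    have "c l \<noteq> 0" using c(1)[of l] by auto
    then show ?thesis using cis_Arg[of "c l"] c(1)[of l] by (simp add: cis_conv_exp sgn_div_norm)
  qed
  have "exp (\<i> * of_real (Arg (c 1) + Arg (c 2))) = c 3"
    unfolding c3 by (simp add: distrib_left exp_add e)
  then show ?thesis
    using c(2)[of _ 1] c(2)[of _ 2] c(2)[of _ 3] e[of 1] e[of 2]
    by (intro exI[of _ "Arg (c 1)"] exI[of _ "Arg (c 2)"]) metis
qed

end

subsection \<open>Passage to almost everywhere classes\<close>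

lemma H1_3_L2: "u \<in> H1_3 \<Longrightarrow> component u i \<in> L2"
  by (simp add: H1_3_def H1_def)

lemma H1c3_subset_H1_3: "u \<in> H1c3 \<Longrightarrow> u \<in> H1_3"
  by (simp add: H1_3_def H1c3_def H1c_subset_H1)

lemma AE_vec3_I:
  fixes f g :: "real \<Rightarrow> complex^3"
  assumes "\<And>i. AE x in lborel. f x $ i = g x $ i"
  shows "AE x in lborel. f x = g x"
proof -
  have "AE x in lborel. \<forall>i\<in>UNIV. f x $ i = g x $ i" using assms by (intro AE_finite_allI) auto
  then show ?thesis by (rule eventually_mono) (simp add: vec_eq_iff)
qed

lemma H1_3_representative:
  assumes "u \<in> H1_3" shows "\<exists>U\<in>H1c3. AE x in lborel. U x = u x"
proof -
  have "\<forall>i. \<exists>F. F \<in> H1c \<and> (AE x in lborel. F x = component u i x)"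
    using H1_representative assms unfolding H1_3_def by blast
  from choice[OF this] obtain F where F: "\<And>i. F i \<in> H1c" "\<And>i. AE x in lborel. F i x = component u i x"
    by blast
  define U where "U x = (\<chi> i. F i x)" for x
  have "component U i = F i" for i by (simp add: U_def)
  then have "U \<in> H1c3" using F(1) by (intro H1c3_I) simp
  moreover have "AE x in lborel. U x = u x"
    by (rule AE_vec3_I) (use F(2) in \<open>simp add: U_def\<close>)
  ultimately show ?thesis by blast
qed

context
  fixes u v :: "real \<Rightarrow> complex^3"
  assumes uv: "AE x in lborel. u x = v x" and u: "\<And>i. component u i \<in> L2" and v: "\<And>i. component v i \<in> L2"
begin

lemma component_cong_AE: "AE x in lborel. component u i x = component v i x"
  using uv by (rule eventually_mono) simp

lemma sqn_component_cong: "sqn (component u i) = sqn (component v i)"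
  by (rule sqn_cong_AE[OF component_cong_AE u v])

lemma weak_deriv_component_cong: "weak_deriv (component u i) = weak_deriv (component v i)"
  using L2_measurable[OF u] L2_measurable[OF v] by (intro weak_deriv_cong component_cong_AE) simp_all

lemma H1_3_norm_cong: "H1_3_norm u = H1_3_norm v"
  by (simp add: H1_3_norm_def H1_norm_def L2_norm_square sqn_component_cong weak_deriv_component_cong)

lemma energy_cong: "energy \<alpha> \<beta> p u = energy \<alpha> \<beta> p v"
proof -
  note [measurable] = L2_measurable[OF u] L2_measurable[OF v]
    L2_measurable[OF L2_cnj[OF u]] L2_measurable[OF L2_cnj[OF v]]
  have "(LINT x|lborel. cmod (u x $ i) powr (p + 1)) = (LINT x|lborel. cmod (v x $ i) powr (p + 1))" for i
    by (rule integral_cong_AE) (use uv in \<open>auto elim!: eventually_mono\<close>)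
  moreover have "(LINT x|lborel. u x $ 1 * u x $ 2 * cnj (u x $ 3)) = (LINT x|lborel. v x $ 1 * v x $ 2 * cnj (v x $ 3))"
    by (rule integral_cong_AE)
      (use uv in \<open>auto elim!: eventually_mono\<close>)
  ultimately show ?thesis by (simp add: energy_def weak_deriv_component_cong)
qed

lemma AE_eq_shift: "AE x in lborel. u (x + c) = v (x + c)"
proof (rule AE_vec3_I)
  fix i
  note [measurable] = L2_measurable[OF u] L2_measurable[OF v]
  have "AE x in lborel. component u i (c + 1 * x) = component v i (c + 1 * x)"
    by (rule AE_borel_affine[where P = "\<lambda>x. component u i x = component v i x"])
      (simp_all only: component_cong_AE, simp_all)
  then show "AE x in lborel. u (x + c) $ i = v (x + c) $ i" by (simp add: add.commute)
qed

end

lemma H1_3_norm_eq: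
  "H1_3_norm u = sqrt (\<Sum>i\<in>UNIV. sqn (component u i) + kin (component u i))"
  by (simp add: H1_3_norm_def H1_norm_def L2_norm_square)

lemma H1_3_norm_nonneg: "0 \<le> H1_3_norm u"
  by (simp add: H1_3_norm_def sum_nonneg)

lemma L2_shift_component: "component w i \<in> L2 \<Longrightarrow> component (\<lambda>x. w (x + c)) i \<in> L2"
  using L2_shift[of "component w i" c] by simp

lemma H1_3_norm_shift:
  assumes W: "W \<in> H1c3" and w: "AE x in lborel. W x = w x" "\<And>i. component w i \<in> L2"
  shows "H1_3_norm (\<lambda>x. w (x + c)) = H1_3_norm w"
proof -
  note c = H1c3_L2[OF W] w(2)
  have "H1_3_norm (\<lambda>x. w (x + c)) = H1_3_norm (\<lambda>x. W (x + c))"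
    using H1_3_norm_cong[OF AE_eq_shift[OF w(1) c] L2_shift_component[OF c(1)] L2_shift_component[OF c(2)]] by simp
  also have "\<dots> = H1_3_norm W"
    using H1c_shift(3)[OF H1c3_D[OF W], where c = c]
    by (simp add: H1_3_norm_eq sqn_shift[of "component W _" c])
  also have "\<dots> = H1_3_norm w" by (rule H1_3_norm_cong[OF w(1) c])
  finally show ?thesis .
qed

definition masses :: "real \<Rightarrow> real \<Rightarrow> real \<Rightarrow> 3 \<Rightarrow> real" where
  "masses \<gamma> \<mu> s i = (vector [\<gamma>, \<mu>, s] :: real^3) $ i"

lemma masses_simps [simp]: "masses \<gamma> \<mu> s 1 = \<gamma>" "masses \<gamma> \<mu> s 2 = \<mu>" "masses \<gamma> \<mu> s 3 = s"
  by (simp_all add: masses_def vector_3)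

lemma admissible_iff: "u \<in> admissible \<gamma> \<mu> s \<longleftrightarrow> u \<in> H1_3 \<and> (\<forall>i. sqn (component u i) = masses \<gamma> \<mu> s i)"
  by (auto simp: admissible_def L2_norm_square forall_3)

lemma minimizing_sequence_subseq:
  assumes "minimizing_sequence \<alpha> \<beta> p \<gamma> \<mu> s u" "strict_mono r"
  shows "minimizing_sequence \<alpha> \<beta> p \<gamma> \<mu> s (\<lambda>n. u (r n))"
proof -
  note u = assms(1)[unfolded minimizing_sequence_def]
  show ?thesis unfolding minimizing_sequence_def
    using u LIMSEQ_subseq_LIMSEQ[OF u[THEN conjunct2, THEN conjunct1] assms(2)]
      LIMSEQ_subseq_LIMSEQ[OF u[THEN conjunct2, THEN conjunct2, THEN conjunct1] assms(2)]
      LIMSEQ_subseq_LIMSEQ[OF u[THEN conjunct2, THEN conjunct2, THEN conjunct2, THEN conjunct1] assms(2)]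
      LIMSEQ_subseq_LIMSEQ[OF u[THEN conjunct2, THEN conjunct2, THEN conjunct2, THEN conjunct2] assms(2)]
    by (simp add: o_def)
qed

section \<open>The infimum and the transfer of compactness\<close>

context three_wave
begin

text \<open>Either the energy is positive, or \<open>coercive\<close> with \<open>D = 0\<close>
  bounds the kinetic energies and thereby every term.\<close>

lemma energy_bounded_below:
  assumes m: "0 \<le> m"
  shows "\<exists>C\<ge>0. \<forall>u\<in>H1c3. (\<forall>i. sqn (component u i) \<le> m) \<longrightarrow> - C \<le> E u"
proof -
  from coercive[OF m, where D = 0] obtain B where
    B: "\<And>u i. u \<in> H1c3 \<Longrightarrow> (\<And>i. sqn (component u i) \<le> m) \<Longrightarrow> E u \<le> 0 \<Longrightarrow> kin (component u i) \<le> B"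
    by blast
  define M where "M = sqrt (2 * m + 2 * \<bar>B\<bar>)"
  have M0: "0 \<le> M" using m by (simp add: M_def)
  define c where "c = \<beta> / (p + 1) * (M powr (p - 1) * m)"
  have c0: "0 \<le> c" using m \<beta>p unfolding c_def by (intro mult_nonneg_nonneg) auto
  define C where "C = 3 * c + \<alpha> * (M * m)"
  have C0: "0 \<le> C" using c0 \<alpha> M0 m by (simp add: C_def)
  have "- C \<le> E u" if u: "u \<in> H1c3" "\<forall>i. sqn (component u i) \<le> m" for u
  proof (cases "E u \<le> 0")
    case True
    have k: "kin (component u i) \<le> \<bar>B\<bar>" for i using B[OF u(1) _ True, of i] u(2) by force
    have bd: "cmod (u x $ i) \<le> M" for x i
      using H1c_bound[OF H1c3_D[OF u(1)] _ k, of i m x] u(2) by (simp add: M_def)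
    have "pot (p + 1) (component u i) \<le> M powr (p - 1) * m" for i
    proof -
      have "pot (p + 1) (component u i) \<le> M powr (p + 1 - 2) * sqn (component u i)"
        by (rule pot_bound(2)[OF H1c3_L2[OF u(1)] bd q2])
      also have "\<dots> \<le> M powr (p + 1 - 2) * m" using u(2) by (intro mult_left_mono) auto
      finally show ?thesis by simp
    qed
    then have c: "\<beta> / (p + 1) * pot (p + 1) (component u i) \<le> c" for i
      unfolding c_def using \<beta>p by (intro mult_left_mono) auto
    have "- c \<le> 1/2 * kin (component u i) - \<beta> / (p + 1) * pot (p + 1) (component u i)" for i
      using add_mono[OF _ c[of i], of 0 "1/2 * kin (component u i)"] by simp
    then have "(\<Sum>i\<in>(UNIV :: 3 set). - c) \<le>
        (\<Sum>i\<in>UNIV. 1/2 * kin (component u i) - \<beta> / (p + 1) * pot (p + 1) (component u i))"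
      by (intro sum_mono)
    moreover have "\<bar>coup (component u 1) (component u 2) (component u 3)\<bar> \<le> M * m"
      by (rule coup_small[where l = 1]) (use H1c3_L2[OF u(1)] u(2) bd in auto)
    then have "\<alpha> * coup (component u 1) (component u 2) (component u 3) \<le> \<alpha> * (M * m)"
      using \<alpha> by (intro mult_left_mono) auto
    ultimately show ?thesis unfolding energy_eq C_def by simp
  qed (use C0 in auto)
  with C0 show ?thesis by blast
qed

context
  fixes \<gamma> \<mu> s :: real
  assumes pos: "\<gamma> > 0" "\<mu> > 0" "s > 0"
begin

lemma masses_pos: "masses \<gamma> \<mu> s i > 0"
  using pos by (cases rule: component_cases[of "\<lambda>i. masses \<gamma> \<mu> s i > 0"]) auto

lemma admissible_H1c3:
  assumes "u \<in> admissible \<gamma> \<mu> s"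
  obtains U where "U \<in> H1c3" "AE x in lborel. U x = u x" "U \<in> admissible \<gamma> \<mu> s" "E U = E u"
proof -
  have u: "u \<in> H1_3" using assms by (simp add: admissible_iff)
  from H1_3_representative[OF u] obtain U where U: "U \<in> H1c3" "AE x in lborel. U x = u x" by blast
  note c = U(2) H1c3_L2[OF U(1)] H1_3_L2[OF u]
  have "U \<in> admissible \<gamma> \<mu> s"
    using assms sqn_component_cong[OF c] H1c3_subset_H1_3[OF U(1)] by (simp add: admissible_iff)
  with U energy_cong[OF c] show thesis by (intro that)
qed

text \<open>A triple of profiles with the prescribed masses bounds the infimum from above,
  \<open>energy_bounded_below\<close> bounds it from below.\<close>

lemma min_energy_finite:
  "\<exists>I. min_energy \<alpha> \<beta> p \<gamma> \<mu> s = ereal I \<and> lower_bound (masses \<gamma> \<mu> s) I"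
proof -
  have "\<exists>Q. Q \<in> H1c \<and> sqn Q = masses \<gamma> \<mu> s i" for i
    using negative_energy_profile[OF masses_pos[of i]] by blast
  then obtain Q where Q: "\<And>i. Q i \<in> H1c" "\<And>i. sqn (Q i) = masses \<gamma> \<mu> s i" by metis
  define U where "U x = (\<chi> i. Q i x)" for x
  have c: "component U i = Q i" for i by (simp add: U_def)
  then have "U \<in> H1c3" using Q(1) by (intro H1c3_I) simp
  then have "U \<in> admissible \<gamma> \<mu> s" using H1c3_subset_H1_3 c Q(2) by (simp add: admissible_iff)
  then have up: "min_energy \<alpha> \<beta> p \<gamma> \<mu> s \<le> ereal (E U)" unfolding min_energy_def by (rule INF_lower)
  have "masses \<gamma> \<mu> s i \<le> \<gamma> + \<mu> + s" for i
    using pos by (cases rule: component_cases[of "\<lambda>i. masses \<gamma> \<mu> s i \<le> \<gamma> + \<mu> + s"]) auto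
  moreover have "0 \<le> \<gamma> + \<mu> + s" using pos by simp
  from energy_bounded_below[OF this] obtain C where
    "\<And>u. u \<in> H1c3 \<Longrightarrow> (\<And>i. sqn (component u i) \<le> \<gamma> + \<mu> + s) \<Longrightarrow> - C \<le> E u" by blast
  ultimately have C: "- C \<le> E u" if "u \<in> H1c3" "u \<in> admissible \<gamma> \<mu> s" for u
    using that by (simp add: admissible_iff)
  have "ereal (- C) \<le> min_energy \<alpha> \<beta> p \<gamma> \<mu> s"
    unfolding min_energy_def
  proof (rule INF_greatest)
    fix u assume "u \<in> admissible \<gamma> \<mu> s"
    from admissible_H1c3[OF this] C show "ereal (- C) \<le> ereal (E u)" by (metis ereal_less_eq(3))
  qed
  with up obtain I where I: "min_energy \<alpha> \<beta> p \<gamma> \<mu> s = ereal I"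
    by (cases "min_energy \<alpha> \<beta> p \<gamma> \<mu> s") auto
  have "I \<le> E u" if "u \<in> H1c3" "\<forall>i. sqn (component u i) = masses \<gamma> \<mu> s i" for u
  proof -
    have "u \<in> admissible \<gamma> \<mu> s" using that H1c3_subset_H1_3 by (simp add: admissible_iff)
    then have "min_energy \<alpha> \<beta> p \<gamma> \<mu> s \<le> ereal (E u)" unfolding min_energy_def by (rule INF_lower)
    then show ?thesis by (simp add: I)
  qed
  with I show ?thesis unfolding lower_bound_def by blast
qed

lemma minimizer_shift:
  assumes "\<phi> \<in> H1c3" "\<phi> \<in> minimizers \<alpha> \<beta> p \<gamma> \<mu> s"
  shows "(\<lambda>x. \<phi> (x + c)) \<in> minimizers \<alpha> \<beta> p \<gamma> \<mu> s"
  using assms H1c3_subset_H1_3[OF H1c3_shift[OF assms(1), of c]]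
  by (simp add: minimizers_def admissible_iff energy_shift sqn_shift[of "component \<phi> _" c])

text \<open>The last clause moves the translation from the sequence to the limit. As translates of a
  minimizer are minimizers, this gives convergence to the set of minimizers for the untranslated
  sequence.\<close>

lemma minimizing_sequence_compact:
  assumes u: "minimizing_sequence \<alpha> \<beta> p \<gamma> \<mu> s u"
  shows "\<exists>r y \<phi>. strict_mono r \<and> \<phi> \<in> H1c3 \<and> \<phi> \<in> minimizers \<alpha> \<beta> p \<gamma> \<mu> s \<and>
    (\<lambda>n. H1_3_norm (\<lambda>x. u (r n) (x + y n) - \<phi> x)) \<longlonglongrightarrow> 0 \<and>
    (\<forall>n. H1_3_norm (\<lambda>x. u (r n) x - \<phi> (x - y n)) = H1_3_norm (\<lambda>x. u (r n) (x + y n) - \<phi> x))"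
proof -
  have uH: "u n \<in> H1_3" for n using u by (simp add: minimizing_sequence_def)
  then have "\<forall>n. \<exists>U. U \<in> H1c3 \<and> (AE x in lborel. U x = u n x)" using H1_3_representative by blast
  from choice[OF this] obtain U where U: "\<And>n. U n \<in> H1c3" "\<And>n. AE x in lborel. U n x = u n x" by blast
  note c = U(2) H1c3_L2[OF U(1)] H1_3_L2[OF uH]
  from min_energy_finite obtain I where
    I: "min_energy \<alpha> \<beta> p \<gamma> \<mu> s = ereal I" "lower_bound (masses \<gamma> \<mu> s) I" by blast
  have "sqn (component (U n) i) = sqn (component (u n) i)" for n i
    by (rule sqn_component_cong[OF c(1)[of n] c(2) c(3)])
  moreover have "(\<lambda>n. sqn (component (u n) i)) \<longlonglongrightarrow> masses \<gamma> \<mu> s i" for i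
    by (rule component_cases[of "\<lambda>i. (\<lambda>n. sqn (component (u n) i)) \<longlonglongrightarrow> masses \<gamma> \<mu> s i"])
      (use u in \<open>simp_all add: minimizing_sequence_def L2_norm_square\<close>)
  ultimately have "(\<lambda>n. sqn (component (U n) i)) \<longlonglongrightarrow> masses \<gamma> \<mu> s i" for i by simp
  moreover have "E (U n) = E (u n)" for n by (rule energy_cong[OF c(1)[of n] c(2) c(3)])
  then have "(\<lambda>n. E (U n)) \<longlonglongrightarrow> I" using u by (simp add: minimizing_sequence_def I(1))
  ultimately have "minimizing (masses \<gamma> \<mu> s) I U" using U(1) unfolding minimizing_def by blast
  from minimizing_compact[OF I(2) _ this] masses_pos obtain r y \<phi> where
    r: "strict_mono r" and \<phi>: "\<phi> \<in> H1c3" "\<And>i. sqn (component \<phi> i) = masses \<gamma> \<mu> s i" "E \<phi> = I"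
    and lim: "\<And>i. (\<lambda>n. sqn (component (\<lambda>x. U (r n) (x + y n) - \<phi> x) i)) \<longlonglongrightarrow> 0"
      "\<And>i. (\<lambda>n. kin (component (\<lambda>x. U (r n) (x + y n) - \<phi> x) i)) \<longlonglongrightarrow> 0" by blast
  have min: "\<phi> \<in> minimizers \<alpha> \<beta> p \<gamma> \<mu> s"
    using \<phi> H1c3_subset_H1_3[OF \<phi>(1)] by (simp add: minimizers_def admissible_iff I(1))
  have L2d: "component (\<lambda>x. f x - g x) i \<in> L2" if "\<And>i. component f i \<in> L2" "\<And>i. component g i \<in> L2" for f g i
    using L2_diff[OF that(1)[of i] that(2)[of i]] by simp
  have L2\<phi>: "component \<phi> i \<in> L2" for i by (rule H1c3_L2[OF \<phi>(1)])
  have "(\<lambda>n. H1_3_norm (\<lambda>x. U (r n) (x + y n) - \<phi> x)) \<longlonglongrightarrow> sqrt (\<Sum>i\<in>(UNIV :: 3 set). 0 + 0)"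
    unfolding H1_3_norm_eq by (intro tendsto_real_sqrt tendsto_sum tendsto_add lim)
  moreover have "H1_3_norm (\<lambda>x. U (r n) (x + y n) - \<phi> x) = H1_3_norm (\<lambda>x. u (r n) (x + y n) - \<phi> x)" for n
  proof (rule H1_3_norm_cong)
    show "AE x in lborel. U (r n) (x + y n) - \<phi> x = u (r n) (x + y n) - \<phi> x"
      using AE_eq_shift[OF c(1)[of "r n"] c(2) c(3), of "y n"] by (rule eventually_mono) simp
  qed (intro L2d L2_shift_component c L2\<phi>)+
  ultimately have "(\<lambda>n. H1_3_norm (\<lambda>x. u (r n) (x + y n) - \<phi> x)) \<longlonglongrightarrow> 0" by simp
  moreover have "H1_3_norm (\<lambda>x. u (r n) x - \<phi> (x - y n)) = H1_3_norm (\<lambda>x. u (r n) (x + y n) - \<phi> x)" for n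
  proof -
    define w where "w x = u (r n) x - \<phi> (x + - y n)" for x
    have "H1_3_norm (\<lambda>x. w (x + y n)) = H1_3_norm w"
    proof (rule H1_3_norm_shift)
      show "(\<lambda>x. U (r n) x - \<phi> (x + - y n)) \<in> H1c3" by (intro H1c3_diff H1c3_shift \<phi>(1) U(1))
      show "AE x in lborel. U (r n) x - \<phi> (x + - y n) = w x"
        using U(2)[of "r n"] by (rule eventually_mono) (simp add: w_def)
      show "component w i \<in> L2" for i
        unfolding w_def by (rule L2d[OF c(3) L2_shift_component[OF L2\<phi>]])
    qed
    moreover have "w = (\<lambda>x. u (r n) x - \<phi> (x - y n))" by (simp add: w_def fun_eq_iff)
    ultimately show ?thesis by simp
  qed
  ultimately show ?thesis using r \<phi>(1) min by blast
qed

lemma minimizer_representative: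
  assumes "w \<in> minimizers \<alpha> \<beta> p \<gamma> \<mu> s"
  obtains v where "is_minimizer v" "AE x in lborel. v x = w x"
proof -
  have w: "w \<in> admissible \<gamma> \<mu> s" "ereal (E w) = min_energy \<alpha> \<beta> p \<gamma> \<mu> s"
    using assms by (auto simp: minimizers_def)
  from admissible_H1c3[OF w(1)] obtain v where
    v: "v \<in> H1c3" "AE x in lborel. v x = w x" "v \<in> admissible \<gamma> \<mu> s" "E v = E w" by blast
  from min_energy_finite obtain I where
    I: "min_energy \<alpha> \<beta> p \<gamma> \<mu> s = ereal I" "lower_bound (masses \<gamma> \<mu> s) I" by blast
  have m: "sqn (component v i) = masses \<gamma> \<mu> s i" for i using v(3) by (simp add: admissible_iff)
  have "E v = I" using w(2) I(1) v(4) by simp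
  then have "is_minimizer v"
    using v(1) I(2) m masses_pos by (simp add: is_minimizer_def lower_bound_def)
  with v(2) show thesis by (intro that)
qed

end

end

lemma tendsto_0_if_subseq:
  fixes X :: "nat \<Rightarrow> real"
  assumes "\<And>r. strict_mono r \<Longrightarrow> \<exists>k :: nat \<Rightarrow> nat. (\<lambda>n. X (r (k n))) \<longlonglongrightarrow> 0"
  shows "X \<longlonglongrightarrow> 0"
proof (rule ccontr)
  assume "\<not> X \<longlonglongrightarrow> 0"
  then obtain e where e: "e > 0" "\<not> (\<forall>\<^sub>F n in sequentially. dist (X n) 0 < e)" by (auto simp: tendsto_iff)
  from not_eventually_sequentiallyD[OF e(2)] obtain r :: "nat \<Rightarrow> nat"
    where r: "strict_mono r" "\<And>n. \<not> dist (X (r n)) 0 < e" by auto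
  from assms[OF r(1)] obtain k :: "nat \<Rightarrow> nat" where "(\<lambda>n. X (r (k n))) \<longlonglongrightarrow> 0" by blast
  then have "\<forall>\<^sub>F n in sequentially. dist (X (r (k n))) 0 < e" using e(1) by (rule tendstoD)
  with r(2) show False by simp
qed

text \<open>The two limits of distances follow from compactness of every subsequence, the limit 0
  being common to all of them. In the last part \<open>v\<close> is the continuous representative of
  the class of \<open>w\<close>, to which pointwise statements refer.\<close>

theorem theorem1p2:
  fixes \<alpha> \<beta> p \<gamma> \<mu> s :: real
    and u :: "nat \<Rightarrow> real \<Rightarrow> complex^3"
  assumes "\<alpha> > 0" "\<beta> > 0" "1 < p" "p < 5" "\<gamma> > 0" "\<mu> > 0" "s > 0"
    and "minimizing_sequence \<alpha> \<beta> p \<gamma> \<mu> s u"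
  shows
    "(minimizers \<alpha> \<beta> p \<gamma> \<mu> s \<noteq> {} \<and>
      (\<exists>(y :: nat \<Rightarrow> real) (\<phi> :: real \<Rightarrow> complex^3) (r :: nat \<Rightarrow> nat).
         \<phi> \<in> H1_3 \<and> strict_mono r \<and>
         (\<lambda>n. H1_3_norm (\<lambda>x. u (r n) (x + y (r n)) - \<phi> x)) \<longlonglongrightarrow> 0)) \<and>
     (\<lambda>n. INF (g, y) \<in> minimizers \<alpha> \<beta> p \<gamma> \<mu> s \<times> (UNIV :: real set).
        H1_3_norm (\<lambda>x. u n (x + y) - g x)) \<longlonglongrightarrow> 0 \<and>
     (\<lambda>n. INF g \<in> minimizers \<alpha> \<beta> p \<gamma> \<mu> s. H1_3_norm (\<lambda>x. u n x - g x)) \<longlonglongrightarrow> 0 \<and>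
     (\<forall>w \<in> minimizers \<alpha> \<beta> p \<gamma> \<mu> s. \<exists>v. (AE x in lborel. v x = w x) \<and>
        (\<exists>\<omega>1 \<omega>2 \<omega>3 :: real. classical_solution \<alpha> \<beta> p \<omega>1 \<omega>2 \<omega>3 v) \<and>
        (\<exists>(\<theta>1 :: real) (\<theta>2 :: real) (\<rho>1 :: real \<Rightarrow> real) (\<rho>2 :: real \<Rightarrow> real) (\<rho>3 :: real \<Rightarrow> real).
           (\<forall>x. (0::real) \<le> \<rho>1 x \<and> (0::real) \<le> \<rho>2 x \<and> (0::real) \<le> \<rho>3 x) \<and>
           (\<forall>x. v x $ 1 = exp (\<i> * of_real \<theta>1) * of_real (\<rho>1 x) \<and>
                v x $ 2 = exp (\<i> * of_real \<theta>2) * of_real (\<rho>2 x) \<and>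
                v x $ 3 = exp (\<i> * of_real (\<theta>1 + \<theta>2)) * of_real (\<rho>3 x))))"
proof -
  interpret three_wave \<alpha> \<beta> p using assms(1-4) by unfold_locales
  note pos = assms(5-7) and ms = assms(8)
  let ?G = "minimizers \<alpha> \<beta> p \<gamma> \<mu> s"
  define X where "X n = (INF (g, y) \<in> ?G \<times> (UNIV :: real set). H1_3_norm (\<lambda>x. u n (x + y) - g x))" for n
  define Y where "Y n = (INF g \<in> ?G. H1_3_norm (\<lambda>x. u n x - g x))" for n
  have bdd: "bdd_below ((\<lambda>(g, y). H1_3_norm (\<lambda>x. u n (x + y) - g x)) ` (?G \<times> UNIV))"
    "bdd_below ((\<lambda>g. H1_3_norm (\<lambda>x. u n x - g x)) ` ?G)" for n
    by (rule bdd_belowI2[where m = 0], auto intro: H1_3_norm_nonneg)+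
  have X_le: "X n \<le> H1_3_norm (\<lambda>x. u n (x + y) - g x)" if "g \<in> ?G" for n g y
    unfolding X_def using cINF_lower[OF bdd(1), of "(g, y)"] that by simp
  have Y_le: "Y n \<le> H1_3_norm (\<lambda>x. u n x - g x)" if "g \<in> ?G" for n g
    unfolding Y_def using cINF_lower[OF bdd(2)] that by simp
  have *: "\<exists>k y \<phi>. strict_mono k \<and> \<phi> \<in> H1c3 \<and> \<phi> \<in> ?G \<and>
      (\<lambda>n. H1_3_norm (\<lambda>x. u (r (k n)) (x + y n) - \<phi> x)) \<longlonglongrightarrow> 0 \<and>
      (\<forall>n. H1_3_norm (\<lambda>x. u (r (k n)) x - \<phi> (x - y n)) = H1_3_norm (\<lambda>x. u (r (k n)) (x + y n) - \<phi> x))"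
    if "strict_mono r" for r :: "nat \<Rightarrow> nat"
    using minimizing_sequence_compact[OF pos minimizing_sequence_subseq[OF ms that]] .
  from *[OF strict_mono_id] obtain r y \<phi> where
    r: "strict_mono r" "\<phi> \<in> H1c3" "\<phi> \<in> ?G" "(\<lambda>n. H1_3_norm (\<lambda>x. u (r n) (x + y n) - \<phi> x)) \<longlonglongrightarrow> 0"
    by auto
  have ne: "?G \<noteq> {}" using r(3) by blast
  have nonneg: "0 \<le> X n" "0 \<le> Y n" for n
    unfolding X_def Y_def using ne by (auto intro!: cINF_greatest H1_3_norm_nonneg)
  \<comment> \<open>The translations come indexed by the subsequence; \<open>inv r\<close> reindexes
    them by the original sequence.\<close>
  have "y (inv r (r n)) = y n" for n using strict_mono_imp_inj_on[OF r(1)] by simp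
  then have i: "\<exists>y \<phi> r. \<phi> \<in> H1_3 \<and> strict_mono r \<and>
      (\<lambda>n. H1_3_norm (\<lambda>x. u (r n) (x + y (r n)) - \<phi> x)) \<longlonglongrightarrow> 0"
    using r H1c3_subset_H1_3[OF r(2)] by (intro exI[of _ "\<lambda>n. y (inv r n)"] exI[of _ \<phi>] exI[of _ r]) simp
  have ii: "X \<longlonglongrightarrow> 0"
  proof (rule tendsto_0_if_subseq)
    fix r :: "nat \<Rightarrow> nat" assume "strict_mono r"
    from *[OF this] obtain k y \<phi> where k: "\<phi> \<in> ?G"
      "(\<lambda>n. H1_3_norm (\<lambda>x. u (r (k n)) (x + y n) - \<phi> x)) \<longlonglongrightarrow> 0" by blast
    have "(\<lambda>n. X (r (k n))) \<longlonglongrightarrow> 0"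
      by (rule tendsto_sandwich[OF _ _ tendsto_const k(2)]) (simp_all add: nonneg X_le k(1))
    then show "\<exists>k :: nat \<Rightarrow> nat. (\<lambda>n. X (r (k n))) \<longlonglongrightarrow> 0" by blast
  qed
  have iii: "Y \<longlonglongrightarrow> 0"
  proof (rule tendsto_0_if_subseq)
    fix r :: "nat \<Rightarrow> nat" assume "strict_mono r"
    from *[OF this] obtain k y \<phi> where k: "\<phi> \<in> H1c3" "\<phi> \<in> ?G"
      "(\<lambda>n. H1_3_norm (\<lambda>x. u (r (k n)) (x + y n) - \<phi> x)) \<longlonglongrightarrow> 0"
      "\<And>n. H1_3_norm (\<lambda>x. u (r (k n)) x - \<phi> (x - y n)) = H1_3_norm (\<lambda>x. u (r (k n)) (x + y n) - \<phi> x)" by blast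
    \<comment> \<open>The competitor is the translate of \<open>\<phi>\<close> by
      \<open>- y n\<close>, again a minimizer.\<close>
    have "Y (r (k n)) \<le> H1_3_norm (\<lambda>x. u (r (k n)) (x + y n) - \<phi> x)" for n
      using Y_le[OF minimizer_shift[OF pos k(1,2), of "- y n"], of "r (k n)"] k(4)[of n] by simp
    then have "(\<lambda>n. Y (r (k n))) \<longlonglongrightarrow> 0"
      by (intro tendsto_sandwich[OF _ _ tendsto_const k(3)]) (simp_all add: nonneg)
    then show "\<exists>k :: nat \<Rightarrow> nat. (\<lambda>n. Y (r (k n))) \<longlonglongrightarrow> 0" by blast
  qed
  have iv: "\<exists>v. (AE x in lborel. v x = w x) \<and>
        (\<exists>\<omega>1 \<omega>2 \<omega>3 :: real. classical_solution \<alpha> \<beta> p \<omega>1 \<omega>2 \<omega>3 v) \<and>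
        (\<exists>(\<theta>1 :: real) (\<theta>2 :: real) (\<rho>1 :: real \<Rightarrow> real) (\<rho>2 :: real \<Rightarrow> real) (\<rho>3 :: real \<Rightarrow> real).
           (\<forall>x. (0::real) \<le> \<rho>1 x \<and> (0::real) \<le> \<rho>2 x \<and> (0::real) \<le> \<rho>3 x) \<and>
           (\<forall>x. v x $ 1 = exp (\<i> * of_real \<theta>1) * of_real (\<rho>1 x) \<and>
                v x $ 2 = exp (\<i> * of_real \<theta>2) * of_real (\<rho>2 x) \<and>
                v x $ 3 = exp (\<i> * of_real (\<theta>1 + \<theta>2)) * of_real (\<rho>3 x)))" if "w \<in> ?G" for w
  proof -
    from minimizer_representative[OF pos that] obtain v where v: "is_minimizer v" "AE x in lborel. v x = w x" by blast
    from minimizer_phases[OF v(1)] obtain \<theta>1 \<theta>2 where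
      \<theta>: "\<forall>x. v x $ 1 = exp (\<i> * of_real \<theta>1) * of_real (cmod (v x $ 1)) \<and>
           v x $ 2 = exp (\<i> * of_real \<theta>2) * of_real (cmod (v x $ 2)) \<and>
           v x $ 3 = exp (\<i> * of_real (\<theta>1 + \<theta>2)) * of_real (cmod (v x $ 3))" by blast
    show ?thesis
      by (rule exI[of _ v], intro conjI v(2) minimizer_classical_solution v(1), rule exI[of _ \<theta>1], rule exI[of _ \<theta>2],
          rule exI[of _ "\<lambda>x. cmod (v x $ 1)"], rule exI[of _ "\<lambda>x. cmod (v x $ 2)"],
          rule exI[of _ "\<lambda>x. cmod (v x $ 3)"], rule conjI[OF _ \<theta>]) simp
  qed
  show ?thesis using ne i ii iii iv unfolding X_def Y_def by blast
qed

end
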